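(* Let $\boldsymbol X=A\times_{\max}\boldsymbol Z$ be a recursive max-linear (ML) vector on a well-ordered DAG satisfying assumptions (A1)-(A3) of the context, and let $\boldsymbol X_1,\dots,\boldsymbol X_n$ be i.i.d. copies of $\boldsymbol X$. Choose $k=k(n)$ with $k=o(n)$ and $k\to\infty$ as $n\to\infty$. Let $S_M$, $\hat S_M$, the vector $A^2$ and the matrix $T$ be as defined in the context. Assume that for every $\boldsymbol h\subset\{1,\dots,d\}$ such that $\sigma^2_{M_{\boldsymbol h}}$ is a component of $S_M$, the function $f(\boldsymbol\omega)=d\bigvee_{j\in\boldsymbol h}\omega_j^2$ satisfies $\mathrm{Var}_{\tilde H_{\boldsymbol X}}(f(\boldsymbol\omega))>0$ and $$\lim_{n\to\infty}\sqrt k\Big(\frac nk\,\mathbb E\big[f(\boldsymbol\omega_1)\mathbf 1\{R_1\ge b_{\lfloor n/k\rfloor}t^{-1/2}\}\big]-\mathbb E_{\tilde H_{\boldsymbol X}}[f(\boldsymbol\omega_1)]\,\frac nk\,\bar F\big(b_{\lfloor n/k\rfloor}t^{-1/2}\big)\Big)=0$$ locally uniformly for $t\in[0,\infty)$, and that the ML coefficient matrix $A=(a_{ij})$, with columns $a_1,\dots,a_d$, satisfies $$d\sum_{j=1}^d\bigvee_{i\in\boldsymbol h}\frac{a_{ij}^4}{\|a_j\|_2^2}-\Big(\sum_{j=1}^d\bigvee_{i\in\boldsymbol h}a_{ij}^2\Big)^2>0 .$$ Estimate $A^2$ by $\hat A^2=T\hat S_M$. Then $$\sqrt k(\hat A^2-A^2)\xrightarrow{\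 \mathcal D\ }N(0,TW_MT^\top),\qquad n\to\infty,$$ where $W_M$ is the $\frac{d(d+1)}2\times\frac{d(d+1)}2$ matrix, indexed by the sets $\boldsymbol h$ of the components of $S_M$, whose diagonal entry at $\boldsymbol h$ is $d\sum_{j=1}^d\bigvee_{i\in\boldsymbol h}\frac{a_{ij}^4}{\|a_j\|_2^2}-\big(\sum_{j=1}^d\bigvee_{i\in\boldsymbol h}a_{ij}^2\big)^2$ and whose entry at $(\boldsymbol h,\boldsymbol h')$, $\boldsymbol h\neq\boldsymbol h'$, is $$d\sum_{k=1}^d\frac1{\|a_k\|_2^2}\Big(\bigvee_{m\in\boldsymbol h}a_{mk}^2\Big)\Big(\bigvee_{l\in\boldsymbol h'}a_{lk}^2\Big)-\Big(\sum_{k=1}^d\bigvee_{m\in\boldsymbol h}a_{mk}^2\Big)\Big(\sum_{k=1}^d\bigvee_{l\in\boldsymbol h'}a_{lk}^2\Big).$$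
   Context: Recursive ML vector. Let $\mathcal D=(V,E)$ be a DAG with nodes $V=\{1,\dots,d\}$; $\mathrm{pa}(i)$ are the parents of $i$, $\mathrm{an}(i)$ the ancestors of $i$ (not including $i$), $\mathrm{An}(i)=\mathrm{an}(i)\cup\{i\}$. $\mathcal D$ is well-ordered if $i<j$ for all $i\in V$ and $j\in\mathrm{pa}(i)$. An innovations vector $\boldsymbol Z=(Z_1,\dots,Z_d)$ has independent, atom-free components with support $\mathbb R_+$. Given edge weights $c_{ik}>0$ for $k\in\mathrm{pa}(i)\cup\{i\}$, define $X_i=\bigvee_{k\in\mathrm{pa}(i)}c_{ik}X_k\vee c_{ii}Z_i$. For a path $p=[j\to k_1\to\cdots\to k_l=i]$ put $d(p)=c_{jj}c_{k_1j}\cdots c_{ik_{l-1}}$; let $a_{ij}=\max_p d(p)$ over all paths from $j$ to $i$ if $j\in\mathrm{an}(i)$, $a_{ii}=c_{ii}$, and $a_{ij}=0$ if $j\notin\mathrm{An}(i)$. Then $X_i=\bigvee_{j=1}^d a_{ij}Z_j$, written $\boldsymbol X=A\times_{\max}\boldsymbol Z$; $\boldsymbol X$ is called a recursive ML vector and $A=(a_{ij})$ its ML coefficient matrix. Regular variation. $\boldsymbol Y\in\mathbb R^d_+$ is in $RV^d_+(2)$ (with normalizing sequence $b_n=\sqrt n$ and the Euclidean norm) if, for $R=\|\boldsymbol Y\|_2$ and $\boldsymbol\omega=\boldsymbol Y/R$, $n\mathbb P[(R/b_n,\boldsymbol\omega)\in\cdot]\to\nu_2\times H_{\boldsymbol Y}$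 vaguely on $(0,\infty]\times\Theta_+^{d-1}$, where $d\nu_2(x)=2x^{-3}dx$, $\Theta_+^{d-1}=\{\boldsymbol\omega\in\mathbb R_+^d:\|\boldsymbol\omega\|_2=1\}$ and $H_{\boldsymbol Y}$ is a finite (spectral) measure. $\tilde H_{\boldsymbol Y}=H_{\boldsymbol Y}/H_{\boldsymbol Y}(\Theta_+^{d-1})$; $\mathbb E_{\tilde H_{\boldsymbol Y}}$, $\mathrm{Var}_{\tilde H_{\boldsymbol Y}}$ are expectation and variance when $\boldsymbol\omega\sim\tilde H_{\boldsymbol Y}$. Assumptions. (A1) $\boldsymbol Z\in RV^d_+(2)$ has independent and standardized components: $n\mathbb P(n^{-1/2}Z_i>x)\to x^{-2}$ for all $x>0$ and all $i$. (A2) The norm is the Euclidean norm. (A3) $A$ is standardized, i.e. $a_{ij}$ is replaced by $a_{ij}/(\sum_{k=1}^da_{ik}^2)^{1/2}$, so that every row of $A$ has Euclidean norm $1$. Scalings. For $Y\in RV^1_+(2)$ the squared scaling is $\sigma_Y^2=\lim_{n\to\infty}n\mathbb P(Y>\sqrt n)$. For nonempty $\boldsymbol h\subseteq\{1,\dots,d\}$, $M_{\boldsymbol h}=\max_{i\in\boldsymbol h}X_i$, and $\sigma_i^2=\sigma_{X_i}^2=\sigma^2_{M_{\{i\}}}$. Put $$S_M=(\sigma^2_{M_{1,2,\dots,d}},\sigma^2_{M_{1,3,\dots,d}},\dots,\sigma^2_{M_{1,d}},\sigma_1^2,\ \sigma^2_{M_{2,3,\dots,d}},\sigma^2_{M_{2,4,\dots,d}},\dots,\sigma^2_{M_{2,d}},\sigma_2^2,\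 \dots,\ \sigma^2_{M_{d-1,d}},\sigma^2_{d-1},\ \sigma_d^2)^\top,$$ $$A^2=(a_{11}^2,\dots,a_{1d}^2,\ a_{22}^2,\dots,a_{2d}^2,\ \dots,\ a_{d-1,d-1}^2,a_{d-1,d}^2,\ a_{dd}^2)^\top,$$ both in $\mathbb R_+^{d(d+1)/2}$. Matrix $T$. With $l_{ij}=(j-d)+\sum_{k=0}^{i-1}(d-k)$ for $1\le i\le j\le d$, $T=(t_{uv})$ is the $\frac{d(d+1)}2\times\frac{d(d+1)}2$ matrix with: $t_{l_{ii},l_{ii}}=1$, $t_{l_{ii},l_{i+1,i+1}}=-1$ for $i\le d-1$; $t_{l_{dd},l_{dd}}=1$; $t_{l_{ij},l_{ij}}=1$, $t_{l_{ij},l_{j+1,j+1}}=-1$, $t_{l_{ij},l_{i,j-1}}=-1$, $t_{l_{ij},l_{jj}}=1$ for $i<j\le d-1$; $t_{l_{id},l_{id}}=1$, $t_{l_{id},l_{i,d-1}}=-1$, $t_{l_{id},l_{dd}}=1$ for $i\le d-1$; all other entries $0$. (It satisfies $A^2=TS_M$.) Estimators. $R_\ell=\|\boldsymbol X_\ell\|_2$, $\boldsymbol\omega_\ell=(\omega_{\ell1},\dots,\omega_{\ell d})=\boldsymbol X_\ell/R_\ell$, $R^{(k)}$ is the $k$-th largest among $R_1,\dots,R_n$, $F$ is the distribution function of $R_1$, $\bar F=1-F$, and $$\hat\sigma^2_{M_{\boldsymbol h}}=\frac dk\sum_{\ell=1}^n\bigvee_{j\in\boldsymbol h}\omega_{\ell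 j}^2\,\mathbf 1\{R_\ell\ge R^{(k)}\}$$ (for $\boldsymbol h=\{i\}$ this is $\hat\sigma_i^2$). $\hat S_M$ is obtained from $S_M$ by replacing each component by its estimator. *)

theory Defs
  imports "HOL-Probability.Probability" "HOL-Library.Landau_Symbols"
begin

text \<open>
  Vectors in \<open>\<real>\<^sup>d\<close> are the functions in \<open>{1..d} \<rightarrow>\<^sub>E UNIV\<close>, i.e. functions on \<^typ>\<open>nat\<close> with the dummy
  value \<^const>\<open>undefined\<close> outside \<open>{1..d}\<close>. On this set the product topology of \<^typ>\<open>nat \<Rightarrow> real\<close>
  is the usual topology of \<open>\<real>\<^sup>d\<close>. A random vector is a measurable map into \<open>Rvec d\<close>.
\<close>

abbreviation Rvec :: "nat \<Rightarrow> (nat \<Rightarrow> real) measure" where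
  "Rvec d \<equiv> Pi\<^sub>M {1..d} (\<lambda>_. borel)"

abbreviation enorm :: "nat \<Rightarrow> (nat \<Rightarrow> real) \<Rightarrow> real" where
  "enorm d y \<equiv> L2_set y {1..d}"


section \<open>Recursive max-linear vectors\<close>

text \<open>A pair \<open>(j, i) \<in> E\<close> is the edge \<open>j \<rightarrow> i\<close>, and \<open>c i k\<close> is the weight \<open>c\<^sub>i\<^sub>k\<close> of \<open>k \<rightarrow> i\<close>.\<close>

definition dag :: "nat \<Rightarrow> (nat \<times> nat) set \<Rightarrow> bool" where
  "dag d E \<longleftrightarrow> E \<subseteq> {1..d} \<times> {1..d} \<and> acyclic E"

definition pa :: "(nat \<times> nat) set \<Rightarrow> nat \<Rightarrow> nat set" where
  "pa E i = {k. (k, i) \<in> E}"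

definition an :: "(nat \<times> nat) set \<Rightarrow> nat \<Rightarrow> nat set" where
  "an E i = {j. (j, i) \<in> E\<^sup>+}"

definition well_ordered_dag :: "nat \<Rightarrow> (nat \<times> nat) set \<Rightarrow> bool" where
  "well_ordered_dag d E \<longleftrightarrow> dag d E \<and> (\<forall>i\<in>{1..d}. \<forall>j\<in>pa E i. i < j)"

definition edge_weights :: "nat \<Rightarrow> (nat \<times> nat) set \<Rightarrow> (nat \<Rightarrow> nat \<Rightarrow> real) \<Rightarrow> bool" where
  "edge_weights d E c \<longleftrightarrow> (\<forall>i\<in>{1..d}. \<forall>k\<in>pa E i \<union> {i}. c i k > 0)"

definition paths :: "(nat \<times> nat) set \<Rightarrow> nat \<Rightarrow> nat \<Rightarrow> nat list set" where
  "paths E j i = {p. p \<noteq> [] \<and> hd p = j \<and> last p = i \<and> successively (\<lambda>u v. (u, v) \<in> E) p}"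

definition path_weight :: "(nat \<Rightarrow> nat \<Rightarrow> real) \<Rightarrow> nat list \<Rightarrow> real" where
  "path_weight c p = c (hd p) (hd p) * (\<Prod>m<length p - 1. c (p ! Suc m) (p ! m))"

definition ml_coeff :: "(nat \<times> nat) set \<Rightarrow> (nat \<Rightarrow> nat \<Rightarrow> real) \<Rightarrow> nat \<Rightarrow> nat \<Rightarrow> real" where
  "ml_coeff E c i j =
     (if j = i then c i i
      else if j \<in> an E i then Max (path_weight c ` paths E j i)
      else 0)"

definition measure_support :: "'a::topological_space measure \<Rightarrow> 'a set" where
  "measure_support \<mu> = {x. \<forall>U. open U \<and> x \<in> U \<longrightarrow> emeasure \<mu> U > 0}"

definition innovations :: "'a measure \<Rightarrow> nat \<Rightarrow> ('a \<Rightarrow> nat \<Rightarrow> real) \<Rightarrow> bool" where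
  "innovations M d Z \<longleftrightarrow>
     Z \<in> M \<rightarrow>\<^sub>M Rvec d \<and>
     prob_space.indep_vars M (\<lambda>_. borel) (\<lambda>i x. Z x i) {1..d} \<and>
     (\<forall>i\<in>{1..d}. \<forall>z. measure M {x \<in> space M. Z x i = z} = 0) \<and>
     (\<forall>i\<in>{1..d}. measure_support (distr M borel (\<lambda>x. Z x i)) = {0..})"

definition recursive_ml :: "'a measure \<Rightarrow> nat \<Rightarrow> (nat \<times> nat) set \<Rightarrow> (nat \<Rightarrow> nat \<Rightarrow> real) \<Rightarrow>
    ('a \<Rightarrow> nat \<Rightarrow> real) \<Rightarrow> ('a \<Rightarrow> nat \<Rightarrow> real) \<Rightarrow> bool" where
  "recursive_ml M d E c Z X \<longleftrightarrow>
     X \<in> M \<rightarrow>\<^sub>M Rvec d \<and>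
     (\<forall>x\<in>space M. \<forall>i\<in>{1..d}.
        X x i = Max (insert (c i i * Z x i) ((\<lambda>k. c i k * X x k) ` pa E i)))"

definition standardized :: "nat \<Rightarrow> (nat \<Rightarrow> nat \<Rightarrow> real) \<Rightarrow> bool" where
  "standardized d a \<longleftrightarrow> (\<forall>i\<in>{1..d}. enorm d (a i) = 1)"

lemma paths_trancl:
  assumes "successively (\<lambda>u v. (u, v) \<in> E) p" "m < n" "n < length p"
  shows "(p ! m, p ! n) \<in> E\<^sup>+"
  using assms(2,3)
proof (induction n)
  case (Suc n)
  have "(p ! n, p ! Suc n) \<in> E" using assms(1) Suc.prems by (simp add: successively_conv_nth)
  then show ?case using Suc by (cases "m = n") (auto intro: trancl_into_trancl)
qed simp

lemma finite_paths:
  assumes "dag d E" "j \<noteq> i"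
  shows "finite (paths E j i)"
proof (rule finite_subset)
  have fE: "finite {1..d}" by simp
  show "finite {p. set p \<subseteq> {1..d} \<and> distinct p}" by (rule finite_subset_distinct[OF fE])
  show "paths E j i \<subseteq> {p. set p \<subseteq> {1..d} \<and> distinct p}"
  proof
    fix p assume p: "p \<in> paths E j i"
    then have s: "successively (\<lambda>u v. (u, v) \<in> E) p" and l: "length p \<ge> 2"
      using assms(2) by (cases p; cases "tl p"; auto simp: paths_def)+
    have "p ! m \<in> {1..d}" if "m < length p" for m
    proof (cases "Suc m < length p")
      case True
      then have "(p ! m, p ! Suc m) \<in> E" using s by (simp add: successively_conv_nth)
      then show ?thesis using assms(1) by (auto simp: dag_def)
    next
      case False
      then have "m = Suc (m - 1)" using l that by linarith
      then have "(p ! (m - 1), p ! m) \<in> E" using s that by (metis successively_conv_nth)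
      then show ?thesis using assms(1) by (auto simp: dag_def)
    qed
    then have "set p \<subseteq> {1..d}" by (metis in_set_conv_nth subsetI)
    moreover have "distinct p"
      unfolding distinct_conv_nth
    proof (intro allI impI)
      fix m n assume "m < length p" "n < length p" "m \<noteq> n"
      then have "(p ! m, p ! n) \<in> E\<^sup>+ \<or> (p ! n, p ! m) \<in> E\<^sup>+"
        using paths_trancl[OF s] by (meson linorder_neqE_nat)
      then show "p ! m \<noteq> p ! n" using assms(1) by (auto simp: dag_def acyclic_def)
    qed
    ultimately show "p \<in> {p. set p \<subseteq> {1..d} \<and> distinct p}" by simp
  qed
qed

lemma paths_nonempty:
  assumes "(j, i) \<in> E\<^sup>+" shows "paths E j i \<noteq> {}"
  using assms
proof (induction rule: trancl_induct)
  case (base y)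
  then have "[j, y] \<in> paths E j y" by (simp add: paths_def)
  then show ?case by blast
next
  case (step y z)
  then obtain p where "p \<in> paths E j y" by blast
  then have "p @ [z] \<in> paths E j z" using step(2) by (auto simp: paths_def successively_append_iff)
  then show ?case by blast
qed

text \<open>Dividing the rows of the coefficient matrix by their norms amounts to rescaling the weights,
  so the standardized matrix is again an ML coefficient matrix on the same DAG.\<close>

lemma ml_coeff_standardize:
  fixes c :: "nat \<Rightarrow> nat \<Rightarrow> real"
  assumes D: "dag d E" and W: "edge_weights d E c"
  defines "s \<equiv> \<lambda>i. enorm d (ml_coeff E c i)"
  defines "c' \<equiv> \<lambda>i k. if k = i then c i i / s i else c i k * s k / s i"
  shows "edge_weights d E c'"
    and "\<And>i j. i \<in> {1..d} \<Longrightarrow> ml_coeff E c' i j = ml_coeff E c i j / s i"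
    and "standardized d (ml_coeff E c')"
proof -
  have s: "s i > 0" if "i \<in> {1..d}" for i
  proof -
    have "ml_coeff E c i i > 0" using that W by (auto simp: ml_coeff_def edge_weights_def)
    moreover have "ml_coeff E c i i \<le> s i"
      unfolding s_def using member_le_L2_set[of "{1..d}" i "ml_coeff E c i"] that
      by simp
    ultimately show ?thesis by linarith
  qed
  have E: "u \<in> {1..d}" "v \<in> {1..d}" "u \<noteq> v" if "(u, v) \<in> E" for u v
    using D that by (auto simp: dag_def acyclic_def)
  show "edge_weights d E c'"
    using W s E by (auto simp: edge_weights_def c'_def pa_def)
  have pw: "path_weight c' p = path_weight c p / s i"
    if p: "p \<in> paths E j i" and ij: "j \<noteq> i" for p i j
  proof -
    from p have ne: "p \<noteq> []" and hd: "hd p = p ! 0" "p ! 0 = j" and la: "p ! (length p - 1) = i"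
      and su: "\<And>m. Suc m < length p \<Longrightarrow> (p ! m, p ! Suc m) \<in> E"
      by (auto simp: paths_def hd_conv_nth last_conv_nth successively_conv_nth)
    have l: "length p \<ge> 2" using ne hd la ij by (cases p; cases "tl p") auto
    have j: "j \<in> {1..d}" using E su[of 0] l hd by auto
    have *: "c' j j * (\<Prod>m<n. c' (p ! Suc m) (p ! m)) =
        c j j * (\<Prod>m<n. c (p ! Suc m) (p ! m)) / s (p ! n)" if "n < length p" for n
      using that
    proof (induction n)
      case 0 then show ?case using hd by (simp add: c'_def)
    next
      case (Suc n)
      have e: "(p ! n, p ! Suc n) \<in> E" using su Suc by simp
      have "c' (p ! Suc n) (p ! n) = c (p ! Suc n) (p ! n) * s (p ! n) / s (p ! Suc n)"
        using E(3)[OF e] by (simp add: c'_def)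
      moreover have "s (p ! n) > 0" "s (p ! Suc n) > 0" using s E e by blast+
      moreover have "c' j j * (\<Prod>m<Suc n. c' (p ! Suc m) (p ! m)) =
          (c j j * (\<Prod>m<n. c (p ! Suc m) (p ! m)) / s (p ! n)) * c' (p ! Suc n) (p ! n)"
        using Suc by (simp add: mult.assoc[symmetric])
      ultimately show ?case by simp
    qed
    show ?thesis using *[of "length p - 1"] l hd la by (simp add: path_weight_def)
  qed
  show eq: "ml_coeff E c' i j = ml_coeff E c i j / s i" if i: "i \<in> {1..d}" for i j
  proof (cases "j \<noteq> i \<and> j \<in> an E i")
    case True
    have "path_weight c' ` paths E j i = (\<lambda>x. x / s i) ` path_weight c ` paths E j i"
      using pw True by (auto simp: image_image)
    moreover have "mono (\<lambda>x. x / s i)"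
      using s[OF i] by (auto intro!: monoI divide_right_mono)
    moreover have "finite (path_weight c ` paths E j i)" "path_weight c ` paths E j i \<noteq> {}"
      using finite_paths[OF D] paths_nonempty True by (auto simp: an_def)
    ultimately show ?thesis
      using True mono_Max_commute[of "\<lambda>x. x / s i" "path_weight c ` paths E j i"]
      by (simp add: ml_coeff_def)
  qed (auto simp: ml_coeff_def c'_def)
  show "standardized d (ml_coeff E c')"
    unfolding standardized_def
  proof
    fix i assume i: "i \<in> {1..d}"
    have "enorm d (ml_coeff E c' i) = enorm d (\<lambda>j. (1 / s i) * ml_coeff E c i j)"
      by (intro L2_set_cong refl) (simp add: eq[OF i])
    also have "\<dots> = (1 / s i) * s i"
      unfolding s_def using s[OF i, unfolded s_def] by (subst L2_set_right_distrib[symmetric]) auto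
    finally show "enorm d (ml_coeff E c' i) = 1" using s[OF i] by simp
  qed
qed



section \<open>Regular variation with index 2\<close>

definition vague_conv_on ::
    "'a::topological_space set \<Rightarrow> (nat \<Rightarrow> 'a measure) \<Rightarrow> 'a measure \<Rightarrow> bool" where
  "vague_conv_on S \<mu> \<nu> \<longleftrightarrow>
     (\<forall>g :: 'a \<Rightarrow> real.
        continuous_on S g \<and> (\<exists>K. compact K \<and> K \<subseteq> S \<and> (\<forall>x\<in>S - K. g x = 0)) \<longrightarrow>
        (\<lambda>n. LINT x:S|\<mu> n. g x) \<longlonglongrightarrow> (LINT x:S|\<nu>. g x))"

definition Theta_pos :: "nat \<Rightarrow> (nat \<Rightarrow> real) set" where
  "Theta_pos d = {w \<in> {1..d} \<rightarrow>\<^sub>E {0..}. enorm d w = 1}"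

definition angle :: "nat \<Rightarrow> (nat \<Rightarrow> real) \<Rightarrow> nat \<Rightarrow> real" where
  "angle d y = (\<lambda>i\<in>{1..d}. y i / enorm d y)"

text \<open>The measure with Lebesgue density \<open>2 x\<^sup>-\<^sup>3\<close> on \<open>(0, \<infinity>)\<close>, as a measure on the extended reals
  without mass at \<open>\<infinity>\<close>.\<close>

definition nu2 :: "ereal measure" where
  "nu2 = distr (density lborel (\<lambda>x. ennreal (indicator {0<..} x * (2 / x ^ 3)))) borel ereal"

definition rv2_spectral ::
    "'a measure \<Rightarrow> nat \<Rightarrow> ('a \<Rightarrow> nat \<Rightarrow> real) \<Rightarrow> (nat \<Rightarrow> real) measure \<Rightarrow> bool" where
  "rv2_spectral M d Y H \<longleftrightarrow>
     Y \<in> M \<rightarrow>\<^sub>M Rvec d \<and>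
     (AE x in M. \<forall>i\<in>{1..d}. 0 \<le> Y x i) \<and>
     sets H = sets (restrict_space (Rvec d) (Theta_pos d)) \<and>
     finite_measure H \<and>
     vague_conv_on ({0<..} \<times> Theta_pos d)
       (\<lambda>n. scale_measure (ennreal (real n))
          (distr M (borel \<Otimes>\<^sub>M Rvec d)
             (\<lambda>x. (ereal (enorm d (Y x) / sqrt (real n)), angle d (Y x)))))
       (nu2 \<Otimes>\<^sub>M H)"

definition regularly_varying2 :: "'a measure \<Rightarrow> nat \<Rightarrow> ('a \<Rightarrow> nat \<Rightarrow> real) \<Rightarrow> bool" where
  "regularly_varying2 M d Y \<longleftrightarrow> (\<exists>H. rv2_spectral M d Y H)"

text \<open>The vague limit determines the spectral measure, so the choice is unique whenever \<open>Y\<close> is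
  regularly varying.\<close>

definition spectral_measure ::
    "'a measure \<Rightarrow> nat \<Rightarrow> ('a \<Rightarrow> nat \<Rightarrow> real) \<Rightarrow> (nat \<Rightarrow> real) measure" where
  "spectral_measure M d Y = (SOME H. rv2_spectral M d Y H)"

definition norm_spectral ::
    "'a measure \<Rightarrow> nat \<Rightarrow> ('a \<Rightarrow> nat \<Rightarrow> real) \<Rightarrow> (nat \<Rightarrow> real) measure" where
  "norm_spectral M d Y =
     scale_measure (inverse (emeasure (spectral_measure M d Y) (Theta_pos d)))
       (spectral_measure M d Y)"

definition standardized_innovations :: "'a measure \<Rightarrow> nat \<Rightarrow> ('a \<Rightarrow> nat \<Rightarrow> real) \<Rightarrow> bool" where
  "standardized_innovations M d Z \<longleftrightarrow>
     innovations M d Z \<and> regularly_varying2 M d Z \<and>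
     (\<forall>i\<in>{1..d}. \<forall>x>0.
        (\<lambda>n. real n * measure M {y \<in> space M. real n powr (-1/2) * Z y i > x})
          \<longlonglongrightarrow> x powr (-2))"


section \<open>The vectors and matrices of the estimation problem\<close>

definition dimN :: "nat \<Rightarrow> nat" where
  "dimN d = d * (d + 1) div 2"

definition upper_pairs :: "nat \<Rightarrow> (nat \<times> nat) set" where
  "upper_pairs d = {(i, j). 1 \<le> i \<and> i \<le> j \<and> j \<le> d}"

text \<open>The summand \<open>j - d\<close> of \<open>l\<^sub>i\<^sub>j\<close> may be negative; since \<open>i \<ge> 1\<close>, the order of operations
  below avoids truncation.\<close>

definition lpos :: "nat \<Rightarrow> nat \<Rightarrow> nat \<Rightarrow> nat" where
  "lpos d i j = (\<Sum>k<i. d - k) + j - d"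

definition lpair :: "nat \<Rightarrow> nat \<Rightarrow> nat \<times> nat" where
  "lpair d = the_inv_into (upper_pairs d) (\<lambda>(i, j). lpos d i j)"

lemma lpos_Suc:
  assumes "i \<ge> 1" "i \<le> j" "j \<le> d"
  shows "lpos d i j = (\<Sum>k<i - 1. d - k) + (j - i) + 1"
proof -
  obtain m where m: "i = Suc m" using assms(1) by (cases i) auto
  show ?thesis using assms by (simp add: lpos_def m)
qed

lemma sum_rows: "(m::nat) \<le> d \<Longrightarrow> 2 * (\<Sum>k<m. d - k) + m * m = m * (2 * d + 1)"
proof (induction m)
  case (Suc m)
  then obtain e where "d = m + Suc e" by (metis Suc_le_lessD less_imp_Suc_add add_Suc_right)
  with Suc show ?case by (simp add: algebra_simps)
qed simp

lemma lpos_bij: "bij_betw (\<lambda>(i, j). lpos d i j) (upper_pairs d) {1..dimN d}"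
proof -
  have fin: "finite (upper_pairs d)"
    by (rule finite_subset[of _ "{..d} \<times> {..d}"]) (auto simp: upper_pairs_def)
  have mono: "(\<Sum>k<i'. d - k) \<le> (\<Sum>k<i. d - k)" if "i' \<le> i" for i i'
    using that by (intro sum_mono2) auto
  have lt: "lpos d i j < lpos d i' j'"
    if ij: "1 \<le> i" "i \<le> j" "j \<le> d" "1 \<le> i'" "i' \<le> j'" "j' \<le> d" "i < i'" for i j i' j'
  proof -
    obtain m where m: "i = Suc m" using ij(1) by (cases i) auto
    have "(\<Sum>k<Suc m. d - k) \<le> (\<Sum>k<i' - 1. d - k)" using ij m by (intro mono) auto
    moreover have "lpos d i j \<le> (\<Sum>k<Suc m. d - k)" using ij by (simp add: lpos_Suc m)
    ultimately show ?thesis using lpos_Suc[OF ij(4-6)] by linarith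
  qed
  have inj: "inj_on (\<lambda>(i, j). lpos d i j) (upper_pairs d)"
  proof (rule inj_onI, clarify)
    fix i j i' j'
    assume A: "(i, j) \<in> upper_pairs d" "(i', j') \<in> upper_pairs d" "lpos d i j = lpos d i' j'"
    then have "i = i'"
      using lt[of i j i' j'] lt[of i' j' i j] by (cases i i' rule: linorder_cases) (auto simp: upper_pairs_def)
    with A show "i = i' \<and> j = j'" by (auto simp: upper_pairs_def lpos_Suc)
  qed
  have dim: "(\<Sum>k<d. d - k) = dimN d"
    using sum_rows[of d d] by (simp add: dimN_def algebra_simps)
  have "card (upper_pairs d) = dimN d"
  proof -
    have "upper_pairs d = (SIGMA i:{1..d}. {i..d})" by (auto simp: upper_pairs_def)
    then have "card (upper_pairs d) = (\<Sum>i=1..d. Suc d - i)" by simp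
    also have "\<dots> = (\<Sum>k<d. d - k)"
      by (rule sum.reindex_bij_witness[of _ Suc "\<lambda>i. i - 1"]) auto
    finally show ?thesis using dim by simp
  qed
  moreover have "(\<lambda>(i, j). lpos d i j) ` upper_pairs d \<subseteq> {1..dimN d}"
  proof clarify
    fix i j assume "(i, j) \<in> upper_pairs d"
    then have ij: "1 \<le> i" "i \<le> j" "j \<le> d" by (auto simp: upper_pairs_def)
    have "lpos d i j \<le> (\<Sum>k<i. d - k)" using ij by (simp add: lpos_def)
    also have "\<dots> \<le> dimN d" using mono[of i d] ij dim by simp
    finally show "lpos d i j \<in> {1..dimN d}" using ij by (simp add: lpos_Suc)
  qed
  ultimately have "(\<lambda>(i, j). lpos d i j) ` upper_pairs d = {1..dimN d}"
    using inj by (intro card_subset_eq) (auto simp: card_image)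
  with inj show ?thesis by (simp add: bij_betw_def)
qed

lemma lpair_lpos: "1 \<le> i \<Longrightarrow> i \<le> j \<Longrightarrow> j \<le> d \<Longrightarrow> lpair d (lpos d i j) = (i, j)"
  using the_inv_into_f_f[OF bij_betw_imp_inj_on[OF lpos_bij], of "(i, j)" d]
  by (simp add: lpair_def upper_pairs_def)

text \<open>Component \<open>l\<^sub>i\<^sub>j\<close> of \<open>S\<^sub>M\<close> belongs to the set \<open>{i, j + 1, \<dots>, d}\<close>; for \<open>j = d\<close> this is \<open>{i}\<close>.\<close>

definition comp_set :: "nat \<Rightarrow> nat \<Rightarrow> nat set" where
  "comp_set d u = (case lpair d u of (i, j) \<Rightarrow> {i} \<union> {j + 1..d})"

definition A2_vec :: "nat \<Rightarrow> (nat \<Rightarrow> nat \<Rightarrow> real) \<Rightarrow> nat \<Rightarrow> real" where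
  "A2_vec d a = (\<lambda>u\<in>{1..dimN d}. case lpair d u of (i, j) \<Rightarrow> (a i j)\<^sup>2)"

definition T_mat :: "nat \<Rightarrow> nat \<Rightarrow> nat \<Rightarrow> real" where
  "T_mat d u v =
     (if \<exists>i. 1 \<le> i \<and> i \<le> d \<and> u = lpos d i i \<and> v = lpos d i i then 1
      else if \<exists>i. 1 \<le> i \<and> i < d \<and> u = lpos d i i \<and> v = lpos d (i + 1) (i + 1) then -1
      else if \<exists>i j. 1 \<le> i \<and> i < j \<and> j < d \<and> u = lpos d i j \<and>
                (v = lpos d i j \<or> v = lpos d j j) then 1
      else if \<exists>i j. 1 \<le> i \<and> i < j \<and> j < d \<and> u = lpos d i j \<and>
                (v = lpos d (j + 1) (j + 1) \<or> v = lpos d i (j - 1)) then -1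
      else if \<exists>i. 1 \<le> i \<and> i < d \<and> u = lpos d i d \<and>
                (v = lpos d i d \<or> v = lpos d d d) then 1
      else if \<exists>i. 1 \<le> i \<and> i < d \<and> u = lpos d i d \<and> v = lpos d i (d - 1) then -1
      else 0)"

definition W_entry :: "nat \<Rightarrow> (nat \<Rightarrow> nat \<Rightarrow> real) \<Rightarrow> nat set \<Rightarrow> nat set \<Rightarrow> real" where
  "W_entry d a h h' =
     (if h = h' then
        real d * (\<Sum>j=1..d. MAX i\<in>h. (a i j) ^ 4 / (enorm d (\<lambda>m. a m j))\<^sup>2)
        - (\<Sum>j=1..d. MAX i\<in>h. (a i j)\<^sup>2)\<^sup>2
      else
        real d * (\<Sum>k=1..d. 1 / (enorm d (\<lambda>m. a m k))\<^sup>2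
                    * (MAX m\<in>h. (a m k)\<^sup>2) * (MAX l\<in>h'. (a l k)\<^sup>2))
        - (\<Sum>k=1..d. MAX m\<in>h. (a m k)\<^sup>2) * (\<Sum>k=1..d. MAX l\<in>h'. (a l k)\<^sup>2))"

definition W_mat :: "nat \<Rightarrow> (nat \<Rightarrow> nat \<Rightarrow> real) \<Rightarrow> nat \<Rightarrow> nat \<Rightarrow> real" where
  "W_mat d a u v = W_entry d a (comp_set d u) (comp_set d v)"

definition TWT_mat :: "nat \<Rightarrow> (nat \<Rightarrow> nat \<Rightarrow> real) \<Rightarrow> nat \<Rightarrow> nat \<Rightarrow> real" where
  "TWT_mat d a u v = (\<Sum>p=1..dimN d. \<Sum>q=1..dimN d. T_mat d u p * W_mat d a p q * T_mat d v q)"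


section \<open>Estimators and the second-order condition\<close>

definition iid_copies ::
    "'a measure \<Rightarrow> nat \<Rightarrow> ('a \<Rightarrow> nat \<Rightarrow> real) \<Rightarrow> (nat \<Rightarrow> 'a \<Rightarrow> nat \<Rightarrow> real) \<Rightarrow> bool" where
  "iid_copies M d X Xs \<longleftrightarrow>
     prob_space.indep_vars M (\<lambda>_. Rvec d) Xs {1..} \<and>
     (\<forall>l\<ge>1. distr M (Rvec d) (Xs l) = distr M (Rvec d) X)"

definition kth_largest :: "nat \<Rightarrow> nat \<Rightarrow> (nat \<Rightarrow> real) \<Rightarrow> real" where
  "kth_largest n k r = rev (sort (map r [1..<n + 1])) ! (k - 1)"

definition sigma2_hat :: "nat \<Rightarrow> nat \<Rightarrow> nat \<Rightarrow> (nat \<Rightarrow> nat \<Rightarrow> real) \<Rightarrow> nat set \<Rightarrow> real" where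
  "sigma2_hat d n k xs h =
     real d / real k *
       (\<Sum>l=1..n. (MAX j\<in>h. (angle d (xs l) j)\<^sup>2) *
          indicator {l. enorm d (xs l) \<ge> kth_largest n k (\<lambda>m. enorm d (xs m))} l)"

definition SM_hat :: "nat \<Rightarrow> nat \<Rightarrow> nat \<Rightarrow> (nat \<Rightarrow> nat \<Rightarrow> real) \<Rightarrow> nat \<Rightarrow> real" where
  "SM_hat d n k xs = (\<lambda>u\<in>{1..dimN d}. sigma2_hat d n k xs (comp_set d u))"

definition A2_hat :: "nat \<Rightarrow> nat \<Rightarrow> nat \<Rightarrow> (nat \<Rightarrow> nat \<Rightarrow> real) \<Rightarrow> nat \<Rightarrow> real" where
  "A2_hat d n k xs = (\<lambda>u\<in>{1..dimN d}. \<Sum>v=1..dimN d. T_mat d u v * SM_hat d n k xs v)"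

definition f_max :: "nat \<Rightarrow> nat set \<Rightarrow> (nat \<Rightarrow> real) \<Rightarrow> real" where
  "f_max d h w = real d * (MAX j\<in>h. (w j)\<^sup>2)"

text \<open>The threshold \<open>b\<^bsub>\<lfloor>n/k\<rfloor>\<^esub> t\<^bsup>-1/2\<^esup>\<close> is an extended real, equal to \<open>\<infinity>\<close> for \<open>t = 0\<close>. (For real
  numbers \<open>1 / 0 = 0\<close> would give the wrong value.)\<close>

definition threshold :: "nat \<Rightarrow> nat \<Rightarrow> real \<Rightarrow> ereal" where
  "threshold n k t = ereal (sqrt (real (n div k))) / ereal (sqrt t)"

definition bias_term :: "'a measure \<Rightarrow> nat \<Rightarrow> ('a \<Rightarrow> nat \<Rightarrow> real) \<Rightarrow> (nat \<Rightarrow> real) measure \<Rightarrow>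
    ((nat \<Rightarrow> real) \<Rightarrow> real) \<Rightarrow> nat \<Rightarrow> nat \<Rightarrow> real \<Rightarrow> real" where
  "bias_term M d X1 H f n k t =
     sqrt (real k) *
       (real n / real k *
          (LINT x|M. f (angle d (X1 x)) * indicator {x. ereal (enorm d (X1 x)) \<ge> threshold n k t} x)
        - (LINT w|H. f w) * (real n / real k) *
          (1 - measure M {x \<in> space M. ereal (enorm d (X1 x)) \<le> threshold n k t}))"


section \<open>Convergence in distribution to a normal vector\<close>

definition conv_in_distribution ::
    "'a measure \<Rightarrow> nat \<Rightarrow> (nat \<Rightarrow> 'a \<Rightarrow> nat \<Rightarrow> real) \<Rightarrow> (nat \<Rightarrow> real) measure \<Rightarrow> bool" where
  "conv_in_distribution M N Y \<mu> \<longleftrightarrow>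
     (\<forall>g :: (nat \<Rightarrow> real) \<Rightarrow> real.
        continuous_on ({1..N} \<rightarrow>\<^sub>E UNIV) g \<and> bounded (g ` ({1..N} \<rightarrow>\<^sub>E UNIV)) \<longrightarrow>
        (\<lambda>n. LINT y|distr M (Rvec N) (Y n). g y) \<longlonglongrightarrow> (LINT y|\<mu>. g y))"

text \<open>The law \<open>N(m, \<Sigma>)\<close> on \<open>\<real>\<^sup>N\<close> by its characteristic function, as \<open>\<Sigma>\<close> may be singular.\<close>

definition mv_normal ::
    "nat \<Rightarrow> (nat \<Rightarrow> real) \<Rightarrow> (nat \<Rightarrow> nat \<Rightarrow> real) \<Rightarrow> (nat \<Rightarrow> real) measure \<Rightarrow> bool" where
  "mv_normal N m \<Sigma> \<mu> \<longleftrightarrow>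
     prob_space \<mu> \<and> sets \<mu> = sets (Rvec N) \<and>
     (\<forall>t :: nat \<Rightarrow> real.
        (CLINT y|\<mu>. iexp (\<Sum>u=1..N. t u * y u)) =
        exp (\<i> * of_real (\<Sum>u=1..N. t u * m u)
             - of_real ((\<Sum>u=1..N. \<Sum>v=1..N. t u * \<Sigma> u v * t v) / 2)))"

end

theory Submission
  imports Defs
begin

text \<open>
  Since a single innovation dominates when \<open>X\<close> is large, the spectral measure of \<open>X\<close> puts mass
  \<open>\<parallel>a\<^sub>j\<parallel>\<^sup>2\<close> on the direction \<open>a\<^sub>j / \<parallel>a\<^sub>j\<parallel>\<close> of each column \<open>a\<^sub>j\<close>. Hence the expectation of
  \<open>d \<Or>\<^bsub>j\<in>h\<^esub> \<omega>\<^sub>j\<^sup>2\<close> under the normalized spectral measure is \<open>\<Sum>\<^sub>j \<Or>\<^bsub>i\<in>h\<^esub> a\<^sub>i\<^sub>j\<^sup>2\<close>, the squared scaling of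
  \<open>M\<^sub>h\<close>, and \<open>W\<^sub>M\<close> is the covariance matrix of these functions.

  Because the law of \<open>R = \<parallel>X\<parallel>\<close> has no atoms, exactly \<open>k\<close> observations satisfy \<open>R\<^sub>l \<ge> R\<^sup>(\<^sup>k\<^sup>)\<close>, and by
  \<open>A\<^sup>2 = T S\<^sub>M\<close> a linear functional of the estimation error is \<open>k\<^sup>-\<^sup>1\<^sup>/\<^sup>2\<close> times the sum of a centred function
  of their angles. Given \<open>R\<^sup>(\<^sup>k\<^sup>) = r\<close>, the \<open>k - 1\<close> larger observations are independent with the law of
  \<open>X\<close> conditioned on \<open>R > r\<close>. The second-order condition makes their conditional mean negligible,
  uniformly in \<open>r\<close> over a window that contains \<open>R\<^sup>(\<^sup>k\<^sup>)\<close> with high probability, so the characteristic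
  functions converge to the normal one. A trigonometric form of the Stone--Weierstrass theorem and
  tightness of the marginals turn this into convergence in distribution.
\<close>

section \<open>Continuity theorem in several dimensions\<close>

text \<open>The threshold of the estimator is random, and its \<open>k\<close> summands are
  dependent through it. Since the summed function is centred at its spectral mean, the conditional
  limit is the same for every threshold in the window, so the law of the threshold itself never has
  to be computed. Conditioning on the value of an order statistic, an event of probability zero, is
  replaced by an exact decomposition: up to a null set the sample space splits according to the
  index that carries the \<open>k\<close>-th largest radius and the set of the \<open>k - 1\<close>
  indices above it, and on each piece Fubini factorizes the integral.

  The covariance comes from a random direction with only \<open>d\<close> atoms, so its rank is at
  most \<open>d\<close>, whereas the vector has \<open>d (d + 1) / 2\<close> components. For
  \<open>d >= 2\<close> the normal limit therefore has no density; it is built as a linear image of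
  \<open>d\<close> independent standard normals and identified through its characteristic
  function.\<close>

declare One_nat_def [simp del]

text \<open>The Borel sets of \<open>nat => real\<close> are generated by all coordinates, and those
  outside \<open>{1..N}\<close> are constantly \<open>undefined\<close> on \<open>Rvec N\<close>.
  This links topological continuity of test functions with measurability for the finite
  product.\<close>

lemma measurable_Rvec_borel: "(\<lambda>y. y) \<in> Rvec N \<rightarrow>\<^sub>M borel"
proof -
  have "(\<lambda>y. y) \<in> Rvec N \<rightarrow>\<^sub>M Pi\<^sub>M UNIV (\<lambda>_. borel :: real measure)"
  proof (rule measurable_PiM_single')
    fix i :: nat
    show "(\<lambda>y. y i) \<in> borel_measurable (Rvec N)"
    proof (cases "i \<in> {1..N}")
      case False
      then have "y i = undefined" if "y \<in> space (Rvec N)" for y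
        using that by (auto simp: space_PiM PiE_def extensional_def)
      then show ?thesis by (subst measurable_cong[where g = "\<lambda>_. undefined"]) auto
    qed measurable
  qed auto
  then show ?thesis by (simp add: measurable_cong_sets[OF refl sets_PiM_equal_borel])
qed

lemma continuous_on_measurable_Rvec:
  fixes g :: "(nat \<Rightarrow> real) \<Rightarrow> 'b::topological_space"
  assumes "continuous_on S g" "S \<subseteq> space (Rvec N)"
  shows "g \<in> borel_measurable (restrict_space (Rvec N) S)"
proof (rule measurable_compose[of "\<lambda>y. y" _ "restrict_space borel S"])
  show "(\<lambda>y. y) \<in> restrict_space (Rvec N) S \<rightarrow>\<^sub>M restrict_space borel S"
    using measurable_Rvec_borel by (intro measurable_restrict_space3) auto
  show "g \<in> borel_measurable (restrict_space borel S)"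
    by (rule borel_measurable_continuous_on_restrict[OF assms(1)])
qed

lemma space_Rvec: "space (Rvec N) = {1..N} \<rightarrow>\<^sub>E UNIV"
  by (simp add: space_PiM)

lemma continuous_borel_measurable_Rvec:
  fixes g :: "(nat \<Rightarrow> real) \<Rightarrow> 'b::topological_space"
  assumes "continuous_on ({1..N} \<rightarrow>\<^sub>E UNIV) g"
  shows "g \<in> borel_measurable (Rvec N)"
proof (rule measurable_compose[of "\<lambda>y. y" _ "restrict_space borel ({1..N} \<rightarrow>\<^sub>E UNIV)"])
  show "(\<lambda>y. y) \<in> Rvec N \<rightarrow>\<^sub>M restrict_space borel ({1..N} \<rightarrow>\<^sub>E UNIV)"
    using measurable_Rvec_borel by (intro measurable_restrict_space2) (auto simp: space_Rvec)
  show "g \<in> borel_measurable (restrict_space borel ({1..N} \<rightarrow>\<^sub>E UNIV))"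
    by (rule borel_measurable_continuous_on_restrict[OF assms])
qed

section \<open>Trigonometric polynomials and uniform approximation on boxes\<close>

inductive_set trig_poly :: "nat \<Rightarrow> ((nat \<Rightarrow> real) \<Rightarrow> real) set" for N where
  cos: "(\<lambda>y. c * cos ((\<Sum>u=1..N. s u * y u) + b)) \<in> trig_poly N"
| add: "f \<in> trig_poly N \<Longrightarrow> g \<in> trig_poly N \<Longrightarrow> (\<lambda>y. f y + g y) \<in> trig_poly N"

lemma trig_poly_const: "(\<lambda>_. c) \<in> trig_poly N"
  using trig_poly.cos[where c = c and s = "\<lambda>_. 0" and b = 0] by simp

text \<open>The product-to-sum formula for cosines keeps products inside the set. The free phase in
  \<open>trig_poly\<close> is what makes this close up: it also yields sines and constants from a
  single generator.\<close>

lemma trig_poly_mult_cos: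
  assumes "f \<in> trig_poly N"
  shows "(\<lambda>y. f y * (c * cos ((\<Sum>u=1..N. s u * y u) + b))) \<in> trig_poly N"
  using assms
proof induction
  case (cos c' s' b')
  have "(\<lambda>y. c' * cos ((\<Sum>u=1..N. s' u * y u) + b') * (c * cos ((\<Sum>u=1..N. s u * y u) + b))) =
      (\<lambda>y. (c' * c / 2) * cos ((\<Sum>u=1..N. (s' u - s u) * y u) + (b' - b)) +
           (c' * c / 2) * cos ((\<Sum>u=1..N. (s' u + s u) * y u) + (b' + b)))"
  proof
    fix y
    have prod: "c' * cos x * (c * cos z) = c' * c / 2 * cos (x - z) + c' * c / 2 * cos (x + z)" for x z
      by (simp add: cos_add cos_diff field_simps)
    have sums: "(\<Sum>u=1..N. (s' u - s u) * y u) + (b' - b) = ((\<Sum>u=1..N. s' u * y u) + b') - ((\<Sum>u=1..N. s u * y u) + b)"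
      "(\<Sum>u=1..N. (s' u + s u) * y u) + (b' + b) = ((\<Sum>u=1..N. s' u * y u) + b') + ((\<Sum>u=1..N. s u * y u) + b)"
      by (simp_all add: algebra_simps sum.distrib sum_subtractf)
    show "c' * cos ((\<Sum>u=1..N. s' u * y u) + b') * (c * cos ((\<Sum>u=1..N. s u * y u) + b)) =
        (c' * c / 2) * cos ((\<Sum>u=1..N. (s' u - s u) * y u) + (b' - b)) +
        (c' * c / 2) * cos ((\<Sum>u=1..N. (s' u + s u) * y u) + (b' + b))"
      unfolding prod sums ..
  qed
  then show ?case by (simp only:) (intro trig_poly.intros)
next
  case (add f g)
  then show ?case by (simp add: distrib_right trig_poly.add)
qed

lemma trig_poly_mult:
  assumes "g \<in> trig_poly N" "f \<in> trig_poly N"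
  shows "(\<lambda>y. f y * g y) \<in> trig_poly N"
  using assms(1)
  by induction (simp_all only: trig_poly_mult_cos[OF assms(2)] distrib_left trig_poly.add)

lemma continuous_on_coord: "continuous_on S (\<lambda>y::'i \<Rightarrow> 'a::topological_space. y i)"
  by (rule continuous_on_subset[OF continuous_on_product_coordinates]) simp

lemma trig_poly_continuous:
  assumes "f \<in> trig_poly N" shows "continuous_on S f"
  using assms by induction (auto intro!: continuous_intros continuous_on_coord)

lemma trig_poly_bounded:
  assumes "f \<in> trig_poly N" shows "\<exists>B. \<forall>y. \<bar>f y\<bar> \<le> B"
  using assms
proof induction
  case (cos c s b)
  show ?case by (intro exI[of _ "\<bar>c\<bar>"]) (auto simp: abs_mult intro: mult_left_le)
next
  case (add f g)
  then obtain B B' where "\<forall>y. \<bar>f y\<bar> \<le> B" "\<forall>y. \<bar>g y\<bar> \<le> B'" by blast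
  then have "\<bar>f y + g y\<bar> \<le> B + B'" for y
    by (meson abs_triangle_ineq add_mono order_trans)
  then show ?case by blast
qed

lemma real_polynomial_function_comp_trig_poly:
  assumes "real_polynomial_function q" "f \<in> trig_poly N"
  shows "(\<lambda>y. q (f y)) \<in> trig_poly N"
  using assms(1)
proof induction
  case (linear h)
  then interpret bounded_linear h .
  have "h (f y) = h 1 * f y" for y using scaleR[of "f y" 1] by simp
  then show ?case using trig_poly_mult[OF assms(2) trig_poly_const[of "h 1"]] by simp
qed (auto intro: trig_poly_const trig_poly.add trig_poly_mult)


lemma compact_PiE:
  fixes S :: "'i \<Rightarrow> 'a::topological_space set"
  assumes "\<And>i. compact (S i)"
  shows "compact (PiE UNIV S)"
proof -
  have "compactin (product_topology (\<lambda>_. euclidean) UNIV) (PiE UNIV S)"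
    using assms by (subst compactin_PiE) auto
  then show ?thesis by (simp add: euclidean_product_topology)
qed

text \<open>Read as functions on all of \<open>nat\<close>, the elements of the box range over a
  product of intervals and of singletons \<open>{undefined}\<close>, so Tychonoff's theorem
  applies.\<close>

lemma compact_box: "compact ({1..N::nat} \<rightarrow>\<^sub>E {a..b::real})"
proof -
  have "({1..N} \<rightarrow>\<^sub>E {a..b}) = PiE UNIV (\<lambda>i. if i \<in> {1..N} then {a..b} else {undefined})"
    by (fastforce simp: PiE_def extensional_def Pi_def split: if_splits)
  also have "compact \<dots>" by (rule compact_PiE) auto
  finally show ?thesis .
qed

lemma trig_poly_approx:
  fixes g :: "(nat \<Rightarrow> real) \<Rightarrow> real"
  assumes g: "continuous_on ({1..N} \<rightarrow>\<^sub>E {-K..K}) g" and e: "e > 0"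
  shows "\<exists>f\<in>trig_poly N. \<forall>y \<in> {1..N} \<rightarrow>\<^sub>E {-K..K}. \<bar>g y - f y\<bar> < e"
proof -
  let ?S = "{1..N} \<rightarrow>\<^sub>E {-K..K}"
  interpret function_ring_on "trig_poly N" ?S
  proof
    show "compact ?S" by (rule compact_box)
    show "\<exists>f\<in>trig_poly N. f x \<noteq> f y" if xy: "x \<in> ?S" "y \<in> ?S" "x \<noteq> y" for x y
    proof -
      obtain u where u: "u \<in> {1..N}" "x u \<noteq> y u"
        using xy by (metis PiE_ext)
      \<comment> \<open>Points are separated by sines. The frequency \<open>pi / (2 t)\<close> maps
        the coordinate range into \<open>[-pi/2, pi/2]\<close>, where the sine is injective, and the
        phase \<open>-pi/2\<close> turns the cosine generator into a sine. The added 1 keeps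
        \<open>t\<close> positive also for \<open>K = 0\<close>.\<close>
      define t where "t = \<bar>K\<bar> + 1"
      have t: "t > 0" by (simp add: t_def add_nonneg_pos)
      define s where "s = pi / (2 * t)"
      have s: "s > 0" using t by (simp add: s_def)
      have range: "- (pi / 2) \<le> s * z" "s * z \<le> pi / 2" if "z \<in> {-K..K}" for z
      proof -
        have "\<bar>s * z\<bar> \<le> s * (\<bar>K\<bar> + 1)" using s that by (auto simp: abs_mult intro!: mult_left_mono)
        also have "\<dots> = pi / 2" using t by (simp add: s_def t_def[symmetric])
        finally show "- (pi / 2) \<le> s * z" "s * z \<le> pi / 2" by linarith+
      qed
      have sum: "(\<Sum>v=1..N. (if v = u then s else 0) * z v) = s * z u" for z
        using u by (simp add: if_distrib[of "\<lambda>r. r * _"] cong: if_cong)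
      have cs: "1 * cos (z + - (pi / 2)) = sin z" for z :: real
        by (simp add: cos_diff)
      have "(\<lambda>y. 1 * cos ((\<Sum>v=1..N. (if v = u then s else 0) * y v) + - (pi/2))) \<in> trig_poly N"
        by (rule trig_poly.cos)
      then have trig: "(\<lambda>y. sin (s * y u)) \<in> trig_poly N" unfolding sum cs .
      note b = range[OF PiE_mem[OF xy(1) u(1)]] range[OF PiE_mem[OF xy(2) u(1)]]
      have "sin (s * x u) \<noteq> sin (s * y u)"
      proof
        assume "sin (s * x u) = sin (s * y u)"
        then have "s * x u = s * y u" by (rule sin_inj_pi[OF b])
        then show False using u(2) s by simp
      qed
      then show ?thesis by (rule bexI[where x = "\<lambda>y. sin (s * y u)", OF _ trig])
    qed
  qed (auto intro: trig_poly_continuous trig_poly_const trig_poly.add trig_poly_mult)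
  show ?thesis using Stone_Weierstrass_basic[OF g e] .
qed

text \<open>Composing with a polynomial close to the truncation at \<open>\<plusminus>B\<close> keeps the approximation on the
  box and bounds it outside, where the trigonometric polynomial is uncontrolled.\<close>

lemma trig_poly_approx_bounded:
  fixes g :: "(nat \<Rightarrow> real) \<Rightarrow> real"
  assumes g: "continuous_on ({1..N} \<rightarrow>\<^sub>E {-K..K}) g" and e: "e > 0"
    and B: "\<And>y. y \<in> {1..N} \<rightarrow>\<^sub>E {-K..K} \<Longrightarrow> \<bar>g y\<bar> \<le> B" "B \<ge> 0"
  shows "\<exists>f\<in>trig_poly N. (\<forall>y \<in> {1..N} \<rightarrow>\<^sub>E {-K..K}. \<bar>g y - f y\<bar> < e) \<and> (\<forall>y. \<bar>f y\<bar> \<le> B + e)"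
proof -
  obtain f where f: "f \<in> trig_poly N" "\<And>y. y \<in> {1..N} \<rightarrow>\<^sub>E {-K..K} \<Longrightarrow> \<bar>g y - f y\<bar> < e / 2"
    using trig_poly_approx[OF g, of "e / 2"] e by auto
  obtain B' where B': "\<And>y. \<bar>f y\<bar> \<le> B'" using trig_poly_bounded[OF f(1)] by blast
  define clip where "clip x = max (- B) (min B x)" for x :: real
  have "continuous_on {-B'..B'} clip" unfolding clip_def by (intro continuous_intros)
  then obtain q where q: "real_polynomial_function q" "\<And>x. x \<in> {-B'..B'} \<Longrightarrow> \<bar>clip x - q x\<bar> < e / 2"
    using Stone_Weierstrass_real_polynomial_function[of "{-B'..B'}" clip "e / 2"] e by auto
  have qf: "\<bar>clip (f y) - q (f y)\<bar> < e / 2" for y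
    using B'[of y] by (intro q(2)) (simp add: abs_le_iff)
  show ?thesis
  proof (intro bexI[of _ "\<lambda>y. q (f y)"] conjI allI ballI)
    show "(\<lambda>y. q (f y)) \<in> trig_poly N"
      by (rule real_polynomial_function_comp_trig_poly[OF q(1) f(1)])
    show "\<bar>g y - q (f y)\<bar> < e" if "y \<in> {1..N} \<rightarrow>\<^sub>E {-K..K}" for y
      using qf[of y] f(2)[OF that] B(1)[OF that] B(2) unfolding clip_def by linarith
    show "\<bar>q (f y)\<bar> \<le> B + e" for y
      using qf[of y] e B(2) unfolding clip_def by linarith
  qed
qed

section \<open>From characteristic functions to weak convergence\<close>

locale char_fun_convergence =
  fixes N :: nat and \<mu> :: "nat \<Rightarrow> (nat \<Rightarrow> real) measure" and \<nu> :: "(nat \<Rightarrow> real) measure"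
  assumes prob: "\<And>n. prob_space (\<mu> n)" "prob_space \<nu>"
    and sets: "\<And>n. sets (\<mu> n) = sets (Rvec N)" "sets \<nu> = sets (Rvec N)"
    and char_conv: "\<And>t :: nat \<Rightarrow> real.
      (\<lambda>n. CLINT y|\<mu> n. iexp (\<Sum>u=1..N. t u * y u)) \<longlonglongrightarrow> (CLINT y|\<nu>. iexp (\<Sum>u=1..N. t u * y u))"
begin

lemma integrable_bounded:
  fixes f :: "_ \<Rightarrow> 'b::{banach, second_countable_topology}"
  assumes "prob_space P" "sets P = sets (Rvec N)" "f \<in> borel_measurable (Rvec N)"
    and "\<And>y. y \<in> space (Rvec N) \<Longrightarrow> norm (f y) \<le> B"
  shows "integrable P f"
proof -
  interpret prob_space P by fact
  have "space P = space (Rvec N)" using assms(2) by (rule sets_eq_imp_space_eq)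
  then show ?thesis
    using assms by (intro integrable_const_bound[of _ B]) (auto simp: measurable_cong_sets[OF assms(2) refl])
qed

text \<open>A phase-shifted cosine is the real part of a rotated complex exponential, so its
  integral is a fixed real-linear image of the characteristic function at one frequency.\<close>

lemma trig_poly_conv:
  assumes "f \<in> trig_poly N"
  shows "(\<lambda>n. LINT y|\<mu> n. f y) \<longlonglongrightarrow> (LINT y|\<nu>. f y)"
  using assms
proof induction
  case (cos c s b)
  let ?l = "\<lambda>y. \<Sum>u=1..N. s u * y u"
  have int: "integrable P (\<lambda>y. iexp (?l y))" if "prob_space P" "sets P = sets (Rvec N)" for P
    by (rule integrable_bounded[OF that, of _ 1]) simp_all
  have eq: "(LINT y|P. c * cos (?l y + b)) = Re (of_real c * iexp b * (CLINT y|P. iexp (?l y)))"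
    if P: "prob_space P" "sets P = sets (Rvec N)" for P
  proof -
    have "Re (of_real c * iexp b * (CLINT y|P. iexp (?l y))) =
        Re (CLINT y|P. of_real c * iexp b * iexp (?l y))"
      by (subst integral_mult_right_zero) (rule refl)
    also have "\<dots> = (LINT y|P. Re (of_real c * iexp b * iexp (?l y)))"
      by (rule integral_Re[symmetric]) (intro integrable_mult_right int[OF P])
    also have "(\<lambda>y. Re (of_real c * iexp b * iexp (?l y))) = (\<lambda>y. c * cos (?l y + b))"
    proof
      fix y
      have "of_real c * iexp b * iexp (?l y) = of_real c * cis (?l y + b)"
        by (simp only: cis_conv_exp mult.assoc exp_add[symmetric]) (simp add: algebra_simps)
      then show "Re (of_real c * iexp b * iexp (?l y)) = c * cos (?l y + b)" by (simp only:) simp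
    qed
    finally show ?thesis by simp
  qed
  show ?case
    unfolding eq[OF prob(1) sets(1)] eq[OF prob(2) sets(2)] by (intro tendsto_intros char_conv)
next
  case (add f g)
  have int: "integrable P f" if "f \<in> trig_poly N" "prob_space P" "sets P = sets (Rvec N)" for P f
  proof -
    obtain B where "\<forall>y. \<bar>f y\<bar> \<le> B" using trig_poly_bounded[OF \<open>f \<in> trig_poly N\<close>] by blast
    then show ?thesis
      by (intro integrable_bounded[OF that(2,3), of _ B] continuous_borel_measurable_Rvec
          trig_poly_continuous[OF that(1)]) auto
  qed
  show ?case
    using tendsto_add[OF add.IH] by (simp add: int add.hyps prob sets)
qed

text \<open>Frequencies supported on the coordinate \<open>u\<close> give the characteristic
  function of a marginal. The one-dimensional Levy theorem then yields weak convergence of the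
  marginals, and a continuous cut-off transfers the tail bound of the limit to almost all
  \<open>n\<close>.\<close>

lemma tight:
  assumes u: "u \<in> {1..N}" and e: "e > 0"
  shows "\<exists>K. (\<forall>\<^sub>F n in sequentially. measure (\<mu> n) {y \<in> space (Rvec N). \<bar>y u\<bar> > K} < e) \<and>
    measure \<nu> {y \<in> space (Rvec N). \<bar>y u\<bar> > K} < e"
proof -
  have meas: "(\<lambda>y. y u) \<in> borel_measurable P" if "sets P = sets (Rvec N)" for P
    using u by (simp add: measurable_cong_sets[OF that refl])
  have rd: "real_distribution (distr P borel (\<lambda>y. y u))"
    if "prob_space P" "sets P = sets (Rvec N)" for P
    using prob_space.prob_space_distr[OF that(1) meas[OF that(2)]]
    by (simp add: real_distribution_def real_distribution_axioms_def)
  have ch: "char (distr P borel (\<lambda>y. y u)) t = (CLINT y|P. iexp (\<Sum>v=1..N. (if v = u then t else 0) * y v))"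
    if "prob_space P" "sets P = sets (Rvec N)" for P t
    unfolding char_def using u
    by (subst integral_distr[OF meas[OF that(2)]])
       (simp_all add: if_distrib[of "\<lambda>r. r * _"] cong: if_cong)
  have wc: "weak_conv_m (\<lambda>n. distr (\<mu> n) borel (\<lambda>y. y u)) (distr \<nu> borel (\<lambda>y. y u))"
    by (rule levy_continuity) (auto intro!: rd prob sets simp only: ch[OF prob(1) sets(1)] ch[OF prob(2) sets(2)] char_conv)
  interpret nu: prob_space \<nu> by (rule prob)
  have sp: "space P = space (Rvec N)" if "sets P = sets (Rvec N)" for P
    using that by (rule sets_eq_imp_space_eq)
  define A where "A K = {y \<in> space (Rvec N). \<bar>y u\<bar> > K}" for K :: real
  have A[measurable]: "A K \<in> sets (Rvec N)" for K
    unfolding A_def using u by measurable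
  have "(\<lambda>j. measure \<nu> (A (real j))) \<longlonglongrightarrow> measure \<nu> (\<Inter>j. A (real j))"
    using sets A by (intro nu.finite_Lim_measure_decseq) (auto simp: decseq_def A_def)
  moreover have "(\<Inter>j. A (real j)) = {}"
    using reals_Archimedean2 by (fastforce simp: A_def dest: order.asym)
  ultimately have "(\<lambda>j. measure \<nu> (A (real j))) \<longlonglongrightarrow> 0" by simp
  then have "\<forall>\<^sub>F j in sequentially. measure \<nu> (A (real j)) < e" using e by (rule order_tendstoD)
  then obtain K0 :: real where K0: "measure \<nu> (A K0) < e" by (auto simp: eventually_sequentially)
  \<comment> \<open>A continuous ramp lying between the indicators of \<open>|x| > K0 + 1\<close>
    and \<open>|x| > K0\<close>; this is why the final bound carries the threshold
    \<open>K0 + 1\<close>.\<close>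
  define \<psi> where "\<psi> x = min 1 (max 0 (\<bar>x\<bar> - K0))" for x :: real
  have psi: "continuous_on UNIV \<psi>" unfolding \<psi>_def by (intro continuous_intros)
  have psiB: "\<bar>\<psi> x\<bar> \<le> 1" for x by (auto simp: \<psi>_def)
  have "(\<lambda>n. LINT x|distr (\<mu> n) borel (\<lambda>y. y u). \<psi> x) \<longlonglongrightarrow> (LINT x|distr \<nu> borel (\<lambda>y. y u). \<psi> x)"
    using psi psiB
    by (intro weak_conv_imp_integral_bdd_continuous_conv[OF rd rd wc, where B = 1])
       (auto simp: prob sets continuous_on_eq_continuous_at)
  moreover have psim: "\<psi> \<in> borel_measurable borel" using psi by (rule borel_measurable_continuous_onI)
  ultimately have lim: "(\<lambda>n. LINT y|\<mu> n. \<psi> (y u)) \<longlonglongrightarrow> (LINT y|\<nu>. \<psi> (y u))"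
    by (simp add: integral_distr meas sets)
  have int: "integrable P (\<lambda>y. \<psi> (y u))" if "prob_space P" "sets P = sets (Rvec N)" for P
    using psiB u by (intro integrable_bounded[OF that, of _ 1] measurable_compose[OF _ psim]) auto
  have intI: "integrable P (\<lambda>y. indicator (A K) y :: real)" if "prob_space P" "sets P = sets (Rvec N)" for P K
    by (rule integrable_bounded[OF that borel_measurable_indicator[OF A], of _ 1]) (simp add: indicator_def)
  have "(LINT y|\<nu>. \<psi> (y u)) \<le> (LINT y|\<nu>. indicator (A K0) y)"
    using sp[OF sets(2)]
    by (intro integral_mono int prob sets intI) (auto simp: \<psi>_def A_def indicator_def)
  also have "\<dots> < e" using K0 sets by simp
  finally have ev: "\<forall>\<^sub>F n in sequentially. (LINT y|\<mu> n. \<psi> (y u)) < e"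
    by (rule order_tendstoD(2)[OF lim])
  have le: "measure (\<mu> n) (A (K0 + 1)) \<le> (LINT y|\<mu> n. \<psi> (y u))" for n
  proof -
    interpret prob_space "\<mu> n" by (rule prob)
    have "measure (\<mu> n) (A (K0 + 1)) = (LINT y|\<mu> n. indicator (A (K0 + 1)) y)" using sets by simp
    also have "\<dots> \<le> (LINT y|\<mu> n. \<psi> (y u))"
      using sp[OF sets(1)]
      by (intro integral_mono int prob sets intI) (auto simp: \<psi>_def A_def indicator_def)
    finally show ?thesis .
  qed
  have "\<forall>\<^sub>F n in sequentially. measure (\<mu> n) (A (K0 + 1)) < e"
    by (intro eventually_mono[OF ev] le_less_trans[OF le])
  moreover have "measure \<nu> (A (K0 + 1)) \<le> measure \<nu> (A K0)"
    using sets A by (intro nu.finite_measure_mono) (auto simp only: A_def)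
  ultimately show ?thesis using K0 unfolding A_def by (intro exI[of _ "K0 + 1"]) simp
qed

lemma tight_box:
  assumes e: "e > 0"
  shows "\<exists>K. (\<forall>\<^sub>F n in sequentially. measure (\<mu> n) (space (Rvec N) - ({1..N} \<rightarrow>\<^sub>E {-K..K})) < e) \<and>
    measure \<nu> (space (Rvec N) - ({1..N} \<rightarrow>\<^sub>E {-K..K})) < e"
proof -
  \<comment> \<open>Dividing by \<open>N + 1\<close> instead of \<open>N\<close> keeps the union
    bound over coordinates strict and covers \<open>N = 0\<close>.\<close>
  define e' where "e' = e / (real N + 1)"
  have e': "e' > 0" "real N * e' < e" using e by (simp_all add: e'_def field_simps add_pos_pos)
  define A where "A u K = {y \<in> space (Rvec N). \<bar>y u\<bar> > K}" for u and K :: real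
  have A[measurable]: "A u K \<in> sets (Rvec N)" if "u \<in> {1..N}" for u K
    unfolding A_def using that by measurable
  have "\<forall>u\<in>{1..N}. \<exists>K. (\<forall>\<^sub>F n in sequentially. measure (\<mu> n) (A u K) < e') \<and> measure \<nu> (A u K) < e'"
    using tight[OF _ e'(1)] unfolding A_def by blast
  from bchoice[OF this] obtain K where K: "\<And>u. u \<in> {1..N} \<Longrightarrow> (\<forall>\<^sub>F n in sequentially. measure (\<mu> n) (A u (K u)) < e')"
    "\<And>u. u \<in> {1..N} \<Longrightarrow> measure \<nu> (A u (K u)) < e'"
    by blast
  define K0 where "K0 = Max (insert 0 (K ` {1..N}))"
  have K0: "K u \<le> K0" if "u \<in> {1..N}" for u unfolding K0_def using that by (intro Max_ge) auto
  have sub: "space (Rvec N) - ({1..N} \<rightarrow>\<^sub>E {-K0..K0}) \<subseteq> (\<Union>u\<in>{1..N}. A u (K u))"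
  proof
    fix y assume y: "y \<in> space (Rvec N) - ({1..N} \<rightarrow>\<^sub>E {-K0..K0})"
    then obtain u where u: "u \<in> {1..N}" "y u \<notin> {-K0..K0}"
      by (auto simp: space_Rvec PiE_def Pi_def simp del: One_nat_def)
    then have "\<bar>y u\<bar> > K u" using K0[OF u(1)] by auto
    then show "y \<in> (\<Union>u\<in>{1..N}. A u (K u))" using u y by (auto simp: A_def simp del: One_nat_def)
  qed
  have small: "measure P (space (Rvec N) - ({1..N} \<rightarrow>\<^sub>E {-K0..K0})) < e"
    if P: "prob_space P" "sets P = sets (Rvec N)" and lt: "\<And>u. u \<in> {1..N} \<Longrightarrow> measure P (A u (K u)) < e'" for P
  proof -
    interpret prob_space P by fact
    have "measure P (space (Rvec N) - ({1..N} \<rightarrow>\<^sub>E {-K0..K0})) \<le> measure P (\<Union>u\<in>{1..N}. A u (K u))"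
      using A P(2) by (intro finite_measure_mono sub) (simp add: sets.finite_UN)
    also have "\<dots> \<le> (\<Sum>u\<in>{1..N}. measure P (A u (K u)))"
      using A P(2) by (intro finite_measure_subadditive_finite) (simp_all add: image_subset_iff)
    also have "\<dots> \<le> (\<Sum>u\<in>{1..N}. e')" using lt by (intro sum_mono) (simp add: less_imp_le)
    also have "\<dots> < e" using e' by simp
    finally show ?thesis .
  qed
  have "\<forall>\<^sub>F n in sequentially. \<forall>u\<in>{1..N}. measure (\<mu> n) (A u (K u)) < e'"
    using K(1) by (intro eventually_ball_finite ballI) simp_all
  then have "\<forall>\<^sub>F n in sequentially. measure (\<mu> n) (space (Rvec N) - ({1..N} \<rightarrow>\<^sub>E {-K0..K0})) < e"
    by (rule eventually_mono) (rule small[OF prob(1) sets(1)], blast)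
  then show ?thesis using small[OF prob(2) sets(2) K(2)] by (intro exI[of _ K0] conjI)
qed

theorem bounded_continuous_conv:
  assumes g: "continuous_on ({1..N} \<rightarrow>\<^sub>E UNIV) g" "bounded (g ` ({1..N} \<rightarrow>\<^sub>E UNIV))"
  shows "(\<lambda>n. LINT y|\<mu> n. g y) \<longlonglongrightarrow> (LINT y|\<nu>. (g y :: real))"
proof (rule LIMSEQ_I)
  fix r :: real assume r: "r > 0"
  obtain B where B: "B > 0" "\<And>y. y \<in> space (Rvec N) \<Longrightarrow> \<bar>g y\<bar> \<le> B"
    using g(2) unfolding bounded_pos space_Rvec by auto
  \<comment> \<open>Each of the two measures costs \<open>e + (2 B + e) e\<close> and the
    approximating polynomial costs another \<open>e\<close>. With \<open>e <= 1\<close> the total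
    \<open>2 (e + (2 B + e) e) + e\<close> is at most \<open>e (3 + 4 B + 2)\<close>.\<close>
  define e where "e = min 1 (r / (3 + 4 * B + 2))"
  have e: "e > 0" "e \<le> 1" using r B by (auto simp: e_def)
  have "e \<le> r / (3 + 4 * B + 2)" by (simp add: e_def)
  then have er: "e * (3 + 4 * B + 2) \<le> r" using B by (subst (asm) pos_le_divide_eq) auto
  obtain K where K: "\<forall>\<^sub>F n in sequentially. measure (\<mu> n) (space (Rvec N) - ({1..N} \<rightarrow>\<^sub>E {-K..K})) < e"
    "measure \<nu> (space (Rvec N) - ({1..N} \<rightarrow>\<^sub>E {-K..K})) < e"
    using tight_box[OF e(1)] by blast
  let ?S = "{1..N} \<rightarrow>\<^sub>E {-K..K}"
  have S: "?S \<in> sets (Rvec N)" "?S \<subseteq> {1..N} \<rightarrow>\<^sub>E UNIV" by (auto intro!: sets_PiM_I_finite)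
  obtain f where f: "f \<in> trig_poly N" "\<And>y. y \<in> ?S \<Longrightarrow> \<bar>g y - f y\<bar> < e" "\<And>y. \<bar>f y\<bar> \<le> B + e"
    using trig_poly_approx_bounded[OF continuous_on_subset[OF g(1) S(2)] e(1) B(2), unfolded space_Rvec, OF subsetD[OF S(2)]] B(1)
    by auto
  \<comment> \<open>On the box the two functions differ by less than \<open>e\<close>; outside they
    differ by at most \<open>2 B + e\<close>, on a set of probability below \<open>e\<close>. This
    uses the global bound on \<open>f\<close>.\<close>
  have close: "\<bar>(LINT y|P. g y) - (LINT y|P. f y)\<bar> \<le> e + (2 * B + e) * e"
    if P: "prob_space P" "sets P = sets (Rvec N)"
      and small: "measure P (space (Rvec N) - ({1..N} \<rightarrow>\<^sub>E {-K..K})) < e" for P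
  proof -
    interpret prob_space P by fact
    have sp: "space P = space (Rvec N)" using P(2) by (rule sets_eq_imp_space_eq)
    have gi: "integrable P g" using B by (intro integrable_bounded[OF P, of _ B] continuous_borel_measurable_Rvec g) auto
    have fi: "integrable P f" using f by (intro integrable_bounded[OF P, of _ "B + e"]
        continuous_borel_measurable_Rvec trig_poly_continuous) auto
    let ?I = "indicator (space (Rvec N) - ?S) :: _ \<Rightarrow> real"
    have Ii: "integrable P ?I" using S P by (auto simp: less_top[symmetric])
    have "\<bar>(LINT y|P. g y) - (LINT y|P. f y)\<bar> = \<bar>LINT y|P. g y - f y\<bar>" using gi fi by simp
    also have "\<dots> \<le> (LINT y|P. \<bar>g y - f y\<bar>)" by (rule integral_abs_bound)
    also have "\<dots> \<le> (LINT y|P. e + (2 * B + e) * ?I y)"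
    proof (rule integral_mono)
      show "integrable P (\<lambda>y. \<bar>g y - f y\<bar>)" using gi fi by simp
      show "integrable P (\<lambda>y. e + (2 * B + e) * ?I y)" using Ii by simp
      fix y assume y: "y \<in> space P"
      then show "\<bar>g y - f y\<bar> \<le> e + (2 * B + e) * ?I y"
      proof (cases "y \<in> ?S")
        case True
        then show ?thesis using f(2)[of y] by (simp only: indicator_simps) simp
      next
        case False
        then have I: "?I y = 1" using y sp by simp
        have "\<bar>g y\<bar> \<le> B" using B(2) y sp by simp
        then show ?thesis unfolding I mult_1_right using f(3)[of y] e B(1) by linarith
      qed
    qed
    also have "\<dots> = e + (2 * B + e) * measure P (space (Rvec N) - ?S)"
      using Ii S P sp prob_space[unfolded sp] by simp
    also have "\<dots> \<le> e + (2 * B + e) * e" using small B e by (intro add_mono mult_left_mono) auto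
    finally show ?thesis .
  qed
  have close_f: "\<forall>\<^sub>F n in sequentially. \<bar>(LINT y|\<mu> n. f y) - (LINT y|\<nu>. f y)\<bar> < e"
    using tendstoD[OF trig_poly_conv[OF f(1)] e(1)] by (simp add: dist_real_def)
  have triangle: "\<bar>p - q\<bar> < x \<Longrightarrow> \<bar>s - p\<bar> \<le> D \<Longrightarrow> \<bar>t - q\<bar> \<le> D \<Longrightarrow> \<bar>s - t\<bar> < 2 * D + x" for p q s t D x :: real
    by linarith
  from close_f K(1) have "\<forall>\<^sub>F n in sequentially. norm ((LINT y|\<mu> n. g y) - (LINT y|\<nu>. g y)) < r"
  proof eventually_elim
    case (elim n)
    have "\<bar>(LINT y|\<mu> n. g y) - (LINT y|\<nu>. g y)\<bar> < 2 * (e + (2 * B + e) * e) + e"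
      by (rule triangle[OF elim(1) close[OF prob(1) sets(1) elim(2)] close[OF prob(2) sets(2) K(2)]])
    also have "\<dots> \<le> e * (3 + 4 * B + 2)"
      using mult_right_mono[OF e(2), of e] e(1) by (simp add: algebra_simps)
    finally show ?case using er by simp
  qed
  then show "\<exists>no. \<forall>n\<ge>no. norm ((LINT y|\<mu> n. g y) - (LINT y|\<nu>. g y)) < r"
    by (simp add: eventually_sequentially)
qed

end

section \<open>Sums over the largest observations\<close>

text \<open>Counting exceedances replaces sorting: this equivalence is the access to
  \<open>kth_largest\<close> for measurability, for ties and for the tail bounds.\<close>

lemma kth_largest_gt_iff:
  assumes k: "1 \<le> k" "k \<le> n"
  shows "kth_largest n k r > c \<longleftrightarrow> k \<le> card {l\<in>{1..n}. r l > c}"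
proof -
  define xs where "xs = sort (map r [1..<n + 1])"
  have len: "length xs = n" by (simp add: xs_def)
  have kth: "kth_largest n k r = xs ! (n - k)"
    using k len by (simp add: kth_largest_def xs_def[symmetric] rev_nth)
  have mono: "xs ! p \<le> xs ! q" if "p \<le> q" "q < n" for p q
    using that len by (intro sorted_nth_mono) (simp_all add: xs_def)
  have "card {l\<in>{1..n}. r l > c} = length (filter (\<lambda>l. r l > c) [1..<n + 1])"
  proof -
    have "{l\<in>{1..n}. r l > c} = set (filter (\<lambda>l. r l > c) [1..<n + 1])" by auto
    then show ?thesis by (metis distinct_card distinct_filter distinct_upt)
  qed
  also have "\<dots> = length (filter (\<lambda>x. x > c) (map r [1..<n + 1]))"
    by (simp add: filter_map comp_def)
  also have "\<dots> = length (filter (\<lambda>x. x > c) xs)"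
    by (simp add: xs_def filter_sort)
  also have "\<dots> = card {m. m < n \<and> xs ! m > c}"
    by (simp add: length_filter_conv_card len)
  finally have card: "card {l\<in>{1..n}. r l > c} = card {m. m < n \<and> xs ! m > c}" .
  show ?thesis
  proof
    assume "kth_largest n k r > c"
    then have "{n - k..<n} \<subseteq> {m. m < n \<and> xs ! m > c}"
      using mono[of "n - k"] unfolding kth by (auto intro: less_le_trans)
    then have "card {n - k..<n} \<le> card {m. m < n \<and> xs ! m > c}" by (intro card_mono) auto
    then show "k \<le> card {l\<in>{1..n}. r l > c}" using k card by simp
  next
    assume *: "k \<le> card {l\<in>{1..n}. r l > c}"
    show "kth_largest n k r > c"
    proof (rule ccontr)
      assume "\<not> kth_largest n k r > c"
      then have le: "xs ! m \<le> c" if "m \<le> n - k" for m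
        using mono[OF that] k unfolding kth by force
      have "{m. m < n \<and> xs ! m > c} \<subseteq> {n - k<..<n}"
      proof
        fix m assume "m \<in> {m. m < n \<and> xs ! m > c}"
        then show "m \<in> {n - k<..<n}" using le[of m] by (cases "m \<le> n - k") auto
      qed
      then have "card {m. m < n \<and> xs ! m > c} \<le> card {n - k<..<n}" by (intro card_mono) auto
      then show False using * card k by simp
    qed
  qed
qed

lemma kth_largest_inj:
  assumes k: "1 \<le> k" "k \<le> n" and inj: "inj_on r {1..n}"
  defines "v \<equiv> kth_largest n k r"
  obtains l0 where "l0 \<in> {1..n}" "r l0 = v" "card {l\<in>{1..n}. r l > v} = k - 1"
    "{l\<in>{1..n}. r l \<ge> v} = insert l0 {l\<in>{1..n}. r l > v}"
proof -
  have upper: "card {l\<in>{1..n}. r l > v} < k"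
    using kth_largest_gt_iff[OF k, of v r] by (simp add: v_def)
  \<comment> \<open>The largest sample value strictly below \<open>v\<close>, or
    \<open>v - 1\<close> if there is none. Exceeding \<open>c\<close> is then the same as being at
    least \<open>v\<close>, so the counting criterion also controls the non-strict count.\<close>
  define c where "c = Max (insert (v - 1) {x\<in>r ` {1..n}. x < v})"
  have "c < v" unfolding c_def by (subst Max_less_iff) auto
  then have "k \<le> card {l\<in>{1..n}. r l > c}"
    using kth_largest_gt_iff[OF k, of c r] by (simp add: v_def)
  also have "{l\<in>{1..n}. r l > c} = {l\<in>{1..n}. r l \<ge> v}"
  proof -
    have "r l \<le> c" if "l \<in> {1..n}" "r l < v" for l
      unfolding c_def using that by (intro Max_ge) auto
    then have "r l > c \<longleftrightarrow> r l \<ge> v" if "l \<in> {1..n}" for l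
      using \<open>c < v\<close> that by (meson leD le_less_linear less_le_trans)
    then show ?thesis by blast
  qed
  finally have lower: "k \<le> card {l\<in>{1..n}. r l \<ge> v}" .
  have "{l\<in>{1..n}. r l \<ge> v} \<noteq> {l\<in>{1..n}. r l > v}" using upper lower by auto
  then have "\<exists>l0\<in>{1..n}. r l0 = v" by (rule contrapos_np) (auto simp: le_less)
  then obtain l0 where l0: "l0 \<in> {1..n}" "r l0 = v" by blast
  have eq: "{l\<in>{1..n}. r l \<ge> v} = insert l0 {l\<in>{1..n}. r l > v}"
  proof
    show "{l\<in>{1..n}. r l \<ge> v} \<subseteq> insert l0 {l\<in>{1..n}. r l > v}"
    proof
      fix l assume l: "l \<in> {l\<in>{1..n}. r l \<ge> v}"
      show "l \<in> insert l0 {l\<in>{1..n}. r l > v}"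
      proof (cases "r l = v")
        case True
        then have "l = l0" using inj_onD[OF inj, of l l0] l l0 by simp
        then show ?thesis by simp
      qed (use l in simp)
    qed
  qed (use l0 in auto)
  have "card (insert l0 {l\<in>{1..n}. r l > v}) = Suc (card {l\<in>{1..n}. r l > v})"
    using l0 by (intro card_insert_disjoint) auto
  then have "card {l\<in>{1..n}. r l > v} = k - 1" using upper lower eq by simp
  then show ?thesis by (rule that[OF l0 _ eq])
qed

text \<open>The counting criterion turns each superlevel set into a condition on a finite sum of
  indicators.\<close>

lemma measurable_kth_largest:
  assumes k: "1 \<le> k" "k \<le> n" and f: "\<And>l. l \<in> {1..n} \<Longrightarrow> (\<lambda>x. f x l) \<in> borel_measurable M"
  shows "(\<lambda>x. kth_largest n k (f x)) \<in> borel_measurable M"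
proof (rule borel_measurableI_greater)
  fix c :: real
  have card: "real (card {l\<in>{1..n}. f x l > c}) = (\<Sum>l=1..n. indicator {c<..} (f x l))" for x
    by (simp add: indicator_def sum.If_cases Int_def flip: sum.inter_filter)
  have "{x \<in> space M. c < kth_largest n k (f x)} = {x \<in> space M. real k \<le> (\<Sum>l=1..n. indicator {c<..} (f x l))}"
    using kth_largest_gt_iff[OF k] by (simp flip: card)
  also have "\<dots> \<in> sets M" using f by measurable
  finally show "{x \<in> space M. c < kth_largest n k (f x)} \<in> sets M" .
qed

definition top_indices :: "nat \<Rightarrow> nat \<Rightarrow> (nat \<Rightarrow> real) \<Rightarrow> nat set" where
  "top_indices n k r = {l\<in>{1..n}. r l \<ge> kth_largest n k r}"

lemma norm_integral_le:
  fixes f :: "'a \<Rightarrow> 'c::{banach, second_countable_topology}"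
  assumes "integrable M f" "integrable M g" "\<And>x. x \<in> space M \<Longrightarrow> norm (f x) \<le> g x"
  shows "norm (LINT x|M. f x) \<le> (LINT x|M. g x)"
  using assms by (intro order_trans[OF integral_norm_bound] integral_mono) auto

lemma exp_minus_approx:
  fixes x :: real assumes "x \<ge> 0" shows "\<bar>exp (- x) - (1 - x)\<bar> \<le> x\<^sup>2"
proof -
  have "exp (- x) \<le> 1 - x + x\<^sup>2"
  proof (cases "x \<le> 1")
    case True
    have "1 / exp x \<le> 1 / (1 + x)" using assms exp_ge_add_one_self[of x] by (intro divide_left_mono) (auto intro!: mult_pos_pos)
    also have "\<dots> \<le> 1 - x + x\<^sup>2"
    proof -
      \<comment> \<open>The product on the right equals \<open>1 + x^3\<close>.\<close>
      have "1 \<le> (1 - x + x\<^sup>2) * (1 + x)" using assms by (simp add: algebra_simps power2_eq_square)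
      then show ?thesis using assms by (simp add: pos_divide_le_eq)
    qed
    finally show ?thesis by (simp add: exp_minus inverse_eq_divide)
  next
    case False
    have "exp (- x) \<le> 1" using assms by simp
    also have "\<dots> \<le> 1 - x + x\<^sup>2" using False mult_left_mono[of 1 x x] by (simp add: power2_eq_square)
    finally show ?thesis .
  qed
  moreover have "1 - x \<le> exp (- x)" using exp_ge_add_one_self[of "- x"] by simp
  ultimately show ?thesis by simp
qed

section \<open>Order statistics of an i.i.d. sample with an atom-free radius\<close>

locale iid_sample = prob_space Q for Q :: "'b measure" +
  fixes \<rho> :: "'b \<Rightarrow> real"
  assumes measurable_rho [measurable]: "\<rho> \<in> borel_measurable Q"
    and atomless: "\<And>r. measure Q {y \<in> space Q. \<rho> y = r} = 0"
begin

abbreviation "sample n \<equiv> Pi\<^sub>M {1..n::nat} (\<lambda>_. Q)"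

sublocale sample: product_prob_space "\<lambda>_ :: nat. Q"
  by unfold_locales

lemma prob_space_sample: "prob_space (Pi\<^sub>M I (\<lambda>_ :: nat. Q))"
  by (rule prob_space_PiM) (rule prob_space_axioms)

definition tail :: "real \<Rightarrow> real" where
  "tail r = measure Q {y \<in> space Q. \<rho> y > r}"

definition exceedances :: "nat \<Rightarrow> real \<Rightarrow> (nat \<Rightarrow> 'b) \<Rightarrow> nat" where
  "exceedances n r x = card {l\<in>{1..n}. \<rho> (x l) > r}"

lemma real_exceedances: "real (exceedances n r x) = (\<Sum>l=1..n. indicator {r<..} (\<rho> (x l)))"
  by (simp add: exceedances_def indicator_def sum.If_cases Int_def flip: sum.inter_filter)

lemma measurable_exceedances [measurable]: "exceedances n r \<in> sample n \<rightarrow>\<^sub>M count_space UNIV"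
proof -
  have "(\<lambda>x. real (exceedances n r x)) \<in> borel_measurable (sample n)"
    unfolding real_exceedances by measurable
  then have "(\<lambda>x. nat \<lfloor>real (exceedances n r x)\<rfloor>) \<in> sample n \<rightarrow>\<^sub>M count_space UNIV"
    by measurable
  then show ?thesis by simp
qed

text \<open>Fubini with one coordinate outermost. In the application \<open>l\<close> is the index
  of the \<open>k\<close>-th largest radius, and the inner integral plays the role of the
  conditional expectation given that observation.\<close>

lemma integral_split_index:
  fixes f :: "(nat \<Rightarrow> 'b) \<Rightarrow> 'c::{banach, second_countable_topology}"
  assumes l: "l \<in> {1..n}" and f[measurable]: "f \<in> borel_measurable (sample n)"
    and bound: "\<And>x. x \<in> space (sample n) \<Longrightarrow> norm (f x) \<le> B"
  shows "(LINT x|sample n. f x) = (LINT y|Q. LINT x|Pi\<^sub>M ({1..n} - {l}) (\<lambda>_. Q). f (x(l := y)))"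
proof -
  let ?J = "{1..n} - {l}"
  have ins: "insert l ?J = {1..n}" using l by auto
  interpret S: prob_space "sample n" by (rule prob_space_sample)
  interpret J: prob_space "Pi\<^sub>M ?J (\<lambda>_. Q)" by (rule prob_space_sample)
  interpret pair: pair_prob_space "Pi\<^sub>M ?J (\<lambda>_. Q)" Q ..
  have int: "integrable (Pi\<^sub>M (insert l ?J) (\<lambda>_. Q)) f"
    unfolding ins using bound by (intro S.integrable_const_bound[of _ B]) auto
  have upd: "(\<lambda>(x, y). x(l := y)) \<in> Pi\<^sub>M ?J (\<lambda>_. Q) \<Otimes>\<^sub>M Q \<rightarrow>\<^sub>M sample n"
    using measurable_add_dim[of l ?J "\<lambda>_. Q"] unfolding ins .
  have "(LINT x|sample n. f x) = (LINT x|Pi\<^sub>M ?J (\<lambda>_. Q). LINT y|Q. f (x(l := y)))"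
    using sample.product_integral_insert[OF _ _ int] unfolding ins by simp
  also have "\<dots> = (LINT y|Q. LINT x|Pi\<^sub>M ?J (\<lambda>_. Q). f (x(l := y)))"
  proof (rule pair.Fubini_integral[symmetric])
    have "(\<lambda>p. f (case p of (x, y) \<Rightarrow> x(l := y))) \<in> borel_measurable (Pi\<^sub>M ?J (\<lambda>_. Q) \<Otimes>\<^sub>M Q)"
      by (rule measurable_compose[OF upd f])
    moreover have "norm (f (case p of (x, y) \<Rightarrow> x(l := y))) \<le> B"
      if "p \<in> space (Pi\<^sub>M ?J (\<lambda>_. Q) \<Otimes>\<^sub>M Q)" for p
      by (rule bound) (rule measurable_space[OF upd that])
    ultimately have "integrable (Pi\<^sub>M ?J (\<lambda>_. Q) \<Otimes>\<^sub>M Q) (\<lambda>p. f (case p of (x, y) \<Rightarrow> x(l := y)))"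
      by (intro pair.P.integrable_const_bound[of _ B]) auto
    then show "integrable (Pi\<^sub>M ?J (\<lambda>_. Q) \<Otimes>\<^sub>M Q) (\<lambda>(x, y). f (x(l := y)))"
      by (simp add: case_prod_beta')
  qed
  finally show ?thesis .
qed

text \<open>With the other coordinates fixed, a tie forces \<open>rho (x l)\<close> to equal one
  prescribed value, which has probability zero.\<close>

lemma AE_inj: "AE x in sample n. inj_on (\<lambda>l. \<rho> (x l)) {1..n}"
proof -
  interpret S: prob_space "sample n" by (rule prob_space_sample)
  have "AE x in sample n. \<rho> (x l) \<noteq> \<rho> (x m)" if lm: "l \<in> {1..n}" "m \<in> {1..n}" "l \<noteq> m" for l m
  proof -
    let ?J = "{1..n} - {l}" and ?A = "{x \<in> space (sample n). \<rho> (x l) = \<rho> (x m)}"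
    have ins: "insert l ?J = {1..n}" using lm by auto
    have [measurable]: "(\<lambda>x. \<rho> (x l)) \<in> borel_measurable (sample n)" "(\<lambda>x. \<rho> (x m)) \<in> borel_measurable (sample n)"
      using lm by measurable
    have A: "?A \<in> sets (sample n)" by measurable
    have "emeasure (sample n) ?A = (\<integral>\<^sup>+x. indicator ?A x \<partial>sample n)"
      using A by simp
    also have "\<dots> = (\<integral>\<^sup>+x. \<integral>\<^sup>+y. indicator ?A (x(l := y)) \<partial>Q \<partial>Pi\<^sub>M ?J (\<lambda>_. Q))"
      using A by (intro sample.product_nn_integral_insert[of ?J l "indicator ?A", unfolded ins]) auto
    also have "\<dots> = (\<integral>\<^sup>+x. 0 \<partial>Pi\<^sub>M ?J (\<lambda>_. Q))"
    proof (rule nn_integral_cong)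
      fix x assume x: "x \<in> space (Pi\<^sub>M ?J (\<lambda>_. Q))"
      have "(\<integral>\<^sup>+y. indicator ?A (x(l := y)) \<partial>Q) = (\<integral>\<^sup>+y. indicator {y \<in> space Q. \<rho> y = \<rho> (x m)} y \<partial>Q)"
      proof (rule nn_integral_cong)
        fix y assume "y \<in> space Q"
        then have "x(l := y) \<in> space (sample n)"
          using x lm by (auto simp: space_PiM PiE_def Pi_def extensional_def)
        then show "indicator ?A (x(l := y)) = (indicator {y \<in> space Q. \<rho> y = \<rho> (x m)} y :: ennreal)"
          using \<open>y \<in> space Q\<close> lm by (simp add: indicator_def)
      qed
      also have "\<dots> = emeasure Q {y \<in> space Q. \<rho> y = \<rho> (x m)}"
        by (intro nn_integral_indicator) measurable
      finally show "(\<integral>\<^sup>+y. indicator ?A (x(l := y)) \<partial>Q) = 0"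
        by (simp add: emeasure_eq_measure atomless)
    qed
    finally have "emeasure (sample n) ?A = 0" by simp
    then show ?thesis using A by (intro AE_I[of _ _ ?A]) auto
  qed
  then have "AE x in sample n. \<forall>l\<in>{1..n}. \<forall>m\<in>{1..n}. l \<noteq> m \<longrightarrow> \<rho> (x l) \<noteq> \<rho> (x m)"
    by (auto simp: AE_finite_all)
  then show ?thesis by eventually_elim (auto simp: inj_on_def)
qed

text \<open>For a fixed value \<open>y\<close> of observation \<open>l\<close>, the remaining
  observations are independent. The factors \<open>a\<close> describe those in \<open>B\<close>,
  later the larger ones, and the factors \<open>b\<close> describe the rest, later the smaller ones,
  so the inner integral is a product of two powers.\<close>

lemma integral_split_prod:
  fixes u :: "'b \<Rightarrow> 'c::{real_normed_field, banach, second_countable_topology}"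
  assumes l: "l \<in> {1..n}" and B: "B \<subseteq> {1..n} - {l}"
    and [measurable]: "u \<in> borel_measurable Q"
    and a[measurable]: "(\<lambda>(y, z). a y z) \<in> borel_measurable (Q \<Otimes>\<^sub>M Q)"
    and b[measurable]: "(\<lambda>(y, z). b y z) \<in> borel_measurable (Q \<Otimes>\<^sub>M Q)"
    and bounds: "\<And>y. norm (u y) \<le> K" "\<And>y z. norm (a y z) \<le> 1" "\<And>y z. norm (b y z) \<le> 1"
  defines "f \<equiv> \<lambda>x. u (x l) * ((\<Prod>m\<in>B. a (x l) (x m)) * (\<Prod>m\<in>{1..n} - {l} - B. b (x l) (x m)))"
  shows "integrable (sample n) f"
    and "(LINT x|sample n. f x) =
      (LINT y|Q. u y * ((LINT z|Q. a y z) ^ card B * (LINT z|Q. b y z) ^ (n - 1 - card B)))"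
proof -
  interpret S: prob_space "sample n" by (rule prob_space_sample)
  let ?J = "{1..n} - {l}"
  have finB: "finite B" using B finite_subset by blast
  have meas2: "(\<lambda>x. g (x l) (x m)) \<in> borel_measurable (sample n)"
    if "(\<lambda>(y, z). g y z) \<in> borel_measurable (Q \<Otimes>\<^sub>M Q)" "m \<in> {1..n}" for g :: "'b \<Rightarrow> 'b \<Rightarrow> 'c" and m
    using measurable_compose[OF _ that(1), of "\<lambda>x. (x l, x m)" "sample n"] l that(2) by simp
  have f: "f \<in> borel_measurable (sample n)"
    unfolding f_def using l B
    by (intro borel_measurable_times borel_measurable_prod meas2 a b measurable_compose[OF measurable_component_singleton]) auto
  have bound: "norm (f x) \<le> K" for x
  proof -
    have "norm (\<Prod>m\<in>I. g (x l) (x m)) \<le> 1" if "\<And>y z. norm (g y z) \<le> 1" for g :: "'b \<Rightarrow> 'b \<Rightarrow> 'c" and I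
      unfolding prod_norm[symmetric] using that by (intro prod_le_1) auto
    then have "norm (f x) \<le> K * (1 * 1)"
      unfolding f_def norm_mult using bounds
      by (intro mult_mono mult_nonneg_nonneg) (auto intro: order_trans[OF norm_ge_zero])
    then show ?thesis by simp
  qed
  show "integrable (sample n) f" using f bound by (intro S.integrable_const_bound[of _ K]) auto
  have "(LINT x|sample n. f x) = (LINT y|Q. LINT x|Pi\<^sub>M ?J (\<lambda>_. Q). f (x(l := y)))"
    by (rule integral_split_index[OF l f bound])
  also have "\<dots> = (LINT y|Q. u y * ((LINT z|Q. a y z) ^ card B * (LINT z|Q. b y z) ^ (n - 1 - card B)))"
  proof (rule Bochner_Integration.integral_cong[OF refl])
    fix y assume y: "y \<in> space Q"
    define g where "g m = (if m \<in> B then a y else b y)" for m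
    have g: "integrable Q (g m)" for m
      unfolding g_def using bounds y by (intro integrable_const_bound[of _ 1]) auto
    have split: "(\<Prod>m\<in>?J. h m) = (\<Prod>m\<in>B. h m) * (\<Prod>m\<in>?J - B. h m)" for h :: "nat \<Rightarrow> 'c"
      using B by (subst prod.subset_diff[OF B]) (auto simp: mult.commute)
    have "f (x(l := y)) = u y * (\<Prod>m\<in>?J. g m (x m))" for x
    proof -
      have "(\<Prod>m\<in>B. a y ((x(l := y)) m)) = (\<Prod>m\<in>B. g m (x m))"
        using B by (intro prod.cong) (auto simp: g_def)
      moreover have "(\<Prod>m\<in>?J - B. b y ((x(l := y)) m)) = (\<Prod>m\<in>?J - B. g m (x m))"
        by (intro prod.cong) (auto simp: g_def)
      ultimately show ?thesis unfolding f_def split by simp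
    qed
    then have "(LINT x|Pi\<^sub>M ?J (\<lambda>_. Q). f (x(l := y))) = u y * (\<Prod>m\<in>?J. LINT z|Q. g m z)"
      by (simp add: sample.product_integral_prod[OF _ g])
    also have "(\<Prod>m\<in>?J. LINT z|Q. g m z) = (\<Prod>m\<in>B. LINT z|Q. a y z) * (\<Prod>m\<in>?J - B. LINT z|Q. b y z)"
      unfolding split by (intro arg_cong2[of _ _ _ _ "(*)"] prod.cong) (auto simp: g_def)
    also have "\<dots> = (LINT z|Q. a y z) ^ card B * (LINT z|Q. b y z) ^ (n - 1 - card B)"
    proof -
      have "card (?J - B) = n - 1 - card B" using B finB l by (simp add: card_Diff_subset)
      then show ?thesis by (simp only: prod_constant)
    qed
    finally show "(LINT x|Pi\<^sub>M ?J (\<lambda>_. Q). f (x(l := y))) =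
      u y * ((LINT z|Q. a y z) ^ card B * (LINT z|Q. b y z) ^ (n - 1 - card B))" .
  qed
  finally show "(LINT x|sample n. f x) =
      (LINT y|Q. u y * ((LINT z|Q. a y z) ^ card B * (LINT z|Q. b y z) ^ (n - 1 - card B)))" .
qed

text \<open>Markov's inequality for \<open>2\<close> to the number of exceedances, whose mean is
  \<open>(1 + tail r)^n\<close>.\<close>

lemma exceedances_upper: "measure (sample n) {x \<in> space (sample n). k \<le> exceedances n r x} \<le> exp (real n * tail r) / 2 ^ k"
proof -
  interpret S: prob_space "sample n" by (rule prob_space_sample)
  define w where "w y = 1 + indicat_real {y \<in> space Q. \<rho> y > r} y" for y :: 'b
  have [measurable]: "{y \<in> space Q. \<rho> y > r} \<in> sets Q" by measurable
  then have intA: "integrable Q (indicat_real {y \<in> space Q. \<rho> y > r})"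
    by (intro integrable_real_indicator) (auto simp: emeasure_finite less_top[symmetric])
  have int: "integrable Q w" unfolding w_def
    by (intro integrable_const_bound[of _ 2]) (auto simp: indicator_def)
  have Ew: "(LINT y|Q. w y) = 1 + tail r"
    unfolding w_def tail_def by (subst Bochner_Integration.integral_add) (use intA in \<open>auto simp: prob_space\<close>)
  have pw: "(\<Prod>l\<in>{1..n}. w (x l)) = 2 ^ exceedances n r x" if "x \<in> space (sample n)" for x
  proof -
    have "w (x l) = (if \<rho> (x l) > r then 2 else 1)" if "l \<in> {1..n}" for l
      using PiE_mem[OF \<open>x \<in> _\<close>[unfolded space_PiM] that] by (simp add: w_def indicator_def)
    then have "(\<Prod>l\<in>{1..n}. w (x l)) = (\<Prod>l\<in>{1..n}. if \<rho> (x l) > r then 2 else 1)"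
      by (intro prod.cong) auto
    also have "\<dots> = 2 ^ exceedances n r x"
      by (simp add: exceedances_def prod.If_cases Int_def)
    finally show ?thesis .
  qed
  have "measure (sample n) {x \<in> space (sample n). k \<le> exceedances n r x} =
      (LINT x|sample n. indicator {x \<in> space (sample n). k \<le> exceedances n r x} x)"
    by simp
  also have "\<dots> \<le> (LINT x|sample n. (\<Prod>l\<in>{1..n}. w (x l)) / 2 ^ k)"
  proof (rule integral_mono)
    show "integrable (sample n) (\<lambda>x. (\<Prod>l\<in>{1..n}. w (x l)) / 2 ^ k)"
      using sample.product_integrable_prod[of "{1..n}" "\<lambda>_. w"] int by auto
    fix x assume x: "x \<in> space (sample n)"
    show "indicator {x \<in> space (sample n). k \<le> exceedances n r x} x \<le> (\<Prod>l\<in>{1..n}. w (x l)) / 2 ^ k"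
      unfolding pw[OF x] by (auto simp: indicator_def field_simps power_increasing)
  qed (simp add: S.emeasure_finite less_top[symmetric])
  also have "\<dots> = (1 + tail r) ^ n / 2 ^ k"
    using sample.product_integral_prod[of "{1..n}" "\<lambda>_. w"] int by (simp add: Ew)
  also have "\<dots> \<le> exp (tail r) ^ n / 2 ^ k"
    by (intro divide_right_mono power_mono) (auto simp: tail_def add.commute)
  finally show ?thesis by (simp add: exp_of_nat_mult)
qed

text \<open>Markov's inequality for \<open>1/2\<close> to the number of exceedances, whose mean is
  \<open>(1 - tail r / 2)^n\<close>.\<close>

lemma exceedances_lower: "measure (sample n) {x \<in> space (sample n). exceedances n r x < k} \<le> 2 ^ k * exp (- (real n * tail r) / 2)"
proof -
  interpret S: prob_space "sample n" by (rule prob_space_sample)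
  define w where "w y = 1 - indicat_real {y \<in> space Q. \<rho> y > r} y / 2" for y :: 'b
  have [measurable]: "{y \<in> space Q. \<rho> y > r} \<in> sets Q" by measurable
  then have intA: "integrable Q (indicat_real {y \<in> space Q. \<rho> y > r})"
    by (intro integrable_real_indicator) (auto simp: emeasure_finite less_top[symmetric])
  have int: "integrable Q w" unfolding w_def
    by (intro integrable_const_bound[of _ 1]) (auto simp: indicator_def)
  have Ew: "(LINT y|Q. w y) = 1 - tail r / 2"
    unfolding w_def tail_def by (subst Bochner_Integration.integral_diff) (use intA in \<open>auto simp: prob_space\<close>)
  have pw: "(\<Prod>l\<in>{1..n}. w (x l)) = (1 / 2) ^ exceedances n r x" if "x \<in> space (sample n)" for x
  proof -
    have "w (x l) = (if \<rho> (x l) > r then 1 / 2 else 1)" if "l \<in> {1..n}" for l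
      using PiE_mem[OF \<open>x \<in> _\<close>[unfolded space_PiM] that] by (simp add: w_def indicator_def)
    then have "(\<Prod>l\<in>{1..n}. w (x l)) = (\<Prod>l\<in>{1..n}. if \<rho> (x l) > r then 1 / 2 else 1)"
      by (intro prod.cong) auto
    also have "\<dots> = (1 / 2) ^ exceedances n r x"
      by (simp add: exceedances_def prod.If_cases Int_def)
    finally show ?thesis .
  qed
  have "measure (sample n) {x \<in> space (sample n). exceedances n r x < k} =
      (LINT x|sample n. indicator {x \<in> space (sample n). exceedances n r x < k} x)"
    by simp
  also have "\<dots> \<le> (LINT x|sample n. 2 ^ k * (\<Prod>l\<in>{1..n}. w (x l)))"
  proof (rule integral_mono)
    show "integrable (sample n) (\<lambda>x. 2 ^ k * (\<Prod>l\<in>{1..n}. w (x l)))"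
      using sample.product_integrable_prod[of "{1..n}" "\<lambda>_. w"] int by auto
    fix x assume x: "x \<in> space (sample n)"
    show "indicator {x \<in> space (sample n). exceedances n r x < k} x \<le> 2 ^ k * (\<Prod>l\<in>{1..n}. w (x l))"
      unfolding pw[OF x] by (auto simp: indicator_def field_simps power_increasing)
  qed (simp add: S.emeasure_finite less_top[symmetric])
  also have "\<dots> = 2 ^ k * (1 - tail r / 2) ^ n"
    using sample.product_integral_prod[of "{1..n}" "\<lambda>_. w"] int by (simp add: Ew)
  also have "\<dots> \<le> 2 ^ k * exp (- tail r / 2) ^ n"
  proof (intro mult_left_mono power_mono)
    show "1 - tail r / 2 \<le> exp (- tail r / 2)" using exp_ge_add_one_self[of "- tail r / 2"] by simp
    show "0 \<le> 1 - tail r / 2" using order_trans[OF prob_le_1[of "{y \<in> space Q. \<rho> y > r}"], of 2] by (simp add: tail_def)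
  qed simp
  finally show ?thesis by (simp flip: exp_of_nat_mult)
qed

text \<open>The decomposition over pairs \<open>(l, B)\<close>: \<open>l\<close> carries the
  \<open>k\<close>-th largest radius and \<open>B\<close> collects the \<open>k - 1\<close> larger
  ones. On each piece the integral becomes that of \<open>psi y * alpha y^(k-1) * F y^(n-k)\<close>,
  to be compared with \<open>e * tail^(k-1) * F^(n-k)\<close>; summed over all pairs, the latter
  gives exactly \<open>e\<close>. Thus a pointwise estimate relative to \<open>tail^(k-1)\<close>
  suffices, and the combinatorial weights never have to be evaluated.\<close>

lemma top_prod_bound:
  fixes \<psi> :: "'b \<Rightarrow> complex" and e :: complex
  assumes k: "1 \<le> k" "k \<le> n"
    and psi[measurable]: "\<psi> \<in> borel_measurable Q" and psi1: "\<And>y. norm (\<psi> y) \<le> 1" and e1: "norm e \<le> 1"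
    and eps: "eps \<ge> 0"
    and good: "\<And>y. y \<in> space Q \<Longrightarrow> r1 < \<rho> y \<Longrightarrow> \<rho> y \<le> r2 \<Longrightarrow>
      norm (\<psi> y * (CLINT z|Q. indicator {\<rho> y<..} (\<rho> z) * \<psi> z) ^ (k - 1) - e * of_real (tail (\<rho> y)) ^ (k - 1))
        \<le> eps * tail (\<rho> y) ^ (k - 1)"
  shows "norm ((CLINT x|sample n. (\<Prod>l\<in>top_indices n k (\<lambda>l. \<rho> (x l)). \<psi> (x l))) - e) \<le> eps
    + 2 * measure (sample n) {x \<in> space (sample n). exceedances n r1 x < k}
    + 2 * measure (sample n) {x \<in> space (sample n). k \<le> exceedances n r2 x}"
proof -
  interpret S: prob_space "sample n" by (rule prob_space_sample)
  define pairs where "pairs = (SIGMA l:{1..n}. {B. B \<subseteq> {1..n} - {l} \<and> card B = k - 1})"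
  have fin: "finite pairs" unfolding pairs_def by (intro finite_SigmaI) auto
  define I where "I p x = (\<Prod>m\<in>snd p. indicat_real {\<rho> (x (fst p))<..} (\<rho> (x m))) *
      (\<Prod>m\<in>{1..n} - {fst p} - snd p. indicat_real {..<\<rho> (x (fst p))} (\<rho> (x m)))" for p and x :: "nat \<Rightarrow> 'b"
  define \<Psi> where "\<Psi> x = (\<Prod>l\<in>top_indices n k (\<lambda>l. \<rho> (x l)). \<psi> (x l))" for x :: "nat \<Rightarrow> 'b"
  define G where "G p x = (\<Prod>m\<in>insert (fst p) (snd p). \<psi> (x m))" for p and x :: "nat \<Rightarrow> 'b"
  \<comment> \<open>The error allowed when the \<open>k\<close>-th largest radius equals
    \<open>rho y\<close>: \<open>eps\<close> inside the window, and the trivial bound 2 on top of it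
    outside.\<close>
  define \<zeta> where "\<zeta> y = eps + 2 * indicat_real {..r1} (\<rho> y) + 2 * indicat_real {r2<..} (\<rho> y)" for y
  have zeta[measurable]: "\<zeta> \<in> borel_measurable Q" unfolding \<zeta>_def by measurable
  have zeta_bound: "norm (\<zeta> y) \<le> eps + 4" for y using eps by (auto simp: \<zeta>_def indicator_def)
  have pairs: "fst p \<in> {1..n}" "snd p \<subseteq> {1..n} - {fst p}" "card (snd p) = k - 1" "finite (snd p)" "fst p \<notin> snd p"
    if "p \<in> pairs" for p
    using that finite_subset[of "snd p" "{1..n} - {fst p}"] by (auto simp: pairs_def)

  have I01: "I p x = of_bool ((\<forall>m\<in>snd p. \<rho> (x m) > \<rho> (x (fst p))) \<and> (\<forall>m\<in>{1..n} - {fst p} - snd p. \<rho> (x m) < \<rho> (x (fst p))))"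
    if "p \<in> pairs" for p x
    using pairs(4)[OF that] unfolding I_def by (auto simp: indicator_def)

  \<comment> \<open>Without ties exactly one pair describes the sample. A \<open>k\<close>-th
    largest radius outside the window forces too few exceedances of \<open>r1\<close> or too many of
    \<open>r2\<close>, which bounds \<open>zeta\<close> by events about counts.\<close>
  have unique: "\<exists>p\<in>pairs. (\<forall>q\<in>pairs. I q x = of_bool (q = p)) \<and> \<Psi> x = G p x \<and>
      \<zeta> (x (fst p)) \<le> eps + 2 * of_bool (exceedances n r1 x < k) + 2 * of_bool (k \<le> exceedances n r2 x)"
    if inj: "inj_on (\<lambda>l. \<rho> (x l)) {1..n}" for x
  proof -
    define r where "r l = \<rho> (x l)" for l
    obtain l0 where l0: "l0 \<in> {1..n}" "r l0 = kth_largest n k r" "card {l\<in>{1..n}. r l > kth_largest n k r} = k - 1"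
      "{l\<in>{1..n}. r l \<ge> kth_largest n k r} = insert l0 {l\<in>{1..n}. r l > kth_largest n k r}"
      using kth_largest_inj[OF k] inj[folded r_def] by blast
    define B0 where "B0 = {l\<in>{1..n}. r l > r l0}"
    have p: "(l0, B0) \<in> pairs" using l0 by (auto simp: pairs_def B0_def)
    have inj': "l = m" if "r l = r m" "l \<in> {1..n}" "m \<in> {1..n}" for l m
      using inj_onD[OF inj, of l m] that by (simp add: r_def)
    have Iq: "I q x = of_bool (q = (l0, B0))" if q: "q \<in> pairs" for q
    proof -
      obtain l B where lB: "q = (l, B)" by (cases q)
      note qs = pairs[OF q, unfolded lB fst_conv snd_conv]
      have "(\<forall>m\<in>B. r m > r l) \<and> (\<forall>m\<in>{1..n} - {l} - B. r m < r l) \<longleftrightarrow> l = l0 \<and> B = B0"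
      proof
        assume *: "(\<forall>m\<in>B. r m > r l) \<and> (\<forall>m\<in>{1..n} - {l} - B. r m < r l)"
        have B: "B = {m\<in>{1..n}. r m > r l}"
        proof
          show "B \<subseteq> {m\<in>{1..n}. r m > r l}" using * qs(2) by auto
          show "{m\<in>{1..n}. r m > r l} \<subseteq> B"
          proof
            fix m assume m: "m \<in> {m\<in>{1..n}. r m > r l}"
            show "m \<in> B"
            proof (rule ccontr)
              assume "m \<notin> B"
              then have "m \<in> {1..n} - {l} - B" using m by auto
              then have "r m < r l" using * by blast
              then show False using m by simp
            qed
          qed
        qed
        \<comment> \<open>If the two levels differed, the set above the lower one would contain the
          set above the higher one together with the higher index itself, so the two sets could not
          both have \<open>k - 1\<close> elements.\<close>
        have "r l = r l0"
        proof (rule ccontr)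
          assume "r l \<noteq> r l0"
          then consider "r l < r l0" | "r l0 < r l" by linarith
          then show False
          proof cases
            case 1
            then have "insert l0 B0 \<subseteq> B" using l0(1) by (auto simp: B B0_def)
            then have "card (insert l0 B0) \<le> card B" using qs(4) by (rule card_mono[rotated])
            moreover have "card (insert l0 B0) = Suc (card B0)" by (intro card_insert_disjoint) (auto simp: B0_def)
            ultimately show False using qs(3) l0 by (simp add: B0_def)
          next
            case 2
            then have "insert l B \<subseteq> B0" using qs(1) by (auto simp: B B0_def)
            then have "card (insert l B) \<le> card B0" by (rule card_mono[rotated]) (simp add: B0_def)
            moreover have "card (insert l B) = Suc (card B)" using qs by (intro card_insert_disjoint) auto
            ultimately show False using qs(3) l0 by (simp add: B0_def)
          qed
        qed
        then show "l = l0 \<and> B = B0" using inj' qs(1) l0(1) B by (simp add: B0_def)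
      next
        assume eq: "l = l0 \<and> B = B0"
        have "r m < r l0" if "m \<in> {1..n} - {l0} - B0" for m
          using that inj'[of m l0] l0(1) by (cases "r m = r l0") (auto simp: B0_def)
        then show "(\<forall>m\<in>B. r m > r l) \<and> (\<forall>m\<in>{1..n} - {l} - B. r m < r l)" using eq by (auto simp: B0_def)
      qed
      then show ?thesis unfolding I01[OF q] by (simp add: lB r_def)
    qed
    have top: "top_indices n k (\<lambda>l. \<rho> (x l)) = insert l0 B0"
      unfolding top_indices_def using l0(2,4) by (simp add: B0_def r_def[abs_def])
    have "\<rho> (x l0) \<le> r1 \<Longrightarrow> exceedances n r1 x < k"
    proof -
      assume "\<rho> (x l0) \<le> r1"
      then have "{l\<in>{1..n}. \<rho> (x l) > r1} \<subseteq> B0" by (auto simp: B0_def r_def)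
      then have "exceedances n r1 x \<le> card B0"
        unfolding exceedances_def by (rule card_mono[rotated]) (simp add: B0_def)
      then show ?thesis using l0 k by (simp add: B0_def)
    qed
    moreover have "r2 < \<rho> (x l0) \<Longrightarrow> k \<le> exceedances n r2 x"
    proof -
      assume "r2 < \<rho> (x l0)"
      then have "insert l0 B0 \<subseteq> {l\<in>{1..n}. \<rho> (x l) > r2}" using l0(1) by (auto simp: B0_def r_def)
      then have "card (insert l0 B0) \<le> exceedances n r2 x"
        unfolding exceedances_def by (rule card_mono[rotated]) simp
      moreover have "card (insert l0 B0) = Suc (card B0)" by (intro card_insert_disjoint) (auto simp: B0_def)
      ultimately show ?thesis using l0 k by (simp add: B0_def)
    qed
    ultimately have "\<zeta> (x l0) \<le> eps + 2 * of_bool (exceedances n r1 x < k) + 2 * of_bool (k \<le> exceedances n r2 x)"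
      by (auto simp: \<zeta>_def indicator_def)
    then show ?thesis using Iq top p by (intro bexI[of _ "(l0, B0)"]) (auto simp: \<Psi>_def G_def)
  qed
  have collapse: "AE x in sample n. \<Psi> x = (\<Sum>p\<in>pairs. of_real (I p x) * G p x) \<and> (\<Sum>p\<in>pairs. I p x) = 1 \<and>
      (\<Sum>p\<in>pairs. I p x * \<zeta> (x (fst p))) \<le> eps + 2 * of_bool (exceedances n r1 x < k) + 2 * of_bool (k \<le> exceedances n r2 x)"
    using AE_inj[of n]
  proof eventually_elim
    case (elim x)
    obtain p where p: "p \<in> pairs" "\<And>q. q \<in> pairs \<Longrightarrow> I q x = of_bool (q = p)" "\<Psi> x = G p x"
      "\<zeta> (x (fst p)) \<le> eps + 2 * of_bool (exceedances n r1 x < k) + 2 * of_bool (k \<le> exceedances n r2 x)"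
      using unique[OF elim] by blast
    have single: "(\<Sum>q\<in>pairs. of_real (I q x) * h q) = h p" for h :: "_ \<Rightarrow> 'z::{comm_ring_1, real_algebra_1}"
    proof -
      have "(\<Sum>q\<in>pairs. of_real (I q x) * h q) = (\<Sum>q\<in>pairs. if q = p then h q else 0)"
        by (intro sum.cong) (auto simp: p(2))
      then show ?thesis using p(1) fin by simp
    qed
    show ?case using single[of "\<lambda>q. G q x"] single[of "\<lambda>_. 1 :: real"] single[of "\<lambda>q. \<zeta> (x (fst q))"] p(3,4)
      by simp
  qed

  define F where "F y = measure Q {z \<in> space Q. \<rho> z < \<rho> y}" for y
  define \<alpha> where "\<alpha> y = (CLINT z|Q. indicator {\<rho> y<..} (\<rho> z) * \<psi> z)" for y
  have ind_int: "(LINT z|Q. indicator A (\<rho> z)) = (of_real (measure Q {z \<in> space Q. \<rho> z \<in> A}) :: 'z::{real_normed_field, banach, second_countable_topology})"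
    if [measurable]: "A \<in> sets borel" for A
  proof -
    have "(LINT z|Q. indicator A (\<rho> z)) = (LINT z|Q. (indicat_real {z \<in> space Q. \<rho> z \<in> A} z *\<^sub>R (1 :: 'z)))"
      by (intro Bochner_Integration.integral_cong) (auto simp: indicator_def)
    also have "\<dots> = (LINT z|Q. indicat_real {z \<in> space Q. \<rho> z \<in> A} z) *\<^sub>R 1"
      by (intro integral_scaleR_left integrable_const_bound[of _ 1]) (auto simp: indicator_def)
    finally show ?thesis by (simp add: of_real_def)
  qed
  have ind_up: "(LINT z|Q. indicator {c<..} (\<rho> z)) = (of_real (tail c) :: 'z::{real_normed_field, banach, second_countable_topology})" for c
    by (simp add: ind_int tail_def)
  have ind_dn: "(LINT z|Q. indicator {..<\<rho> y} (\<rho> z)) = (of_real (F y) :: 'z::{real_normed_field, banach, second_countable_topology})" for y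
    by (simp add: ind_int F_def)
  have ind_meas: "(\<lambda>(y, z). indicator {\<rho> y<..} (\<rho> z) :: 'z::{real_normed_field, second_countable_topology}) \<in> borel_measurable (Q \<Otimes>\<^sub>M Q)"
    "(\<lambda>(y, z). indicator {..<\<rho> y} (\<rho> z) :: 'z) \<in> borel_measurable (Q \<Otimes>\<^sub>M Q)"
  proof -
    have "(\<lambda>p. if \<rho> (fst p) < \<rho> (snd p) then 1 else 0 :: 'z) \<in> borel_measurable (Q \<Otimes>\<^sub>M Q)"
      "(\<lambda>p. if \<rho> (snd p) < \<rho> (fst p) then 1 else 0 :: 'z) \<in> borel_measurable (Q \<Otimes>\<^sub>M Q)"
      by measurable
    then show "(\<lambda>(y, z). indicator {\<rho> y<..} (\<rho> z) :: 'z) \<in> borel_measurable (Q \<Otimes>\<^sub>M Q)"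
      "(\<lambda>(y, z). indicator {..<\<rho> y} (\<rho> z) :: 'z) \<in> borel_measurable (Q \<Otimes>\<^sub>M Q)"
      by (simp_all add: case_prod_beta' indicator_def)
  qed
  have ind_bd: "norm (indicator A w :: 'z::{real_normed_field}) \<le> 1" for A and w :: real
    by (simp add: indicator_def)
  have up_psi: "(\<lambda>(y, z). indicator {\<rho> y<..} (\<rho> z) * \<psi> z) \<in> borel_measurable (Q \<Otimes>\<^sub>M Q)"
    using borel_measurable_times[OF ind_meas(1) measurable_compose[OF measurable_snd psi]]
    by (simp add: case_prod_beta')
  have up_psi_bd: "norm (indicator {\<rho> y<..} (\<rho> z) * \<psi> z) \<le> 1" for y z
    using psi1[of z] by (simp add: indicator_def)
  have [measurable]: "\<alpha> \<in> borel_measurable Q"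
    unfolding \<alpha>_def using up_psi by (intro borel_measurable_lebesgue_integral)
  have "(\<lambda>y. LINT z|Q. indicat_real {\<rho> y<..} (\<rho> z)) \<in> borel_measurable Q"
    by (rule borel_measurable_lebesgue_integral[OF ind_meas(1)])
  then have Tm[measurable]: "(\<lambda>y. tail (\<rho> y)) \<in> borel_measurable Q" by (simp add: ind_up)
  have "(\<lambda>y. LINT z|Q. indicat_real {..<\<rho> y} (\<rho> z)) \<in> borel_measurable Q"
    by (rule borel_measurable_lebesgue_integral[OF ind_meas(2)])
  then have Fm[measurable]: "F \<in> borel_measurable Q" by (simp add: ind_dn)
  have T01: "0 \<le> tail c" "tail c \<le> 1" and F01: "0 \<le> F y" "F y \<le> 1" for c y by (auto simp: tail_def F_def)
  have int_up: "integrable Q (\<lambda>z. indicat_real {c<..} (\<rho> z))" for c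
    by (intro integrable_const_bound[of _ 1]) (auto simp: indicator_def)
  have alpha_le: "norm (\<alpha> y) \<le> tail (\<rho> y)" for y
  proof -
    have "norm (\<alpha> y) \<le> (LINT z|Q. indicator {\<rho> y<..} (\<rho> z))"
      unfolding \<alpha>_def
    proof (rule norm_integral_le[OF _ int_up])
      show "integrable Q (\<lambda>z. indicator {\<rho> y<..} (\<rho> z) * \<psi> z)"
        by (intro integrable_const_bound[of _ 1] AE_I2 up_psi_bd) measurable
      show "norm (indicator {\<rho> y<..} (\<rho> z) * \<psi> z) \<le> indicator {\<rho> y<..} (\<rho> z)" for z
        using psi1[of z] by (simp add: indicator_def)
    qed
    then show ?thesis by (simp add: ind_up)
  qed

  \<comment> \<open>Fubini on one piece, with the error integrated against the same weights
    \<open>tail^(k-1) * F^(n-k)\<close>, so that the right-hand side can be folded back into an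
    integral over the sample space.\<close>
  have pair_bound: "norm (CLINT x|sample n. of_real (I p x) * (G p x - e)) \<le> (LINT x|sample n. I p x * \<zeta> (x (fst p)))"
    and pair_int: "integrable (sample n) (\<lambda>x. of_real (I p x) * G p x)" "integrable (sample n) (I p)"
      "integrable (sample n) (\<lambda>x. I p x * \<zeta> (x (fst p)))"
    if p: "p \<in> pairs" for p
  proof -
    obtain l B where lB: "p = (l, B)" by (cases p)
    note ps = pairs[OF p, unfolded lB fst_conv snd_conv]
    have card: "card B = k - 1" "n - 1 - (k - 1) = n - k" using ps(3) k by auto
    note A1 = integral_split_prod[OF ps(1,2) psi up_psi ind_meas(2) psi1 up_psi_bd ind_bd]
    note A2 = integral_split_prod[OF ps(1,2) borel_measurable_const[of e] ind_meas _ ind_bd ind_bd, of "norm e"]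
    note A3 = integral_split_prod[OF ps(1,2) zeta ind_meas zeta_bound ind_bd ind_bd]
    note A4 = integral_split_prod[OF ps(1,2) borel_measurable_const[of "1 :: real"] ind_meas _ ind_bd ind_bd, of 1]
    have G: "of_real (I p x) * G p x = \<psi> (x l) * ((\<Prod>m\<in>B. indicator {\<rho> (x l)<..} (\<rho> (x m)) * \<psi> (x m)) *
        (\<Prod>m\<in>{1..n} - {l} - B. indicator {..<\<rho> (x l)} (\<rho> (x m))))" for x
      using ps(4,5) by (simp add: I_def G_def lB prod.distrib of_real_indicator mult_ac)
    have Ge: "of_real (I p x) * e = e * ((\<Prod>m\<in>B. indicator {\<rho> (x l)<..} (\<rho> (x m))) *
        (\<Prod>m\<in>{1..n} - {l} - B. indicator {..<\<rho> (x l)} (\<rho> (x m))))" for x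
      by (simp add: I_def lB of_real_indicator mult_ac)
    have Gz: "I p x * \<zeta> (x (fst p)) = \<zeta> (x l) * ((\<Prod>m\<in>B. indicator {\<rho> (x l)<..} (\<rho> (x m))) *
        (\<Prod>m\<in>{1..n} - {l} - B. indicator {..<\<rho> (x l)} (\<rho> (x m))))" for x
      by (simp add: I_def lB mult_ac)
    have G1: "I p x = 1 * ((\<Prod>m\<in>B. indicator {\<rho> (x l)<..} (\<rho> (x m))) *
        (\<Prod>m\<in>{1..n} - {l} - B. indicator {..<\<rho> (x l)} (\<rho> (x m))))" for x
      by (simp add: I_def lB)
    show i1: "integrable (sample n) (\<lambda>x. of_real (I p x) * G p x)" unfolding G by (rule A1(1))
    show "integrable (sample n) (I p)" unfolding G1[abs_def] by (rule A4(1)) simp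
    show i3: "integrable (sample n) (\<lambda>x. I p x * \<zeta> (x (fst p)))" unfolding Gz by (rule A3(1))
    have i2: "integrable (sample n) (\<lambda>x. of_real (I p x) * e)" unfolding Ge by (rule A2(1)) simp_all
    have e1': "(CLINT x|sample n. of_real (I p x) * G p x) = (CLINT y|Q. \<psi> y * (\<alpha> y ^ (k - 1) * of_real (F y) ^ (n - k)))"
      unfolding G A1(2) card ind_dn \<alpha>_def ..
    have e2': "(CLINT x|sample n. of_real (I p x) * e) = (CLINT y|Q. e * (of_real (tail (\<rho> y)) ^ (k - 1) * of_real (F y) ^ (n - k)))"
      unfolding Ge by (subst A2(2), simp, unfold card ind_dn ind_up, rule refl)
    have e3': "(LINT x|sample n. I p x * \<zeta> (x (fst p))) = (LINT y|Q. \<zeta> y * (tail (\<rho> y) ^ (k - 1) * F y ^ (n - k)))"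
      unfolding Gz A3(2) card ind_dn ind_up of_real_eq_id id_apply ..
    have pw: "tail (\<rho> y) ^ (k - 1) \<le> 1" "F y ^ (n - k) \<le> 1" for y
      using T01 F01 by (auto intro: power_le_one)
    have j1: "integrable Q (\<lambda>y. \<psi> y * (\<alpha> y ^ (k - 1) * of_real (F y) ^ (n - k)))"
    proof (intro integrable_const_bound[of _ 1] AE_I2)
      fix y
      have "norm (\<alpha> y) ^ (k - 1) \<le> 1" using alpha_le[of y] T01[of "\<rho> y"] by (intro power_le_one) auto
      then have "norm (\<psi> y) * (norm (\<alpha> y) ^ (k - 1) * F y ^ (n - k)) \<le> 1 * (1 * 1)"
        using psi1[of y] pw(2)[of y] F01[of y] by (intro mult_mono mult_nonneg_nonneg zero_le_power) auto
      then show "norm (\<psi> y * (\<alpha> y ^ (k - 1) * of_real (F y) ^ (n - k))) \<le> 1"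
        using F01[of y] by (simp add: norm_mult norm_power)
    qed measurable
    have j2: "integrable Q (\<lambda>y. e * (of_real (tail (\<rho> y)) ^ (k - 1) * of_real (F y) ^ (n - k)))"
    proof (intro integrable_const_bound[of _ 1] AE_I2)
      fix y
      have "norm e * (tail (\<rho> y) ^ (k - 1) * F y ^ (n - k)) \<le> 1 * (1 * 1)"
        using e1 pw[of y] F01[of y] T01[of "\<rho> y"] by (intro mult_mono mult_nonneg_nonneg zero_le_power) auto
      then show "norm (e * (of_real (tail (\<rho> y)) ^ (k - 1) * of_real (F y) ^ (n - k))) \<le> 1"
        using F01[of y] T01[of "\<rho> y"] by (simp add: norm_mult norm_power)
    qed measurable
    have j3: "integrable Q (\<lambda>y. \<zeta> y * (tail (\<rho> y) ^ (k - 1) * F y ^ (n - k)))"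
    proof (intro integrable_const_bound[of _ "eps + 4"] AE_I2)
      fix y
      have "norm (\<zeta> y) * (tail (\<rho> y) ^ (k - 1) * F y ^ (n - k)) \<le> (eps + 4) * (1 * 1)"
        using zeta_bound[of y] pw[of y] F01[of y] T01[of "\<rho> y"] eps
        by (intro mult_mono mult_nonneg_nonneg zero_le_power) auto
      then show "norm (\<zeta> y * (tail (\<rho> y) ^ (k - 1) * F y ^ (n - k))) \<le> eps + 4"
        using F01[of y] T01[of "\<rho> y"] by (simp add: abs_mult)
    qed measurable
    have "(CLINT x|sample n. of_real (I p x) * (G p x - e)) =
        (CLINT y|Q. \<psi> y * (\<alpha> y ^ (k - 1) * of_real (F y) ^ (n - k)) - e * (of_real (tail (\<rho> y)) ^ (k - 1) * of_real (F y) ^ (n - k)))"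
      by (simp only: right_diff_distrib Bochner_Integration.integral_diff[OF i1 i2]
          Bochner_Integration.integral_diff[OF j1 j2] e1' e2')
    also have "norm \<dots> \<le> (LINT y|Q. \<zeta> y * (tail (\<rho> y) ^ (k - 1) * F y ^ (n - k)))"
    proof (rule norm_integral_le)
      show "integrable Q (\<lambda>y. \<psi> y * (\<alpha> y ^ (k - 1) * of_real (F y) ^ (n - k)) - e * (of_real (tail (\<rho> y)) ^ (k - 1) * of_real (F y) ^ (n - k)))"
        using j1 j2 by simp
      fix y assume y: "y \<in> space Q"
      have "norm (\<psi> y * \<alpha> y ^ (k - 1) - e * of_real (tail (\<rho> y)) ^ (k - 1)) \<le> \<zeta> y * tail (\<rho> y) ^ (k - 1)"
      proof (cases "r1 < \<rho> y \<and> \<rho> y \<le> r2")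
        case True
        then show ?thesis using good[OF y] by (simp add: \<alpha>_def \<zeta>_def)
      next
        case False
        have "norm (\<psi> y * \<alpha> y ^ (k - 1) - e * of_real (tail (\<rho> y)) ^ (k - 1)) \<le>
            norm (\<psi> y * \<alpha> y ^ (k - 1)) + norm (e * of_real (tail (\<rho> y)) ^ (k - 1))"
          by (rule norm_triangle_ineq4)
        also have "\<dots> \<le> 1 * tail (\<rho> y) ^ (k - 1) + 1 * tail (\<rho> y) ^ (k - 1)"
          unfolding norm_mult norm_power using psi1[of y] e1 alpha_le[of y] T01[of "\<rho> y"]
          by (intro add_mono mult_mono power_mono) auto
        also have "\<dots> \<le> \<zeta> y * tail (\<rho> y) ^ (k - 1)"
        proof -
          \<comment> \<open>Outside the window one of the two indicators in \<open>zeta\<close>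
            equals 1.\<close>
          have "2 \<le> \<zeta> y" using False eps by (auto simp: \<zeta>_def indicator_def)
          then have "2 * tail (\<rho> y) ^ (k - 1) \<le> \<zeta> y * tail (\<rho> y) ^ (k - 1)"
            using T01 by (intro mult_right_mono) auto
          then show ?thesis by simp
        qed
        finally show ?thesis .
      qed
      then have "norm (\<psi> y * \<alpha> y ^ (k - 1) - e * of_real (tail (\<rho> y)) ^ (k - 1)) * F y ^ (n - k) \<le>
          \<zeta> y * tail (\<rho> y) ^ (k - 1) * F y ^ (n - k)"
        using F01[of y] by (intro mult_right_mono) auto
      moreover have "\<psi> y * (\<alpha> y ^ (k - 1) * of_real (F y) ^ (n - k)) - e * (of_real (tail (\<rho> y)) ^ (k - 1) * of_real (F y) ^ (n - k))
          = (\<psi> y * \<alpha> y ^ (k - 1) - e * of_real (tail (\<rho> y)) ^ (k - 1)) * of_real (F y) ^ (n - k)"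
        by (simp add: algebra_simps)
      ultimately show "norm (\<psi> y * (\<alpha> y ^ (k - 1) * of_real (F y) ^ (n - k)) - e * (of_real (tail (\<rho> y)) ^ (k - 1) * of_real (F y) ^ (n - k)))
          \<le> \<zeta> y * (tail (\<rho> y) ^ (k - 1) * F y ^ (n - k))"
        using F01[of y] by (simp add: norm_mult norm_power mult.assoc)
    qed (rule j3)
    finally show "norm (CLINT x|sample n. of_real (I p x) * (G p x - e)) \<le> (LINT x|sample n. I p x * \<zeta> (x (fst p)))"
      unfolding e3' .
  qed

  have Psi_meas[measurable]: "\<Psi> \<in> borel_measurable (sample n)"
  proof -
    have [measurable]: "(\<lambda>x. kth_largest n k (\<lambda>l. \<rho> (x l))) \<in> borel_measurable (sample n)"
      by (intro measurable_kth_largest[OF k]) measurable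
    have "\<Psi> = (\<lambda>x. \<Prod>l\<in>{1..n}. if \<rho> (x l) \<ge> kth_largest n k (\<lambda>l. \<rho> (x l)) then \<psi> (x l) else 1)"
      unfolding \<Psi>_def top_indices_def by (intro ext prod.inter_filter) simp
    also have "\<dots> \<in> borel_measurable (sample n)" by measurable
    finally show ?thesis .
  qed
  have Ie_int: "integrable (sample n) (\<lambda>x. of_real (I p x) * e)" if "p \<in> pairs" for p
    using pair_int(2)[OF that] by (intro integrable_mult_left integrable_of_real)
  have eq: "(CLINT x|sample n. \<Psi> x) = (\<Sum>p\<in>pairs. CLINT x|sample n. of_real (I p x) * G p x)"
  proof -
    have "(CLINT x|sample n. \<Psi> x) = (CLINT x|sample n. (\<Sum>p\<in>pairs. of_real (I p x) * G p x))"
    proof (rule integral_cong_AE[OF Psi_meas])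
      show "(\<lambda>x. \<Sum>p\<in>pairs. of_real (I p x) * G p x) \<in> borel_measurable (sample n)"
        by (intro borel_measurable_sum borel_measurable_integrable pair_int(1))
      show "AE x in sample n. \<Psi> x = (\<Sum>p\<in>pairs. of_real (I p x) * G p x)"
        using collapse by eventually_elim blast
    qed
    then show ?thesis using pair_int(1) by simp
  qed
  \<comment> \<open>The indicators of the pieces sum to 1 almost surely, so the comparison terms add
    up to the constant \<open>e\<close>.\<close>
  have one: "(\<Sum>p\<in>pairs. CLINT x|sample n. of_real (I p x) * e) = e"
  proof -
    have "(\<Sum>p\<in>pairs. CLINT x|sample n. of_real (I p x) * e) = (CLINT x|sample n. (\<Sum>p\<in>pairs. of_real (I p x) * e))"
      using Ie_int by simp
    also have "\<dots> = (CLINT x|sample n. e)"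
    proof (intro integral_cong_AE borel_measurable_sum borel_measurable_integrable)
      show "AE x in sample n. (\<Sum>p\<in>pairs. of_real (I p x) * e) = e"
        using collapse by eventually_elim (simp flip: sum_distrib_right of_real_sum)
    qed (use Ie_int in auto)
    finally show ?thesis by (simp add: S.prob_space)
  qed
  have "norm ((CLINT x|sample n. \<Psi> x) - e) = norm (\<Sum>p\<in>pairs. CLINT x|sample n. of_real (I p x) * (G p x - e))"
  proof -
    have "(\<Sum>p\<in>pairs. CLINT x|sample n. of_real (I p x) * (G p x - e)) =
        (\<Sum>p\<in>pairs. (CLINT x|sample n. of_real (I p x) * G p x) - (CLINT x|sample n. of_real (I p x) * e))"
      by (intro sum.cong refl)
         (simp only: right_diff_distrib Bochner_Integration.integral_diff[OF pair_int(1) Ie_int])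
    then show ?thesis by (simp only: sum_subtractf one eq)
  qed
  also have "\<dots> \<le> (\<Sum>p\<in>pairs. LINT x|sample n. I p x * \<zeta> (x (fst p)))"
    by (rule sum_norm_le) (rule pair_bound)
  also have "\<dots> = (LINT x|sample n. (\<Sum>p\<in>pairs. I p x * \<zeta> (x (fst p))))"
    using pair_int(3) by simp
  also have "\<dots> \<le> (LINT x|sample n. eps + 2 * indicator {x \<in> space (sample n). exceedances n r1 x < k} x
      + 2 * indicator {x \<in> space (sample n). k \<le> exceedances n r2 x} x)"
  proof (rule integral_mono_AE)
    show "integrable (sample n) (\<lambda>x. eps + 2 * indicator {x \<in> space (sample n). exceedances n r1 x < k} x
      + 2 * indicat_real {x \<in> space (sample n). k \<le> exceedances n r2 x} x)"
      by (intro S.integrable_const_bound[of _ "eps + 4"]) (use eps in \<open>auto simp: indicator_def\<close>)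
    show "AE x in sample n. (\<Sum>p\<in>pairs. I p x * \<zeta> (x (fst p))) \<le> eps + 2 * indicator {x \<in> space (sample n). exceedances n r1 x < k} x
      + 2 * indicat_real {x \<in> space (sample n). k \<le> exceedances n r2 x} x"
      using collapse AE_space by eventually_elim (simp add: indicator_def)
  qed (use pair_int(3) in simp)
  also have "\<dots> = eps + 2 * measure (sample n) {x \<in> space (sample n). exceedances n r1 x < k}
    + 2 * measure (sample n) {x \<in> space (sample n). k \<le> exceedances n r2 x}"
    by (simp add: S.prob_space less_top[symmetric] S.emeasure_finite)
  finally show ?thesis unfolding \<Psi>_def .
qed

lemma tail_nonneg: "0 \<le> tail r" and tail_le_1: "tail r \<le> 1"
  by (auto simp: tail_def)

lemma integral_indicator_gt: "(LINT z|Q. indicat_real {r<..} (\<rho> z)) = tail r"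
proof -
  have "(LINT z|Q. indicat_real {r<..} (\<rho> z)) = (LINT z|Q. indicat_real {z \<in> space Q. \<rho> z > r} z)"
    by (intro Bochner_Integration.integral_cong) (auto simp: indicator_def)
  then show ?thesis by (simp add: tail_def)
qed

text \<open>Given the value \<open>r\<close> of the \<open>k\<close>-th largest observation, the larger ones are i.i.d. from the law
  conditioned on \<open>\<rho> > r\<close>, and the estimate is the usual second-order expansion of their
  characteristic function, multiplied by \<open>tail r\<close> to avoid dividing by it.\<close>

lemma conditional_char_expansion:
  assumes U[measurable]: "U \<in> borel_measurable Q" and C: "\<And>y. \<bar>U y\<bar> \<le> C" and k: "1 \<le> k" and v: "v \<ge> 0"
    and e0: "\<epsilon> \<ge> 0"
    and m1: "sqrt (real k) * \<bar>LINT z|Q. indicator {r<..} (\<rho> z) * U z\<bar> \<le> \<epsilon> * tail r"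
    and m2: "\<bar>(LINT z|Q. indicator {r<..} (\<rho> z) * (U z)\<^sup>2) - v * tail r\<bar> \<le> \<epsilon> * tail r"
  defines "\<psi> \<equiv> \<lambda>y. iexp (U y / sqrt (real k))"
  defines "\<delta> \<equiv> C ^ 3 / sqrt (real k) + 2 * \<epsilon> + v\<^sup>2 / real k"
  shows "norm ((CLINT z|Q. indicator {r<..} (\<rho> z) * \<psi> z) - of_real (tail r * exp (- v / (2 * real k)))) \<le> tail r * (\<delta> / real k)"
proof -
  define s where "s = sqrt (real k)"
  have s: "s > 0" "s\<^sup>2 = real k" "s \<ge> 1" using k by (auto simp: s_def)
  have C0: "C \<ge> 0" using C[of undefined] by linarith
  define I where "I z = indicat_real {r<..} (\<rho> z)" for z
  have [measurable]: "I \<in> borel_measurable Q" unfolding I_def by measurable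
  have I01: "0 \<le> I z" "I z \<le> 1" for z by (auto simp: I_def indicator_def)
  have intI: "integrable Q I" by (intro integrable_const_bound[of _ 1]) (auto simp: I_def indicator_def)
  have intIU: "integrable Q (\<lambda>z. I z * U z)"
    using C C0 by (intro integrable_const_bound[of _ C]) (auto simp: I_def indicator_def)
  have U2: "\<bar>(U z)\<^sup>2\<bar> \<le> C\<^sup>2" for z using power_mono[where n = 2, OF C[of z] abs_ge_zero] by simp
  have intIU2: "integrable Q (\<lambda>z. I z * (U z)\<^sup>2)"
    using U2 by (intro integrable_const_bound[of _ "C\<^sup>2"]) (auto simp: I_def indicator_def)
  \<comment> \<open>The second-order Taylor polynomial of the exponential at 0; boundedness of
    \<open>U\<close> makes its remainder of order \<open>k^(-3/2)\<close> uniformly.\<close>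
  define p where "p z = 1 + \<i> * of_real (U z / s) - of_real ((U z)\<^sup>2 / (2 * real k))" for z
  have psi_p: "norm (\<psi> z - p z) \<le> C ^ 3 / (s * real k)" for z
  proof -
    have "norm (iexp (U z / s) - (\<Sum>j\<le>2. (\<i> * (U z / s)) ^ j / fact j)) \<le> \<bar>U z / s\<bar> ^ Suc 2 / fact (Suc 2)"
      by (rule iexp_approx1)
    also have "(\<Sum>j\<le>2. (\<i> * (U z / s)) ^ j / fact j) = p z"
    proof -
      have "(\<i> * of_real (U z / s))\<^sup>2 = - of_real ((U z)\<^sup>2 / real k)"
        unfolding power_mult_distrib of_real_power[symmetric] power_divide s(2) by simp
      then have "(\<i> * of_real (U z / s))\<^sup>2 / 2 = - of_real ((U z)\<^sup>2 / (2 * real k))"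
        by simp
      moreover have "(\<Sum>j\<le>2. (\<i> * of_real x) ^ j / fact j) = 1 + \<i> * of_real x + (\<i> * of_real x)\<^sup>2 / 2" for x
        by (simp add: numeral_2_eq_2)
      ultimately show ?thesis by (simp only: p_def) simp
    qed
    also have "\<bar>U z / s\<bar> ^ Suc 2 / fact (Suc 2) \<le> C ^ 3 / (s * real k)"
    proof -
      have "\<bar>U z / s\<bar> ^ Suc 2 / fact (Suc 2) \<le> \<bar>U z / s\<bar> ^ 3 / 1"
        by (intro frac_le) (auto simp: numeral_3_eq_3 numeral_2_eq_2)
      also have "\<bar>U z / s\<bar> ^ 3 = \<bar>U z\<bar> ^ 3 / (s * real k)"
        using s by (simp add: power_divide abs_divide power3_eq_cube flip: s(2)) (simp add: power2_eq_square)
      also have "\<dots> \<le> C ^ 3 / (s * real k)"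
        using C s by (intro divide_right_mono power_mono) auto
      finally show ?thesis by simp
    qed
    finally show ?thesis by (simp add: \<psi>_def s_def)
  qed
  have psi1: "norm (\<psi> z) = 1" for z by (simp add: \<psi>_def)
  have [measurable]: "\<psi> \<in> borel_measurable Q" "p \<in> borel_measurable Q" unfolding \<psi>_def p_def by measurable
  have int_psi: "integrable Q (\<lambda>z. of_real (I z) * \<psi> z)"
    using psi1 by (intro integrable_const_bound[of _ 1]) (auto simp: norm_mult I_def indicator_def)
  have p_eq: "of_real (I z) * p z = of_real (I z) + \<i> * of_real (I z * U z / s) - of_real (I z * (U z)\<^sup>2 / (2 * real k))" for z
    by (simp add: p_def algebra_simps)
  have ia: "integrable Q (\<lambda>z. complex_of_real (I z))" and ib: "integrable Q (\<lambda>z. \<i> * complex_of_real (I z * U z / s))"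
    and ic: "integrable Q (\<lambda>z. complex_of_real (I z * (U z)\<^sup>2 / (2 * real k)))"
    by (intro integrable_mult_right integrable_of_real integrable_divide_zero intI intIU intIU2)+
  have int_p: "integrable Q (\<lambda>z. of_real (I z) * p z)"
    unfolding p_eq by (intro Bochner_Integration.integrable_add Bochner_Integration.integrable_diff ia ib ic)
  define m1' where "m1' = (LINT z|Q. I z * U z)"
  define m2' where "m2' = (LINT z|Q. I z * (U z)\<^sup>2)"
  have Ep: "(CLINT z|Q. of_real (I z) * p z) = of_real (tail r) + \<i> * of_real (m1' / s) - of_real (m2' / (2 * real k))"
  proof -
    have "(CLINT z|Q. of_real (I z) * p z) = of_real (LINT z|Q. I z) + \<i> * of_real (LINT z|Q. I z * U z / s)
        - of_real (LINT z|Q. I z * (U z)\<^sup>2 / (2 * real k))"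
      unfolding p_eq Bochner_Integration.integral_diff[OF Bochner_Integration.integrable_add[OF ia ib] ic]
        Bochner_Integration.integral_add[OF ia ib] integral_mult_right_zero integral_complex_of_real ..
    then show ?thesis unfolding m1'_def m2'_def I_def integral_divide_zero integral_indicator_gt .
  qed
  have "norm ((CLINT z|Q. of_real (I z) * \<psi> z) - (CLINT z|Q. of_real (I z) * p z)) \<le> (LINT z|Q. I z * (C ^ 3 / (s * real k)))"
  proof -
    have "norm (CLINT z|Q. of_real (I z) * \<psi> z - of_real (I z) * p z) \<le> (LINT z|Q. I z * (C ^ 3 / (s * real k)))"
    proof (rule order_trans[OF integral_norm_bound], rule integral_mono)
      show "integrable Q (\<lambda>z. norm (of_real (I z) * \<psi> z - of_real (I z) * p z))" using int_psi int_p by simp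
      show "integrable Q (\<lambda>z. I z * (C ^ 3 / (s * real k)))" using intI by simp
      fix z
      have "norm (of_real (I z) * \<psi> z - of_real (I z) * p z) = I z * norm (\<psi> z - p z)"
        using I01[of z] by (simp add: norm_mult flip: right_diff_distrib)
      also have "\<dots> \<le> I z * (C ^ 3 / (s * real k))" by (intro mult_left_mono psi_p I01)
      finally show "norm (of_real (I z) * \<psi> z - of_real (I z) * p z) \<le> I z * (C ^ 3 / (s * real k))" .
    qed
    then show ?thesis using int_psi int_p by simp
  qed
  also have "\<dots> = tail r * (C ^ 3 / (s * real k))"
    unfolding I_def by (simp only: integral_mult_left_zero integral_indicator_gt)
  finally have b1: "norm ((CLINT z|Q. of_real (I z) * \<psi> z) - (CLINT z|Q. of_real (I z) * p z)) \<le> tail r * (C ^ 3 / (s * real k))" .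
  \<comment> \<open>The factor \<open>sqrt k\<close> in \<open>m1\<close> is what raises the linear
    term, divided only by \<open>s = sqrt k\<close>, to the order \<open>1 / k\<close>.\<close>
  have b2: "norm (\<i> * of_real (m1' / s)) \<le> tail r * (\<epsilon> / real k)"
  proof -
    have "norm (\<i> * of_real (m1' / s)) = (s * \<bar>m1'\<bar>) / real k"
      using s(1) unfolding s(2)[symmetric] by (simp add: norm_mult norm_divide power2_eq_square)
    also have "\<dots> \<le> (\<epsilon> * tail r) / real k"
      using m1 by (intro divide_right_mono) (auto simp: s_def m1'_def I_def)
    finally show ?thesis by (simp add: mult.commute)
  qed
  have b3: "norm (of_real (v * tail r / (2 * real k)) - of_real (m2' / (2 * real k)) :: complex) \<le> tail r * (\<epsilon> / real k)"
  proof -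
    have "of_real (v * tail r / (2 * real k)) - of_real (m2' / (2 * real k)) = (of_real ((v * tail r - m2') / (2 * real k)) :: complex)"
      by (simp add: diff_divide_distrib)
    then have "norm (of_real (v * tail r / (2 * real k)) - of_real (m2' / (2 * real k)) :: complex) = \<bar>m2' - v * tail r\<bar> / (2 * real k)"
      by (simp only: norm_of_real) (simp add: abs_minus_commute)
    also have "\<dots> \<le> (\<epsilon> * tail r) / real k"
      using m2 k tail_nonneg[of r] e0 by (intro frac_le) (auto simp: m2'_def I_def)
    finally show ?thesis by (simp add: mult.commute)
  qed
  \<comment> \<open>Replaces \<open>1 - v / (2 k)\<close> by an exponential, whose
    \<open>k\<close>-th power is exactly \<open>exp (- v / 2)\<close>.\<close>
  have b4: "norm (of_real (tail r) - of_real (v * tail r / (2 * real k)) - of_real (tail r * exp (- v / (2 * real k))) :: complex) \<le> tail r * (v\<^sup>2 / real k / real k)"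
  proof -
    have "of_real (tail r) - of_real (v * tail r / (2 * real k)) - of_real (tail r * exp (- v / (2 * real k))) =
        (of_real (tail r * ((1 - v / (2 * real k)) - exp (- (v / (2 * real k))))) :: complex)"
      by (simp add: algebra_simps)
    then have "norm (of_real (tail r) - of_real (v * tail r / (2 * real k)) - of_real (tail r * exp (- v / (2 * real k))) :: complex)
        = tail r * \<bar>exp (- (v / (2 * real k))) - (1 - v / (2 * real k))\<bar>"
      using tail_nonneg[of r] by (simp only: norm_of_real abs_mult) (simp add: abs_minus_commute)
    also have "\<dots> \<le> tail r * (v / (2 * real k))\<^sup>2"
      using v by (intro mult_left_mono exp_minus_approx tail_nonneg) auto
    also have "(v / (2 * real k))\<^sup>2 \<le> v\<^sup>2 / real k / real k"
      using k by (simp add: power2_eq_square field_simps)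
    finally show ?thesis using tail_nonneg[of r] by (simp add: mult_left_mono)
  qed
  define \<alpha> where "\<alpha> = (CLINT z|Q. of_real (I z) * \<psi> z)"
  \<comment> \<open>The four differences are the Taylor remainder, the first moment, the error in
    the second moment and the passage to the exponential. Each is \<open>tail r / k\<close> times a
    small quantity.\<close>
  have "\<alpha> - of_real (tail r * exp (- v / (2 * real k))) = (\<alpha> - (CLINT z|Q. of_real (I z) * p z))
      + \<i> * of_real (m1' / s) + (of_real (v * tail r / (2 * real k)) - of_real (m2' / (2 * real k)))
      + (of_real (tail r) - of_real (v * tail r / (2 * real k)) - of_real (tail r * exp (- v / (2 * real k))))"
    unfolding Ep by simp
  also have "norm \<dots> \<le> tail r * (C ^ 3 / (s * real k)) + tail r * (\<epsilon> / real k) + tail r * (\<epsilon> / real k) + tail r * (v\<^sup>2 / real k / real k)"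
    by (intro norm_triangle_mono b1[folded \<alpha>_def] b2 b3 b4)
  also have "\<dots> = tail r * (\<delta> / real k)"
    using k s by (simp add: \<delta>_def s_def[symmetric] field_simps)
  finally show ?thesis by (simp add: \<alpha>_def I_def of_real_indicator)
qed

text \<open>At \<open>r1\<close> at least \<open>2 k\<close> exceedances are expected and at
  \<open>r2\<close> at most \<open>k / 2\<close>, so the \<open>k\<close>-th largest radius lies in
  the window up to geometrically small probability. Inside the window the conditional characteristic
  function of one larger observation is \<open>exp (- v / (2 k))\<close> up to
  \<open>o(1 / k)\<close>, which survives the power \<open>k - 1\<close>.\<close>

theorem top_sum_char_limit:
  fixes k :: "nat \<Rightarrow> nat" and r1 r2 :: "nat \<Rightarrow> real"
  assumes U[measurable]: "U \<in> borel_measurable Q" and C: "\<And>y. \<bar>U y\<bar> \<le> C" and v: "v \<ge> 0"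
    and k: "filterlim k at_top sequentially" "\<forall>\<^sub>F n in sequentially. k n \<le> n"
    and r1: "\<forall>\<^sub>F n in sequentially. 2 * real (k n) \<le> real n * tail (r1 n)"
    and r2: "\<forall>\<^sub>F n in sequentially. real n * tail (r2 n) \<le> real (k n) / 2"
    and m1: "\<And>\<epsilon>. \<epsilon> > 0 \<Longrightarrow> \<forall>\<^sub>F n in sequentially. \<forall>r. r1 n < r \<longrightarrow> r \<le> r2 n \<longrightarrow>
      sqrt (real (k n)) * \<bar>LINT z|Q. indicator {r<..} (\<rho> z) * U z\<bar> \<le> \<epsilon> * tail r"
    and m2: "\<And>\<epsilon>. \<epsilon> > 0 \<Longrightarrow> \<forall>\<^sub>F n in sequentially. \<forall>r. r1 n < r \<longrightarrow> r \<le> r2 n \<longrightarrow>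
      \<bar>(LINT z|Q. indicator {r<..} (\<rho> z) * (U z)\<^sup>2) - v * tail r\<bar> \<le> \<epsilon> * tail r"
  shows "(\<lambda>n. CLINT x|sample n. iexp ((\<Sum>l\<in>top_indices n (k n) (\<lambda>l. \<rho> (x l)). U (x l)) / sqrt (real (k n))))
    \<longlonglongrightarrow> exp (- v / 2)"
proof (rule tendstoI)
  fix e :: real assume e: "e > 0"
  have C0: "C \<ge> 0" using C[of undefined] by linarith
  \<comment> \<open>The total error is below \<open>3 + 2 + 2 = 7\<close> times
    \<open>epsilon\<close>: three from \<open>eta\<close> and two from each exceedance
    bound.\<close>
  define \<epsilon> where "\<epsilon> = e / 8"
  have eps: "\<epsilon> > 0" using e by (simp add: \<epsilon>_def)
  \<comment> \<open>First summand: the threshold observation is replaced by the factor 1. Middle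
    bracket: \<open>k - 1\<close> replacements, each costing a \<open>k\<close>-th of it. Last
    summand: the exponent \<open>k - 1\<close> is replaced by \<open>k\<close>.\<close>
  define \<eta> where "\<eta> n = C / sqrt (real (k n)) + (C ^ 3 / sqrt (real (k n)) + 2 * \<epsilon> + v\<^sup>2 / real (k n)) + v / real (k n)" for n
  have kr: "filterlim (\<lambda>n. real (k n)) at_top sequentially"
    by (rule filterlim_compose[OF filterlim_real_sequentially k(1)])
  have inv: "(\<lambda>n. c / real (k n)) \<longlonglongrightarrow> 0" for c :: real
    by (rule tendsto_divide_0[OF tendsto_const filterlim_at_top_imp_at_infinity[OF kr]])
  have inv_sqrt: "(\<lambda>n. c / sqrt (real (k n))) \<longlonglongrightarrow> 0" for c :: real
    by (rule tendsto_divide_0[OF tendsto_const filterlim_at_top_imp_at_infinity[OF filterlim_compose[OF sqrt_at_top kr]]])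
  have "\<eta> \<longlonglongrightarrow> 0 + (0 + 2 * \<epsilon> + 0) + 0"
    unfolding \<eta>_def by (intro tendsto_intros inv inv_sqrt)
  then have eta: "\<forall>\<^sub>F n in sequentially. \<eta> n < 3 * \<epsilon>"
    using eps by (intro order_tendstoD(2)) auto
  have geo: "(\<lambda>n. x ^ k n) \<longlonglongrightarrow> 0" if "0 \<le> x" "x < 1" for x :: real
    by (rule filterlim_compose[OF LIMSEQ_power_zero k(1)]) (use that in simp)
  have e2: "exp 1 > (2 :: real)" using exp_lower_Taylor_quadratic[of "1::real"] by simp
  \<comment> \<open>With \<open>2 k <= n * tail (r1 n)\<close> the lower exceedance bound is at most
    \<open>2^k * exp (- k)\<close>; with \<open>n * tail (r2 n) <= k / 2\<close> the upper one is at
    most \<open>exp (k / 2) / 2^k\<close>. Both ratios lie below 1.\<close>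
  have q1: "2 / exp 1 < (1 :: real)" using e2 by simp
  have q2: "exp (1 / 2) / 2 < (1 :: real)"
  proof -
    have "(exp (1 / 2))\<^sup>2 = (exp 1 :: real)" by (simp add: power2_eq_square flip: exp_add)
    also have "\<dots> < 2\<^sup>2" using exp_le by simp
    finally show ?thesis using power_less_imp_less_base[of "exp (1/2) :: real" 2 2] by simp
  qed
  have g1: "\<forall>\<^sub>F n in sequentially. (2 / exp 1) ^ k n < \<epsilon>"
    using geo[OF _ q1] eps by (intro order_tendstoD(2)) auto
  have g2: "\<forall>\<^sub>F n in sequentially. (exp (1 / 2) / 2) ^ k n < \<epsilon>"
    using geo[OF _ q2] eps by (intro order_tendstoD(2)) auto
  have k1: "\<forall>\<^sub>F n in sequentially. 1 \<le> k n" using k(1) by (simp add: filterlim_at_top)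
  show "\<forall>\<^sub>F n in sequentially. dist (CLINT x|sample n. iexp ((\<Sum>l\<in>top_indices n (k n) (\<lambda>l. \<rho> (x l)). U (x l)) / sqrt (real (k n))))
    (of_real (exp (- v / 2))) < e"
    using k1 k(2) r1 r2 m1[OF eps] m2[OF eps] eta g1 g2
  proof eventually_elim
    case (elim n)
    define K where "K = k n"
    have K: "1 \<le> K" "K \<le> n" using elim by (auto simp: K_def)
    define \<psi> where "\<psi> y = iexp (U y / sqrt (real K))" for y
    define \<delta> where "\<delta> = C ^ 3 / sqrt (real K) + 2 * \<epsilon> + v\<^sup>2 / real K"
    define w where "w = exp (- v / (2 * real K))"
    define E where "E = exp (- v / 2)"
    have w01: "0 \<le> w" "w \<le> 1" using v by (auto simp: w_def divide_nonneg_nonneg)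
    have E01: "0 \<le> E" "E \<le> 1" using v by (auto simp: E_def)
    have wK: "w ^ K = E" using K by (simp add: w_def E_def flip: exp_of_nat_mult)
    have d0: "\<delta> \<ge> 0" using C0 eps v by (auto simp: \<delta>_def)
    have [measurable]: "\<psi> \<in> borel_measurable Q" unfolding \<psi>_def by measurable
    have psi1: "norm (\<psi> y) = 1" for y by (simp add: \<psi>_def)
    have good: "norm (\<psi> y * (CLINT z|Q. indicator {\<rho> y<..} (\<rho> z) * \<psi> z) ^ (K - 1) - of_real E * of_real (tail (\<rho> y)) ^ (K - 1))
        \<le> \<eta> n * tail (\<rho> y) ^ (K - 1)" if y: "y \<in> space Q" "r1 n < \<rho> y" "\<rho> y \<le> r2 n" for y
    proof -
      define t where "t = tail (\<rho> y)"
      have t: "0 \<le> t" "t \<le> 1" by (auto simp: t_def tail_nonneg tail_le_1)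
      define \<alpha> where "\<alpha> = (CLINT z|Q. indicator {\<rho> y<..} (\<rho> z) * \<psi> z)"
      have exp_bd: "norm (\<alpha> - of_real (t * w)) \<le> t * (\<delta> / real K)"
        unfolding \<alpha>_def t_def w_def \<delta>_def \<psi>_def using elim y eps
        by (intro conditional_char_expansion U C K v) (auto simp: K_def)
      have alpha_le: "norm \<alpha> \<le> t"
      proof -
        have "norm \<alpha> \<le> (LINT z|Q. norm (indicator {\<rho> y<..} (\<rho> z) * \<psi> z))"
          unfolding \<alpha>_def by (rule integral_norm_bound)
        also have "\<dots> = t"
        proof -
          have "norm (indicator {\<rho> y<..} (\<rho> z) * \<psi> z) = indicat_real {\<rho> y<..} (\<rho> z)" for z
            using psi1[of z] by (simp add: norm_mult indicator_def)
          then show ?thesis by (simp add: integral_indicator_gt t_def)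
        qed
        finally show ?thesis .
      qed
      \<comment> \<open>The conditional characteristic function of an observation above
        \<open>rho y\<close>. If the tail vanishes there is nothing to condition on, and the value
        \<open>w\<close> makes both bounds below hold trivially.\<close>
      define \<alpha>' where "\<alpha>' = (if t = 0 then of_real w else \<alpha> / of_real t)"
      have alpha: "\<alpha> = of_real t * \<alpha>'" using alpha_le by (auto simp: \<alpha>'_def)
      have a1: "norm \<alpha>' \<le> 1" using alpha_le t w01 by (auto simp: \<alpha>'_def norm_divide)
      have a2: "norm (\<alpha>' - of_real w) \<le> \<delta> / real K"
      proof (cases "t = 0")
        case False
        have "t * norm (\<alpha>' - of_real w) = norm (\<alpha> - of_real (t * w))"
          using t by (simp add: alpha norm_mult flip: right_diff_distrib)
        then have "t * norm (\<alpha>' - of_real w) \<le> t * (\<delta> / real K)" using exp_bd by (simp only:)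
        then show ?thesis by (rule mult_left_le_imp_le) (use False t in simp)
      qed (use d0 in \<open>simp add: \<alpha>'_def\<close>)
      have c1: "norm (\<psi> y * \<alpha>' ^ (K - 1) - \<alpha>' ^ (K - 1)) \<le> C / sqrt (real K)"
      proof -
        have "norm (\<psi> y * \<alpha>' ^ (K - 1) - \<alpha>' ^ (K - 1)) = norm (\<psi> y - 1) * norm \<alpha>' ^ (K - 1)"
        proof -
          have "\<psi> y * \<alpha>' ^ (K - 1) - \<alpha>' ^ (K - 1) = (\<psi> y - 1) * \<alpha>' ^ (K - 1)"
            by (simp add: algebra_simps)
          then show ?thesis by (simp only: norm_mult norm_power)
        qed
        also have "\<dots> \<le> norm (\<psi> y - 1) * 1" using a1 by (intro mult_left_mono power_le_one) auto
        also have "norm (\<psi> y - 1) \<le> \<bar>U y / sqrt (real K)\<bar>"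
          using iexp_approx1[of "U y / sqrt (real K)" 0] by (simp add: \<psi>_def)
        also have "\<dots> \<le> C / sqrt (real K)" using C[of y] by (simp add: abs_divide divide_right_mono)
        finally show ?thesis by simp
      qed
      have c2: "norm (\<alpha>' ^ (K - 1) - of_real w ^ (K - 1)) \<le> \<delta>"
      proof -
        have "norm (\<alpha>' ^ (K - 1) - of_real w ^ (K - 1)) \<le> real (K - 1) * norm (\<alpha>' - of_real w)"
          using a1 w01 by (intro norm_power_diff) auto
        also have "\<dots> \<le> real K * (\<delta> / real K)" using a2 by (intro mult_mono) auto
        also have "\<dots> = \<delta>" using K by simp
        finally show ?thesis .
      qed
      have c3: "norm (of_real w ^ (K - 1) - of_real E :: complex) \<le> v / real K"
      proof -
        have "w ^ K = w ^ (K - 1) * w" using K by (metis Suc_diff_1 less_le_trans power_Suc2 zero_less_one)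
        then have "of_real w ^ (K - 1) - of_real E = (of_real (w ^ (K - 1) * (1 - w)) :: complex)"
          using wK by (simp add: algebra_simps)
        then have "norm (of_real w ^ (K - 1) - of_real E :: complex) = w ^ (K - 1) * (1 - w)"
          using w01 by (simp only: norm_of_real) simp
        also have "\<dots> \<le> 1 * (1 - w)" using w01 by (intro mult_right_mono power_le_one) auto
        also have "1 - w \<le> v / (2 * real K)" using exp_ge_add_one_self[of "- v / (2 * real K)"] by (simp add: w_def)
        also have "v / (2 * real K) \<le> v / real K" using v K by (intro divide_left_mono) auto
        finally show ?thesis by simp
      qed
      have "\<psi> y * \<alpha>' ^ (K - 1) - of_real E = (\<psi> y * \<alpha>' ^ (K - 1) - \<alpha>' ^ (K - 1))
          + (\<alpha>' ^ (K - 1) - of_real w ^ (K - 1)) + (of_real w ^ (K - 1) - of_real E)" by simp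
      also have "norm \<dots> \<le> C / sqrt (real K) + \<delta> + v / real K"
        by (intro norm_triangle_mono c1 c2 c3)
      also have "\<dots> = \<eta> n" by (simp add: \<eta>_def \<delta>_def K_def)
      finally have "norm (\<psi> y * \<alpha>' ^ (K - 1) - of_real E) * t ^ (K - 1) \<le> \<eta> n * t ^ (K - 1)"
        using t by (intro mult_right_mono) auto
      moreover have "\<psi> y * \<alpha> ^ (K - 1) - of_real E * of_real t ^ (K - 1) = (\<psi> y * \<alpha>' ^ (K - 1) - of_real E) * of_real t ^ (K - 1)"
        by (simp add: alpha power_mult_distrib algebra_simps)
      ultimately show ?thesis using t by (simp add: norm_mult norm_power \<alpha>_def t_def)
    qed
    have eta0: "\<eta> n \<ge> 0" using C0 eps v by (auto simp: \<eta>_def)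
    have "norm ((CLINT x|sample n. (\<Prod>l\<in>top_indices n K (\<lambda>l. \<rho> (x l)). \<psi> (x l))) - of_real E) \<le> \<eta> n
        + 2 * measure (sample n) {x \<in> space (sample n). exceedances n (r1 n) x < K}
        + 2 * measure (sample n) {x \<in> space (sample n). K \<le> exceedances n (r2 n) x}"
      using psi1 E01 eta0 good by (intro top_prod_bound K) auto
    also have "\<dots> \<le> \<eta> n + 2 * (2 / exp 1) ^ K + 2 * (exp (1 / 2) / 2) ^ K"
    proof -
      have "measure (sample n) {x \<in> space (sample n). exceedances n (r1 n) x < K} \<le> 2 ^ K * exp (- (real n * tail (r1 n)) / 2)"
        by (rule exceedances_lower)
      also have "\<dots> \<le> 2 ^ K * exp (- real K)" using elim by (intro mult_left_mono) (auto simp: K_def)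
      also have "\<dots> = (2 / exp 1) ^ K" by (simp add: power_divide exp_minus field_simps flip: exp_of_nat_mult)
      finally have "measure (sample n) {x \<in> space (sample n). exceedances n (r1 n) x < K} \<le> (2 / exp 1) ^ K" .
      moreover have "measure (sample n) {x \<in> space (sample n). K \<le> exceedances n (r2 n) x} \<le> exp (real n * tail (r2 n)) / 2 ^ K"
        by (rule exceedances_upper)
      then have "measure (sample n) {x \<in> space (sample n). K \<le> exceedances n (r2 n) x} \<le> exp (real K * (1 / 2)) / 2 ^ K"
        using elim by (elim order_trans) (auto simp: K_def intro!: divide_right_mono)
      then have "measure (sample n) {x \<in> space (sample n). K \<le> exceedances n (r2 n) x} \<le> (exp (1 / 2) / 2) ^ K"
        unfolding exp_of_nat_mult power_divide .
      ultimately show ?thesis by linarith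
    qed
    also have "\<dots> < e"
    proof -
      have "\<eta> n < 3 * \<epsilon>" "(2 / exp 1) ^ K < \<epsilon>" "(exp (1 / 2) / 2) ^ K < \<epsilon>"
        using elim unfolding K_def by blast+
      moreover have "8 * \<epsilon> = e" by (simp add: \<epsilon>_def)
      ultimately show ?thesis using eps by linarith
    qed
    finally have "norm ((CLINT x|sample n. (\<Prod>l\<in>top_indices n K (\<lambda>l. \<rho> (x l)). \<psi> (x l))) - of_real E) < e" .
    moreover have "(\<Prod>l\<in>top_indices n K (\<lambda>l. \<rho> (x l)). \<psi> (x l)) =
        iexp ((\<Sum>l\<in>top_indices n (k n) (\<lambda>l. \<rho> (x l)). U (x l)) / sqrt (real (k n)))" for x
      by (simp add: \<psi>_def K_def sum_divide_distrib sum_distrib_left exp_sum top_indices_def)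
    ultimately show ?case by (simp add: dist_norm E_def)
  qed
qed

end

section \<open>Max-linear coefficients and scalings\<close>

lemma path_weight_snoc:
  assumes "q \<noteq> []"
  shows "path_weight c (q @ [i]) = path_weight c q * c i (last q)"
proof -
  obtain n where n: "length q = Suc n" using assms by (cases q) auto
  have "(\<Prod>m<n. c ((q @ [i]) ! Suc m) ((q @ [i]) ! m)) = (\<Prod>m<n. c (q ! Suc m) (q ! m))"
    using n by (intro prod.cong) (auto simp: nth_append)
  moreover have "(q @ [i]) ! Suc n = i" "(q @ [i]) ! n = last q"
    using n assms by (auto simp: nth_append last_conv_nth)
  ultimately show ?thesis using assms n by (simp add: path_weight_def mult.assoc)
qed

lemma paths_snoc:
  assumes "q \<in> paths E j k" "(k, i) \<in> E" shows "q @ [i] \<in> paths E j i"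
  using assms by (auto simp: paths_def successively_append_iff)

text \<open>Paths grow at their end point, matching the recursion that expresses \<open>X i\<close>
  through the parents of \<open>i\<close>.\<close>

lemma paths_induct [consumes 1, case_names single snoc]:
  assumes "p \<in> paths E j i"
    and single: "P [j] j"
    and snoc: "\<And>q k i. q \<in> paths E j k \<Longrightarrow> (k, i) \<in> E \<Longrightarrow> P q k \<Longrightarrow> P (q @ [i]) i"
  shows "P p i"
  using assms(1)
proof (induction p arbitrary: i rule: rev_induct)
  case (snoc x xs)
  show ?case
  proof (cases "xs = []")
    case True
    then show ?thesis using snoc.prems single by (auto simp: paths_def)
  next
    case False
    then have "xs \<in> paths E j (last xs)" "(last xs, i) \<in> E" "x = i"
      using snoc.prems by (auto simp: paths_def successively_append_iff)
    then show ?thesis using snoc.IH assms(3) by simp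
  qed
qed (simp add: paths_def)

lemma paths_imp_an:
  assumes "p \<in> paths E j i" shows "i = j \<or> j \<in> an E i"
  using assms by (induction rule: paths_induct) (auto simp: an_def intro: trancl_into_trancl)

lemma Max_scale:
  fixes f :: "'i \<Rightarrow> real"
  assumes "finite I" "I \<noteq> {}" "r \<ge> 0"
  shows "(MAX i\<in>I. r * f i) = r * (MAX i\<in>I. f i)"
  using mono_Max_commute[of "\<lambda>x. r * x" "f ` I"] assms
  by (simp add: image_image monoI mult_left_mono)

lemma Max_power2:
  fixes f :: "'i \<Rightarrow> real"
  assumes "finite I" "I \<noteq> {}" "\<And>i. i \<in> I \<Longrightarrow> f i \<ge> 0"
  shows "(MAX i\<in>I. (f i)\<^sup>2) = (MAX i\<in>I. f i)\<^sup>2"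
proof (rule antisym)
  show "(MAX i\<in>I. (f i)\<^sup>2) \<le> (MAX i\<in>I. f i)\<^sup>2"
    using assms by (auto intro!: Max.boundedI power_mono)
  have "Max (f ` I) \<in> f ` I" using assms by (intro Max_in) auto
  then obtain i where "i \<in> I" "Max (f ` I) = f i" by blast
  then show "(MAX i\<in>I. f i)\<^sup>2 \<le> (MAX i\<in>I. (f i)\<^sup>2)"
    using assms by (auto intro!: Max_ge)
qed

section \<open>Solution of the recursion by maximal path weights\<close>

locale ml_dag =
  fixes d :: nat and E :: "(nat \<times> nat) set" and c :: "nat \<Rightarrow> nat \<Rightarrow> real"
  assumes well_ordered: "well_ordered_dag d E" and weights: "edge_weights d E c"
begin

abbreviation "a \<equiv> ml_coeff E c"

lemma edge: "(k, i) \<in> E \<Longrightarrow> k \<in> {1..d} \<and> i \<in> {1..d} \<and> i < k"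
  using well_ordered by (auto simp: well_ordered_dag_def dag_def pa_def)

lemma trancl_edge: "(k, i) \<in> E\<^sup>+ \<Longrightarrow> k \<in> {1..d} \<and> i \<in> {1..d} \<and> i < k"
  by (induction rule: trancl_induct) (auto dest: edge)

lemma weight_pos: "i \<in> {1..d} \<Longrightarrow> c i i > 0" "(k, i) \<in> E \<Longrightarrow> c i k > 0"
  using weights edge[of k i] by (auto simp: edge_weights_def pa_def)

lemma path_weight_pos:
  assumes "p \<in> paths E j i" "j \<in> {1..d}" shows "path_weight c p > 0"
  using assms
proof (induction rule: paths_induct)
  case single
  then show ?case by (simp add: path_weight_def weight_pos)
next
  case (snoc q k i)
  then have "q \<noteq> []" "last q = k" by (auto simp: paths_def)
  then show ?case using snoc weight_pos(2) by (simp add: path_weight_snoc)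
qed

text \<open>Edges strictly decrease the label, so no closed path has an edge. The path description
  of the coefficients thereby extends to the diagonal.\<close>

lemma paths_refl: "paths E i i = {[i]}"
proof
  show "paths E i i \<subseteq> {[i]}"
  proof
    fix p assume "p \<in> paths E i i"
    moreover have "p = [i] \<and> j = i \<or> (i, j) \<in> E\<^sup>+" if "p \<in> paths E i j" for j
      using that by (induction rule: paths_induct) (auto intro: trancl_into_trancl)
    ultimately show "p \<in> {[i]}" using trancl_edge by blast
  qed
qed (simp add: paths_def)

lemma dag: "dag d E" using well_ordered by (simp add: well_ordered_dag_def)

lemma path_weight_le:
  assumes "p \<in> paths E j i" shows "path_weight c p \<le> a i j"
proof (cases "i = j")
  case True
  then show ?thesis using assms paths_refl by (simp add: ml_coeff_def path_weight_def)
next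
  case False
  then show ?thesis using assms paths_imp_an[OF assms] finite_paths[OF dag, of j i]
    by (auto simp: ml_coeff_def intro!: Max_ge)
qed

lemma ml_coeff_attained:
  assumes "i = j \<or> j \<in> an E i" shows "\<exists>p\<in>paths E j i. path_weight c p = a i j"
proof (cases "i = j")
  case True
  then show ?thesis using paths_refl by (simp add: ml_coeff_def path_weight_def)
next
  case False
  then have "j \<in> an E i" using assms by auto
  then have "Max (path_weight c ` paths E j i) \<in> path_weight c ` paths E j i"
    using False finite_paths[OF dag, of j i] paths_nonempty by (intro Max_in) (auto simp: an_def)
  then show ?thesis using False \<open>j \<in> an E i\<close> by (auto simp: ml_coeff_def)
qed

lemma ml_coeff_diag: "a i i = c i i"
  by (simp add: ml_coeff_def)

lemma ml_coeff_nonneg: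
  assumes "j \<in> {1..d}" shows "a i j \<ge> 0"
proof (cases "i = j \<or> j \<in> an E i")
  case True
  then obtain p where "p \<in> paths E j i" "path_weight c p = a i j" using ml_coeff_attained by blast
  then show ?thesis using path_weight_pos[OF _ assms] less_imp_le by metis
qed (simp add: ml_coeff_def)

text \<open>Well-ordering gives every ancestor a larger label, so the coefficient matrix is upper
  triangular.\<close>

lemma ml_coeff_lower: "j < i \<Longrightarrow> a i j = 0"
  using trancl_edge by (fastforce simp: ml_coeff_def an_def)

lemma ml_coeff_parent:
  assumes "(k, i) \<in> E" "l \<in> {1..d}" shows "c i k * a k l \<le> a i l"
proof (cases "k = l \<or> l \<in> an E k")
  case True
  then obtain p where p: "p \<in> paths E l k" "path_weight c p = a k l" using ml_coeff_attained by blast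
  then have "path_weight c (p @ [i]) = c i k * a k l"
    by (auto simp: path_weight_snoc paths_def)
  then show ?thesis using path_weight_le[OF paths_snoc[OF p(1) assms(1)]] by simp
next
  case False
  then show ?thesis using ml_coeff_nonneg[OF assms(2)] by (simp add: ml_coeff_def)
qed

text \<open>Prepending a path from \<open>l\<close> to \<open>j\<close> to \<open>p\<close> makes
  the initial weight \<open>c j j\<close> of \<open>p\<close> disappear from the product; it
  reappears as the factor on the right.\<close>

lemma ml_coeff_path:
  assumes "p \<in> paths E j i" "l \<in> {1..d}" "j \<in> {1..d}"
  shows "path_weight c p * a j l \<le> c j j * a i l"
  using assms(1)
proof (induction rule: paths_induct)
  case single
  then show ?case by (simp add: path_weight_def)
next
  case (snoc q k i)
  have "path_weight c (q @ [i]) * a j l = c i k * (path_weight c q * a j l)"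
    using snoc(1) by (auto simp: path_weight_snoc paths_def)
  also have "\<dots> \<le> c i k * (c j j * a k l)"
    using snoc.IH weight_pos(2)[OF snoc(2)] by (intro mult_left_mono) auto
  also have "\<dots> = c j j * (c i k * a k l)" by simp
  also have "\<dots> \<le> c j j * a i l"
    using ml_coeff_parent[OF snoc(2) assms(2)] weight_pos(1)[OF assms(3)] by (intro mult_left_mono) auto
  finally show ?case .
qed

text \<open>Every path from \<open>l\<close> to \<open>j\<close> extends to \<open>i\<close>, so row \<open>i\<close> dominates \<open>a\<^sub>i\<^sub>j / a\<^sub>j\<^sub>j\<close> times row \<open>j\<close>;
  since both rows have norm 1, the factor is at most 1.\<close>

lemma ml_coeff_le_diag:
  assumes std: "standardized d a" and ij: "i \<in> {1..d}" "j \<in> {1..d}"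
  shows "a i j \<le> a j j"
proof (cases "i = j \<or> j \<in> an E i")
  case True
  then obtain p where p: "p \<in> paths E j i" "path_weight c p = a i j" using ml_coeff_attained by blast
  have "a i j * enorm d (a j) = enorm d (\<lambda>l. a i j * a j l)"
    using ml_coeff_nonneg[OF ij(2), of i] by (intro L2_set_right_distrib)
  also have "\<dots> \<le> enorm d (\<lambda>l. c j j * a i l)"
    using ml_coeff_path[OF p(1) _ ij(2)] ml_coeff_nonneg p(2) ij
    by (intro L2_set_mono) (auto intro!: mult_nonneg_nonneg)
  also have "\<dots> = c j j * enorm d (a i)"
    using weight_pos(1)[OF ij(2)] by (intro L2_set_right_distrib[symmetric]) simp
  finally show ?thesis using std ij by (simp add: standardized_def ml_coeff_diag)
next
  case False
  then show ?thesis using ml_coeff_nonneg[OF ij(2), of j] by (simp add: ml_coeff_def)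
qed

text \<open>Unrolling the recursion along any path gives a lower bound for \<open>X i\<close>;
  following at each node a parent that attains the maximum gives a path on which equality
  holds.\<close>

lemma recursive_ml_solution:
  assumes X: "\<And>i. i \<in> {1..d} \<Longrightarrow> X i = Max (insert (c i i * z i) ((\<lambda>k. c i k * X k) ` pa E i))"
    and z: "\<And>j. j \<in> {1..d} \<Longrightarrow> z j \<ge> 0"
    and i: "i \<in> {1..d}"
  shows "X i = (MAX j\<in>{1..d}. a i j * z j)"
proof -
  have fin: "finite (pa E i)" for i
    by (rule finite_subset[of _ "{1..d}"]) (auto simp: pa_def dest: edge)
  have self: "c i i * z i \<le> X i" if "i \<in> {1..d}" for i
    unfolding X[OF that] using fin[of i] by (intro Max_ge) auto
  have step: "c i k * X k \<le> X i" if "(k, i) \<in> E" for i k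
    unfolding X[OF conjunct1[OF conjunct2[OF edge[OF that]]]]
    using fin[of i] that by (intro Max_ge) (auto simp: pa_def)
  have ge: "path_weight c p * z j \<le> X i" if "p \<in> paths E j i" "j \<in> {1..d}" for p i j
    using that(1)
  proof (induction rule: paths_induct)
    case single
    then show ?case using self[OF that(2)] by (simp add: path_weight_def)
  next
    case (snoc q k i)
    have "path_weight c (q @ [i]) * z j = c i k * (path_weight c q * z j)"
      using snoc(1) by (auto simp: path_weight_snoc paths_def)
    also have "\<dots> \<le> c i k * X k"
      using snoc.IH weight_pos(2)[OF snoc(2)] by (intro mult_left_mono) auto
    also have "\<dots> \<le> X i" by (rule step[OF snoc(2)])
    finally show ?case .
  qed
  have attained: "\<exists>j\<in>{1..d}. \<exists>p\<in>paths E j i. X i = path_weight c p * z j" if "i \<in> {1..d}" for i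
    using that
  \<comment> \<open>Parents have larger labels, so \<open>d - i\<close> decreases along the backward
    search.\<close>
  proof (induction "d - i" arbitrary: i rule: less_induct)
    case less
    have "X i \<in> insert (c i i * z i) ((\<lambda>k. c i k * X k) ` pa E i)"
      unfolding X[OF less.prems] using fin[of i] by (intro Max_in) auto
    then consider "X i = c i i * z i" | k where "(k, i) \<in> E" "X i = c i k * X k"
      by (auto simp: pa_def)
    then show ?case
    proof cases
      case 1
      then show ?thesis using less.prems by (intro bexI[of _ i] bexI[of _ "[i]"]) (auto simp: path_weight_def paths_def)
    next
      case 2
      then have "d - k < d - i" "k \<in> {1..d}" using edge[OF 2(1)] by auto
      then obtain j p where jp: "j \<in> {1..d}" "p \<in> paths E j k" "X k = path_weight c p * z j"
        using less.hyps by blast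
      then have "X i = path_weight c (p @ [i]) * z j"
        using 2(2) by (auto simp: path_weight_snoc paths_def)
      then show ?thesis using jp paths_snoc[OF jp(2) 2(1)] by blast
    qed
  qed
  \<comment> \<open>Settles the indices \<open>j\<close> that are no ancestors of \<open>i\<close>,
    whose zero coefficient contributes 0 to the maximum.\<close>
  have nonneg: "X i \<ge> 0"
    using self[OF i] weight_pos(1)[OF i] z[OF i] by (meson less_imp_le mult_nonneg_nonneg order_trans)
  show ?thesis
  proof (rule antisym)
    obtain j p where jp: "j \<in> {1..d}" "p \<in> paths E j i" "X i = path_weight c p * z j"
      using attained[OF i] by blast
    have "X i \<le> a i j * z j"
      unfolding jp(3) using path_weight_le[OF jp(2)] z[OF jp(1)] by (rule mult_right_mono)
    also have "\<dots> \<le> (MAX j\<in>{1..d}. a i j * z j)" using jp(1) by (intro Max_ge) auto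
    finally show "X i \<le> (MAX j\<in>{1..d}. a i j * z j)" .
    have "a i j * z j \<le> X i" if j: "j \<in> {1..d}" for j
    proof (cases "i = j \<or> j \<in> an E i")
      case True
      then show ?thesis using ml_coeff_attained ge[OF _ j] by metis
    next
      case False
      then show ?thesis using nonneg by (simp add: ml_coeff_def)
    qed
    then show "(MAX j\<in>{1..d}. a i j * z j) \<le> X i" using i by (intro Max.boundedI) auto
  qed
qed

end

section \<open>The identity between \<open>A2_vec\<close> and \<open>T_mat\<close>, and
  \<open>W_mat\<close> as a covariance\<close>

definition col_sq :: "nat \<Rightarrow> (nat \<Rightarrow> nat \<Rightarrow> real) \<Rightarrow> nat \<Rightarrow> real" where
  "col_sq d a j = (\<Sum>i=1..d. (a i j)\<^sup>2)"

lemma enorm_col: "(enorm d (\<lambda>m. a m j))\<^sup>2 = col_sq d a j"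
  by (simp add: col_sq_def L2_set_def sum_nonneg)

definition max_scaling :: "nat \<Rightarrow> (nat \<Rightarrow> nat \<Rightarrow> real) \<Rightarrow> nat set \<Rightarrow> real" where
  "max_scaling d a h = (\<Sum>j=1..d. MAX i\<in>h. (a i j)\<^sup>2)"

lemma lpos_cases:
  assumes "u \<in> {1..dimN d}"
  obtains i j where "1 \<le> i" "i \<le> j" "j \<le> d" "u = lpos d i j"
proof -
  have "u \<in> (\<lambda>(i, j). lpos d i j) ` upper_pairs d"
    using assms bij_betw_imp_surj_on[OF lpos_bij] by simp
  then show ?thesis by (auto simp: upper_pairs_def intro: that)
qed

lemma comp_set_subset:
  assumes "u \<in> {1..dimN d}" shows "comp_set d u \<subseteq> {1..d}" "comp_set d u \<noteq> {}" "finite (comp_set d u)"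
proof -
  obtain i j where "1 \<le> i" "i \<le> j" "j \<le> d" "u = lpos d i j"
    using lpos_cases[OF assms] .
  then show "comp_set d u \<subseteq> {1..d}" "comp_set d u \<noteq> {}" "finite (comp_set d u)"
    by (auto simp: comp_set_def lpair_lpos)
qed

lemma lpos_eq_iff:
  assumes "1 \<le> i" "i \<le> j" "j \<le> d" "1 \<le> k" "k \<le> l" "l \<le> d"
  shows "lpos d i j = lpos d k l \<longleftrightarrow> i = k \<and> j = l"
  using lpair_lpos[OF assms(1-3)] lpair_lpos[OF assms(4-6)] by (metis prod.inject)

text \<open>One formula for all rows: on the diagonal \<open>i = j\<close> the second and fourth
  terms vanish, and in the last column \<open>j = d\<close> the third does. The nested cases of
  \<open>T_mat\<close> become four signed indicators that can be summed separately.\<close>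

lemma T_mat_lpos:
  assumes ij: "1 \<le> i" "i \<le> j" "j \<le> d" and kl: "1 \<le> k" "k \<le> l" "l \<le> d"
  shows "T_mat d (lpos d i j) (lpos d k l) =
    of_bool (k = i \<and> l = j) + of_bool (i < j \<and> k = j \<and> l = j)
    - of_bool (j < d \<and> k = j + 1 \<and> l = j + 1) - of_bool (i < j \<and> k = i \<and> l = j - 1)"
proof -
  note * = lpos_eq_iff[OF ij] lpos_eq_iff[OF kl]
  have c1: "(\<exists>i'. 1 \<le> i' \<and> i' \<le> d \<and> lpos d i j = lpos d i' i' \<and> lpos d k l = lpos d i' i')
      \<longleftrightarrow> i = j \<and> k = i \<and> l = i" (is "?c1 = _")
    using ij by (auto simp: *)
  have c2: "(\<exists>i'. 1 \<le> i' \<and> i' < d \<and> lpos d i j = lpos d i' i' \<and> lpos d k l = lpos d (i' + 1) (i' + 1))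
      \<longleftrightarrow> i = j \<and> j < d \<and> k = i + 1 \<and> l = i + 1"
    using ij by (auto simp: *)
  have c3: "(\<exists>i' j'. 1 \<le> i' \<and> i' < j' \<and> j' < d \<and> lpos d i j = lpos d i' j' \<and>
        (lpos d k l = lpos d i' j' \<or> lpos d k l = lpos d j' j'))
      \<longleftrightarrow> i < j \<and> j < d \<and> (k = i \<and> l = j \<or> k = j \<and> l = j)"
    using ij by (auto simp: *)
  have c4: "(\<exists>i' j'. 1 \<le> i' \<and> i' < j' \<and> j' < d \<and> lpos d i j = lpos d i' j' \<and>
        (lpos d k l = lpos d (j' + 1) (j' + 1) \<or> lpos d k l = lpos d i' (j' - 1)))
      \<longleftrightarrow> i < j \<and> j < d \<and> (k = j + 1 \<and> l = j + 1 \<or> k = i \<and> l = j - 1)"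
    using ij by (auto simp: *)
  have c5: "(\<exists>i'. 1 \<le> i' \<and> i' < d \<and> lpos d i j = lpos d i' d \<and>
        (lpos d k l = lpos d i' d \<or> lpos d k l = lpos d d d))
      \<longleftrightarrow> i < j \<and> j = d \<and> (k = i \<and> l = d \<or> k = d \<and> l = d)"
    using ij by (auto simp: *)
  have c6: "(\<exists>i'. 1 \<le> i' \<and> i' < d \<and> lpos d i j = lpos d i' d \<and> lpos d k l = lpos d i' (d - 1))
      \<longleftrightarrow> i < j \<and> j = d \<and> k = i \<and> l = d - 1"
    using ij by (auto simp: *)
  consider "i = j" "j = d" | "i = j" "j < d" | "i < j" "j < d" | "i < j" "j = d" using ij by linarith
  then show ?thesis
    unfolding T_mat_def c1 c2 c3 c4 c5 c6 using kl
    by cases (cases "k = i"; cases "k = j"; cases "k = j + 1"; cases "l = j"; simp)+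
qed

text \<open>A row of the matrix is a second difference: the increment of \<open>S\<close> when
  \<open>i\<close> joins \<open>{j+1..d}\<close>, minus the increment when \<open>i\<close> joins
  \<open>{j..d}\<close>. For \<open>i = j\<close> the second increment is zero, and for
  \<open>j = d\<close> the set \<open>{j+1..d}\<close> is empty; the conditionals drop these
  terms.\<close>

lemma T_mat_sum:
  assumes ij: "1 \<le> i" "i \<le> j" "j \<le> d"
  shows "(\<Sum>v=1..dimN d. T_mat d (lpos d i j) v * S (comp_set d v)) =
    S ({i} \<union> {j+1..d}) + (if i < j then S {j..d} else 0)
    - (if j < d then S {j+1..d} else 0) - (if i < j then S ({i} \<union> {j..d}) else 0)"
proof -
  have fin: "finite (upper_pairs d)"
    by (rule finite_subset[of _ "{..d} \<times> {..d}"]) (auto simp: upper_pairs_def)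
  define s where "s kl = S ({fst kl} \<union> {snd kl + 1..d})" for kl :: "nat \<times> nat"
  have delta: "(\<Sum>kl\<in>upper_pairs d. of_bool (P \<and> fst kl = k \<and> snd kl = l) * s kl) = (if P then s (k, l) else 0)"
    if "P \<Longrightarrow> (k, l) \<in> upper_pairs d" for P k l
  proof (cases P)
    case True
    have "(\<Sum>kl\<in>upper_pairs d. of_bool (P \<and> fst kl = k \<and> snd kl = l) * s kl) =
        (\<Sum>kl\<in>upper_pairs d. if kl = (k, l) then s kl else 0)"
      using True by (intro sum.cong) (auto simp: prod_eq_iff)
    then show ?thesis using True that fin by simp
  qed simp
  have "(\<Sum>v=1..dimN d. T_mat d (lpos d i j) v * S (comp_set d v)) =
      (\<Sum>kl\<in>upper_pairs d. T_mat d (lpos d i j) (lpos d (fst kl) (snd kl)) * S (comp_set d (lpos d (fst kl) (snd kl))))"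
    by (subst sum.reindex_bij_betw[OF lpos_bij, symmetric]) (simp add: case_prod_beta)
  also have "\<dots> = (\<Sum>kl\<in>upper_pairs d. of_bool (True \<and> fst kl = i \<and> snd kl = j) * s kl
      + of_bool (i < j \<and> fst kl = j \<and> snd kl = j) * s kl
      - of_bool (j < d \<and> fst kl = j + 1 \<and> snd kl = j + 1) * s kl
      - of_bool (i < j \<and> fst kl = i \<and> snd kl = j - 1) * s kl)"
  proof (rule sum.cong[OF refl])
    fix kl assume "kl \<in> upper_pairs d"
    then have kl: "1 \<le> fst kl" "fst kl \<le> snd kl" "snd kl \<le> d" by (auto simp: upper_pairs_def)
    have "comp_set d (lpos d (fst kl) (snd kl)) = {fst kl} \<union> {snd kl + 1..d}"
      by (simp add: comp_set_def lpair_lpos[OF kl] case_prod_beta)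
    then show "T_mat d (lpos d i j) (lpos d (fst kl) (snd kl)) * S (comp_set d (lpos d (fst kl) (snd kl))) =
      of_bool (True \<and> fst kl = i \<and> snd kl = j) * s kl
      + of_bool (i < j \<and> fst kl = j \<and> snd kl = j) * s kl
      - of_bool (j < d \<and> fst kl = j + 1 \<and> snd kl = j + 1) * s kl
      - of_bool (i < j \<and> fst kl = i \<and> snd kl = j - 1) * s kl"
      unfolding T_mat_lpos[OF ij kl] s_def by (simp add: algebra_simps)
  qed
  also have "\<dots> = s (i, j) + (if i < j then s (j, j) else 0)
    - (if j < d then s (j+1, j+1) else 0) - (if i < j then s (i, j-1) else 0)"
    unfolding sum_subtractf sum.distrib using ij
    by (subst (1 2 3 4) delta) (auto simp: upper_pairs_def)
  also have "\<dots> = S ({i} \<union> {j+1..d}) + (if i < j then S {j..d} else 0)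
    - (if j < d then S {j+1..d} else 0) - (if i < j then S ({i} \<union> {j..d}) else 0)"
  proof -
    have "{j} \<union> {j+1..d} = {j..d}" "j < d \<Longrightarrow> {j+1} \<union> {j+1+1..d} = {j+1..d}" "i < j \<Longrightarrow> {j - 1 + 1..d} = {j..d}"
      using ij by auto
    then show ?thesis by (simp add: s_def)
  qed
  finally show ?thesis .
qed

text \<open>By triangularity and \<open>ml_coeff_le_diag\<close>, the maximum of column
  \<open>l\<close> over the rows \<open>{k..d}\<close> is the squared diagonal entry if
  \<open>k <= l\<close> and 0 otherwise. Joining row \<open>i\<close> to \<open>{k..d}\<close> hence
  adds its squared entries in the columns \<open>l < k\<close> only. Taking \<open>k = j + 1\<close>
  and \<open>k = j\<close>, the second difference leaves column \<open>j\<close> alone; for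
  \<open>i = j\<close> the first increment suffices, as row \<open>i\<close> vanishes left of the
  diagonal.\<close>

lemma (in ml_dag) A2_vec_eq:
  assumes std: "standardized d a" and u: "u \<in> {1..dimN d}"
  shows "A2_vec d a u = (\<Sum>v=1..dimN d. T_mat d u v * max_scaling d a (comp_set d v))"
proof -
  obtain i j where ij: "1 \<le> i" "i \<le> j" "j \<le> d" "u = lpos d i j"
    using lpos_cases[OF u] .
  define mx where "mx k l = (if k \<le> l \<and> l \<le> d then (a l l)\<^sup>2 else 0)" for k l
  have sq: "(a k l)\<^sup>2 \<le> (a l l)\<^sup>2" if "k \<in> {1..d}" "l \<in> {1..d}" for k l
    by (rule power_mono[OF ml_coeff_le_diag[OF std that] ml_coeff_nonneg[OF that(2)]])
  have mx: "(MAX m\<in>{k..d}. (a m l)\<^sup>2) = mx k l" if k: "1 \<le> k" "k \<le> d" and l: "l \<in> {1..d}" for k l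
  proof (cases "k \<le> l")
    case True
    have "(MAX m\<in>{k..d}. (a m l)\<^sup>2) = (a l l)\<^sup>2"
      using True k l sq by (intro Max_eqI) auto
    then show ?thesis using True l by (simp add: mx_def)
  next
    case False
    have "(MAX m\<in>{k..d}. (a m l)\<^sup>2) = (MAX m\<in>{k..d}. 0)"
      using False ml_coeff_lower by (intro arg_cong[of _ _ Max] image_cong) auto
    then show ?thesis using False k by (simp add: mx_def)
  qed
  have mx': "(MAX m\<in>{i} \<union> {k..d}. (a m l)\<^sup>2) = max ((a i l)\<^sup>2) (mx k l)"
    if k: "1 \<le> k" and l: "l \<in> {1..d}" for k l
  proof (cases "k \<le> d")
    case True
    then show ?thesis using mx[OF k True l] by simp
  next
    case False
    then show ?thesis by (simp add: mx_def max_absorb1)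
  qed
  let ?S = "max_scaling d a"
  have mxj: "(if j < d then ?S {j+1..d} else 0) = (\<Sum>l=1..d. mx (j+1) l)"
    using mx[of "j + 1"] ij by (auto simp: max_scaling_def mx_def intro!: sum.cong)
  have "(\<Sum>v=1..dimN d. T_mat d u v * ?S (comp_set d v)) =
    ?S ({i} \<union> {j+1..d}) + (if i < j then ?S {j..d} else 0)
    - (if j < d then ?S {j+1..d} else 0) - (if i < j then ?S ({i} \<union> {j..d}) else 0)"
    unfolding ij(4) by (rule T_mat_sum[OF ij(1-3)])
  also have "\<dots> = (\<Sum>l=1..d. max ((a i l)\<^sup>2) (mx (j+1) l) + (if i < j then mx j l else 0)
    - mx (j+1) l - (if i < j then max ((a i l)\<^sup>2) (mx j l) else 0))"
    unfolding mxj using mx'[of "j + 1"] mx'[of j] mx[of j] ij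
    by (auto simp: max_scaling_def sum.distrib sum_subtractf)
  also have "\<dots> = (\<Sum>l=1..d. if l = j then (a i j)\<^sup>2 else 0)"
  proof (rule sum.cong[OF refl])
    fix l assume l: "l \<in> {1..d}"
    have "(a i l)\<^sup>2 \<le> (a l l)\<^sup>2" using sq ij l by auto
    moreover have "a i l = 0" if "l < i" using that by (rule ml_coeff_lower)
    ultimately show "max ((a i l)\<^sup>2) (mx (j+1) l) + (if i < j then mx j l else 0)
      - mx (j+1) l - (if i < j then max ((a i l)\<^sup>2) (mx j l) else 0) = (if l = j then (a i j)\<^sup>2 else 0)"
      using ij l by (cases l j rule: linorder_cases; cases "l < i") (auto simp: mx_def max_def)
  qed
  also have "\<dots> = (a i j)\<^sup>2" using ij by simp
  finally show ?thesis using u lpair_lpos[OF ij(1-3)] by (simp add: A2_vec_def ij(4))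
qed

lemma sum_col_sq:
  assumes "standardized d a" shows "(\<Sum>j=1..d. col_sq d a j) = real d"
proof -
  have "(\<Sum>j=1..d. (a i j)\<^sup>2) = 1" if "i \<in> {1..d}" for i
    using assms that by (auto simp: standardized_def L2_set_def sum_nonneg)
  then show ?thesis unfolding col_sq_def by (subst sum.swap) simp
qed

definition col_angle :: "nat \<Rightarrow> (nat \<Rightarrow> nat \<Rightarrow> real) \<Rightarrow> nat \<Rightarrow> nat \<Rightarrow> real" where
  "col_angle d a j = angle d (\<lambda>m. a m j)"

lemma f_max_col_angle:
  assumes h: "h \<subseteq> {1..d}" "h \<noteq> {}"
  shows "f_max d h (col_angle d a j) = real d / col_sq d a j * (MAX m\<in>h. (a m j)\<^sup>2)"
proof -
  have fin: "finite h" using h finite_subset by blast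
  have "(MAX m\<in>h. (col_angle d a j m)\<^sup>2) = (MAX m\<in>h. (1 / col_sq d a j) * (a m j)\<^sup>2)"
    using h unfolding enorm_col[symmetric]
    by (intro arg_cong[of _ _ Max] image_cong) (auto simp: col_angle_def angle_def power_divide)
  also have "\<dots> = 1 / col_sq d a j * (MAX m\<in>h. (a m j)\<^sup>2)"
    using fin h by (intro Max_scale) (auto simp: col_sq_def sum_nonneg)
  finally show ?thesis by (simp add: f_max_def)
qed

text \<open>The weights \<open>col_sq d a j / d\<close> sum to 1 because all rows have norm 1, and
  under them \<open>f_max\<close> has mean \<open>max_scaling\<close>. Written as a covariance, the
  matrix is visibly of the form \<open>B\<close> times its transpose.\<close>

lemma W_entry_covariance:
  assumes std: "standardized d a" and d: "d \<ge> 1" and pos: "\<And>j. j \<in> {1..d} \<Longrightarrow> col_sq d a j > 0"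
    and h: "h \<subseteq> {1..d}" "h \<noteq> {}" and h': "h' \<subseteq> {1..d}" "h' \<noteq> {}"
  shows "W_entry d a h h' = (\<Sum>j=1..d. col_sq d a j / real d *
      (f_max d h (col_angle d a j) - max_scaling d a h) * (f_max d h' (col_angle d a j) - max_scaling d a h'))"
proof -
  define g where "g h j = (MAX m\<in>h. (a m j)\<^sup>2)" for h j
  define q where "q j = col_sq d a j" for j
  have sum_g: "(\<Sum>j=1..d. g h j) = max_scaling d a h" for h
    by (simp add: g_def max_scaling_def)
  have sum_q: "(\<Sum>j=1..d. q j) = real d" using sum_col_sq[OF std] by (simp add: q_def)
  have "W_entry d a h h' = real d * (\<Sum>j=1..d. g h j * g h' j / q j) - max_scaling d a h * max_scaling d a h'"
  proof (cases "h = h'")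
    case True
    have fin: "finite h" using h finite_subset by blast
    \<comment> \<open>The maximum of fourth powers is the square of the maximum of squares, so the
      diagonal case has the same form as the off-diagonal one.\<close>
    have "(MAX i\<in>h. (a i j) ^ 4 / q j) = g h j * g h j / q j" if j: "j \<in> {1..d}" for j
    proof -
      have "(MAX i\<in>h. (a i j) ^ 4 / q j) = (MAX i\<in>h. 1 / q j * ((a i j)\<^sup>2)\<^sup>2)"
        by (simp flip: power_mult)
      also have "\<dots> = 1 / q j * (MAX i\<in>h. ((a i j)\<^sup>2)\<^sup>2)"
        using pos[OF j] by (intro Max_scale fin h) (simp add: q_def)
      also have "(MAX i\<in>h. ((a i j)\<^sup>2)\<^sup>2) = (MAX i\<in>h. (a i j)\<^sup>2)\<^sup>2"
        by (rule Max_power2[OF fin h(2)]) simp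
      finally show ?thesis by (simp add: g_def power2_eq_square)
    qed
    then have "(\<Sum>j=1..d. MAX i\<in>h. (a i j) ^ 4 / q j) = (\<Sum>j=1..d. g h j * g h j / q j)"
      by (intro sum.cong refl)
    then show ?thesis unfolding True[symmetric] W_entry_def enorm_col q_def[symmetric]
      by (simp add: max_scaling_def power2_eq_square[of "sum _ _"])
  next
    case False
    then show ?thesis
      by (simp add: W_entry_def enorm_col q_def g_def max_scaling_def mult.assoc)
  qed
  \<comment> \<open>Expands the centred product: the two mixed terms each sum to minus the product
    of the means, and the last term restores it once because the \<open>q j\<close> sum to
    \<open>d\<close>.\<close>
  also have "\<dots> = (\<Sum>j=1..d. real d * (g h j * g h' j / q j) - max_scaling d a h' * g h j - max_scaling d a h * g h' j
      + max_scaling d a h * max_scaling d a h' / real d * q j)"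
    unfolding sum.distrib sum_subtractf sum_distrib_left[symmetric] sum_g sum_q using d by simp
  also have "\<dots> = (\<Sum>j=1..d. col_sq d a j / real d *
      (f_max d h (col_angle d a j) - max_scaling d a h) * (f_max d h' (col_angle d a j) - max_scaling d a h'))"
  proof (rule sum.cong[OF refl])
    fix j assume "j \<in> {1..d}"
    then have q: "q j > 0" using pos by (simp add: q_def)
    show "real d * (g h j * g h' j / q j) - max_scaling d a h' * g h j - max_scaling d a h * g h' j
      + max_scaling d a h * max_scaling d a h' / real d * q j = col_sq d a j / real d *
      (f_max d h (col_angle d a j) - max_scaling d a h) * (f_max d h' (col_angle d a j) - max_scaling d a h')"
      unfolding f_max_col_angle[OF h] f_max_col_angle[OF h'] g_def[symmetric] q_def[symmetric]
      using q d by (simp add: field_simps)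
  qed
  finally show ?thesis .
qed

section \<open>Regular variation of max-linear vectors\<close>

lemma integral_uniform_measure:
  fixes \<phi> :: "'a \<Rightarrow> real"
  assumes A: "A \<in> sets N" "emeasure N A \<noteq> 0" "emeasure N A \<noteq> \<infinity>"
    and [measurable]: "\<phi> \<in> borel_measurable N" and zero: "\<And>x. x \<in> space N - A \<Longrightarrow> \<phi> x = 0"
  shows "(LINT x|uniform_measure N A. \<phi> x) = (LINT x|N. \<phi> x) / measure N A"
proof -
  have A0: "measure N A > 0" using A by (simp add: measure_def enn2real_positive_iff less_top zero_less_iff_neq_zero)
  have em: "emeasure N A = ennreal (measure N A)" using A by (intro emeasure_eq_ennreal_measure) auto
  have "uniform_measure N A = density N (\<lambda>x. ennreal (indicator A x / measure N A))"
    unfolding uniform_measure_def em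
    using A0 by (intro arg_cong2[of _ _ _ _ density] refl ext) (auto simp: indicator_def divide_ennreal ennreal_1[symmetric] simp del: ennreal_1)
  then have "(LINT x|uniform_measure N A. \<phi> x) = (LINT x|N. (indicator A x / measure N A) *\<^sub>R \<phi> x)"
    using A A0 by (simp add: integral_density)
  also have "\<dots> = (LINT x|N. \<phi> x / measure N A)"
    using zero by (intro Bochner_Integration.integral_cong) (auto simp: indicator_def)
  finally show ?thesis by simp
qed

lemma cdf_uniform_measure:
  assumes "sets N = sets (borel :: real measure)" "emeasure N {\<delta><..} \<noteq> 0" "emeasure N {\<delta><..} \<noteq> \<infinity>"
  shows "cdf (uniform_measure N {\<delta><..}) x = (if x < \<delta> then 0 else 1 - measure N {x<..} / measure N {\<delta><..})"
proof -
  have "cdf (uniform_measure N {\<delta><..}) x = measure N ({\<delta><..} \<inter> {..x}) / measure N {\<delta><..}"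
    unfolding cdf_def using assms by (intro measure_uniform_measure) auto
  also have "\<dots> = (if x < \<delta> then 0 else 1 - measure N {x<..} / measure N {\<delta><..})"
  proof (cases "x < \<delta>")
    case True
    then have "{\<delta><..} \<inter> {..x} = {}" by auto
    with True show ?thesis by simp
  next
    case False
    then have "{\<delta><..} \<inter> {..x} = {\<delta><..} - {x<..}" by auto
    moreover have "measure N ({\<delta><..} - {x<..}) = measure N {\<delta><..} - measure N {x<..}"
      using assms False by (intro measure_Diff) auto
    moreover have "measure N {\<delta><..} > 0"
      using assms by (simp add: measure_def enn2real_positive_iff less_top zero_less_iff_neq_zero)
    ultimately show ?thesis using False by (simp add: diff_divide_distrib)
  qed
  finally show ?thesis .
qed

lemma real_distribution_uniform_measure:
  assumes "sets N = sets (borel :: real measure)" "emeasure N {\<delta><..} \<noteq> 0" "emeasure N {\<delta><..} \<noteq> \<infinity>"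
  shows "real_distribution (uniform_measure N {\<delta><..})"
  using prob_space_uniform_measure[OF assms(2,3)] assms(1)
  by (simp add: real_distribution_def real_distribution_axioms_def)

text \<open>Conditioning on \<open>{\<delta><..}\<close> turns the tail measures into probability measures with
  converging distribution functions.\<close>

lemma tail_conv_integral:
  fixes N :: "nat \<Rightarrow> real measure" and \<phi> :: "real \<Rightarrow> real" and s :: "nat \<Rightarrow> real"
  assumes sets: "\<And>n. sets (N n) = sets borel" "sets N' = sets borel"
    and fin: "\<And>n. emeasure (N n) {\<delta><..} \<noteq> \<infinity>" "emeasure N' {\<delta><..} \<noteq> \<infinity>"
    and pos: "measure N' {\<delta><..} > 0" "c > 0"
    and tails: "\<And>x. x \<ge> \<delta> \<Longrightarrow> (\<lambda>n. s n * measure (N n) {x<..}) \<longlonglongrightarrow> c * measure N' {x<..}"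
    and phi: "continuous_on UNIV \<phi>" "\<And>x. \<bar>\<phi> x\<bar> \<le> B" "\<And>x. x \<le> \<delta> \<Longrightarrow> \<phi> x = 0"
  shows "(\<lambda>n. s n * (LINT x|N n. \<phi> x)) \<longlonglongrightarrow> c * (LINT x|N'. \<phi> x)"
proof -
  define p where "p n = measure (N n) {\<delta><..}" for n
  define q where "q = measure N' {\<delta><..}"
  have sp: "(\<lambda>n. s n * p n) \<longlonglongrightarrow> c * q" unfolding p_def q_def by (rule tails) simp
  have cq: "c * q > 0" using pos by (simp add: q_def)
  have "\<forall>\<^sub>F n in sequentially. s n * p n > 0" using order_tendstoD(1)[OF sp cq] .
  \<comment> \<open>For small \<open>n\<close> the set above \<open>delta\<close> may be null, and
    conditioning on it would not give a probability measure. The sequence is shifted by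
    \<open>n0\<close> and the shift is undone at the end.\<close>
  then obtain n0 where n0: "\<And>n. n \<ge> n0 \<Longrightarrow> s n * p n > 0" by (auto simp: eventually_sequentially)
  have p_ne: "p n \<noteq> 0" if "n \<ge> n0" for n using n0[OF that] by auto
  have ne: "emeasure (N n) {\<delta><..} \<noteq> 0" if "n \<ge> n0" for n
    using p_ne[OF that] by (auto simp: p_def measure_def)
  have ne': "emeasure N' {\<delta><..} \<noteq> 0" using pos by (auto simp: measure_def)
  have phim[measurable]: "\<phi> \<in> borel_measurable borel" using phi(1) by (rule borel_measurable_continuous_onI)
  define \<mu> where "\<mu> n = uniform_measure (N (n + n0)) {\<delta><..}" for n
  define \<nu> where "\<nu> = uniform_measure N' {\<delta><..}"
  have wc: "weak_conv_m \<mu> \<nu>"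
    unfolding weak_conv_m_def weak_conv_def
  proof (intro allI impI)
    fix x
    show "(\<lambda>n. cdf (\<mu> n) x) \<longlonglongrightarrow> cdf \<nu> x"
    proof (cases "x < \<delta>")
      case True
      then show ?thesis
        by (simp add: \<mu>_def \<nu>_def cdf_uniform_measure[OF sets(1) ne fin(1)] cdf_uniform_measure[OF sets(2) ne' fin(2)])
    next
      case False
      have "(\<lambda>n. (s n * measure (N n) {x<..}) / (s n * p n)) \<longlonglongrightarrow> (c * measure N' {x<..}) / (c * q)"
        using False cq by (intro tendsto_divide sp tails) auto
      then have "(\<lambda>n. 1 - (s (n + n0) * measure (N (n + n0)) {x<..}) / (s (n + n0) * p (n + n0))) \<longlonglongrightarrow> 1 - (c * measure N' {x<..}) / (c * q)"
        by (intro tendsto_diff tendsto_const LIMSEQ_ignore_initial_segment)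
      moreover have "(s (n + n0) * measure (N (n + n0)) {x<..}) / (s (n + n0) * p (n + n0)) = measure (N (n + n0)) {x<..} / p (n + n0)" for n
        using n0[of "n + n0"] by auto
      ultimately show ?thesis using False pos
        by (simp add: \<mu>_def \<nu>_def cdf_uniform_measure[OF sets(1) ne fin(1)] cdf_uniform_measure[OF sets(2) ne' fin(2)] p_def q_def)
    qed
  qed
  have "(\<lambda>n. LINT x|\<mu> n. \<phi> x) \<longlonglongrightarrow> (LINT x|\<nu>. \<phi> x)"
  proof (rule weak_conv_imp_integral_bdd_continuous_conv[OF _ _ wc, where B = B])
    show "real_distribution (\<mu> n)" for n
      unfolding \<mu>_def by (rule real_distribution_uniform_measure[OF sets(1) ne fin(1)]) simp
    show "real_distribution \<nu>"
      unfolding \<nu>_def by (rule real_distribution_uniform_measure[OF sets(2) ne' fin(2)])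
  qed (use phi in \<open>simp_all add: continuous_on_eq_continuous_at\<close>)
  moreover have "(LINT x|\<mu> n. \<phi> x) = (LINT x|N (n + n0). \<phi> x) / p (n + n0)" for n
    unfolding \<mu>_def p_def using sets phi(3) ne fin
    by (intro integral_uniform_measure) (auto simp: measurable_cong_sets[OF sets(1) refl])
  moreover have "(LINT x|\<nu>. \<phi> x) = (LINT x|N'. \<phi> x) / q"
    unfolding \<nu>_def q_def using sets phi(3) ne' fin
    by (intro integral_uniform_measure) (auto simp: measurable_cong_sets[OF sets(2) refl])
  ultimately have "(\<lambda>n. (LINT x|N (n + n0). \<phi> x) / p (n + n0)) \<longlonglongrightarrow> (LINT x|N'. \<phi> x) / q" by simp
  then have "(\<lambda>n. (s (n + n0) * p (n + n0)) * ((LINT x|N (n + n0). \<phi> x) / p (n + n0))) \<longlonglongrightarrow> (c * q) * ((LINT x|N'. \<phi> x) / q)"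
    by (intro tendsto_mult LIMSEQ_ignore_initial_segment[OF sp])
  moreover have "(s (n + n0) * p (n + n0)) * ((LINT x|N (n + n0). \<phi> x) / p (n + n0)) = s (n + n0) * (LINT x|N (n + n0). \<phi> x)" for n
    using p_ne[of "n + n0"] by simp
  moreover have "(c * q) * ((LINT x|N'. \<phi> x) / q) = c * (LINT x|N'. \<phi> x)"
    using pos by (simp add: q_def)
  ultimately have "(\<lambda>n. s (n + n0) * (LINT x|N (n + n0). \<phi> x)) \<longlonglongrightarrow> c * (LINT x|N'. \<phi> x)" by simp
  then show ?thesis by (rule LIMSEQ_offset)
qed

section \<open>The radial limit measure and continuous ramps\<close>

definition nu2_real :: "real measure" where
  "nu2_real = density lborel (\<lambda>x. ennreal (indicator {0<..} x * (2 / x ^ 3)))"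

lemma nu2_distr: "nu2 = distr nu2_real borel ereal"
  by (simp add: nu2_def nu2_real_def)

lemma sets_nu2_real [simp, measurable_cong]: "sets nu2_real = sets borel"
  by (simp add: nu2_real_def)

lemma sets_nu2 [simp, measurable_cong]: "sets nu2 = sets borel"
  by (simp add: nu2_def)

lemma emeasure_nu2_real: assumes "x > 0" shows "emeasure nu2_real {x<..} = ennreal (1 / x\<^sup>2)"
proof -
  have "emeasure nu2_real {x<..} = (\<integral>\<^sup>+t. ennreal (indicator {0<..} t * (2 / t ^ 3)) * indicator {x<..} t \<partial>lborel)"
    unfolding nu2_real_def by (intro emeasure_density) auto
  also have "\<dots> = (\<integral>\<^sup>+t. ennreal (2 / t ^ 3) * indicator {x..} t \<partial>lborel)"
    using AE_lborel_singleton[of x] assms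
    by (intro nn_integral_cong_AE) (auto elim!: eventually_mono simp: indicator_def)
  also have "\<dots> = ennreal (0 - (- (1 / x\<^sup>2)))"
  proof (rule nn_integral_FTC_atLeast)
    show "((\<lambda>t. - (1 / t\<^sup>2)) has_real_derivative 2 / t ^ 3) (at t)" if "x \<le> t" for t :: real
      using that assms by (auto intro!: derivative_eq_intros simp: field_simps power2_eq_square power3_eq_cube)
    have "((\<lambda>t :: real. 1 / t\<^sup>2) \<longlongrightarrow> 0) at_top"
      by (intro tendsto_divide_0[OF tendsto_const] filterlim_at_top_imp_at_infinity filterlim_pow_at_top filterlim_ident) simp
    then show "((\<lambda>t :: real. - (1 / t\<^sup>2)) \<longlongrightarrow> 0) at_top" by (auto dest: tendsto_minus)
  qed (use assms in auto)
  finally show ?thesis by simp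
qed

lemma measure_nu2_real: "x > 0 \<Longrightarrow> measure nu2_real {x<..} = 1 / x\<^sup>2"
  by (simp add: measure_def emeasure_nu2_real)

lemma emeasure_nu2: assumes "x > 0" shows "emeasure nu2 {ereal x<..} = ennreal (1 / x\<^sup>2)"
proof -
  have "ereal -` {ereal x<..} \<inter> space nu2_real = {x<..}" by (auto simp: nu2_real_def)
  then show ?thesis unfolding nu2_distr by (simp add: emeasure_distr emeasure_nu2_real[OF assms])
qed

lemma emeasure_nu2_nonpos: "emeasure nu2 {..0} = 0"
proof -
  have "ereal -` {..0} \<inter> space nu2_real = {..0}" by (auto simp: nu2_real_def)
  then have "emeasure nu2 {..0} = emeasure nu2_real {..0}" unfolding nu2_distr by (simp add: emeasure_distr)
  also have "\<dots> = (\<integral>\<^sup>+t. ennreal (indicator {0<..} t * (2 / t ^ 3)) * indicator {..0} t \<partial>lborel)"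
    unfolding nu2_real_def by (intro emeasure_density) auto
  also have "\<dots> = (\<integral>\<^sup>+t. 0 \<partial>(lborel :: real measure))" by (intro nn_integral_cong) (auto simp: indicator_def)
  finally show ?thesis by simp
qed

text \<open>All the infinite mass sits near 0: the sets above \<open>1 / Suc n\<close> have finite
  mass and the nonpositive half-line is null.\<close>

lemma sigma_finite_nu2: "sigma_finite_measure nu2"
proof
  let ?A = "insert {..0} (range (\<lambda>n. {ereal (1 / Suc n)<..}))"
  have "x \<in> \<Union> ?A" for x :: ereal
  proof (cases "x \<le> 0")
    case False
    then have "0 < x" by simp
    then obtain y where y: "0 < ereal y" "ereal y < x" using ereal_dense2[of 0 x] by auto
    then obtain n where "1 / Suc n < y" using nat_approx_posE[of y] by auto
    then have "ereal (1 / Suc n) < x" using y by (meson less_ereal.simps(1) less_trans)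
    then show ?thesis by auto
  qed simp
  then have "\<Union> ?A = space nu2" by (auto simp: nu2_def)
  moreover have "emeasure nu2 A \<noteq> \<infinity>" if "A \<in> ?A" for A
    using that by (auto simp: emeasure_nu2 emeasure_nu2_nonpos)
  ultimately show "\<exists>A. countable A \<and> A \<subseteq> sets nu2 \<and> \<Union> A = space nu2 \<and> (\<forall>a\<in>A. emeasure nu2 a \<noteq> \<infinity>)"
    by (intro exI[of _ ?A]) auto
qed

lemma integral_nu2:
  fixes f :: "ereal \<Rightarrow> real"
  assumes "f \<in> borel_measurable borel" shows "(LINT r|nu2. f r) = (LINT x|nu2_real. f (ereal x))"
  unfolding nu2_distr using assms by (intro integral_distr) auto

text \<open>The linear ramp from 0 at \<open>p\<close> to 1 at \<open>q\<close>, constant beyond and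
  continuous also at infinity. Ramps are admissible radial test functions for vague convergence and
  sandwich the indicators of half-lines.\<close>

definition clip :: "real \<Rightarrow> real \<Rightarrow> ereal \<Rightarrow> real" where
  "clip p q r = (real_of_ereal (max (ereal p) (min r (ereal q))) - p) / (q - p)"

lemma clip_continuous: assumes "p < q" shows "continuous_on UNIV (clip p q)"
proof -
  have "continuous_on UNIV (\<lambda>r. max (ereal p) (min r (ereal q)))" by (intro continuous_intros continuous_on_max continuous_on_min)
  moreover have "(\<lambda>r. max (ereal p) (min r (ereal q))) ` UNIV \<subseteq> UNIV - {\<infinity>, -\<infinity>}"
    by (auto simp: max_def min_def)
  ultimately have "continuous_on UNIV (\<lambda>r. real_of_ereal (max (ereal p) (min r (ereal q))))"
    using continuous_on_compose2[OF continuous_on_real] by blast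
  then show ?thesis unfolding clip_def[abs_def] using assms by (intro continuous_intros) auto
qed

lemma clip_le: "p < q \<Longrightarrow> r \<le> ereal p \<Longrightarrow> clip p q r = 0"
  by (cases r) (auto simp: clip_def max_def min_def)

lemma clip_ge: "p < q \<Longrightarrow> ereal q \<le> r \<Longrightarrow> clip p q r = 1"
  by (auto simp: clip_def max_def min_def)

lemma clip_01: "p < q \<Longrightarrow> 0 \<le> clip p q r" "p < q \<Longrightarrow> clip p q r \<le> 1"
  by (cases r; auto simp: clip_def max_def min_def)+

lemma clip_measurable [measurable]: "p < q \<Longrightarrow> clip p q \<in> borel_measurable borel"
  by (rule borel_measurable_continuous_onI[OF clip_continuous])

lemma clip_integral:
  assumes "0 < p" "p < q"
  shows "1 / q\<^sup>2 \<le> (LINT r|nu2. clip p q r)" "(LINT r|nu2. clip p q r) \<le> 1 / p\<^sup>2"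
proof -
  have int: "integrable nu2_real (indicat_real {x<..})" if "x > 0" for x
    using that by (intro integrable_real_indicator) (auto simp: emeasure_nu2_real)
  have c: "integrable nu2_real (\<lambda>x. clip p q (ereal x))"
    using clip_01[OF assms(2)] assms clip_le[OF assms(2)]
    by (intro Bochner_Integration.integrable_bound[OF int[OF assms(1)]]) (auto simp: indicator_def not_less)
  have "1 / q\<^sup>2 = (LINT x|nu2_real. indicator {q<..} x)" using assms by (simp add: measure_nu2_real)
  also have "\<dots> \<le> (LINT x|nu2_real. clip p q (ereal x))"
    using assms clip_01[OF assms(2)] clip_ge[OF assms(2)] by (intro integral_mono int c) (auto simp: indicator_def)
  finally show "1 / q\<^sup>2 \<le> (LINT r|nu2. clip p q r)" using assms by (simp add: integral_nu2)
  have "(LINT x|nu2_real. clip p q (ereal x)) \<le> (LINT x|nu2_real. indicator {p<..} x)"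
    using assms clip_01[OF assms(2)] clip_le[OF assms(2)] by (intro integral_mono int c) (auto simp: indicator_def not_less)
  also have "\<dots> = 1 / p\<^sup>2" using assms by (simp add: measure_nu2_real)
  finally show "(LINT r|nu2. clip p q r) \<le> 1 / p\<^sup>2" using assms by (simp add: integral_nu2)
qed

section \<open>Norm, angle and the positive unit sphere\<close>

lemma continuous_on_Max:
  fixes f :: "'i \<Rightarrow> 'a::topological_space \<Rightarrow> 'b::linorder_topology"
  assumes "finite I" "I \<noteq> {}" "\<And>i. i \<in> I \<Longrightarrow> continuous_on S (f i)"
  shows "continuous_on S (\<lambda>x. MAX i\<in>I. f i x)"
  using assms
proof (induction I rule: finite_ne_induct)
  case (insert i I)
  then have "(\<lambda>x. MAX i\<in>insert i I. f i x) = (\<lambda>x. max (f i x) (MAX i\<in>I. f i x))" by simp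
  then show ?case using insert by (simp add: continuous_on_max)
qed simp

lemma continuous_on_enorm:
  fixes f :: "'a::topological_space \<Rightarrow> nat \<Rightarrow> real"
  assumes "\<And>i. i \<in> {1..d} \<Longrightarrow> continuous_on S (\<lambda>x. f x i)"
  shows "continuous_on S (\<lambda>x. enorm d (f x))"
  unfolding L2_set_def using assms by (intro continuous_intros)

lemma continuous_on_angle:
  fixes f :: "'a::topological_space \<Rightarrow> nat \<Rightarrow> real"
  assumes "\<And>i. i \<in> {1..d} \<Longrightarrow> continuous_on S (\<lambda>x. f x i)" "\<And>x. x \<in> S \<Longrightarrow> enorm d (f x) > 0"
  shows "continuous_on S (\<lambda>x. angle d (f x))"
proof (rule continuous_on_coordinatewise_then_product)
  fix i
  show "continuous_on S (\<lambda>x. angle d (f x) i)"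
  proof (cases "i \<in> {1..d}")
    case True
    have "\<forall>x\<in>S. enorm d (f x) \<noteq> 0" using assms(2) by force
    then show ?thesis using True assms(1) unfolding angle_def
      by (simp add: restrict_def del: atLeastAtMost_iff) (intro continuous_on_divide continuous_on_enorm; blast)
  next
    case False
    then show ?thesis by (simp add: angle_def restrict_def del: atLeastAtMost_iff)
  qed
qed

lemma enorm_cong: "(\<And>i. i \<in> {1..d} \<Longrightarrow> u i = v i) \<Longrightarrow> enorm d u = enorm d v"
  by (rule L2_set_cong) simp_all

lemma angle_cong: "(\<And>i. i \<in> {1..d} \<Longrightarrow> u i = v i) \<Longrightarrow> angle d u = angle d v"
  using enorm_cong[of d u v] by (auto simp: angle_def intro!: restrict_ext)

lemma enorm_scale: "r \<ge> 0 \<Longrightarrow> enorm d (\<lambda>i. r * u i) = r * enorm d u"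
  by (simp add: L2_set_right_distrib)

lemma angle_scale: "r > 0 \<Longrightarrow> angle d (\<lambda>i. r * u i) = angle d u"
  by (simp add: angle_def enorm_scale)

lemma angle_Theta:
  assumes "\<And>i. i \<in> {1..d} \<Longrightarrow> 0 \<le> u i" "enorm d u > 0"
  shows "angle d u \<in> Theta_pos d"
proof -
  have "enorm d (angle d u) = enorm d (\<lambda>i. 1 / enorm d u * u i)"
    by (intro enorm_cong) (simp add: angle_def)
  also have "\<dots> = 1" using assms(2) by (subst enorm_scale) auto
  finally show ?thesis using assms by (auto simp: Theta_pos_def angle_def)
qed

lemma compact_Theta: "compact (Theta_pos d)"
proof -
  have eq: "Theta_pos d = ({1..d} \<rightarrow>\<^sub>E {0..1}) \<inter> {w. enorm d w = 1}"
  proof (intro set_eqI iffI)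
    fix w assume w: "w \<in> Theta_pos d"
    have "w i \<in> {0..1}" if "i \<in> {1..d}" for i
      using w that member_le_L2_set[of "{1..d}" i w] by (auto simp: Theta_pos_def)
    then show "w \<in> ({1..d} \<rightarrow>\<^sub>E {0..1}) \<inter> {w. enorm d w = 1}"
      using w by (auto simp: Theta_pos_def PiE_def)
  qed (auto simp: Theta_pos_def PiE_def Pi_def)
  have coord: "continuous_on UNIV (\<lambda>w :: nat \<Rightarrow> real. w i)" for i by (rule continuous_on_coord)
  have cont: "continuous_on UNIV (\<lambda>w. enorm d w)" by (rule continuous_on_enorm[OF coord])
  have "closed ((\<lambda>w. enorm d w) -` {1})"
    using cont by (intro closed_vimage) (simp_all add: closed_singleton)
  then have "closed {w. enorm d w = 1}" by (simp add: vimage_def)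
  then show ?thesis unfolding eq by (rule compact_Int_closed[OF compact_box])
qed

lemma Theta_sets: "Theta_pos d \<in> sets (Rvec d)"
proof -
  have "Theta_pos d = {w \<in> space (Rvec d). (\<forall>i\<in>{1..d}. 0 \<le> w i) \<and> enorm d w = 1}"
    by (auto simp: Theta_pos_def space_PiM PiE_def Pi_def)
  also have "\<dots> \<in> sets (Rvec d)" unfolding L2_set_def by measurable
  finally show ?thesis .
qed

lemma Theta_space: "Theta_pos d \<subseteq> space (Rvec d)"
  using Theta_sets sets.sets_into_space by blast

lemma measurable_enorm [measurable]: "enorm d \<in> borel_measurable (Rvec d)"
  unfolding L2_set_def by measurable

lemma measurable_angle [measurable]: "angle d \<in> Rvec d \<rightarrow>\<^sub>M Rvec d"
  unfolding angle_def[abs_def] by (intro measurable_restrict) measurable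

section \<open>The max-linear map near a single large coordinate\<close>

definition max_map :: "nat \<Rightarrow> (nat \<Rightarrow> nat \<Rightarrow> real) \<Rightarrow> (nat \<Rightarrow> real) \<Rightarrow> nat \<Rightarrow> real" where
  "max_map d a z = (\<lambda>i\<in>{1..d}. MAX j\<in>{1..d}. a i j * z j)"

locale ml_matrix =
  fixes d :: nat and a :: "nat \<Rightarrow> nat \<Rightarrow> real"
  assumes d: "d \<ge> 1"
    and a_nonneg: "\<And>i j. i \<in> {1..d} \<Longrightarrow> j \<in> {1..d} \<Longrightarrow> 0 \<le> a i j"
    and a_diag: "\<And>i. i \<in> {1..d} \<Longrightarrow> 0 < a i i"
begin

definition col_norm :: "nat \<Rightarrow> real" where
  "col_norm j = enorm d (\<lambda>m. a m j)"

lemma col_norm_sq: "(col_norm j)\<^sup>2 = col_sq d a j"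
  by (simp add: col_norm_def enorm_col)

lemma col_norm_pos: assumes "j \<in> {1..d}" shows "col_norm j > 0"
proof -
  have "a j j \<le> col_norm j" unfolding col_norm_def using member_le_L2_set[of "{1..d}" j "\<lambda>m. a m j"] assms by simp
  then show ?thesis using a_diag[OF assms] by linarith
qed

lemma col_sq_pos: "j \<in> {1..d} \<Longrightarrow> col_sq d a j > 0"
  using col_norm_pos[of j] unfolding col_norm_sq[symmetric] by simp

lemma col_angle_Theta: "j \<in> {1..d} \<Longrightarrow> col_angle d a j \<in> Theta_pos d"
  using col_norm_pos a_nonneg unfolding col_angle_def col_norm_def by (intro angle_Theta) auto

lemma Max_scaled: "r \<ge> 0 \<Longrightarrow> (MAX j\<in>{1..d}. r * f j) = r * (MAX j\<in>{1..d}. f j :: real)"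
  using d by (intro Max_scale) auto

lemma max_map_nonneg:
  assumes "\<And>l. l \<in> {1..d} \<Longrightarrow> 0 \<le> z l" "i \<in> {1..d}"
  shows "0 \<le> max_map d a z i"
proof -
  have "0 \<le> a i i * z i" using assms a_nonneg by simp
  also have "\<dots> \<le> (MAX j\<in>{1..d}. a i j * z j)" using assms by (intro Max_ge) auto
  finally show ?thesis using assms by (simp add: max_map_def)
qed

lemma max_map_pos:
  assumes z: "\<And>l. l \<in> {1..d} \<Longrightarrow> 0 \<le> z l" and j: "j \<in> {1..d}" "0 < z j"
  shows "0 < enorm d (max_map d a z)"
proof -
  have "0 < a j j * z j" using j a_diag by simp
  also have "\<dots> \<le> max_map d a z j" using j by (auto simp: max_map_def intro!: Max_ge)
  also have "\<dots> \<le> enorm d (max_map d a z)" using j by (intro member_le_L2_set) auto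
  finally show ?thesis .
qed

text \<open>The norm of the image of the all-ones vector, which by monotonicity and homogeneity
  bounds the dilation of nonnegative vectors measured in the maximum norm.\<close>

definition max_dilation :: real where
  "max_dilation = enorm d (\<lambda>i. MAX j\<in>{1..d}. a i j)"

lemma enorm_max_map_le:
  assumes z: "\<And>l. l \<in> {1..d} \<Longrightarrow> 0 \<le> z l \<and> z l \<le> t" and t: "t \<ge> 0"
  shows "enorm d (max_map d a z) \<le> t * max_dilation"
proof -
  have "enorm d (max_map d a z) \<le> enorm d (\<lambda>i. t * (MAX j\<in>{1..d}. a i j))"
  proof (rule L2_set_mono)
    fix i assume i: "i \<in> {1..d}"
    show "0 \<le> max_map d a z i" using z i by (intro max_map_nonneg) auto
    have "a i j * z j \<le> t * (MAX j\<in>{1..d}. a i j)" if j: "j \<in> {1..d}" for j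
    proof -
      have "a i j * z j \<le> a i j * t" using z[OF j] a_nonneg[OF i j] by (intro mult_left_mono) auto
      also have "\<dots> \<le> (MAX j\<in>{1..d}. a i j) * t" using t j by (intro mult_right_mono Max_ge) auto
      finally show ?thesis by (simp add: mult.commute)
    qed
    then show "max_map d a z i \<le> t * (MAX j\<in>{1..d}. a i j)"
      using i d by (auto simp: max_map_def intro!: Max.boundedI)
  qed
  then show ?thesis using t by (simp add: enorm_scale max_dilation_def)
qed

lemma col_norm_le_max_dilation: assumes "j \<in> {1..d}" shows "col_norm j \<le> max_dilation"
  unfolding col_norm_def max_dilation_def using assms a_nonneg by (intro L2_set_mono Max_ge) auto

lemma max_dilation_pos: "max_dilation > 0"
  using col_norm_pos[of 1] col_norm_le_max_dilation[of 1] d by auto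

lemma max_map_scale: "r \<ge> 0 \<Longrightarrow> i \<in> {1..d} \<Longrightarrow> max_map d a (\<lambda>l. r * z l) i = r * max_map d a z i"
  using Max_scaled[of r "\<lambda>j. a i j * z j"] by (simp add: max_map_def mult.left_commute)

lemma enorm_max_map_scale: "r \<ge> 0 \<Longrightarrow> enorm d (max_map d a (\<lambda>l. r * z l)) = r * enorm d (max_map d a z)"
  unfolding enorm_scale[symmetric] by (intro enorm_cong max_map_scale)

lemma angle_max_map_scale: "r > 0 \<Longrightarrow> angle d (max_map d a (\<lambda>l. r * z l)) = angle d (max_map d a z)"
  unfolding angle_scale[of r d "max_map d a z", symmetric] by (intro angle_cong max_map_scale) simp_all

text \<open>When \<open>z\<^sub>j\<close> dominates, \<open>max_map d a z / z\<^sub>j\<close> is close to column \<open>j\<close>; compactness of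
  \<open>[\<delta>, \<infinity>]\<close> makes the estimate uniform in the size of \<open>z\<^sub>j\<close>.\<close>

lemma big_jump_modulus:
  fixes g :: "ereal \<times> (nat \<Rightarrow> real) \<Rightarrow> real"
  assumes g: "continuous_on ({0<..} \<times> Theta_pos d) g" and \<delta>: "\<delta> > 0" and \<eta>: "\<eta> > 0" and j: "j \<in> {1..d}"
  shows "\<exists>\<epsilon>>0. \<epsilon> \<le> \<delta> \<and> (\<forall>z. (\<forall>l\<in>{1..d}. 0 \<le> z l) \<longrightarrow> \<delta> < z j \<longrightarrow> (\<forall>l\<in>{1..d} - {j}. z l \<le> \<epsilon>) \<longrightarrow>
    \<bar>g (ereal (enorm d (max_map d a z)), angle d (max_map d a z)) - g (ereal (z j * col_norm j), col_angle d a j)\<bar> \<le> \<eta>)"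
proof -
  \<comment> \<open>The image of \<open>z / z j\<close> when \<open>z\<close> equals
    \<open>z j\<close> times the unit vector \<open>j\<close> plus \<open>s\<close> times
    \<open>y\<close>. At \<open>s = 0\<close> it is column \<open>j\<close>, so the claim becomes
    continuity in \<open>s\<close> at 0, uniformly over the compact set \<open>Y\<close> of sizes
    and perturbations.\<close>
  define u where "u s y i = max (a i j) (s * (MAX l\<in>{1..d}. a i l * y l))" for s :: real and y :: "nat \<Rightarrow> real" and i
  define Y where "Y = {ereal \<delta>..} \<times> ({1..d} \<rightarrow>\<^sub>E {0..1 :: real})"
  define f where "f p = (fst (snd p) * ereal (enorm d (u (fst p) (snd (snd p)))), angle d (u (fst p) (snd (snd p))))"
    for p :: "real \<times> ereal \<times> (nat \<Rightarrow> real)"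
  have u_ge: "a i j \<le> u s y i" for s y i by (simp add: u_def)
  have u_nonneg: "0 \<le> u s y i" if "i \<in> {1..d}" for s y i using u_ge a_nonneg[OF that j] order_trans by blast
  have u_pos: "0 < enorm d (u s y)" for s y
  proof -
    have "col_norm j \<le> enorm d (u s y)" unfolding col_norm_def using u_ge a_nonneg j by (intro L2_set_mono) auto
    then show ?thesis using col_norm_pos[OF j] by linarith
  qed
  have cY: "continuous_on A (\<lambda>p :: real \<times> ereal \<times> (nat \<Rightarrow> real). snd (snd p) l)" for A l
    by (rule continuous_on_compose2[OF continuous_on_coord[of UNIV l]]) (auto intro!: continuous_on_snd continuous_on_id)
  have cu: "continuous_on A (\<lambda>p :: real \<times> ereal \<times> (nat \<Rightarrow> real). u (fst p) (snd (snd p)) i)" for A i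
    unfolding u_def using d by (intro continuous_on_max continuous_on_mult continuous_on_Max cY continuous_intros) auto
  \<comment> \<open>Multiplication of extended reals is discontinuous where 0 meets infinity; here
    the size stays above \<open>delta\<close> and the norm is positive.\<close>
  have c1: "continuous_on ({0..1} \<times> Y) (\<lambda>p. fst (snd p) * ereal (enorm d (u (fst p) (snd (snd p)))))"
    unfolding continuous_on_def
  proof
    fix p assume p: "p \<in> {0..1::real} \<times> Y"
    then have "ereal \<delta> \<le> fst (snd p)" by (auto simp: Y_def)
    then have "0 < fst (snd p)" using \<delta> by (intro less_le_trans[of 0 "ereal \<delta>" "fst (snd p)"]) simp_all
    moreover have "continuous_on ({0..1} \<times> Y) (\<lambda>p. fst (snd p))" by (intro continuous_intros)
    then have "((\<lambda>p. fst (snd p)) \<longlongrightarrow> fst (snd p)) (at p within {0..1} \<times> Y)"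
      using p unfolding continuous_on_def by blast
    moreover have "continuous_on ({0..1} \<times> Y) (\<lambda>p. ereal (enorm d (u (fst p) (snd (snd p)))))"
      by (intro continuous_on_ereal continuous_on_enorm cu)
    then have "((\<lambda>p. ereal (enorm d (u (fst p) (snd (snd p))))) \<longlongrightarrow> ereal (enorm d (u (fst p) (snd (snd p))))) (at p within {0..1} \<times> Y)"
      using p unfolding continuous_on_def by blast
    ultimately show "((\<lambda>p. fst (snd p) * ereal (enorm d (u (fst p) (snd (snd p))))) \<longlongrightarrow>
        fst (snd p) * ereal (enorm d (u (fst p) (snd (snd p))))) (at p within {0..1} \<times> Y)"
      using u_pos by (intro tendsto_mult_ereal_pos) auto
  qed
  have cf: "continuous_on ({0..1} \<times> Y) f"
    unfolding f_def by (intro continuous_on_Pair c1 continuous_on_angle cu u_pos)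
  have fS: "f ` ({0..1} \<times> Y) \<subseteq> {0<..} \<times> Theta_pos d"
  proof
    fix q assume "q \<in> f ` ({0..1} \<times> Y)"
    then obtain s \<rho> y where q: "q = f (s, \<rho>, y)" "ereal \<delta> \<le> \<rho>" by (auto simp: Y_def)
    have "0 < \<rho>" using \<delta> by (intro less_le_trans[OF _ q(2)]) simp
    then have "0 < \<rho> * ereal (enorm d (u s y))" using u_pos[of s y] by (simp add: ereal_zero_less_0_iff)
    then show "q \<in> {0<..} \<times> Theta_pos d" using u_pos u_nonneg by (auto simp: q(1) f_def intro!: angle_Theta)
  qed
  have "continuous_on ({0..1} \<times> Y) (\<lambda>p. g (f p))"
    by (rule continuous_on_compose2[OF g cf fS])
  moreover have "compact Y"
    unfolding Y_def by (intro compact_Times compact_box) (simp add: compact_eq_closed)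
  \<comment> \<open>Compactness of \<open>Y\<close> gives one neighbourhood of \<open>s = 0\<close>
    that works for all sizes up to and including infinity.\<close>
  ultimately obtain V where V: "0 \<in> V" "open V"
    "\<forall>s\<in>V \<inter> {0..1}. \<forall>t\<in>Y. dist (g (f (s, t))) (g (f (0, t))) \<le> \<eta>"
    using continuous_on_prod_compactE[of "{0..1::real}" Y "\<lambda>p. g (f p)" 0 \<eta>] \<eta> by auto
  obtain e where e: "e > 0" "ball 0 e \<subseteq> V" using V(1,2) openE by blast
  define s where "s = min 1 (e / 2)"
  have s: "0 < s" "s \<le> 1" "s \<in> V \<inter> {0..1}" using e by (auto simp: s_def dist_real_def subset_eq min_def)
  show ?thesis
  proof (intro exI[of _ "s * \<delta>"] conjI allI impI)
    show "s * \<delta> > 0" "s * \<delta> \<le> \<delta>" using s \<delta> by auto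
    fix z assume z: "\<forall>l\<in>{1..d}. 0 \<le> z l" "\<delta> < z j" "\<forall>l\<in>{1..d} - {j}. z l \<le> s * \<delta>"
    have zj: "z j > 0" using z \<delta> by linarith
    \<comment> \<open>From \<open>z l <= s * delta < s * z j\<close> the quotients lie in
      \<open>[0, 1]\<close>; the coordinate \<open>j\<close> is set to 0 because it is already
      represented by \<open>a i j\<close> in \<open>u\<close>.\<close>
    define y where "y = (\<lambda>l\<in>{1..d}. if l = j then 0 else z l / (z j * s))"
    have y01: "0 \<le> y l" "y l \<le> 1" if l: "l \<in> {1..d}" for l
    proof -
      show "0 \<le> y l" using z(1) zj s l by (auto simp: y_def)
      have "z l \<le> z j * s" if "l \<noteq> j"
      proof -
        have "z l \<le> s * \<delta>" using z(3) l that by blast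
        also have "\<dots> \<le> s * z j" using z(2) s by (intro mult_left_mono) auto
        finally show ?thesis by (simp add: mult.commute)
      qed
      then show "y l \<le> 1" using l zj s by (auto simp: y_def)
    qed
    then have t: "(ereal (z j), y) \<in> Y" using z(2) by (auto simp: Y_def y_def)
    have uz: "z j * u s y i = max_map d a z i" if i: "i \<in> {1..d}" for i
    proof -
      have "z j * u s y i = max (a i j * z j) (z j * s * (MAX l\<in>{1..d}. a i l * y l))"
        using zj by (simp add: u_def max_mult_distrib_left mult_ac)
      also have "z j * s * (MAX l\<in>{1..d}. a i l * y l) = (MAX l\<in>{1..d}. z j * s * (a i l * y l))"
        using zj s by (intro Max_scaled[symmetric]) auto
      also have "max (a i j * z j) (MAX l\<in>{1..d}. z j * s * (a i l * y l)) = (MAX l\<in>{1..d}. a i l * z l)"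
      proof (rule antisym)
        have trm: "z j * s * (a i l * y l) = (if l = j then 0 else a i l * z l)" if "l \<in> {1..d}" for l
          using that zj s by (auto simp: y_def)
        have le: "a i l * z l \<le> (MAX l\<in>{1..d}. a i l * z l)" if "l \<in> {1..d}" for l using that by (intro Max_ge) auto
        have "0 \<le> a i j * z j" using a_nonneg[OF i j] zj by simp
        then have "0 \<le> (MAX l\<in>{1..d}. a i l * z l)" using le[OF j] by linarith
        then have "z j * s * (a i l * y l) \<le> (MAX l\<in>{1..d}. a i l * z l)" if "l \<in> {1..d}" for l
          unfolding trm[OF that] using le[OF that] by simp
        then have "(MAX l\<in>{1..d}. z j * s * (a i l * y l)) \<le> (MAX l\<in>{1..d}. a i l * z l)"
          using d by (intro Max.boundedI) auto
        then show "max (a i j * z j) (MAX l\<in>{1..d}. z j * s * (a i l * y l)) \<le> (MAX l\<in>{1..d}. a i l * z l)"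
          using le[OF j] by simp
        have "a i l * z l \<le> max (a i j * z j) (MAX l\<in>{1..d}. z j * s * (a i l * y l))" if l: "l \<in> {1..d}" for l
        proof (cases "l = j")
          case False
          then have "a i l * z l = z j * s * (a i l * y l)" by (simp only: trm[OF l] if_False)
          also have "\<dots> \<le> (MAX l\<in>{1..d}. z j * s * (a i l * y l))" using l by (intro Max_ge) auto
          finally show ?thesis by simp
        qed simp
        then show "(MAX l\<in>{1..d}. a i l * z l) \<le> max (a i j * z j) (MAX l\<in>{1..d}. z j * s * (a i l * y l))"
          using d by (intro Max.boundedI) auto
      qed
      finally show ?thesis using i by (simp add: max_map_def)
    qed
    have "ereal (z j) * ereal (enorm d (u s y)) = ereal (enorm d (max_map d a z))"
      using zj enorm_cong[of d "\<lambda>i. z j * u s y i" "max_map d a z"] uz enorm_scale[where r = "z j" and d = d and u = "u s y"] by simp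
    moreover have "angle d (u s y) = angle d (max_map d a z)"
      using zj angle_cong[of d "\<lambda>i. z j * u s y i" "max_map d a z"] uz angle_scale[of "z j" d "u s y"] by simp
    ultimately have f1: "f (s, ereal (z j), y) = (ereal (enorm d (max_map d a z)), angle d (max_map d a z))"
      by (simp add: f_def)
    have u0: "u 0 y i = a i j" if "i \<in> {1..d}" for i using a_nonneg[OF that j] by (simp add: u_def)
    have "enorm d (u 0 y) = col_norm j" unfolding col_norm_def by (rule enorm_cong) (rule u0)
    moreover have "angle d (u 0 y) = col_angle d a j" unfolding col_angle_def by (rule angle_cong) (rule u0)
    ultimately have f0: "f (0, ereal (z j), y) = (ereal (z j * col_norm j), col_angle d a j)" by (simp add: f_def)
    have "dist (g (f (s, ereal (z j), y))) (g (f (0, ereal (z j), y))) \<le> \<eta>" using V(3) s(3) t by blast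
    then show "\<bar>g (ereal (enorm d (max_map d a z)), angle d (max_map d a z)) - g (ereal (z j * col_norm j), col_angle d a j)\<bar> \<le> \<eta>"
      unfolding f1 f0 dist_real_def .
  qed
qed

end

text \<open>The case \<open>n = 0\<close> is separate because \<open>0 powr (-1/2)\<close> is
  0.\<close>

lemma less_powr_mult_iff: "real n powr (- 1 / 2) * z > x \<longleftrightarrow> (n > 0 \<and> z > sqrt (real n) * x) \<or> (n = 0 \<and> 0 > x)"
proof (cases "n = 0")
  case False
  then have "real n powr (- 1 / 2) = 1 / sqrt (real n)"
    by (simp add: powr_minus powr_half_sqrt inverse_eq_divide)
  then show ?thesis using False by (simp add: pos_less_divide_eq mult.commute)
qed simp

text \<open>A compact subset of \<open>(0, infinity]\<close> times the sphere keeps a positive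
  distance from radius 0, so a test function vanishes at small radii and is bounded.\<close>

lemma finite_test_function_bound:
  fixes g :: "ereal \<times> (nat \<Rightarrow> real) \<Rightarrow> real"
  assumes g: "continuous_on ({0<..} \<times> Theta_pos d) g"
    and K: "compact K" "K \<subseteq> {0<..} \<times> Theta_pos d" "\<And>x. x \<in> {0<..} \<times> Theta_pos d - K \<Longrightarrow> g x = 0"
  obtains B \<delta> where "B > 0" "\<delta> > 0" "\<And>x. x \<in> {0<..} \<times> Theta_pos d \<Longrightarrow> \<bar>g x\<bar> \<le> B"
    "\<And>r w. r \<le> ereal \<delta> \<Longrightarrow> (r, w) \<in> {0<..} \<times> Theta_pos d \<Longrightarrow> g (r, w) = 0"
proof -
  have "compact (g ` K)" by (rule compact_continuous_image[OF continuous_on_subset[OF g K(2)] K(1)])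
  then obtain B where B: "B > 0" "\<And>x. x \<in> K \<Longrightarrow> \<bar>g x\<bar> \<le> B"
    using compact_imp_bounded bounded_pos[of "g ` K"] by auto
  have bound: "\<bar>g x\<bar> \<le> B" if "x \<in> {0<..} \<times> Theta_pos d" for x
    using B K(3)[of x] that by (cases "x \<in> K") auto
  have "\<exists>\<delta>>0. \<forall>r w. r \<le> ereal \<delta> \<longrightarrow> (r, w) \<notin> K"
  proof (cases "K = {}")
    case False
    have "compact (fst ` K)" by (intro compact_continuous_image K continuous_on_fst continuous_on_id)
    then obtain m where m: "m \<in> fst ` K" "\<And>r. r \<in> fst ` K \<Longrightarrow> m \<le> r"
      using compact_attains_inf[of "fst ` K"] False by auto
    then have "0 < m" using K(2) by auto
    then obtain \<delta> where "0 < ereal \<delta>" "ereal \<delta> < m" using ereal_dense2[of 0 m] by auto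
    then show ?thesis using m(2) by (intro exI[of _ \<delta>]) (force dest: leD)
  qed (auto intro: exI[of _ 1])
  then obtain \<delta> where "\<delta> > 0" "\<And>r w. r \<le> ereal \<delta> \<Longrightarrow> (r, w) \<notin> K" by blast
  then show ?thesis using B(1) bound K(3) by (intro that[of B \<delta>]) auto
qed

section \<open>The principle of a single big jump\<close>

locale max_linear = prob_space M + ml_matrix d a
  for M :: "'a measure" and d :: nat and a :: "nat \<Rightarrow> nat \<Rightarrow> real" +
  fixes Z X :: "'a \<Rightarrow> nat \<Rightarrow> real"
  assumes Z_meas [measurable]: "Z \<in> M \<rightarrow>\<^sub>M Rvec d" and X_meas [measurable]: "X \<in> M \<rightarrow>\<^sub>M Rvec d"
    and Z_indep: "indep_vars (\<lambda>_. borel) (\<lambda>i x. Z x i) {1..d}"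
    and Z_atomless: "\<And>i z. i \<in> {1..d} \<Longrightarrow> measure M {x \<in> space M. Z x i = z} = 0"
    and Z_nonneg: "AE x in M. \<forall>i\<in>{1..d}. 0 \<le> Z x i"
    and Z_tail: "\<And>i x. i \<in> {1..d} \<Longrightarrow> x > 0 \<Longrightarrow>
      (\<lambda>n. real n * measure M {y \<in> space M. real n powr (-1/2) * Z y i > x}) \<longlonglongrightarrow> x powr (-2)"
    and X_max: "AE x in M. \<forall>i\<in>{1..d}. X x i = (MAX j\<in>{1..d}. a i j * Z x j)"
begin

definition tail_event :: "nat \<Rightarrow> real \<Rightarrow> nat \<Rightarrow> 'a set" where
  "tail_event n t i = {x \<in> space M. Z x i > sqrt (real n) * t}"

lemma tail_event_sets [measurable]: "i \<in> {1..d} \<Longrightarrow> tail_event n t i \<in> sets M"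
  unfolding tail_event_def by measurable

lemma tail_event_limit:
  assumes "i \<in> {1..d}" "t > 0"
  shows "(\<lambda>n. real n * measure M (tail_event n t i)) \<longlonglongrightarrow> 1 / t\<^sup>2"
proof -
  have eq1: "t powr (-2) = 1 / t\<^sup>2" using assms by (simp add: powr_minus powr_numeral inverse_eq_divide)
  have eq2: "real n * measure M {y \<in> space M. real n powr (-1/2) * Z y i > t} = real n * measure M (tail_event n t i)" for n
    unfolding tail_event_def less_powr_mult_iff by (cases "n = 0") auto
  show ?thesis using Z_tail[OF assms] unfolding eq1 eq2 .
qed

text \<open>Independence gives a product of two probabilities of order \<open>1 / n\<close>, which
  is still of order \<open>1 / n\<close> after multiplication by \<open>n\<close>.\<close>

lemma joint_tail_limit:
  assumes ij: "i \<in> {1..d}" "j \<in> {1..d}" "i \<noteq> j" and t: "t > 0"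
  shows "(\<lambda>n. real n * measure M (tail_event n t i \<inter> tail_event n t j)) \<longlonglongrightarrow> 0"
proof -
  have prod: "measure M (tail_event n t i \<inter> tail_event n t j) = measure M (tail_event n t i) * measure M (tail_event n t j)" for n
  proof -
    let ?A = "\<lambda>_ :: nat. {sqrt (real n) * t<..}"
    have "prob (\<Inter>l\<in>{i, j}. (\<lambda>x. Z x l) -` ?A l \<inter> space M) = (\<Prod>l\<in>{i, j}. prob ((\<lambda>x. Z x l) -` ?A l \<inter> space M))"
      using ij by (intro indep_varsD[OF Z_indep]) auto
    moreover have "(\<lambda>x. Z x l) -` ?A l \<inter> space M = tail_event n t l" for l
      by (auto simp: tail_event_def)
    ultimately show ?thesis using ij by simp
  qed
  have "(\<lambda>n. (real n * measure M (tail_event n t i)) * (real n * measure M (tail_event n t j)) * (1 / real n)) \<longlonglongrightarrow> 1 / t\<^sup>2 * (1 / t\<^sup>2) * 0"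
    by (intro tendsto_mult tail_event_limit ij t lim_1_over_n)
  moreover have "(real n * measure M (tail_event n t i)) * (real n * measure M (tail_event n t j)) * (1 / real n)
      = real n * measure M (tail_event n t i \<inter> tail_event n t j)" for n
    unfolding prod by (cases "n = 0") auto
  ultimately show ?thesis by simp
qed

text \<open>Scaling the innovation by \<open>c\<close> moves the tail threshold from
  \<open>t\<close> to \<open>t / c\<close>, which produces the factor \<open>c^2\<close>; with
  \<open>c = col_norm j\<close> this becomes the spectral mass of column \<open>j\<close>.\<close>

lemma marginal_integral_limit:
  assumes j: "j \<in> {1..d}" and c: "c > 0" and \<delta>: "\<delta> > 0"
    and phi: "continuous_on UNIV \<phi>" "\<And>x. \<bar>\<phi> x\<bar> \<le> B" "\<And>x. x \<le> \<delta> \<Longrightarrow> \<phi> x = 0"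
  shows "(\<lambda>n. real n * (LINT x|M. \<phi> (c * Z x j / sqrt (real n)))) \<longlonglongrightarrow> c\<^sup>2 * (LINT r|nu2_real. (\<phi> r :: real))"
proof -
  define N where "N n = distr M borel (\<lambda>x. c * Z x j / sqrt (real n))" for n
  have [measurable]: "(\<lambda>x. Z x j) \<in> borel_measurable M" using j by measurable
  have N: "measure (N n) {t<..} = measure M (tail_event n (t / c) j)" if "n > 0" for n t
  proof -
    have "(\<lambda>x. c * Z x j / sqrt (real n)) -` {t<..} \<inter> space M = tail_event n (t / c) j"
      using that c by (auto simp: tail_event_def field_simps)
    then show ?thesis unfolding N_def by (subst measure_distr) auto
  qed
  have tails: "(\<lambda>n. real n * measure (N n) {t<..}) \<longlonglongrightarrow> c\<^sup>2 * measure nu2_real {t<..}" if "t \<ge> \<delta>" for t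
  proof -
    have t: "t > 0" using that \<delta> by linarith
    have "(\<lambda>n. real n * measure M (tail_event n (t / c) j)) \<longlonglongrightarrow> 1 / (t / c)\<^sup>2"
      using t c by (intro tail_event_limit j) auto
    moreover have "1 / (t / c)\<^sup>2 = c\<^sup>2 * measure nu2_real {t<..}" using t c by (simp add: measure_nu2_real power_divide)
    moreover have "real n * measure M (tail_event n (t / c) j) = real n * measure (N n) {t<..}" for n
      using N[of n t] by (cases "n = 0") auto
    ultimately show ?thesis by simp
  qed
  have phim: "\<phi> \<in> borel_measurable borel" using phi(1) by (rule borel_measurable_continuous_onI)
  have "(\<lambda>n. real n * (LINT x|N n. \<phi> x)) \<longlonglongrightarrow> c\<^sup>2 * (LINT r|nu2_real. \<phi> r)"
  proof (rule tail_conv_integral[OF _ sets_nu2_real _ _ _ _ tails phi])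
    show "emeasure (N n) {\<delta><..} \<noteq> \<infinity>" for n
      unfolding N_def by (subst emeasure_distr) (auto simp: emeasure_finite)
  qed (use \<delta> c in \<open>simp_all add: N_def emeasure_nu2_real measure_nu2_real\<close>)
  then show ?thesis unfolding N_def using phim by (subst (asm) integral_distr) auto
qed

definition scaled :: "nat \<Rightarrow> 'a \<Rightarrow> ereal \<times> (nat \<Rightarrow> real)" where
  "scaled n x = (ereal (enorm d (X x) / sqrt (real n)), angle d (X x))"

lemma scaled_measurable [measurable]: "scaled n \<in> M \<rightarrow>\<^sub>M borel \<Otimes>\<^sub>M Rvec d"
  unfolding scaled_def by measurable

text \<open>Heavy tails and independence make two large innovations negligible, so the limit only sees
  the innovation vectors with a single large component.\<close>

lemma single_big_jump:
  fixes g :: "ereal \<times> (nat \<Rightarrow> real) \<Rightarrow> real"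
  assumes g: "continuous_on ({0<..} \<times> Theta_pos d) g"
    and K: "compact K" "K \<subseteq> {0<..} \<times> Theta_pos d" "\<And>x. x \<in> {0<..} \<times> Theta_pos d - K \<Longrightarrow> g x = 0"
    and meas: "(\<lambda>p. indicat_real ({0<..} \<times> Theta_pos d) p * g p) \<in> borel_measurable (borel \<Otimes>\<^sub>M Rvec d)"
  shows "(\<lambda>n. real n * (LINT x|M. indicator ({0<..} \<times> Theta_pos d) (scaled n x) * g (scaled n x)))
    \<longlonglongrightarrow> (\<Sum>j=1..d. col_sq d a j * (LINT r|nu2_real. indicator {0<..} r * g (ereal r, col_angle d a j)))"
proof -
  let ?S = "{0<..} \<times> Theta_pos d"
  obtain B \<delta>0 where B: "B > 0" "\<delta>0 > 0" "\<And>x. x \<in> ?S \<Longrightarrow> \<bar>g x\<bar> \<le> B"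
    "\<And>r w. r \<le> ereal \<delta>0 \<Longrightarrow> (r, w) \<in> ?S \<Longrightarrow> g (r, w) = 0"
    using finite_test_function_bound[OF g K] by blast
  \<comment> \<open>If all rescaled innovations are at most \<open>delta\<close>, then the rescaled
    norm of \<open>X\<close> is at most \<open>delta0\<close>, where \<open>g\<close>
    vanishes.\<close>
  define \<delta> where "\<delta> = \<delta>0 / max_dilation"
  have \<delta>: "\<delta> > 0" "\<delta> * max_dilation = \<delta>0" using B(2) max_dilation_pos by (auto simp: \<delta>_def)
  define \<phi> where "\<phi> j r = indicator {0<..} r * g (ereal r, col_angle d a j)" for j and r :: real
  have phi0: "\<phi> j r = 0" if "r \<le> \<delta>0" "j \<in> {1..d}" for j r
    using that B(4)[of "ereal r" "col_angle d a j"] col_angle_Theta by (auto simp: \<phi>_def indicator_def)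
  have phiB: "\<bar>\<phi> j r\<bar> \<le> B" if "j \<in> {1..d}" for j r
    using that B(1,3) col_angle_Theta by (auto simp: \<phi>_def indicator_def)
  \<comment> \<open>Extending \<open>g\<close> by 0 to nonpositive radii stays continuous because it
    already vanishes on a neighbourhood of 0; the two open half-lines overlap there.\<close>
  have phic: "continuous_on UNIV (\<phi> j)" if j: "j \<in> {1..d}" for j
  proof -
    have "continuous_on {0<..} (\<lambda>r. g (ereal r, col_angle d a j))"
      by (rule continuous_on_compose2[OF g, of _ "\<lambda>r. (ereal r, col_angle d a j)"])
        (use col_angle_Theta[OF j] in \<open>auto intro!: continuous_intros\<close>)
    then have "continuous_on {0<..} (\<phi> j)"
      by (rule continuous_on_eq) (simp add: \<phi>_def)
    moreover have "continuous_on {..<\<delta>0} (\<phi> j)"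
      by (rule continuous_on_eq[of _ "\<lambda>_. 0"]) (use phi0[OF _ j] in auto)
    ultimately have "continuous_on ({0<..} \<union> {..<\<delta>0}) (\<phi> j)" by (intro continuous_on_open_Un) auto
    moreover have "{0<..} \<union> {..<\<delta>0} = (UNIV :: real set)" using B(2) by auto
    ultimately show ?thesis by simp
  qed
  define h where "h n x = indicator ?S (scaled n x) * g (scaled n x)" for n x
  \<comment> \<open>The comparison sum: each innovation contributes as if it acted alone, along its
    own column.\<close>
  define H where "H n x = (\<Sum>j=1..d. \<phi> j (col_norm j * Z x j / sqrt (real n)))" for n x
  have hB: "\<bar>h n x\<bar> \<le> B" for n x using B(1,3) by (auto simp: h_def indicator_def)
  have HB: "\<bar>H n x\<bar> \<le> real d * B" for n x
  proof -
    have "\<bar>H n x\<bar> \<le> (\<Sum>j=1..d. \<bar>\<phi> j (col_norm j * Z x j / sqrt (real n))\<bar>)" unfolding H_def by (rule sum_abs)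
    also have "\<dots> \<le> (\<Sum>j=1..d. B)" by (intro sum_mono phiB)
    finally show ?thesis by simp
  qed
  have hm[measurable]: "h n \<in> borel_measurable M" for n
    unfolding h_def by (rule measurable_compose[OF scaled_measurable meas])
  have phim: "\<phi> j \<in> borel_measurable borel" if "j \<in> {1..d}" for j
    by (rule borel_measurable_continuous_onI[OF phic[OF that]])
  have Hjm: "(\<lambda>x. \<phi> j (col_norm j * Z x j / sqrt (real n))) \<in> borel_measurable M" if "j \<in> {1..d}" for n j
    using that by (intro measurable_compose[OF _ phim]) measurable
  have Hm[measurable]: "H n \<in> borel_measurable M" for n
    unfolding H_def by (intro borel_measurable_sum Hjm)
  have hi: "integrable M (h n)" for n by (intro integrable_const_bound[of _ B]) (use hB in auto)
  have Hi: "integrable M (H n)" for n by (intro integrable_const_bound[of _ "real d * B"]) (use HB in auto)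
  have Hlim: "(\<lambda>n. real n * (LINT x|M. H n x)) \<longlonglongrightarrow> (\<Sum>j=1..d. col_sq d a j * (LINT r|nu2_real. \<phi> j r))"
  proof -
    have "(\<lambda>n. \<Sum>j=1..d. real n * (LINT x|M. \<phi> j (col_norm j * Z x j / sqrt (real n)))) \<longlonglongrightarrow>
        (\<Sum>j=1..d. (col_norm j)\<^sup>2 * (LINT r|nu2_real. \<phi> j r))"
      by (intro tendsto_sum marginal_integral_limit[where B = B, OF _ col_norm_pos B(2) phic phiB phi0])
    moreover have "(LINT x|M. H n x) = (\<Sum>j=1..d. LINT x|M. \<phi> j (col_norm j * Z x j / sqrt (real n)))" for n
      unfolding H_def
      by (intro Bochner_Integration.integral_sum integrable_const_bound[of _ B]) (use phiB Hjm in auto)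
    ultimately show ?thesis by (simp add: col_norm_sq sum_distrib_left)
  qed

  \<comment> \<open>Three cases. If no component exceeds \<open>delta\<close>, both sides vanish. If
    one does and all others are at most \<open>epsilon\<close>, the modulus of
    \<open>big_jump_modulus\<close> gives \<open>eta\<close>. Otherwise two components exceed
    \<open>epsilon\<close>, and the trivial bound \<open>d B + B\<close> is paid on an event of
    negligible probability.\<close>
  have bound: "\<exists>\<epsilon>>0. \<forall>n>0. AE x in M. \<bar>h n x - H n x\<bar> \<le> \<eta> * (\<Sum>j=1..d. indicator (tail_event n \<delta> j) x)
      + (real d * B + B) * (\<Sum>i=1..d. \<Sum>j\<in>{1..d} - {i}. indicator (tail_event n \<epsilon> i \<inter> tail_event n \<epsilon> j) x)"
    if \<eta>: "\<eta> > 0" for \<eta>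
  proof -
    have "\<forall>j\<in>{1..d}. \<exists>\<epsilon>>0. \<epsilon> \<le> \<delta> \<and> (\<forall>z. (\<forall>l\<in>{1..d}. 0 \<le> z l) \<longrightarrow> \<delta> < z j \<longrightarrow> (\<forall>l\<in>{1..d} - {j}. z l \<le> \<epsilon>) \<longrightarrow>
      \<bar>g (ereal (enorm d (max_map d a z)), angle d (max_map d a z)) - g (ereal (z j * col_norm j), col_angle d a j)\<bar> \<le> \<eta>)"
      using big_jump_modulus[OF g \<delta>(1) \<eta>] by blast
    from bchoice[OF this] obtain e where e: "\<forall>j\<in>{1..d}. e j > 0 \<and> e j \<le> \<delta> \<and> (\<forall>z. (\<forall>l\<in>{1..d}. 0 \<le> z l) \<longrightarrow> \<delta> < z j \<longrightarrow> (\<forall>l\<in>{1..d} - {j}. z l \<le> e j) \<longrightarrow>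
      \<bar>g (ereal (enorm d (max_map d a z)), angle d (max_map d a z)) - g (ereal (z j * col_norm j), col_angle d a j)\<bar> \<le> \<eta>)" ..
    define \<epsilon> where "\<epsilon> = Min (e ` {1..d})"
    have eps_le: "\<epsilon> \<le> e j" if "j \<in> {1..d}" for j unfolding \<epsilon>_def using that by (intro Min_le) auto
    have "\<epsilon> \<in> e ` {1..d}" unfolding \<epsilon>_def using d by (intro Min_in) auto
    then have eps: "\<epsilon> > 0" "\<epsilon> \<le> \<delta>" using e by auto
    show ?thesis
    proof (intro exI[of _ \<epsilon>] conjI allI impI eps)
      fix n :: nat assume n: "n > 0"
      show "AE x in M. \<bar>h n x - H n x\<bar> \<le> \<eta> * (\<Sum>j=1..d. indicator (tail_event n \<delta> j) x)
        + (real d * B + B) * (\<Sum>i=1..d. \<Sum>j\<in>{1..d} - {i}. indicator (tail_event n \<epsilon> i \<inter> tail_event n \<epsilon> j) x)"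
        using Z_nonneg X_max AE_space
      proof eventually_elim
        case (elim x)
        define z where "z l = Z x l / sqrt (real n)" for l
        have sn: "sqrt (real n) > 0" using n by simp
        have Zz: "Z x l = sqrt (real n) * z l" for l using sn by (simp add: z_def)
        have z0: "0 \<le> z l" if "l \<in> {1..d}" for l using elim(1) that sn by (simp add: z_def)
        have tail: "x \<in> tail_event n t l \<longleftrightarrow> t < z l" for t l
          using elim(3) sn by (simp add: tail_event_def Zz)
        have XZ: "X x i = max_map d a (\<lambda>l. sqrt (real n) * z l) i" if "i \<in> {1..d}" for i
          using elim(2) that by (simp add: max_map_def Zz)
        have "enorm d (X x) = sqrt (real n) * enorm d (max_map d a z)"
          using enorm_cong[OF XZ] enorm_max_map_scale[of "sqrt (real n)" z] by simp
        moreover have "angle d (X x) = angle d (max_map d a z)"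
          using angle_cong[OF XZ] angle_max_map_scale[OF sn, of z] by simp
        ultimately have sc: "scaled n x = (ereal (enorm d (max_map d a z)), angle d (max_map d a z))"
          using sn by (simp add: scaled_def)
        have Hz: "H n x = (\<Sum>j=1..d. \<phi> j (z j * col_norm j))"
          unfolding H_def z_def by (simp add: mult.commute)
        have phz: "\<phi> j (z j * col_norm j) = 0" if "j \<in> {1..d}" "z j \<le> \<delta>" for j
        proof -
          have "z j * col_norm j \<le> \<delta> * max_dilation"
            using that z0 col_norm_pos col_norm_le_max_dilation \<delta>(1) by (intro mult_mono) (auto intro: less_imp_le)
          then show ?thesis using phi0 that \<delta>(2) by simp
        qed
        have nn: "0 \<le> \<eta> * (\<Sum>j=1..d. indicator (tail_event n \<delta> j) x)"
          "0 \<le> (\<Sum>i=1..d. \<Sum>j\<in>{1..d} - {i}. indicat_real (tail_event n \<epsilon> i \<inter> tail_event n \<epsilon> j) x)"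
          using \<eta> by (auto intro!: mult_nonneg_nonneg sum_nonneg)
        consider "\<forall>j\<in>{1..d}. z j \<le> \<delta>"
          | j where "j \<in> {1..d}" "\<delta> < z j" "\<forall>l\<in>{1..d} - {j}. z l \<le> \<epsilon>"
          | i j where "i \<in> {1..d}" "j \<in> {1..d} - {i}" "\<epsilon> < z i" "\<epsilon> < z j"
        proof (cases "\<forall>j\<in>{1..d}. z j \<le> \<delta>")
          case False
          then obtain j where j: "j \<in> {1..d}" "\<delta> < z j" by force
          show ?thesis
          proof (cases "\<forall>l\<in>{1..d} - {j}. z l \<le> \<epsilon>")
            case True
            then show ?thesis using j that(2) by blast
          next
            case False
            then obtain l where "l \<in> {1..d} - {j}" "\<epsilon> < z l" by force
            then show ?thesis using j eps(2) that(3)[of j l] by auto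
          qed
        qed (use that(1) in blast)
        then show ?case
        proof cases
          case 1
          have "enorm d (max_map d a z) \<le> \<delta> * max_dilation" using 1 z0 \<delta>(1) by (intro enorm_max_map_le) auto
          then have "h n x = 0" using B(4) \<delta>(2) by (auto simp: h_def sc indicator_def)
          moreover have "H n x = 0" unfolding Hz using phz 1 by (intro sum.neutral) auto
          moreover have "0 \<le> (real d * B + B) * (\<Sum>i=1..d. \<Sum>j\<in>{1..d} - {i}. indicat_real (tail_event n \<epsilon> i \<inter> tail_event n \<epsilon> j) x)"
            using nn(2) B(1) by (intro mult_nonneg_nonneg) auto
          ultimately show ?thesis using nn(1) by simp
        next
          case 2
          have zj: "0 < z j" using 2(2) \<delta>(1) by linarith
          have pos: "0 < enorm d (max_map d a z)" using max_map_pos[of z j] z0 2(1) zj by blast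
          then have "scaled n x \<in> ?S" unfolding sc using z0 max_map_nonneg by (auto intro!: angle_Theta)
          then have h: "h n x = g (scaled n x)" by (simp add: h_def)
          have "z l \<le> \<delta>" if "l \<in> {1..d} - {j}" for l using 2(3) that eps(2) by force
          then have "H n x = \<phi> j (z j * col_norm j)"
            unfolding Hz using 2(1) phz by (subst sum.remove[of _ j]) (auto intro!: sum.neutral)
          also have "\<dots> = g (ereal (z j * col_norm j), col_angle d a j)"
            using zj col_norm_pos[OF 2(1)] by (simp add: \<phi>_def)
          finally have H: "H n x = g (ereal (z j * col_norm j), col_angle d a j)" .
          have "\<forall>l\<in>{1..d} - {j}. z l \<le> e j" using 2(3) eps_le[OF 2(1)] by force
          then have "\<bar>h n x - H n x\<bar> \<le> \<eta>" using e 2(1,2) z0 unfolding h H sc by blast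
          also have "\<eta> \<le> \<eta> * (\<Sum>j=1..d. indicator (tail_event n \<delta> j) x)"
          proof -
            have "indicat_real (tail_event n \<delta> j) x \<le> (\<Sum>j=1..d. indicator (tail_event n \<delta> j) x)"
              using 2(1) by (intro member_le_sum) auto
            then show ?thesis using tail[of \<delta> j] 2(2) \<eta> by simp
          qed
          finally show ?thesis using nn(2) B(1) by (simp add: add_increasing2)
        next
          case 3
          have "indicat_real (tail_event n \<epsilon> i \<inter> tail_event n \<epsilon> j) x \<le> (\<Sum>j\<in>{1..d} - {i}. indicator (tail_event n \<epsilon> i \<inter> tail_event n \<epsilon> j) x)"
            using 3(2) by (intro member_le_sum) auto
          also have "\<dots> \<le> (\<Sum>i=1..d. \<Sum>j\<in>{1..d} - {i}. indicator (tail_event n \<epsilon> i \<inter> tail_event n \<epsilon> j) x)"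
            using 3(1) by (intro member_le_sum) (auto intro!: sum_nonneg)
          finally have "1 \<le> (\<Sum>i=1..d. \<Sum>j\<in>{1..d} - {i}. indicat_real (tail_event n \<epsilon> i \<inter> tail_event n \<epsilon> j) x)"
            using 3 tail by simp
          then have "(real d * B + B) * 1 \<le> (real d * B + B) * (\<Sum>i=1..d. \<Sum>j\<in>{1..d} - {i}. indicat_real (tail_event n \<epsilon> i \<inter> tail_event n \<epsilon> j) x)"
            using B(1) by (intro mult_left_mono) auto
          moreover have "\<bar>h n x - H n x\<bar> \<le> real d * B + B" using hB[of n x] HB[of n x] by linarith
          ultimately show ?thesis by (intro add_increasing[OF nn(1)]) simp
        qed
      qed
    qed
  qed
  have "(\<lambda>n. real n * (LINT x|M. h n x) - real n * (LINT x|M. H n x)) \<longlonglongrightarrow> 0"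
  proof (rule LIMSEQ_I)
    fix r :: real assume r: "r > 0"
    \<comment> \<open>The single-jump part of the error tends to \<open>eta * d / delta^2\<close>,
      which the choice of \<open>eta\<close> makes at most \<open>r / 2\<close>.\<close>
    define D0 where "D0 = real d * (1 / \<delta>\<^sup>2) + 1"
    define \<eta> where "\<eta> = r / (2 * D0)"
    have den: "D0 > 0" by (simp add: D0_def add_nonneg_pos)
    have \<eta>: "\<eta> > 0" using r den by (simp add: \<eta>_def)
    obtain \<epsilon> where \<epsilon>: "\<epsilon> > 0" and AEb: "\<And>n. n > 0 \<Longrightarrow> AE x in M. \<bar>h n x - H n x\<bar> \<le> \<eta> * (\<Sum>j=1..d. indicator (tail_event n \<delta> j) x)
      + (real d * B + B) * (\<Sum>i=1..d. \<Sum>j\<in>{1..d} - {i}. indicator (tail_event n \<epsilon> i \<inter> tail_event n \<epsilon> j) x)"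
      using bound[OF \<eta>] by blast
    define D where "D n = \<eta> * (\<Sum>j=1..d. real n * measure M (tail_event n \<delta> j))
      + (real d * B + B) * (\<Sum>i=1..d. \<Sum>j\<in>{1..d} - {i}. real n * measure M (tail_event n \<epsilon> i \<inter> tail_event n \<epsilon> j))" for n
    have "D \<longlonglongrightarrow> \<eta> * (\<Sum>j=1..d. 1 / \<delta>\<^sup>2) + (real d * B + B) * (\<Sum>i=1..d. \<Sum>j\<in>{1..d} - {i}. 0)"
      unfolding D_def using \<delta>(1) \<epsilon>
      by (intro tendsto_add tendsto_mult tendsto_sum tendsto_const tail_event_limit joint_tail_limit) auto
    moreover have "\<eta> * (\<Sum>j=1..d. 1 / \<delta>\<^sup>2) + (real d * B + B) * (\<Sum>i=1..d. \<Sum>j\<in>{1..d} - {i}. 0) < r"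
    proof -
      have "\<eta> * (real d * (1 / \<delta>\<^sup>2)) \<le> \<eta> * D0" using \<eta> by (intro mult_left_mono) (auto simp: D0_def)
      also have "\<dots> = r / 2" using den by (simp add: \<eta>_def)
      also have "\<dots> < r" using r by simp
      finally show ?thesis by simp
    qed
    ultimately have ev: "\<forall>\<^sub>F n in sequentially. D n < r" by (rule order_tendstoD(2))
    have le: "norm (real n * (LINT x|M. h n x) - real n * (LINT x|M. H n x)) \<le> D n" if n: "n > 0" for n
    proof -
      have ind: "integrable M (\<lambda>x. indicat_real (tail_event n \<delta> j) x)" if "j \<in> {1..d}" for j
        using that by (intro integrable_real_indicator) (auto simp: emeasure_finite less_top[symmetric])
      have ind2: "integrable M (\<lambda>x. indicat_real (tail_event n \<epsilon> i \<inter> tail_event n \<epsilon> j) x)" if "i \<in> {1..d}" "j \<in> {1..d} - {i}" for i j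
        using that by (intro integrable_real_indicator) (auto simp: emeasure_finite less_top[symmetric])
      have "\<bar>(LINT x|M. h n x) - (LINT x|M. H n x)\<bar> = \<bar>LINT x|M. h n x - H n x\<bar>" using hi Hi by simp
      also have "\<dots> \<le> (LINT x|M. \<bar>h n x - H n x\<bar>)" by (rule integral_abs_bound)
      also have "\<dots> \<le> (LINT x|M. \<eta> * (\<Sum>j=1..d. indicator (tail_event n \<delta> j) x)
        + (real d * B + B) * (\<Sum>i=1..d. \<Sum>j\<in>{1..d} - {i}. indicator (tail_event n \<epsilon> i \<inter> tail_event n \<epsilon> j) x))"
      proof (rule integral_mono_AE[OF _ _ AEb[OF n]])
        show "integrable M (\<lambda>x. \<bar>h n x - H n x\<bar>)" using hi Hi by simp
        show "integrable M (\<lambda>x. \<eta> * (\<Sum>j=1..d. indicator (tail_event n \<delta> j) x)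
          + (real d * B + B) * (\<Sum>i=1..d. \<Sum>j\<in>{1..d} - {i}. indicator (tail_event n \<epsilon> i \<inter> tail_event n \<epsilon> j) x))"
          by (intro Bochner_Integration.integrable_add integrable_mult_right Bochner_Integration.integrable_sum ind ind2)
      qed
      also have "\<dots> = \<eta> * (\<Sum>j=1..d. measure M (tail_event n \<delta> j))
        + (real d * B + B) * (\<Sum>i=1..d. \<Sum>j\<in>{1..d} - {i}. measure M (tail_event n \<epsilon> i \<inter> tail_event n \<epsilon> j))"
      proof -
        have m1: "(LINT x|M. indicat_real (tail_event n \<delta> j) x) = measure M (tail_event n \<delta> j)" if "j \<in> {1..d}" for j
          using that by simp
        have m2: "(LINT x|M. indicat_real (tail_event n \<epsilon> i \<inter> tail_event n \<epsilon> j) x) = measure M (tail_event n \<epsilon> i \<inter> tail_event n \<epsilon> j)"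
          if "i \<in> {1..d}" "j \<in> {1..d} - {i}" for i j using that by simp
        have s1: "(LINT x|M. (\<Sum>j=1..d. indicat_real (tail_event n \<delta> j) x)) = (\<Sum>j=1..d. measure M (tail_event n \<delta> j))"
          by (rule trans[OF Bochner_Integration.integral_sum sum.cong[OF refl m1]]) (rule ind)
        have s2: "(LINT x|M. (\<Sum>j\<in>{1..d} - {i}. indicat_real (tail_event n \<epsilon> i \<inter> tail_event n \<epsilon> j) x)) =
            (\<Sum>j\<in>{1..d} - {i}. measure M (tail_event n \<epsilon> i \<inter> tail_event n \<epsilon> j))" if "i \<in> {1..d}" for i
          by (rule trans[OF Bochner_Integration.integral_sum sum.cong[OF refl m2[OF that]]]) (rule ind2[OF that])
        have s3: "(LINT x|M. (\<Sum>i=1..d. \<Sum>j\<in>{1..d} - {i}. indicat_real (tail_event n \<epsilon> i \<inter> tail_event n \<epsilon> j) x)) =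
            (\<Sum>i=1..d. \<Sum>j\<in>{1..d} - {i}. measure M (tail_event n \<epsilon> i \<inter> tail_event n \<epsilon> j))"
          by (rule trans[OF Bochner_Integration.integral_sum sum.cong[OF refl s2]])
            (intro Bochner_Integration.integrable_sum ind2)
        show ?thesis
          unfolding s1[symmetric] s3[symmetric] integral_mult_right_zero[symmetric]
          by (intro Bochner_Integration.integral_add integrable_mult_right Bochner_Integration.integrable_sum ind ind2)
      qed
      finally have "real n * \<bar>(LINT x|M. h n x) - (LINT x|M. H n x)\<bar> \<le> real n * (\<eta> * (\<Sum>j=1..d. measure M (tail_event n \<delta> j))
        + (real d * B + B) * (\<Sum>i=1..d. \<Sum>j\<in>{1..d} - {i}. measure M (tail_event n \<epsilon> i \<inter> tail_event n \<epsilon> j)))"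
        by (intro mult_left_mono) auto
      also have "\<dots> = D n"
        unfolding D_def distrib_left sum_distrib_left by (simp add: mult_ac)
      finally show ?thesis by (simp add: abs_mult flip: right_diff_distrib)
    qed
    have "\<forall>\<^sub>F n in sequentially. norm (real n * (LINT x|M. h n x) - real n * (LINT x|M. H n x)) < r"
      using ev eventually_gt_at_top[of 0] by eventually_elim (rule le_less_trans[OF le])
    then show "\<exists>no. \<forall>n\<ge>no. norm (real n * (LINT x|M. h n x) - real n * (LINT x|M. H n x) - 0) < r"
      by (simp add: eventually_sequentially)
  qed
  from tendsto_add[OF this Hlim] show ?thesis by (simp add: h_def \<phi>_def)
qed

end

section \<open>The spectral measure of a max-linear vector\<close>

lemma integral_scale_measure:
  fixes f :: "'a \<Rightarrow> real"
  assumes "r \<ge> 0" "f \<in> borel_measurable N"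
  shows "(LINT x|scale_measure (ennreal r) N. f x) = r * (LINT x|N. f x)"
proof -
  have "scale_measure (ennreal r) N = density N (\<lambda>_. ennreal r)"
    by (rule measure_eqI) (simp_all add: emeasure_density_const)
  then show ?thesis using assms by (simp add: integral_density)
qed

lemma vague_conv_onD:
  fixes g :: "'a::topological_space \<Rightarrow> real"
  assumes "vague_conv_on S \<mu> \<nu>" "continuous_on S g" "\<exists>K. compact K \<and> K \<subseteq> S \<and> (\<forall>x\<in>S - K. g x = 0)"
  shows "(\<lambda>n. LINT x:S|\<mu> n. g x) \<longlonglongrightarrow> (LINT x:S|\<nu>. g x)"
  by (rule mp[OF spec[OF assms(1)[unfolded vague_conv_on_def]] conjI[OF assms(2,3)]])

definition RV_space :: "nat \<Rightarrow> (ereal \<times> (nat \<Rightarrow> real)) set" where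
  "RV_space d = {0<..} \<times> Theta_pos d"

lemma RV_space_measurable: "RV_space d \<in> sets (borel \<Otimes>\<^sub>M Rvec d)"
  unfolding RV_space_def using Theta_sets by (intro pair_measureI) auto

lemma RV_space_continuous_measurable:
  fixes g :: "ereal \<times> (nat \<Rightarrow> real) \<Rightarrow> real"
  assumes "continuous_on (RV_space d) g"
  shows "(\<lambda>p. indicat_real (RV_space d) p * g p) \<in> borel_measurable (borel \<Otimes>\<^sub>M Rvec d)"
proof -
  have "(\<lambda>p. (fst p, snd p)) \<in> borel \<Otimes>\<^sub>M Rvec d \<rightarrow>\<^sub>M borel \<Otimes>\<^sub>M (borel :: (nat \<Rightarrow> real) measure)"
    by (intro measurable_Pair measurable_fst measurable_compose[OF measurable_snd measurable_Rvec_borel])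
  then have "(\<lambda>p. p) \<in> borel \<Otimes>\<^sub>M Rvec d \<rightarrow>\<^sub>M (borel :: (ereal \<times> (nat \<Rightarrow> real)) measure)"
    by (simp add: borel_prod[where 'a = ereal and 'b = "nat \<Rightarrow> real", symmetric])
  then have "(\<lambda>p. p) \<in> restrict_space (borel \<Otimes>\<^sub>M Rvec d) (RV_space d) \<rightarrow>\<^sub>M restrict_space borel (RV_space d)"
    by (intro measurable_restrict_space3) auto
  then have "g \<in> borel_measurable (restrict_space (borel \<Otimes>\<^sub>M Rvec d) (RV_space d))"
    by (rule measurable_compose) (rule borel_measurable_continuous_on_restrict[OF assms])
  then have "(\<lambda>p. indicat_real (RV_space d) p *\<^sub>R g p) \<in> borel_measurable (borel \<Otimes>\<^sub>M Rvec d)"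
    using RV_space_measurable by (subst (asm) borel_measurable_restrict_space_iff) (auto simp: sets.Int_space_eq2)
  then show ?thesis by simp
qed

text \<open>The total mass of the product may be infinite, but an integrand that vanishes for radii
  up to \<open>delta\<close> lives on a set of finite mass, which makes Fubini applicable.\<close>

lemma nu2_pair_integral:
  fixes F :: "ereal \<times> (nat \<Rightarrow> real) \<Rightarrow> real"
  assumes H: "finite_measure H" "sets H = sets (restrict_space (Rvec d) (Theta_pos d))"
    and F: "F \<in> borel_measurable (borel \<Otimes>\<^sub>M Rvec d)"
    and B: "\<And>p. \<bar>F p\<bar> \<le> B" and \<delta>: "\<delta> > 0" "\<And>r w. r \<le> ereal \<delta> \<Longrightarrow> F (r, w) = 0"
  shows "(LINT p|(nu2 \<Otimes>\<^sub>M H). F p) = (LINT w|H. LINT r|nu2. F (r, w))"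
proof -
  interpret H: finite_measure H by (rule H)
  interpret N: sigma_finite_measure nu2 by (rule sigma_finite_nu2)
  interpret P: pair_sigma_finite nu2 H ..
  have "(\<lambda>p. (fst p, snd p)) \<in> nu2 \<Otimes>\<^sub>M H \<rightarrow>\<^sub>M borel \<Otimes>\<^sub>M Rvec d"
  proof (intro measurable_Pair)
    have "(\<lambda>w. w) \<in> H \<rightarrow>\<^sub>M Rvec d"
      unfolding measurable_cong_sets[OF H(2) refl] by (rule measurable_restrict_space1) simp
    then show "snd \<in> nu2 \<Otimes>\<^sub>M H \<rightarrow>\<^sub>M Rvec d" using measurable_compose[OF measurable_snd] by blast
  qed simp
  then have Fm: "F \<in> borel_measurable (nu2 \<Otimes>\<^sub>M H)" using measurable_compose[OF _ F] by simp
  have spH: "space H = Theta_pos d"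
    using sets_eq_imp_space_eq[OF H(2)] Theta_space by (simp add: space_restrict_space Int_absorb2)
  let ?A = "{ereal \<delta><..} \<times> space H"
  have "integrable (nu2 \<Otimes>\<^sub>M H) F"
  proof (rule integrableI_bounded_set[OF _ Fm])
    show "?A \<in> sets (nu2 \<Otimes>\<^sub>M H)" by (intro pair_measureI) auto
    have "emeasure (nu2 \<Otimes>\<^sub>M H) ?A = emeasure nu2 {ereal \<delta><..} * emeasure H (space H)"
      by (intro H.emeasure_pair_measure_Times) auto
    then show "emeasure (nu2 \<Otimes>\<^sub>M H) ?A < \<infinity>"
      using \<delta>(1) H.emeasure_finite[of "space H"]
      by (auto simp: emeasure_nu2 ennreal_mult_eq_top_iff less_top[symmetric])
    show "AE p in nu2 \<Otimes>\<^sub>M H. p \<in> ?A \<longrightarrow> norm (F p) \<le> B" using B by simp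
    show "AE p in nu2 \<Otimes>\<^sub>M H. p \<notin> ?A \<longrightarrow> F p = 0"
    proof (intro AE_I2 impI)
      fix p assume p: "p \<in> space (nu2 \<Otimes>\<^sub>M H)" "p \<notin> ?A"
      then have "fst p \<le> ereal \<delta>" by (cases p) (auto simp: space_pair_measure not_less)
      then show "F p = 0" using \<delta>(2)[of "fst p" "snd p"] by simp
    qed
  qed
  then show ?thesis using P.integral_snd[of "\<lambda>r w. F (r, w)"] by simp
qed

context ml_matrix
begin

definition discrete_spectral :: "(nat \<Rightarrow> real) measure" where
  "discrete_spectral = distr (point_measure {1..d} (\<lambda>j. ennreal (col_sq d a j)))
     (restrict_space (Rvec d) (Theta_pos d)) (col_angle d a)"

lemma col_angle_measurable:
  "col_angle d a \<in> point_measure {1..d} f \<rightarrow>\<^sub>M restrict_space (Rvec d) (Theta_pos d)"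
  using col_angle_Theta subsetD[OF Theta_space col_angle_Theta]
  by (auto simp: space_restrict_space)

lemma discrete_spectral_integral:
  fixes f :: "(nat \<Rightarrow> real) \<Rightarrow> real"
  assumes "f \<in> borel_measurable (restrict_space (Rvec d) (Theta_pos d))"
  shows "(LINT w|discrete_spectral. f w) = (\<Sum>j=1..d. col_sq d a j * f (col_angle d a j))"
proof -
  have "0 \<le> col_sq d a j" for j by (simp add: col_sq_def sum_nonneg)
  then show ?thesis
    unfolding discrete_spectral_def integral_distr[OF col_angle_measurable assms]
    by (subst lebesgue_integral_point_measure_finite) simp_all
qed

lemma finite_discrete_spectral: "finite_measure discrete_spectral"
proof -
  have "finite_measure (point_measure {1..d} (\<lambda>j. ennreal (col_sq d a j)))"
    by (rule finite_measureI) (simp add: space_point_measure emeasure_point_measure_finite)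
  then show ?thesis unfolding discrete_spectral_def by (rule finite_measure.finite_measure_distr[OF _ col_angle_measurable])
qed

end

context max_linear
begin

lemma X_nonneg: "AE x in M. \<forall>i\<in>{1..d}. 0 \<le> X x i"
  using Z_nonneg X_max
proof eventually_elim
  case (elim x)
  then show ?case using max_map_nonneg[of "Z x"] by (auto simp: max_map_def)
qed

lemma scaled_eq: "(\<lambda>x. (ereal (enorm d (X x) / sqrt (real n)), angle d (X x))) = scaled n"
  by (simp add: scaled_def fun_eq_iff)

lemma scaled_in_RV_space:
  assumes "\<forall>i\<in>{1..d}. 0 \<le> X x i" "enorm d (X x) > 0" "n > 0"
  shows "scaled n x \<in> RV_space d"
  using assms by (auto simp: scaled_def RV_space_def intro!: angle_Theta)

lemma test_sequence:
  fixes g :: "ereal \<times> (nat \<Rightarrow> real) \<Rightarrow> real"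
  assumes "continuous_on (RV_space d) g"
  shows "(LINT p:RV_space d|scale_measure (ennreal (real n)) (distr M (borel \<Otimes>\<^sub>M Rvec d) (scaled n)). g p) =
    real n * (LINT x|M. indicator (RV_space d) (scaled n x) * g (scaled n x))"
  unfolding set_lebesgue_integral_def using RV_space_continuous_measurable[OF assms]
  by (simp add: integral_scale_measure integral_distr)

theorem rv2_spectral_X: "rv2_spectral M d X discrete_spectral"
  unfolding rv2_spectral_def
proof (intro conjI)
  show "sets discrete_spectral = sets (restrict_space (Rvec d) (Theta_pos d))"
    by (simp add: discrete_spectral_def)
  show "vague_conv_on ({0<..} \<times> Theta_pos d)
       (\<lambda>n. scale_measure (ennreal (real n)) (distr M (borel \<Otimes>\<^sub>M Rvec d)
             (\<lambda>x. (ereal (enorm d (X x) / sqrt (real n)), angle d (X x)))))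
       (nu2 \<Otimes>\<^sub>M discrete_spectral)"
    unfolding vague_conv_on_def
  proof (intro allI impI, elim conjE exE)
    fix g :: "ereal \<times> (nat \<Rightarrow> real) \<Rightarrow> real" and K
    assume g: "continuous_on ({0<..} \<times> Theta_pos d) g" and K: "compact K" "K \<subseteq> {0<..} \<times> Theta_pos d"
      "\<forall>x\<in>({0<..} \<times> Theta_pos d) - K. g x = 0"
    note meas = RV_space_continuous_measurable[unfolded RV_space_def, OF g]
    obtain B \<delta> where B: "B > 0" "\<delta> > 0" "\<And>x. x \<in> {0<..} \<times> Theta_pos d \<Longrightarrow> \<bar>g x\<bar> \<le> B"
      "\<And>r w. r \<le> ereal \<delta> \<Longrightarrow> (r, w) \<in> {0<..} \<times> Theta_pos d \<Longrightarrow> g (r, w) = 0"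
      using finite_test_function_bound[OF g K(1,2)] K(3) by blast
    let ?F = "\<lambda>p. indicat_real ({0<..} \<times> Theta_pos d) p * g p"
    have "(LINT p|(nu2 \<Otimes>\<^sub>M discrete_spectral). ?F p) = (LINT w|discrete_spectral. LINT r|nu2. ?F (r, w))"
      by (rule nu2_pair_integral[OF finite_discrete_spectral _ meas, of B \<delta>])
         (use B in \<open>auto simp: discrete_spectral_def indicator_def\<close>)
    also have "\<dots> = (\<Sum>j=1..d. col_sq d a j * (LINT r|nu2. ?F (r, col_angle d a j)))"
    proof (rule discrete_spectral_integral)
      interpret N: sigma_finite_measure nu2 by (rule sigma_finite_nu2)
      have "(\<lambda>p. ?F (snd p, fst p)) \<in> borel_measurable (restrict_space (Rvec d) (Theta_pos d) \<Otimes>\<^sub>M nu2)"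
      proof (rule measurable_compose[OF _ meas])
        show "(\<lambda>p. (snd p, fst p)) \<in> restrict_space (Rvec d) (Theta_pos d) \<Otimes>\<^sub>M nu2 \<rightarrow>\<^sub>M borel \<Otimes>\<^sub>M Rvec d"
          by (intro measurable_Pair measurable_compose[OF measurable_fst measurable_restrict_space1] ) auto
      qed
      then show "(\<lambda>w. LINT r|nu2. ?F (r, w)) \<in> borel_measurable (restrict_space (Rvec d) (Theta_pos d))"
        by (intro N.borel_measurable_lebesgue_integral) (simp add: case_prod_beta')
    qed
    also have "\<dots> = (\<Sum>j=1..d. col_sq d a j * (LINT r|nu2_real. indicator {0<..} r * g (ereal r, col_angle d a j)))"
    proof (intro sum.cong refl arg_cong2[of _ _ _ _ "(*)"])
      fix j assume j: "j \<in> {1..d}"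
      have "(\<lambda>r. ?F (r, col_angle d a j)) \<in> borel_measurable borel"
        by (rule measurable_compose[OF _ meas]) (use col_angle_Theta[OF j] Theta_space in \<open>auto intro!: measurable_Pair measurable_const\<close>)
      then show "(LINT r|nu2. ?F (r, col_angle d a j)) = (LINT r|nu2_real. indicator {0<..} r * g (ereal r, col_angle d a j))"
        using col_angle_Theta[OF j] by (simp add: integral_nu2 indicator_def)
    qed
    finally have rhs: "(LINT p:{0<..} \<times> Theta_pos d|(nu2 \<Otimes>\<^sub>M discrete_spectral). g p) =
        (\<Sum>j=1..d. col_sq d a j * (LINT r|nu2_real. indicator {0<..} r * g (ereal r, col_angle d a j)))"
      by (simp add: set_lebesgue_integral_def)
    show "(\<lambda>n. LINT x:{0<..} \<times> Theta_pos d|scale_measure (ennreal (real n)) (distr M (borel \<Otimes>\<^sub>M Rvec d)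
             (\<lambda>x. (ereal (enorm d (X x) / sqrt (real n)), angle d (X x)))). g x)
      \<longlonglongrightarrow> (LINT x:{0<..} \<times> Theta_pos d|(nu2 \<Otimes>\<^sub>M discrete_spectral). g x)"
      unfolding rhs scaled_eq test_sequence[unfolded RV_space_def, OF g]
      by (rule single_big_jump[OF g K(1,2) bspec[OF K(3)] meas])
  qed
qed (use X_nonneg finite_discrete_spectral in auto)

text \<open>Products of a radial ramp and an angular function separate the two factors of the limit;
  the ramp supplies the compact support.\<close>

lemma clip_test_limit:
  assumes f: "continuous_on (Theta_pos d) f" and pq: "0 < p" "p < q"
  shows "(\<lambda>n. real n * (LINT x|M. indicator (RV_space d) (scaled n x) * (clip p q (fst (scaled n x)) * f (snd (scaled n x)))))
    \<longlonglongrightarrow> (LINT r|nu2. clip p q r) * (\<Sum>j=1..d. col_sq d a j * f (col_angle d a j))"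
    and "continuous_on (RV_space d) (\<lambda>y. clip p q (fst y) * f (snd y))"
    and "\<exists>K. compact K \<and> K \<subseteq> RV_space d \<and> (\<forall>x\<in>RV_space d - K. clip p q (fst x) * f (snd x) = 0)"
proof -
  let ?g = "\<lambda>y. clip p q (fst y) * f (snd y)"
  show g: "continuous_on (RV_space d) ?g"
    unfolding RV_space_def
    by (intro continuous_on_mult continuous_on_compose2[OF clip_continuous[OF pq(2)]] continuous_on_compose2[OF f]
        continuous_on_fst continuous_on_snd continuous_on_id) auto
  let ?K = "{ereal p..} \<times> Theta_pos d"
  have K: "compact ?K" by (intro compact_Times compact_Theta) (simp add: compact_eq_closed)
  have "0 < ereal p" using pq by simp
  from less_le_trans[OF this] have sub: "?K \<subseteq> RV_space d" by (auto simp: RV_space_def)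
  have zero: "?g x = 0" if "x \<in> RV_space d - ?K" for x
    using that clip_le[OF pq(2), of "fst x"] by (cases "fst x \<le> ereal p") (auto simp: RV_space_def)
  show "\<exists>K. compact K \<and> K \<subseteq> RV_space d \<and> (\<forall>x\<in>RV_space d - K. ?g x = 0)"
    using K sub zero by blast
  have lim: "(\<lambda>n. real n * (LINT x|M. indicator (RV_space d) (scaled n x) * ?g (scaled n x))) \<longlonglongrightarrow>
      (\<Sum>j=1..d. col_sq d a j * (LINT r|nu2_real. indicator {0<..} r * ?g (ereal r, col_angle d a j)))"
    using single_big_jump[of ?g ?K, folded RV_space_def, OF g K sub zero RV_space_continuous_measurable[OF g]] .
  have factor: "(LINT r|nu2_real. indicator {0<..} r * ?g (ereal r, w)) = (LINT r|nu2. clip p q r) * f w" for w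
  proof -
    have "(LINT r|nu2_real. indicator {0<..} r * ?g (ereal r, w)) = (LINT r|nu2_real. clip p q (ereal r) * f w)"
      using clip_le[OF pq(2)] pq by (intro Bochner_Integration.integral_cong) (auto simp: indicator_def not_less)
    then show ?thesis using pq by (simp add: integral_nu2)
  qed
  have "(\<Sum>j=1..d. col_sq d a j * ((LINT r|nu2. clip p q r) * f (col_angle d a j))) =
      (LINT r|nu2. clip p q r) * (\<Sum>j=1..d. col_sq d a j * f (col_angle d a j))"
    by (simp add: sum_distrib_left mult.left_commute)
  then show "(\<lambda>n. real n * (LINT x|M. indicator (RV_space d) (scaled n x) * ?g (scaled n x)))
    \<longlonglongrightarrow> (LINT r|nu2. clip p q r) * (\<Sum>j=1..d. col_sq d a j * f (col_angle d a j))"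
    using lim unfolding factor by simp
qed

text \<open>\<open>spectral_measure\<close> is only a choice, so its integrals have to be computed
  for every admissible \<open>H\<close>. Testing vague convergence with the ramp from 1 to 2 times
  \<open>f\<close> determines the product of the radial and the angular integral, and the radial one
  is at least \<open>1/4\<close>.\<close>

lemma spectral_integral_unique:
  assumes H: "rv2_spectral M d X H" and f: "continuous_on (Theta_pos d) f"
  shows "(LINT w|H. f w) = (\<Sum>j=1..d. col_sq d a j * f (col_angle d a j))"
proof -
  let ?g = "\<lambda>y. clip 1 2 (fst y) * f (snd y)"
  have "0 < (1 :: real)" "(1 :: real) < 2" by simp_all
  note lim = clip_test_limit[OF f this]
  have setsH: "sets H = sets (restrict_space (Rvec d) (Theta_pos d))" and finH: "finite_measure H"
    and vague: "vague_conv_on (RV_space d) (\<lambda>n. scale_measure (ennreal (real n)) (distr M (borel \<Otimes>\<^sub>M Rvec d) (scaled n))) (nu2 \<Otimes>\<^sub>M H)"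
    using H unfolding rv2_spectral_def RV_space_def scaled_eq by blast+
  have spH: "space H = Theta_pos d"
    using sets_eq_imp_space_eq[OF setsH] Theta_space by (simp add: space_restrict_space Int_absorb2)
  have "(\<lambda>n. LINT p:RV_space d|scale_measure (ennreal (real n)) (distr M (borel \<Otimes>\<^sub>M Rvec d) (scaled n)). ?g p)
      \<longlonglongrightarrow> (LINT p:RV_space d|(nu2 \<Otimes>\<^sub>M H). ?g p)"
    by (rule vague_conv_onD[OF vague lim(2,3)])
  then have "(\<lambda>n. real n * (LINT x|M. indicator (RV_space d) (scaled n x) * ?g (scaled n x)))
      \<longlonglongrightarrow> (LINT p:RV_space d|(nu2 \<Otimes>\<^sub>M H). ?g p)"
    unfolding test_sequence[OF lim(2)] .
  then have eq: "(LINT p:RV_space d|(nu2 \<Otimes>\<^sub>M H). ?g p) = (LINT r|nu2. clip 1 2 r) * (\<Sum>j=1..d. col_sq d a j * f (col_angle d a j))"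
    using lim(1) by (rule LIMSEQ_unique)
  obtain B where B: "\<And>w. w \<in> Theta_pos d \<Longrightarrow> \<bar>f w\<bar> \<le> B"
    using compact_imp_bounded[OF compact_continuous_image[OF f compact_Theta]] unfolding bounded_iff by auto
  have "col_angle d a 1 \<in> Theta_pos d" using d by (intro col_angle_Theta) simp
  then have B0: "B \<ge> 0" using order_trans[OF abs_ge_zero B] by blast
  have "(LINT p:RV_space d|(nu2 \<Otimes>\<^sub>M H). ?g p) = (LINT p|(nu2 \<Otimes>\<^sub>M H). indicator (RV_space d) p * ?g p)"
    by (simp add: set_lebesgue_integral_def)
  also have "\<dots> = (LINT w|H. LINT r|nu2. indicator (RV_space d) (r, w) * ?g (r, w))"
  proof (rule nu2_pair_integral[OF finH setsH RV_space_continuous_measurable[OF lim(2)], of B 1])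
    show "\<bar>indicator (RV_space d) p * ?g p\<bar> \<le> B" for p
    proof (cases "p \<in> RV_space d")
      case True
      have "\<bar>clip 1 2 (fst p)\<bar> * \<bar>f (snd p)\<bar> \<le> 1 * B"
        using True B clip_01[of 1 2 "fst p"] by (intro mult_mono) (auto simp: RV_space_def)
      then show ?thesis using True by (simp add: abs_mult)
    qed (use B0 in simp)
  qed (use clip_le[of 1 2] in auto)
  also have "\<dots> = (LINT w|H. (LINT r|nu2. clip 1 2 r) * f w)"
  proof (rule Bochner_Integration.integral_cong[OF refl])
    fix w assume "w \<in> space H"
    then have pt: "indicator (RV_space d) (r, w) * ?g (r, w) = clip 1 2 r * f w" for r
      using clip_le[of 1 2 r] order_trans[of r 0 "ereal 1"] spH
      by (cases "0 < r") (auto simp: RV_space_def indicator_def not_less)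
    show "(LINT r|nu2. indicator (RV_space d) (r, w) * ?g (r, w)) = (LINT r|nu2. clip 1 2 r) * f w"
      unfolding pt by (rule integral_mult_left_zero)
  qed
  also have "\<dots> = (LINT r|nu2. clip 1 2 r) * (LINT w|H. f w)" by (rule integral_mult_right_zero)
  finally have "(LINT r|nu2. clip 1 2 r) * (LINT w|H. f w) = (LINT r|nu2. clip 1 2 r) * (\<Sum>j=1..d. col_sq d a j * f (col_angle d a j))"
    unfolding eq by (rule sym)
  moreover have "(LINT r|nu2. clip 1 2 r) > 0"
    using clip_integral(1)[of 1 2] by (auto intro: less_le_trans[of 0 "1/4"])
  ultimately show ?thesis by simp
qed

text \<open>The function 1 shows that the total mass is the sum of all squared entries, which is
  \<open>d\<close> for rows of norm 1.\<close>

lemma norm_spectral_integral: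
  assumes std: "standardized d a" and f: "continuous_on (Theta_pos d) f"
  shows "(LINT w|norm_spectral M d X. f w) = (\<Sum>j=1..d. col_sq d a j / real d * f (col_angle d a j))"
proof -
  define H where "H = spectral_measure M d X"
  have H: "rv2_spectral M d X H"
    unfolding H_def spectral_measure_def using rv2_spectral_X by (rule someI)
  then have setsH: "sets H = sets (restrict_space (Rvec d) (Theta_pos d))" and finH: "finite_measure H"
    by (auto simp: rv2_spectral_def)
  interpret H: finite_measure H by (rule finH)
  have spH: "space H = Theta_pos d"
    using sets_eq_imp_space_eq[OF setsH] Theta_space by (simp add: space_restrict_space Int_absorb2)
  have "measure H (Theta_pos d) = (LINT w|H. 1)" by (simp add: spH)
  also have "\<dots> = real d" using spectral_integral_unique[OF H continuous_on_const[of _ 1]] sum_col_sq[OF std] by simp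
  finally have "inverse (emeasure H (Theta_pos d)) = ennreal (1 / real d)"
    using d by (simp add: H.emeasure_eq_measure inverse_ennreal inverse_eq_divide)
  then have "norm_spectral M d X = scale_measure (ennreal (1 / real d)) H"
    by (simp add: norm_spectral_def H_def)
  moreover have "f \<in> borel_measurable H"
    using continuous_on_measurable_Rvec[OF f Theta_space] by (simp add: measurable_cong_sets[OF setsH refl])
  ultimately have "(LINT w|norm_spectral M d X. f w) = 1 / real d * (LINT w|H. f w)"
    by (simp add: integral_scale_measure)
  then show ?thesis unfolding spectral_integral_unique[OF H f] by (simp add: sum_distrib_left)
qed

section \<open>Tails weighted by a function of the angle\<close>

definition tail_integral :: "((nat \<Rightarrow> real) \<Rightarrow> real) \<Rightarrow> real \<Rightarrow> real" where
  "tail_integral f r = (LINT x|M. indicator {r<..} (enorm d (X x)) * (indicator (Theta_pos d) (angle d (X x)) * f (angle d (X x))))"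

context
  fixes f :: "(nat \<Rightarrow> real) \<Rightarrow> real"
  assumes f: "continuous_on (Theta_pos d) f" and f_nonneg: "\<And>w. w \<in> Theta_pos d \<Longrightarrow> 0 \<le> f w"
begin

text \<open>The indicator cuts off directions outside the positive sphere, where neither continuity
  nor the sign of \<open>f\<close> is controlled. They can occur on a null set, and also when the
  norm is 0.\<close>

definition angle_value :: "'a \<Rightarrow> real" where
  "angle_value x = indicator (Theta_pos d) (angle d (X x)) * f (angle d (X x))"

lemma angle_value_bounded: "\<exists>B\<ge>0. \<forall>x. \<bar>angle_value x\<bar> \<le> B"
proof -
  obtain B where B: "\<And>w. w \<in> Theta_pos d \<Longrightarrow> \<bar>f w\<bar> \<le> B"
    using compact_imp_bounded[OF compact_continuous_image[OF f compact_Theta]] unfolding bounded_iff by auto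
  have "\<bar>angle_value x\<bar> \<le> \<bar>B\<bar>" for x
    using order_trans[OF B abs_ge_self] by (cases "angle d (X x) \<in> Theta_pos d") (auto simp: angle_value_def)
  then show ?thesis by (intro exI[of _ "\<bar>B\<bar>"]) simp
qed

lemma angle_value_nonneg: "0 \<le> angle_value x"
  using f_nonneg by (simp add: angle_value_def indicator_def)

lemma angle_value_measurable [measurable]: "angle_value \<in> borel_measurable M"
proof -
  have "f \<in> borel_measurable (restrict_space (Rvec d) (Theta_pos d))"
    by (rule continuous_on_measurable_Rvec[OF f Theta_space])
  then have "(\<lambda>w. indicat_real (Theta_pos d) w *\<^sub>R f w) \<in> borel_measurable (Rvec d)"
    using Theta_sets by (subst (asm) borel_measurable_restrict_space_iff) (auto simp: sets.Int_space_eq2)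
  then have "(\<lambda>w. indicat_real (Theta_pos d) w * f w) \<in> borel_measurable (Rvec d)" by simp
  then show ?thesis unfolding angle_value_def[abs_def]
    by (rule measurable_compose[rotated]) measurable
qed

lemma weighted_integrable:
  assumes [measurable]: "w \<in> borel_measurable M" and w: "\<And>x. 0 \<le> w x" "\<And>x. w x \<le> 1"
  shows "integrable M (\<lambda>x. w x * angle_value x)"
proof -
  obtain B where B: "B \<ge> 0" "\<And>x. \<bar>angle_value x\<bar> \<le> B" using angle_value_bounded by blast
  have "\<bar>w x\<bar> * \<bar>angle_value x\<bar> \<le> 1 * B" for x
    using w[of x] B by (intro mult_mono) auto
  then show ?thesis by (intro integrable_const_bound[of _ B]) (auto simp: abs_mult)
qed

lemma clip_limit:
  assumes pq: "0 < p" "p < q"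
  shows "(\<lambda>n. real n * (LINT x|M. clip p q (ereal (enorm d (X x) / sqrt (real n))) * angle_value x))
    \<longlonglongrightarrow> (LINT r|nu2. clip p q r) * (\<Sum>j=1..d. col_sq d a j * f (col_angle d a j))"
proof (rule Lim_transform_eventually[OF clip_test_limit(1)[OF f pq]])
  show "\<forall>\<^sub>F n in sequentially. real n * (LINT x|M. indicator (RV_space d) (scaled n x) * (clip p q (fst (scaled n x)) * f (snd (scaled n x)))) =
    real n * (LINT x|M. clip p q (ereal (enorm d (X x) / sqrt (real n))) * angle_value x)"
    using eventually_gt_at_top[of 0]
  proof eventually_elim
    case (elim n)
    have "(LINT x|M. indicator (RV_space d) (scaled n x) * (clip p q (fst (scaled n x)) * f (snd (scaled n x)))) =
        (LINT x|M. clip p q (ereal (enorm d (X x) / sqrt (real n))) * angle_value x)"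
    proof (rule integral_cong_AE)
      show "(\<lambda>x. indicator (RV_space d) (scaled n x) * (clip p q (fst (scaled n x)) * f (snd (scaled n x)))) \<in> borel_measurable M"
        using measurable_compose[OF scaled_measurable RV_space_continuous_measurable[OF clip_test_limit(2)[OF f pq]]] .
      have [measurable]: "clip p q \<in> borel_measurable borel" using pq by simp
      show "(\<lambda>x. clip p q (ereal (enorm d (X x) / sqrt (real n))) * angle_value x) \<in> borel_measurable M" by measurable
      show "AE x in M. indicator (RV_space d) (scaled n x) * (clip p q (fst (scaled n x)) * f (snd (scaled n x))) =
          clip p q (ereal (enorm d (X x) / sqrt (real n))) * angle_value x"
        using X_nonneg
      proof eventually_elim
        case X: (elim x)
        show ?case
        proof (cases "enorm d (X x) > 0")
          case True
          then have "scaled n x \<in> RV_space d" using scaled_in_RV_space[OF X] elim by simp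
          then show ?thesis by (auto simp: angle_value_def scaled_def RV_space_def)
        next
          case False
          then have "ereal (enorm d (X x) / sqrt (real n)) \<le> ereal p"
            using pq(1) elim by (simp add: divide_nonpos_pos order_trans[of _ 0])
          then show ?thesis using clip_le[OF pq(2)] by (simp add: scaled_def)
        qed
      qed
    qed
    then show ?case by simp
  qed
qed

text \<open>Vague convergence does not test indicators. The indicator of radii above 1 is squeezed
  between a ramp starting at 1 and one ending at 1; since \<open>f\<close> is nonnegative, their
  limits differ from \<open>L\<close> by at most the factors \<open>1 / q^2\<close> and
  \<open>1 / p^2\<close>, which tend to 1.\<close>

lemma tail_integral_sequence:
  "(\<lambda>n. real n * tail_integral f (sqrt (real n))) \<longlonglongrightarrow> (\<Sum>j=1..d. col_sq d a j * f (col_angle d a j))"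
proof -
  define L where "L = (\<Sum>j=1..d. col_sq d a j * f (col_angle d a j))"
  have L: "L \<ge> 0" unfolding L_def using f_nonneg col_angle_Theta col_sq_pos
    by (intro sum_nonneg mult_nonneg_nonneg) (auto intro: less_imp_le)
  have T: "tail_integral f r = (LINT x|M. indicator {r<..} (enorm d (X x)) * angle_value x)" for r
    by (simp add: tail_integral_def angle_value_def)
  have int_ind: "integrable M (\<lambda>x. indicator {r<..} (enorm d (X x)) * angle_value x)" for r
    by (intro weighted_integrable) (auto simp: indicator_def)
  have int_clip: "integrable M (\<lambda>x. clip p q (ereal (enorm d (X x) / sqrt (real n))) * angle_value x)" if "p < q" for p q n
  proof -
    have [measurable]: "clip p q \<in> borel_measurable borel" using that by simp
    show ?thesis using that clip_01 by (intro weighted_integrable) auto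
  qed
  have upper: "real n * tail_integral f (sqrt (real n)) \<le> real n * (LINT x|M. clip p 1 (ereal (enorm d (X x) / sqrt (real n))) * angle_value x)"
    if "p < 1" "n > 0" for p n
    unfolding T
  proof (intro mult_left_mono integral_mono int_ind int_clip that mult_right_mono angle_value_nonneg)
    fix x show "indicator {sqrt (real n)<..} (enorm d (X x)) \<le> clip p 1 (ereal (enorm d (X x) / sqrt (real n)))"
      using clip_01[OF that(1)] clip_ge[OF that(1), of "ereal (enorm d (X x) / sqrt (real n))"] that(2)
      by (auto simp: indicator_def one_ereal_def)
  qed simp
  have lower: "real n * (LINT x|M. clip 1 q (ereal (enorm d (X x) / sqrt (real n))) * angle_value x) \<le> real n * tail_integral f (sqrt (real n))"
    if "1 < q" "n > 0" for q n
    unfolding T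
  proof (intro mult_left_mono integral_mono int_ind int_clip that mult_right_mono angle_value_nonneg)
    fix x show "clip 1 q (ereal (enorm d (X x) / sqrt (real n))) \<le> indicator {sqrt (real n)<..} (enorm d (X x))"
      using clip_01[OF that(1)] clip_le[OF that(1), of "ereal (enorm d (X x) / sqrt (real n))"] that(2)
      by (auto simp: indicator_def not_less)
  qed simp
  have sq: "((\<lambda>p :: real. (1 / p\<^sup>2) * L) \<longlongrightarrow> (1 / 1\<^sup>2) * L) (at 1)"
    by (intro tendsto_intros) simp_all
  show ?thesis unfolding L_def[symmetric]
  proof (rule order_tendstoI)
    fix b assume "L < b"
    then have "\<forall>\<^sub>F p in at 1. (1 / p\<^sup>2) * L < b" using sq by (intro order_tendstoD(2)) auto
    then have "\<forall>\<^sub>F p in at_left 1. (1 / p\<^sup>2) * L < b" by (rule filter_leD[OF at_le, rotated]) simp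
    moreover have "\<forall>\<^sub>F p in at_left (1::real). 0 < p \<and> p < 1" by (auto intro: eventually_at_leftI[of 0])
    ultimately have "\<forall>\<^sub>F p in at_left 1. (1 / p\<^sup>2) * L < b \<and> 0 < p \<and> p < 1" by (rule eventually_conj)
    then obtain p where p: "(1 / p\<^sup>2) * L < b" "0 < p" "p < 1"
      using eventually_happens[of _ "at_left (1::real)"] by auto
    have "(LINT r|nu2. clip p 1 r) * L \<le> (1 / p\<^sup>2) * L"
      using clip_integral(2)[OF p(2,3)] L by (intro mult_right_mono)
    then have "\<forall>\<^sub>F n in sequentially. real n * (LINT x|M. clip p 1 (ereal (enorm d (X x) / sqrt (real n))) * angle_value x) < b"
      using p(1) by (intro order_tendstoD(2)[OF clip_limit[OF p(2,3), folded L_def]]) simp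
    with eventually_gt_at_top[of 0] show "\<forall>\<^sub>F n in sequentially. real n * tail_integral f (sqrt (real n)) < b"
      by eventually_elim (rule le_less_trans[OF upper[OF p(3)]])
  next
    fix b assume "b < L"
    then have "\<forall>\<^sub>F p in at 1. b < (1 / p\<^sup>2) * L" using sq by (intro order_tendstoD(1)) auto
    then have "\<forall>\<^sub>F p in at_right 1. b < (1 / p\<^sup>2) * L" by (rule filter_leD[OF at_le, rotated]) simp
    moreover have "\<forall>\<^sub>F p in at_right (1::real). 1 < p" by (auto simp: eventually_at_right_less)
    ultimately have "\<forall>\<^sub>F p in at_right 1. b < (1 / p\<^sup>2) * L \<and> 1 < p" by (rule eventually_conj)
    then obtain q where q: "b < (1 / q\<^sup>2) * L" "1 < q"
      using eventually_happens[of _ "at_right (1::real)"] by auto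
    have "(1 / q\<^sup>2) * L \<le> (LINT r|nu2. clip 1 q r) * L"
      using clip_integral(1)[OF _ q(2)] L by (intro mult_right_mono) auto
    then have "\<forall>\<^sub>F n in sequentially. b < real n * (LINT x|M. clip 1 q (ereal (enorm d (X x) / sqrt (real n))) * angle_value x)"
      using q(1) by (intro order_tendstoD(1)[OF clip_limit[OF _ q(2), folded L_def]]) simp_all
    with eventually_gt_at_top[of 0] show "\<forall>\<^sub>F n in sequentially. b < real n * tail_integral f (sqrt (real n))"
      by eventually_elim (rule less_le_trans[OF _ lower[OF q(2)]])
  qed
qed

lemma tail_integral_antimono: "r \<le> s \<Longrightarrow> tail_integral f s \<le> tail_integral f r"
proof -
  assume rs: "r \<le> s"
  have int_ind: "integrable M (\<lambda>x. indicator {r<..} (enorm d (X x)) * angle_value x)" for r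
    by (intro weighted_integrable) (auto simp: indicator_def)
  show ?thesis
    unfolding tail_integral_def angle_value_def[symmetric]
    using rs angle_value_nonneg by (intro integral_mono int_ind mult_right_mono) (auto simp: indicator_def)
qed

lemma tail_integral_nonneg: "0 \<le> tail_integral f r"
  unfolding tail_integral_def angle_value_def[symmetric]
  using angle_value_nonneg by (intro Bochner_Integration.integral_nonneg mult_nonneg_nonneg) auto

text \<open>Passes from the levels \<open>sqrt n\<close> to all real levels: the weighted tail is
  monotone, and \<open>r^2\<close> lies between \<open>N r\<close> and its successor, whose ratio
  tends to 1.\<close>

theorem tail_integral_limit:
  "((\<lambda>r. r\<^sup>2 * tail_integral f r) \<longlongrightarrow> (\<Sum>j=1..d. col_sq d a j * f (col_angle d a j))) at_top"
proof -
  define A where "A n = real n * tail_integral f (sqrt (real n))" for n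
  define N where "N r = nat \<lfloor>r\<^sup>2\<rfloor>" for r :: real
  define L where "L = (\<Sum>j=1..d. col_sq d a j * f (col_angle d a j))"
  have A: "A \<longlonglongrightarrow> L" unfolding A_def L_def by (rule tail_integral_sequence)
  have N: "filterlim N at_top at_top"
    unfolding N_def
    by (intro filterlim_compose[OF filterlim_nat_sequentially] filterlim_compose[OF filterlim_floor_sequentially] filterlim_pow_at_top filterlim_ident) simp
  have ratio: "(\<lambda>n. real (Suc n) / real n) \<longlonglongrightarrow> 1" by (rule LIMSEQ_Suc_n_over_n)
  have ratio': "(\<lambda>n. real n / real (Suc n)) \<longlonglongrightarrow> 1" by (rule LIMSEQ_n_over_Suc_n)
  have up: "((\<lambda>r. real (Suc (N r)) / real (N r) * A (N r)) \<longlongrightarrow> 1 * L) at_top"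
    by (intro tendsto_mult filterlim_compose[OF ratio N] filterlim_compose[OF A N])
  have lo: "((\<lambda>r. real (N r) / real (Suc (N r)) * A (Suc (N r))) \<longlongrightarrow> 1 * L) at_top"
    by (intro tendsto_mult filterlim_compose[OF ratio' N] filterlim_compose[OF LIMSEQ_Suc[OF A] N])
  have bounds: "real (N r) \<le> r\<^sup>2" "r\<^sup>2 \<le> real (Suc (N r))" for r
  proof -
    have "real (N r) = of_int \<lfloor>r\<^sup>2\<rfloor>" by (simp add: N_def)
    then show "real (N r) \<le> r\<^sup>2" "r\<^sup>2 \<le> real (Suc (N r))" by linarith+
  qed
  show ?thesis unfolding L_def[symmetric]
  proof (rule tendsto_sandwich[OF _ _ lo[unfolded mult_1_left] up[unfolded mult_1_left]])
    show "\<forall>\<^sub>F r in at_top. r\<^sup>2 * tail_integral f r \<le> real (Suc (N r)) / real (N r) * A (N r)"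
      using eventually_ge_at_top[of 1]
    proof eventually_elim
      case (elim r)
      have "1 \<le> r\<^sup>2" using elim by simp
      then have "N r > 0" by (simp add: N_def)
      have "sqrt (real (N r)) \<le> r" using bounds(1)[of r] elim by (intro real_le_lsqrt) auto
      then have "r\<^sup>2 * tail_integral f r \<le> real (Suc (N r)) * tail_integral f (sqrt (real (N r)))"
        using bounds(2)[of r] tail_integral_nonneg by (intro mult_mono tail_integral_antimono) auto
      also have "\<dots> = real (Suc (N r)) / real (N r) * A (N r)" using \<open>N r > 0\<close> by (simp add: A_def)
      finally show ?case .
    qed
    show "\<forall>\<^sub>F r in at_top. real (N r) / real (Suc (N r)) * A (Suc (N r)) \<le> r\<^sup>2 * tail_integral f r"
      using eventually_ge_at_top[of 1]
    proof eventually_elim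
      case (elim r)
      have "r \<le> sqrt (real (Suc (N r)))" using bounds(2)[of r] by (intro real_le_rsqrt)
      then have "real (N r) * tail_integral f (sqrt (real (Suc (N r)))) \<le> r\<^sup>2 * tail_integral f r"
        using bounds(1)[of r] tail_integral_nonneg by (intro mult_mono tail_integral_antimono) auto
      then show ?case by (simp add: A_def)
    qed
  qed
qed

end

end

section \<open>The norm of a max-linear vector has no atoms\<close>

context max_linear begin

text \<open>With the other coordinates fixed, the equation is quadratic in \<open>Z j\<close> with
  nonzero leading coefficient and has at most two solutions, each of probability zero.\<close>

lemma weighted_squares_atomless:
  assumes j: "j \<in> {1..d}" and q: "q j \<noteq> 0"
  shows "AE x in M. (\<Sum>l=1..d. q l * (Z x l)\<^sup>2) \<noteq> r"
proof -
  \<comment> \<open>The product-measure locale asks for a probability measure at every index, so the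
    family is continued by the constant 0 outside \<open>{1..d}\<close>.\<close>
  define Z' where "Z' i x = (if i \<in> {1..d} then Z x i else 0)" for i x
  have Z'm[measurable]: "Z' i \<in> borel_measurable M" for i
    unfolding Z'_def by (cases "i \<in> {1..d}") (simp_all del: atLeastAtMost_iff)
  define \<mu> where "\<mu> i = distr M borel (Z' i)" for i
  have prob_mu: "prob_space (\<mu> i)" for i unfolding \<mu>_def by (rule prob_space_distr) measurable
  interpret P: product_prob_space \<mu> by (rule product_prob_spaceI) (rule prob_mu)
  have setsmu[measurable_cong]: "sets (\<mu> i) = sets borel" for i by (simp add: \<mu>_def)
  have sets_P: "sets (Pi\<^sub>M {1..d} \<mu>) = sets (Rvec d)" by (intro sets_PiM_cong) (simp_all add: setsmu)
  have sp_P: "space (Pi\<^sub>M {1..d} \<mu>) = space (Rvec d)" by (rule sets_eq_imp_space_eq[OF sets_P])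
  have law: "distr M (Rvec d) Z = Pi\<^sub>M {1..d} \<mu>"
  proof -
    have "distr M (Rvec d) (\<lambda>x. \<lambda>i\<in>{1..d}. Z x i) = Pi\<^sub>M {1..d} (\<lambda>i. distr M borel (\<lambda>x. Z x i))"
      using Z_indep d by (subst (asm) indep_vars_iff_distr_eq_PiM') auto
    also have "\<dots> = Pi\<^sub>M {1..d} \<mu>"
      by (intro PiM_cong) (auto simp: \<mu>_def Z'_def intro!: distr_cong)
    also have "distr M (Rvec d) (\<lambda>x. \<lambda>i\<in>{1..d}. Z x i) = distr M (Rvec d) Z"
    proof (intro distr_cong refl)
      fix x assume "x \<in> space M"
      then have "Z x \<in> extensional {1..d}" using measurable_space[OF Z_meas] by (auto simp: space_PiM PiE_def)
      then show "(\<lambda>i\<in>{1..d}. Z x i) = Z x" by (rule extensional_restrict)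
    qed
    finally show ?thesis .
  qed
  let ?J = "{1..d} - {j}" and ?A = "{z \<in> space (Rvec d). (\<Sum>l=1..d. q l * (z l)\<^sup>2) = r}"
  have ins: "insert j ?J = {1..d}" using j by auto
  have A: "?A \<in> sets (Rvec d)" by measurable
  have "emeasure (Pi\<^sub>M {1..d} \<mu>) ?A = (\<integral>\<^sup>+z. indicator ?A z \<partial>Pi\<^sub>M {1..d} \<mu>)"
    using A sets_P by simp
  also have "\<dots> = (\<integral>\<^sup>+z. \<integral>\<^sup>+y. indicator ?A (z(j := y)) \<partial>\<mu> j \<partial>Pi\<^sub>M ?J \<mu>)"
    using A sets_P by (intro P.product_nn_integral_insert[of ?J j "indicator ?A", unfolded ins]) auto
  also have "\<dots> = (\<integral>\<^sup>+z. 0 \<partial>Pi\<^sub>M ?J \<mu>)"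
  proof (rule nn_integral_cong)
    fix z assume "z \<in> space (Pi\<^sub>M ?J \<mu>)"
    define c where "c = (r - (\<Sum>l\<in>?J. q l * (z l)\<^sup>2)) / q j"
    have null: "AE y in \<mu> j. y \<noteq> w" for w
    proof -
      have "{x \<in> space M. Z x j = w} \<in> sets M" using j by measurable
      then have "AE x in M. Z x j \<noteq> w"
        using Z_atomless[OF j, of w] by (intro AE_I[of _ _ "{x \<in> space M. Z x j = w}"]) (auto simp: emeasure_eq_measure)
      then show ?thesis unfolding \<mu>_def using j by (subst AE_distr_iff) (auto simp: Z'_def)
    qed
    have "(\<integral>\<^sup>+y. indicator ?A (z(j := y)) \<partial>\<mu> j) = (\<integral>\<^sup>+y. 0 \<partial>\<mu> j)"
    proof (rule nn_integral_cong_AE)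
      show "AE y in \<mu> j. indicator ?A (z(j := y)) = (0 :: ennreal)"
        using null[of "sqrt c"] null[of "- sqrt c"]
      proof eventually_elim
        case (elim y)
        have "(\<Sum>l=1..d. q l * ((z(j := y)) l)\<^sup>2) = q j * y\<^sup>2 + (\<Sum>l\<in>?J. q l * (z l)\<^sup>2)"
          using j by (subst sum.remove[of _ j]) (auto intro!: sum.cong)
        moreover have "q j * y\<^sup>2 + (\<Sum>l\<in>?J. q l * (z l)\<^sup>2) \<noteq> r"
        proof
          assume "q j * y\<^sup>2 + (\<Sum>l\<in>?J. q l * (z l)\<^sup>2) = r"
          then have "y\<^sup>2 = c" using q by (simp add: c_def field_simps)
          then have "sqrt c = \<bar>y\<bar>" by (metis real_sqrt_abs)
          then show False using elim by (cases "y \<ge> 0") auto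
        qed
        ultimately show ?case by (simp add: indicator_def)
      qed
    qed
    then show "(\<integral>\<^sup>+y. indicator ?A (z(j := y)) \<partial>\<mu> j) = 0" by simp
  qed
  finally have "emeasure (distr M (Rvec d) Z) ?A = 0" unfolding law by simp
  then have "emeasure M (Z -` ?A \<inter> space M) = 0" using A by (simp add: emeasure_distr)
  moreover have "Z -` ?A \<inter> space M \<in> sets M" using A by (intro measurable_sets[OF Z_meas])
  ultimately show ?thesis
    by (intro AE_I[of _ _ "Z -` ?A \<inter> space M"]) (auto dest: measurable_space[OF Z_meas])
qed

text \<open>On the event that the maximum in coordinate \<open>i\<close> is attained at \<open>\<sigma> i\<close>, the squared norm is a
  fixed nonnegative combination of the independent atom-free \<open>Z\<^sub>j\<^sup>2\<close>.\<close>

lemma enorm_atomless: "measure M {x \<in> space M. enorm d (X x) = r} = 0"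
proof -
  define \<Sigma> where "\<Sigma> = ({1..d} \<rightarrow>\<^sub>E {1..d} :: (nat \<Rightarrow> nat) set)"
  define q where "q \<sigma> j = (\<Sum>i\<in>{i\<in>{1..d}. \<sigma> i = j}. (a i j)\<^sup>2)" for \<sigma> :: "nat \<Rightarrow> nat" and j
  have fin: "finite \<Sigma>" unfolding \<Sigma>_def by (intro finite_PiE) auto
  have "AE x in M. (\<exists>j\<in>{1..d}. q \<sigma> j \<noteq> 0) \<longrightarrow> (\<Sum>l=1..d. q \<sigma> l * (Z x l)\<^sup>2) \<noteq> r\<^sup>2" for \<sigma>
    by (cases "\<exists>j\<in>{1..d}. q \<sigma> j \<noteq> 0") (auto intro: weighted_squares_atomless)
  then have "AE x in M. \<forall>\<sigma>\<in>\<Sigma>. (\<exists>j\<in>{1..d}. q \<sigma> j \<noteq> 0) \<longrightarrow> (\<Sum>l=1..d. q \<sigma> l * (Z x l)\<^sup>2) \<noteq> r\<^sup>2"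
    unfolding AE_finite_all[OF fin] by blast
  \<comment> \<open>A nonzero component makes the norm positive, which excludes
    \<open>r = 0\<close>, the only level compatible with vanishing coefficients
    \<open>q\<close>.\<close>
  moreover have "AE x in M. Z x 1 \<noteq> 0"
    using Z_atomless[of 1 0] d
    by (intro AE_I[of _ _ "{x \<in> space M. Z x 1 = 0}"]) (auto simp: emeasure_eq_measure)
  ultimately have "AE x in M. enorm d (X x) \<noteq> r"
    using Z_nonneg X_max
  proof eventually_elim
    case (elim x)
    show ?case
    proof
      assume r: "enorm d (X x) = r"
      have XZ: "X x i = max_map d a (Z x) i" if "i \<in> {1..d}" for i
        using elim(4) that by (simp add: max_map_def)
      have "enorm d (max_map d a (Z x)) > 0"
        using elim(2,3) d by (intro max_map_pos[of _ 1]) force+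
      then have r0: "r \<noteq> 0" using r enorm_cong[OF XZ] by simp
      have "\<forall>i\<in>{1..d}. \<exists>j. j \<in> {1..d} \<and> X x i = a i j * Z x j"
      proof
        fix i assume i: "i \<in> {1..d}"
        have "(MAX j\<in>{1..d}. a i j * Z x j) \<in> (\<lambda>j. a i j * Z x j) ` {1..d}" using d by (intro Max_in) auto
        then obtain j where j: "(MAX j\<in>{1..d}. a i j * Z x j) = a i j * Z x j" "j \<in> {1..d}" by (rule imageE)
        have "X x i = (MAX j\<in>{1..d}. a i j * Z x j)" using elim(4) i by (rule bspec)
        then show "\<exists>j. j \<in> {1..d} \<and> X x i = a i j * Z x j" unfolding j(1) using j(2) by blast
      qed
      from bchoice[OF this] obtain \<tau> where tau: "\<forall>i\<in>{1..d}. \<tau> i \<in> {1..d} \<and> X x i = a i (\<tau> i) * Z x (\<tau> i)" by blast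
      define \<sigma> where "\<sigma> = (\<lambda>i\<in>{1..d}. \<tau> i)"
      have \<sigma>: "\<sigma> \<in> \<Sigma>" "\<And>i. i \<in> {1..d} \<Longrightarrow> \<sigma> i \<in> {1..d}" "\<And>i. i \<in> {1..d} \<Longrightarrow> X x i = a i (\<sigma> i) * Z x (\<sigma> i)"
        using tau by (auto simp: \<sigma>_def \<Sigma>_def)
      have "r\<^sup>2 = (\<Sum>i=1..d. (X x i)\<^sup>2)" using r by (simp add: L2_set_def sum_nonneg flip: r)
      also have "\<dots> = (\<Sum>i=1..d. (a i (\<sigma> i))\<^sup>2 * (Z x (\<sigma> i))\<^sup>2)"
        using \<sigma>(3) by (intro sum.cong) (simp_all add: power_mult_distrib)
      also have "\<dots> = (\<Sum>j=1..d. \<Sum>i\<in>{i\<in>{1..d}. \<sigma> i = j}. (a i (\<sigma> i))\<^sup>2 * (Z x (\<sigma> i))\<^sup>2)"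
        using \<sigma>(2) by (intro sum.group[symmetric]) auto
      also have "\<dots> = (\<Sum>j=1..d. q \<sigma> j * (Z x j)\<^sup>2)"
        unfolding q_def sum_distrib_right by (intro sum.cong refl) auto
      finally have eq: "(\<Sum>j=1..d. q \<sigma> j * (Z x j)\<^sup>2) = r\<^sup>2" ..
      show False
      proof (cases "\<exists>j\<in>{1..d}. q \<sigma> j \<noteq> 0")
        case True
        then show ?thesis using elim(1) \<sigma>(1) eq by blast
      next
        case False
        then have "(\<Sum>j=1..d. q \<sigma> j * (Z x j)\<^sup>2) = 0" by (intro sum.neutral) auto
        then show ?thesis using eq r0 by simp
      qed
    qed
  qed
  then have "emeasure M {x \<in> space M. enorm d (X x) = r} = 0"
    by (subst (asm) AE_iff_measurable[OF _ refl]) auto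
  then show ?thesis by (simp add: emeasure_eq_measure)
qed

end

section \<open>Asymptotic normality\<close>

text \<open>The image of \<open>d\<close> independent standard normals under \<open>L\<close> has
  covariance \<open>L\<close> times its transpose, of whatever rank; its characteristic function
  factorizes over the \<open>d\<close> coordinates.\<close>

lemma mv_normal_linear_image:
  fixes N d :: nat
  assumes \<Sigma>: "\<And>u v. u \<in> {1..N} \<Longrightarrow> v \<in> {1..N} \<Longrightarrow> \<Sigma> u v = (\<Sum>j=1..d. L u j * L v j)"
  shows "\<exists>\<mu>. mv_normal N (\<lambda>_. 0) \<Sigma> \<mu>"
proof -
  let ?G = "std_normal_distribution"
  interpret G: prob_space ?G by (rule real_dist_normal_dist[THEN real_distribution.axioms(1)])
  interpret P: product_prob_space "\<lambda>_ :: nat. ?G" by (rule product_prob_spaceI) unfold_locales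
  let ?P = "Pi\<^sub>M {1..d} (\<lambda>_ :: nat. ?G)"
  interpret PP: prob_space ?P by (rule prob_space_PiM) unfold_locales
  define g where "g \<xi> = (\<lambda>u\<in>{1..N}. \<Sum>j=1..d. L u j * \<xi> j)" for \<xi> :: "nat \<Rightarrow> real"
  have coord: "(\<lambda>\<xi>. \<xi> j) \<in> borel_measurable ?P" if "j \<in> {1..d}" for j
    using measurable_component_singleton[OF that, of "\<lambda>_. ?G"] by simp
  have g[measurable]: "g \<in> ?P \<rightarrow>\<^sub>M Rvec N"
    unfolding g_def[abs_def] by (intro measurable_restrict borel_measurable_sum borel_measurable_times borel_measurable_const coord)
  show ?thesis
  proof (intro exI[of _ "distr ?P (Rvec N) g"], unfold mv_normal_def, intro conjI allI)
    show "prob_space (distr ?P (Rvec N) g)" by (rule PP.prob_space_distr[OF g])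
    show "sets (distr ?P (Rvec N) g) = sets (Rvec N)" by simp
    fix t :: "nat \<Rightarrow> real"
    define s where "s j = (\<Sum>u=1..N. t u * L u j)" for j
    have lin: "(\<Sum>u=1..N. t u * g \<xi> u) = (\<Sum>j=1..d. s j * \<xi> j)" for \<xi>
    proof -
      have "(\<Sum>u=1..N. t u * g \<xi> u) = (\<Sum>u=1..N. \<Sum>j=1..d. t u * L u j * \<xi> j)"
        by (intro sum.cong refl) (simp add: g_def sum_distrib_left mult.assoc)
      also have "\<dots> = (\<Sum>j=1..d. \<Sum>u=1..N. t u * L u j * \<xi> j)" by (rule sum.swap)
      finally show ?thesis by (simp add: s_def sum_distrib_right)
    qed
    have quad: "(\<Sum>u=1..N. \<Sum>v=1..N. t u * \<Sigma> u v * t v) = (\<Sum>j=1..d. (s j)\<^sup>2)"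
    proof -
      have "(\<Sum>u=1..N. \<Sum>v=1..N. t u * \<Sigma> u v * t v) = (\<Sum>u=1..N. \<Sum>v=1..N. \<Sum>j=1..d. (t u * L u j) * (t v * L v j))"
        by (intro sum.cong refl) (simp add: \<Sigma> sum_distrib_left sum_distrib_right mult_ac)
      also have "\<dots> = (\<Sum>u=1..N. \<Sum>j=1..d. \<Sum>v=1..N. (t u * L u j) * (t v * L v j))"
        by (intro sum.cong refl sum.swap)
      also have "\<dots> = (\<Sum>j=1..d. \<Sum>u=1..N. \<Sum>v=1..N. (t u * L u j) * (t v * L v j))" by (rule sum.swap)
      finally show ?thesis by (simp add: s_def power2_eq_square sum_product)
    qed
    have "(CLINT y|distr ?P (Rvec N) g. iexp (\<Sum>u=1..N. t u * y u)) = (CLINT \<xi>|?P. iexp (\<Sum>u=1..N. t u * g \<xi> u))"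
      by (intro integral_distr) simp_all
    also have "\<dots> = (CLINT \<xi>|?P. (\<Prod>j=1..d. iexp (s j * \<xi> j)))"
      unfolding lin by (simp add: sum_distrib_left exp_sum)
    also have "\<dots> = (\<Prod>j=1..d. CLINT x|?G. iexp (s j * x))"
      by (intro P.product_integral_prod) (auto intro!: G.integrable_const_bound[of _ 1])
    also have "\<dots> = (\<Prod>j=1..d. of_real (exp (- (s j)\<^sup>2 / 2)))"
      using char_std_normal_distribution by (simp add: char_def fun_eq_iff)
    also have "\<dots> = of_real (exp (\<Sum>j=1..d. - (s j)\<^sup>2 / 2))"
      by (simp add: exp_sum of_real_prod)
    also have "(\<Sum>j=1..d. - (s j)\<^sup>2 / 2) = - ((\<Sum>u=1..N. \<Sum>v=1..N. t u * \<Sigma> u v * t v) / 2)"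
      unfolding quad by (simp add: sum_negf sum_divide_distrib)
    also have "of_real (exp (- ((\<Sum>u=1..N. \<Sum>v=1..N. t u * \<Sigma> u v * t v) / 2))) =
        exp (\<i> * of_real (\<Sum>u=1..N. t u * 0) - of_real ((\<Sum>u=1..N. \<Sum>v=1..N. t u * \<Sigma> u v * t v) / 2))"
      by (simp only: mult_zero_right sum.neutral_const of_real_0 diff_0 of_real_minus[symmetric] exp_of_real)
    finally show "(CLINT y|distr ?P (Rvec N) g. iexp (\<Sum>u=1..N. t u * y u)) =
        exp (\<i> * of_real (\<Sum>u=1..N. t u * 0) - of_real ((\<Sum>u=1..N. \<Sum>v=1..N. t u * \<Sigma> u v * t v) / 2))" .
  qed
qed

text \<open>The complement of the support is a union of open null sets; by Lindelof a countable
  subfamily suffices, so the complement is null.\<close>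

lemma (in prob_space) AE_in_support:
  assumes [measurable]: "V \<in> borel_measurable M" and supp: "measure_support (distr M borel V) = S"
  shows "AE x in M. V x \<in> (S :: real set)"
proof -
  let ?\<F> = "{U. open U \<and> emeasure (distr M borel V) U = 0}"
  obtain \<F> where F: "\<F> \<subseteq> ?\<F>" "countable \<F>" "\<Union>\<F> = \<Union>?\<F>"
    using Lindelof[of ?\<F>] by auto
  have "\<Union>\<F> = - S"
    unfolding F(3) supp[symmetric] measure_support_def by (auto simp: zero_less_iff_neq_zero)
  moreover have "\<Union>\<F> \<in> null_sets (distr M borel V)"
    using F(1,2) by (intro null_sets_UN'[of \<F> "\<lambda>x. x", simplified]) (auto simp: null_sets_def)
  ultimately have "AE y in distr M borel V. y \<notin> - S" by (metis AE_not_in)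
  then have "AE x in M. V x \<notin> - S" by (rule AE_distrD[rotated]) measurable
  then show ?thesis by simp
qed

lemma f_max_continuous:
  assumes "h \<subseteq> {1..d}" "h \<noteq> {}" shows "continuous_on S (f_max d h)"
proof -
  have "finite h" using assms finite_subset by blast
  then show ?thesis unfolding f_max_def[abs_def] using assms
    by (intro continuous_on_mult continuous_on_const continuous_on_Max continuous_on_power continuous_on_coord)
qed

lemma f_max_measurable:
  assumes "h \<subseteq> {1..d}" "h \<noteq> {}" shows "(\<lambda>y. f_max d h (angle d y)) \<in> borel_measurable (Rvec d)"
  by (rule measurable_compose[OF measurable_angle continuous_borel_measurable_Rvec[OF f_max_continuous[OF assms]]])

lemma f_max_angle_bounds:
  assumes h: "h \<subseteq> {1..d}" "h \<noteq> {}"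
  shows "0 \<le> f_max d h (angle d y)" "f_max d h (angle d y) \<le> real d"
proof -
  have fin: "finite h" using h finite_subset by blast
  have "(angle d y j)\<^sup>2 \<le> 1" if "j \<in> h" for j
  proof -
    have j: "j \<in> {1..d}" using h that by auto
    have "(y j)\<^sup>2 \<le> (\<Sum>i=1..d. (y i)\<^sup>2)" using j by (intro member_le_sum) auto
    also have "\<dots> = (enorm d y)\<^sup>2" by (simp add: L2_set_def sum_nonneg)
    finally show ?thesis using j by (auto simp: angle_def power_divide divide_le_eq_1)
  qed
  then have "(MAX j\<in>h. (angle d y j)\<^sup>2) \<le> 1" using fin h by (intro Max.boundedI) auto
  then show "f_max d h (angle d y) \<le> real d" unfolding f_max_def by (simp add: mult_left_le)
  obtain j where "j \<in> h" using h by auto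
  then have "(angle d y j)\<^sup>2 \<le> (MAX j\<in>h. (angle d y j)\<^sup>2)" using fin by (intro Max_ge) auto
  then have "0 \<le> (MAX j\<in>h. (angle d y j)\<^sup>2)" by (rule order_trans[rotated]) simp
  then show "0 \<le> f_max d h (angle d y)" unfolding f_max_def by simp
qed

section \<open>Conditional moments above high thresholds\<close>

locale ml_sample = max_linear M d a Z X
  for M :: "'a measure" and d :: nat and a :: "nat \<Rightarrow> nat \<Rightarrow> real" and Z X :: "'a \<Rightarrow> nat \<Rightarrow> real" +
  fixes Xs :: "nat \<Rightarrow> 'a \<Rightarrow> nat \<Rightarrow> real" and k :: "nat \<Rightarrow> nat"
  assumes std: "standardized d a"
    and iid: "iid_copies M d X Xs"
    and k_small: "(\<lambda>n. real (k n)) \<in> o(\<lambda>n. real n)"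
    and k_top: "filterlim k at_top sequentially"
    and bias: "\<And>h K. h \<in> comp_set d ` {1..dimN d} \<Longrightarrow> compact K \<Longrightarrow> K \<subseteq> {0..} \<Longrightarrow>
      uniform_limit K (\<lambda>n. bias_term M d (Xs 1) (norm_spectral M d X) (f_max d h) n (k n)) (\<lambda>_. 0) sequentially"
begin

abbreviation "N \<equiv> dimN d"

sublocale obs: iid_sample "distr M (Rvec d) X" "enorm d"
proof -
  interpret Q: prob_space "distr M (Rvec d) X" by (rule prob_space_distr[OF X_meas])
  show "iid_sample (distr M (Rvec d) X) (enorm d)"
  proof
    show "enorm d \<in> borel_measurable (distr M (Rvec d) X)" by simp
    fix r
    have "{y \<in> space (Rvec d). enorm d y = r} \<in> sets (Rvec d)" by measurable
    then have "measure (distr M (Rvec d) X) {y \<in> space (distr M (Rvec d) X). enorm d y = r} =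
        measure M (X -` {y \<in> space (Rvec d). enorm d y = r} \<inter> space M)"
      by (simp add: measure_distr)
    also have "X -` {y \<in> space (Rvec d). enorm d y = r} \<inter> space M = {x \<in> space M. enorm d (X x) = r}"
      using measurable_space[OF X_meas] by auto
    finally show "measure (distr M (Rvec d) X) {y \<in> space (distr M (Rvec d) X). enorm d y = r} = 0"
      by (simp add: enorm_atomless)
  qed
qed

abbreviation "Q \<equiv> distr M (Rvec d) X"

lemma Xs_meas [measurable]: "l \<ge> 1 \<Longrightarrow> Xs l \<in> M \<rightarrow>\<^sub>M Rvec d"
  using iid by (auto simp: iid_copies_def indep_vars_def)

lemma Xs_law: "l \<ge> 1 \<Longrightarrow> distr M (Rvec d) (Xs l) = Q"
  using iid by (simp add: iid_copies_def)

lemma sample_law: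
  assumes "n \<ge> 1"
  shows "distr M (obs.sample n) (\<lambda>x. \<lambda>l\<in>{1..n}. Xs l x) = obs.sample n"
proof -
  have "indep_vars (\<lambda>_. Rvec d) Xs {1..n}"
    by (rule indep_vars_subset[of _ _ "{1..}"]) (use iid in \<open>auto simp: iid_copies_def\<close>)
  then have "distr M (Pi\<^sub>M {1..n} (\<lambda>_. Rvec d)) (\<lambda>x. \<lambda>l\<in>{1..n}. Xs l x) = Pi\<^sub>M {1..n} (\<lambda>l. distr M (Rvec d) (Xs l))"
    using assms by (subst (asm) indep_vars_iff_distr_eq_PiM') auto
  also have "\<dots> = obs.sample n" by (intro PiM_cong) (auto simp: Xs_law)
  finally show ?thesis
    by (subst distr_cong[OF refl sets_PiM_cong[OF refl] refl]) auto
qed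

lemma sample_meas: "(\<lambda>x. \<lambda>l\<in>{1..n}. Xs l x) \<in> M \<rightarrow>\<^sub>M obs.sample n"
  by (intro measurable_restrict) (simp add: measurable_cong_sets[OF refl sets_distr])

definition comp_fun :: "nat \<Rightarrow> (nat \<Rightarrow> real) \<Rightarrow> real" where
  "comp_fun u w = f_max d (comp_set d u) w"

definition comp_mean :: "nat \<Rightarrow> real" where
  "comp_mean u = max_scaling d a (comp_set d u)"

lemma comp_fun_cont: "u \<in> {1..N} \<Longrightarrow> continuous_on S (comp_fun u)"
  unfolding comp_fun_def[abs_def] using comp_set_subset by (intro f_max_continuous)

lemma comp_fun_meas [measurable]: "u \<in> {1..N} \<Longrightarrow> (\<lambda>y. comp_fun u (angle d y)) \<in> borel_measurable (Rvec d)"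
  unfolding comp_fun_def using comp_set_subset by (intro f_max_measurable)

lemma comp_fun_bounds: "u \<in> {1..N} \<Longrightarrow> 0 \<le> comp_fun u (angle d y)" "u \<in> {1..N} \<Longrightarrow> comp_fun u (angle d y) \<le> real d"
  unfolding comp_fun_def by (rule f_max_angle_bounds[OF comp_set_subset(1,2)]; assumption)+

lemma comp_fun_mean: assumes "u \<in> {1..N}" shows "(LINT w|norm_spectral M d X. comp_fun u w) = comp_mean u"
proof -
  note h = comp_set_subset[OF assms]
  have "(LINT w|norm_spectral M d X. comp_fun u w) = (\<Sum>j=1..d. col_sq d a j / real d * comp_fun u (col_angle d a j))"
    by (rule norm_spectral_integral[OF std comp_fun_cont[OF assms]])
  also have "\<dots> = comp_mean u"
    unfolding comp_mean_def max_scaling_def comp_fun_def f_max_col_angle[OF h(1,2)]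
    using col_sq_pos d by (intro sum.cong refl) (auto simp: less_imp_neq[THEN not_sym])
  finally show ?thesis .
qed

definition dev :: "(nat \<Rightarrow> real) \<Rightarrow> (nat \<Rightarrow> real) \<Rightarrow> real" where
  "dev t w = (\<Sum>u=1..N. t u * (comp_fun u w - comp_mean u))"

definition dev_var :: "(nat \<Rightarrow> real) \<Rightarrow> real" where
  "dev_var t = (\<Sum>j=1..d. col_sq d a j / real d * (dev t (col_angle d a j))\<^sup>2)"

lemma dev_var_nonneg: "dev_var t \<ge> 0"
  unfolding dev_var_def by (intro sum_nonneg mult_nonneg_nonneg) (auto simp: col_sq_def sum_nonneg)

lemma dev_meas [measurable]: "(\<lambda>y. dev t (angle d y)) \<in> borel_measurable (Rvec d)"
  unfolding dev_def by measurable

lemma dev_bound: "\<bar>dev t (angle d y)\<bar> \<le> (\<Sum>u=1..N. \<bar>t u\<bar> * (real d + \<bar>comp_mean u\<bar>))"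
  unfolding dev_def
proof (rule order_trans[OF sum_abs], rule sum_mono)
  fix u assume "u \<in> {1..N}"
  then have "\<bar>comp_fun u (angle d y) - comp_mean u\<bar> \<le> real d + \<bar>comp_mean u\<bar>" using comp_fun_bounds[of u y] by linarith
  then show "\<bar>t u * (comp_fun u (angle d y) - comp_mean u)\<bar> \<le> \<bar>t u\<bar> * (real d + \<bar>comp_mean u\<bar>)"
    by (simp add: abs_mult mult_left_mono)
qed

definition tail_mean :: "((nat \<Rightarrow> real) \<Rightarrow> real) \<Rightarrow> real \<Rightarrow> real" where
  "tail_mean f r = (LINT y|Q. indicator {r<..} (enorm d y) * f (angle d y))"

lemma tail_mean_eq: assumes "(\<lambda>y. f (angle d y)) \<in> borel_measurable (Rvec d)"
  shows "tail_mean f r = (LINT x|M. indicator {r<..} (enorm d (X x)) * f (angle d (X x)))"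
  unfolding tail_mean_def using assms by (intro integral_distr) auto

text \<open>A norm above \<open>r >= 0\<close> is positive, and the components are almost surely
  nonnegative, so the angle then lies on the positive sphere.\<close>

lemma tail_mean_tail_integral:
  assumes f: "(\<lambda>y. f (angle d y)) \<in> borel_measurable (Rvec d)" and r: "r \<ge> 0"
  shows "tail_mean f r = tail_integral f r"
  unfolding tail_mean_eq[OF f] tail_integral_def
proof (rule integral_cong_AE)
  have [measurable]: "(\<lambda>x. f (angle d (X x))) \<in> borel_measurable M" by (rule measurable_compose[OF X_meas f])
  have [measurable]: "Theta_pos d \<in> sets (Rvec d)" by (rule Theta_sets)
  have [measurable]: "(\<lambda>x. indicat_real (Theta_pos d) (angle d (X x))) \<in> borel_measurable M" by measurable
  show "(\<lambda>x. indicator {r<..} (enorm d (X x)) * f (angle d (X x))) \<in> borel_measurable M" by measurable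
  show "(\<lambda>x. indicator {r<..} (enorm d (X x)) * (indicator (Theta_pos d) (angle d (X x)) * f (angle d (X x)))) \<in> borel_measurable M"
    by measurable
  show "AE x in M. indicator {r<..} (enorm d (X x)) * f (angle d (X x)) =
      indicator {r<..} (enorm d (X x)) * (indicator (Theta_pos d) (angle d (X x)) * f (angle d (X x)))"
    using X_nonneg
  proof eventually_elim
    case (elim x)
    show ?case
    proof (cases "r < enorm d (X x)")
      case True
      then have "angle d (X x) \<in> Theta_pos d" using elim r by (intro angle_Theta) auto
      then show ?thesis by simp
    qed simp
  qed
qed

lemma tail_mean_limit:
  assumes "continuous_on (Theta_pos d) f" "\<And>w. w \<in> Theta_pos d \<Longrightarrow> 0 \<le> f w"
    and m: "(\<lambda>y. f (angle d y)) \<in> borel_measurable (Rvec d)"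
  shows "((\<lambda>r. r\<^sup>2 * tail_mean f r) \<longlongrightarrow> (\<Sum>j=1..d. col_sq d a j * f (col_angle d a j))) at_top"
proof (rule Lim_transform_eventually[OF tail_integral_limit[OF assms(1,2)]])
  show "\<forall>\<^sub>F r in at_top. r\<^sup>2 * tail_integral f r = r\<^sup>2 * tail_mean f r"
    using eventually_ge_at_top[of 0] by eventually_elim (simp add: tail_mean_tail_integral[OF m])
qed

lemma tail_eq_tail_mean: "obs.tail r = tail_mean (\<lambda>_. 1) r"
  using obs.integral_indicator_gt[of r] by (simp add: tail_mean_def)

lemma tail_limit: "((\<lambda>r. r\<^sup>2 * obs.tail r) \<longlongrightarrow> real d) at_top"
  using tail_mean_limit[of "\<lambda>_. 1"] sum_col_sq[OF std] by (simp add: tail_eq_tail_mean)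

text \<open>After multiplication by \<open>r^2\<close> both terms converge to the same limit, while
  \<open>r^2 * tail r\<close> tends to \<open>d > 0\<close>; an error of order
  \<open>o(r^-2)\<close> is thus small relative to the tail.\<close>

lemma second_moment:
  assumes e: "e > 0"
  shows "\<forall>\<^sub>F r in at_top. \<bar>tail_mean (\<lambda>w. (dev t w)\<^sup>2) r - dev_var t * obs.tail r\<bar> \<le> e * obs.tail r"
proof -
  have dd: "real d > 0" using d by simp
  have lim2: "((\<lambda>r. r\<^sup>2 * tail_mean (\<lambda>w. (dev t w)\<^sup>2) r) \<longlongrightarrow> (\<Sum>j=1..d. col_sq d a j * (dev t (col_angle d a j))\<^sup>2)) at_top"
  proof (rule tail_mean_limit)
    show "continuous_on (Theta_pos d) (\<lambda>w. (dev t w)\<^sup>2)"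
      unfolding dev_def by (intro continuous_intros comp_fun_cont)
  qed simp_all
  also have "(\<Sum>j=1..d. col_sq d a j * (dev t (col_angle d a j))\<^sup>2) = dev_var t * real d"
    unfolding dev_var_def sum_distrib_right using d by (intro sum.cong) auto
  finally have "((\<lambda>r. r\<^sup>2 * tail_mean (\<lambda>w. (dev t w)\<^sup>2) r - dev_var t * (r\<^sup>2 * obs.tail r)) \<longlongrightarrow> dev_var t * real d - dev_var t * real d) at_top"
    by (rule tendsto_diff[OF _ tendsto_mult[OF tendsto_const tail_limit]])
  then have "\<forall>\<^sub>F r in at_top. \<bar>r\<^sup>2 * tail_mean (\<lambda>w. (dev t w)\<^sup>2) r - dev_var t * (r\<^sup>2 * obs.tail r)\<bar> < e * (real d / 2)"
    using tendstoD[where e = "e * (real d / 2)"] e dd by (fastforce simp: dist_real_def)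
  moreover have "\<forall>\<^sub>F r in at_top. real d / 2 < r\<^sup>2 * obs.tail r"
    using dd by (intro order_tendstoD(1)[OF tail_limit]) simp
  ultimately show ?thesis using eventually_gt_at_top[of 0]
  proof eventually_elim
    case (elim r)
    have eq: "r\<^sup>2 * tail_mean (\<lambda>w. (dev t w)\<^sup>2) r - dev_var t * (r\<^sup>2 * obs.tail r) =
        r\<^sup>2 * (tail_mean (\<lambda>w. (dev t w)\<^sup>2) r - dev_var t * obs.tail r)"
      by (simp add: algebra_simps)
    have "r\<^sup>2 * \<bar>tail_mean (\<lambda>w. (dev t w)\<^sup>2) r - dev_var t * obs.tail r\<bar> = \<bar>r\<^sup>2 * tail_mean (\<lambda>w. (dev t w)\<^sup>2) r - dev_var t * (r\<^sup>2 * obs.tail r)\<bar>"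
      unfolding eq abs_mult by simp
    also have "\<dots> \<le> e * (r\<^sup>2 * obs.tail r)"
      using elim(1,2) e mult_left_mono[of "real d / 2" "r\<^sup>2 * obs.tail r" e] by linarith
    finally have "r\<^sup>2 * \<bar>tail_mean (\<lambda>w. (dev t w)\<^sup>2) r - dev_var t * obs.tail r\<bar> \<le> r\<^sup>2 * (e * obs.tail r)"
      by (simp only: mult.left_commute)
    then show ?case by (rule mult_left_le_imp_le) (use elim(3) in simp)
  qed
qed

definition block_size :: "nat \<Rightarrow> nat" where "block_size n = n div k n"

text \<open>By \<open>tail_limit\<close>, \<open>n * tail r\<close> is about
  \<open>k * block_size * d / r^2\<close>. The two radii are half and twice the level at which this
  equals \<open>k\<close>; they give about \<open>4 k\<close> and \<open>k / 4\<close>, which leaves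
  room for the required \<open>2 k\<close> and \<open>k / 2\<close>.\<close>

definition r1 :: "nat \<Rightarrow> real" where "r1 n = sqrt (real (block_size n)) * sqrt (real d) / 2"
definition r2 :: "nat \<Rightarrow> real" where "r2 n = sqrt (real (block_size n)) * (2 * sqrt (real d))"

lemma k_pos: "\<forall>\<^sub>F n in sequentially. 1 \<le> k n"
  using k_top by (simp add: filterlim_at_top)

lemma k_ratio: "c > 0 \<Longrightarrow> \<forall>\<^sub>F n in sequentially. c * real (k n) \<le> real n"
proof -
  assume c: "c > 0"
  then have "\<forall>\<^sub>F n in sequentially. norm (real (k n)) \<le> (1 / c) * norm (real n)"
    using landau_o.smallD[OF k_small, of "1 / c"] by simp
  then show ?thesis by eventually_elim (use c in \<open>simp add: field_simps\<close>)
qed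

lemma block_size_top: "filterlim block_size at_top sequentially"
  unfolding filterlim_at_top
proof
  fix C :: nat
  have "\<forall>\<^sub>F n in sequentially. (real C + 1) * real (k n) \<le> real n" by (rule k_ratio) simp
  with k_pos show "\<forall>\<^sub>F n in sequentially. C \<le> block_size n"
  proof eventually_elim
    case (elim n)
    have "real (C * k n) \<le> real n" using elim by (simp add: algebra_simps)
    then have "C * k n \<le> n" by linarith
    then show ?case using elim by (simp add: block_size_def less_eq_div_iff_mult_less_eq)
  qed
qed

lemma block_size_bounds: "1 \<le> k n \<Longrightarrow> real (block_size n) * real (k n) \<le> real n" "1 \<le> k n \<Longrightarrow> real n \<le> (real (block_size n) + 1) * real (k n)"
proof -
  assume k: "1 \<le> k n"
  have "block_size n * k n \<le> n" by (simp add: block_size_def)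
  then show "real (block_size n) * real (k n) \<le> real n" by (metis of_nat_le_iff of_nat_mult)
  have "n < (block_size n + 1) * k n" using k dividend_less_div_times[of "k n" n] by (simp add: block_size_def algebra_simps)
  then have "real n \<le> real ((block_size n + 1) * k n)" by linarith
  then show "real n \<le> (real (block_size n) + 1) * real (k n)" by (simp add: algebra_simps)
qed

lemma r12_sq: "(r1 n)\<^sup>2 = real (block_size n) * real d / 4" "(r2 n)\<^sup>2 = real (block_size n) * (4 * real d)"
  by (simp_all add: r1_def r2_def power_mult_distrib power_divide)

lemma block_size_real_top: "filterlim (\<lambda>n. sqrt (real (block_size n))) at_top sequentially"
  by (rule filterlim_compose[OF sqrt_at_top filterlim_compose[OF filterlim_real_sequentially block_size_top]])

lemma r1_top: "filterlim r1 at_top sequentially" and r2_top: "filterlim r2 at_top sequentially"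
proof -
  have "filterlim (\<lambda>n. (sqrt (real d) / 2) * sqrt (real (block_size n))) at_top sequentially"
    "filterlim (\<lambda>n. (2 * sqrt (real d)) * sqrt (real (block_size n))) at_top sequentially"
    using d by (intro filterlim_tendsto_pos_mult_at_top[OF tendsto_const _ block_size_real_top]; simp)+
  then show "filterlim r1 at_top sequentially" "filterlim r2 at_top sequentially"
    by (simp_all add: r1_def[abs_def] r2_def[abs_def] mult_ac)
qed

lemma tail_r1: "\<forall>\<^sub>F n in sequentially. 2 * real (k n) \<le> real n * obs.tail (r1 n)"
proof -
  have dd: "real d > 0" using d by simp
  have "\<forall>\<^sub>F n in sequentially. real d / 2 < (r1 n)\<^sup>2 * obs.tail (r1 n)"
    using dd by (intro order_tendstoD(1)[OF filterlim_compose[OF tail_limit r1_top]]) simp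
  with k_pos show ?thesis
  proof eventually_elim
    case (elim n)
    have "2 < real (block_size n) * obs.tail (r1 n)" using elim(2) dd by (simp add: r12_sq field_simps)
    then have "real (k n) * 2 \<le> real (k n) * (real (block_size n) * obs.tail (r1 n))" by (intro mult_left_mono) auto
    also have "\<dots> \<le> real n * obs.tail (r1 n)"
      using mult_right_mono[OF block_size_bounds(1)[OF elim(1)] obs.tail_nonneg[of "r1 n"]] by (simp add: mult_ac)
    finally show ?case by simp
  qed
qed

text \<open>Rounding costs the factor \<open>(block_size + 1) / block_size\<close>, at most
  \<open>4/3\<close> once \<open>block_size >= 3\<close>. The bound \<open>3/2 * d\<close> gives
  \<open>block_size * tail <= 3/8\<close>, and \<open>4/3 * 3/8 = 1/2\<close>.\<close>

lemma tail_r2: "\<forall>\<^sub>F n in sequentially. real n * obs.tail (r2 n) \<le> real (k n) / 2"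
proof -
  have dd: "real d > 0" using d by simp
  have "\<forall>\<^sub>F n in sequentially. (r2 n)\<^sup>2 * obs.tail (r2 n) < 3 / 2 * real d"
    using dd by (intro order_tendstoD(2)[OF filterlim_compose[OF tail_limit r2_top]]) simp
  moreover have "\<forall>\<^sub>F n in sequentially. 3 \<le> block_size n" using block_size_top by (simp add: filterlim_at_top)
  ultimately show ?thesis using k_pos
  proof eventually_elim
    case (elim n)
    have t: "real (block_size n) * obs.tail (r2 n) \<le> 3 / 8" using elim(1) dd by (simp add: r12_sq field_simps)
    have "real n * obs.tail (r2 n) \<le> ((real (block_size n) + 1) * real (k n)) * obs.tail (r2 n)"
      by (intro mult_right_mono block_size_bounds(2) elim obs.tail_nonneg)
    also have "\<dots> \<le> ((4 / 3 * real (block_size n)) * real (k n)) * obs.tail (r2 n)"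
      using elim(2) by (intro mult_right_mono obs.tail_nonneg) auto
    also have "\<dots> = 4 / 3 * real (k n) * (real (block_size n) * obs.tail (r2 n))" by simp
    also have "\<dots> \<le> 4 / 3 * real (k n) * (3 / 8)" by (intro mult_left_mono t) simp
    finally show ?case by simp
  qed
qed

text \<open>The second-order condition is normalized by \<open>k / n\<close>, the expansion of the
  characteristic function by the tail; throughout the window the former is at most a constant times
  the latter.\<close>

lemma tail_lower: "\<forall>\<^sub>F n in sequentially. \<forall>r. r \<le> r2 n \<longrightarrow> real (k n) / real n \<le> 8 * obs.tail r"
proof -
  have dd: "real d > 0" using d by simp
  have "\<forall>\<^sub>F n in sequentially. real d / 2 < (r2 n)\<^sup>2 * obs.tail (r2 n)"
    using dd by (intro order_tendstoD(1)[OF filterlim_compose[OF tail_limit r2_top]]) simp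
  moreover have "\<forall>\<^sub>F n in sequentially. 1 \<le> block_size n" using block_size_top by (simp add: filterlim_at_top)
  ultimately show ?thesis using k_pos
  proof eventually_elim
    case (elim n)
    have t: "1 \<le> real (block_size n) * (8 * obs.tail (r2 n))" using elim(1) dd by (simp add: r12_sq field_simps)
    have n: "real n > 0" using block_size_bounds(1)[OF elim(3)] mult_pos_pos[of "real (block_size n)" "real (k n)"] elim(2,3) by linarith
    have "real (k n) * 1 \<le> real (k n) * (real (block_size n) * (8 * obs.tail (r2 n)))" by (intro mult_left_mono t) simp
    also have "\<dots> \<le> real n * (8 * obs.tail (r2 n))"
      using mult_right_mono[OF block_size_bounds(1)[OF elim(3)], of "8 * obs.tail (r2 n)"] obs.tail_nonneg[of "r2 n"] by (simp add: mult_ac)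
    finally have "real (k n) / real n \<le> 8 * obs.tail (r2 n)" using n by (simp add: divide_le_eq mult.commute)
    moreover have "obs.tail (r2 n) \<le> obs.tail r" if "r \<le> r2 n" for r
      unfolding obs.tail_def using that by (intro obs.finite_measure_mono) auto
    ultimately show ?case by (intro allI impI) fastforce
  qed
qed

text \<open>The parameter \<open>t = block_size / r^2\<close> makes the threshold equal to
  \<open>r\<close>. The condition counts radii at least \<open>r\<close>, \<open>tail_mean\<close>
  those above \<open>r\<close>; they agree because the norm has no atoms.\<close>

lemma bias_term_tail_mean:
  assumes u: "u \<in> {1..N}" and r: "r > 0" and block_size: "block_size n > 0"
  shows "bias_term M d (Xs 1) (norm_spectral M d X) (f_max d (comp_set d u)) n (k n) (real (block_size n) / r\<^sup>2) =
    sqrt (real (k n)) * (real n / real (k n)) * (tail_mean (comp_fun u) r - comp_mean u * obs.tail r)"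
proof -
  have thr: "threshold n (k n) (real (block_size n) / r\<^sup>2) = ereal r"
    using r block_size by (simp add: threshold_def block_size_def[symmetric] real_sqrt_divide)
  have mf: "(\<lambda>y. comp_fun u (angle d y)) \<in> borel_measurable (Rvec d)" using u by measurable
  have lawX: "(LINT x|M. g (Xs 1 x)) = (LINT y|Q. g y)" if "g \<in> borel_measurable (Rvec d)" for g :: "_ \<Rightarrow> real"
    using integral_distr[OF Xs_meas[of 1] that] by (simp add: Xs_law)
  have ne: "AE y in Q. enorm d y \<noteq> r"
    using obs.atomless[of r] by (subst AE_iff_measurable[OF _ refl]) (auto simp: obs.emeasure_eq_measure)
  have "(LINT x|M. comp_fun u (angle d (Xs 1 x)) * indicator {x. ereal (enorm d (Xs 1 x)) \<ge> ereal r} x) =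
      (LINT x|M. indicat_real {r..} (enorm d (Xs 1 x)) * comp_fun u (angle d (Xs 1 x)))"
    by (intro Bochner_Integration.integral_cong) (auto simp: indicator_def)
  also have "\<dots> = (LINT y|Q. indicat_real {r..} (enorm d y) * comp_fun u (angle d y))"
    using mf u by (intro lawX) measurable
  also have "\<dots> = tail_mean (comp_fun u) r"
    unfolding tail_mean_def using ne mf
    by (intro integral_cong_AE) (auto elim!: eventually_mono simp: indicator_def)
  finally have e1: "(LINT x|M. comp_fun u (angle d (Xs 1 x)) * indicator {x. ereal (enorm d (Xs 1 x)) \<ge> ereal r} x) = tail_mean (comp_fun u) r" .
  have le: "{y \<in> space (Rvec d). enorm d y \<le> r} \<in> sets (Rvec d)" by measurable
  have "measure M {x \<in> space M. ereal (enorm d (Xs 1 x)) \<le> ereal r} = measure M (Xs 1 -` {y \<in> space (Rvec d). enorm d y \<le> r} \<inter> space M)"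
    using measurable_space[OF Xs_meas[of 1]] by (intro arg_cong2[of _ _ _ _ measure] refl) auto
  also have "\<dots> = measure Q {y \<in> space (Rvec d). enorm d y \<le> r}"
    using measure_distr[OF Xs_meas[of 1] le] by (simp add: Xs_law)
  finally have "1 - measure M {x \<in> space M. ereal (enorm d (Xs 1 x)) \<le> ereal r} = measure Q (space Q - {y \<in> space (Rvec d). enorm d y \<le> r})"
    using le by (subst obs.prob_compl) auto
  also have "space Q - {y \<in> space (Rvec d). enorm d y \<le> r} = {y \<in> space Q. enorm d y > r}" by auto
  finally have e2: "1 - measure M {x \<in> space M. ereal (enorm d (Xs 1 x)) \<le> ereal r} = obs.tail r"
    unfolding obs.tail_def .
  have f: "f_max d (comp_set d u) = comp_fun u" by (simp add: comp_fun_def[abs_def])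
  show ?thesis unfolding bias_term_def thr f e1 e2 comp_fun_mean[OF u] by (simp add: algebra_simps)
qed

lemma first_moment_component:
  assumes u: "u \<in> {1..N}" and e: "e > 0"
  shows "\<forall>\<^sub>F n in sequentially. \<forall>r. r1 n < r \<longrightarrow> r \<le> r2 n \<longrightarrow>
    sqrt (real (k n)) * \<bar>tail_mean (comp_fun u) r - comp_mean u * obs.tail r\<bar> \<le> e * obs.tail r"
proof -
  have dd: "real d > 0" using d by simp
  \<comment> \<open>The values of \<open>t = block_size / r^2\<close> when \<open>r\<close> runs
    through the window; this compact interval is where local uniformity enters.\<close>
  define K where "K = {1 / (4 * real d)..4 / real d}"
  have "uniform_limit K (\<lambda>n. bias_term M d (Xs 1) (norm_spectral M d X) (f_max d (comp_set d u)) n (k n)) (\<lambda>_. 0) sequentially"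
    using u dd by (intro bias) (auto simp: K_def intro: order_trans[of 0 "1 / (4 * real d)"])
  \<comment> \<open>Dividing by 8 compensates the constant in \<open>tail_lower\<close>.\<close>
  then have "\<forall>\<^sub>F n in sequentially. \<forall>t\<in>K. dist (bias_term M d (Xs 1) (norm_spectral M d X) (f_max d (comp_set d u)) n (k n) t) 0 < e / 8"
    using e by (intro uniform_limitD) auto
  moreover have "\<forall>\<^sub>F n in sequentially. 1 \<le> block_size n" using block_size_top by (simp add: filterlim_at_top)
  ultimately show ?thesis using tail_lower k_pos
  proof eventually_elim
    case (elim n)
    show ?case
    proof (intro allI impI)
      fix r assume r: "r1 n < r" "r \<le> r2 n"
      have r1pos: "r1 n > 0" using elim(2) dd by (simp add: r1_def)
      then have r0: "r > 0" using r by linarith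
      have sq: "(r1 n)\<^sup>2 \<le> r\<^sup>2" "r\<^sup>2 \<le> (r2 n)\<^sup>2" using r r1pos by (auto intro!: power_mono)
      have "real (block_size n) / r\<^sup>2 \<in> K"
      proof -
        have "real (block_size n) * real d \<le> 4 * r\<^sup>2" "r\<^sup>2 \<le> real (block_size n) * (4 * real d)" using sq by (simp_all add: r12_sq)
        then show ?thesis using r0 dd by (simp add: K_def divide_le_eq le_divide_eq mult_ac)
      qed
      then have "\<bar>sqrt (real (k n)) * (real n / real (k n)) * (tail_mean (comp_fun u) r - comp_mean u * obs.tail r)\<bar> < e / 8"
        using bspec[OF elim(1), of "real (block_size n) / r\<^sup>2"] bias_term_tail_mean[OF u r0, of n] elim(2)
        by (simp only: dist_real_def diff_zero)
      then have b: "(real n / real (k n)) * (sqrt (real (k n)) * \<bar>tail_mean (comp_fun u) r - comp_mean u * obs.tail r\<bar>) \<le> e / 8"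
        by (simp add: abs_mult mult_ac)
      have n: "real n > 0" "real (k n) > 0"
        using block_size_bounds(1)[OF elim(4)] elim(2,4) mult_pos_pos[of "real (block_size n)" "real (k n)"] by linarith+
      have "sqrt (real (k n)) * \<bar>tail_mean (comp_fun u) r - comp_mean u * obs.tail r\<bar> =
          (real (k n) / real n) * ((real n / real (k n)) * (sqrt (real (k n)) * \<bar>tail_mean (comp_fun u) r - comp_mean u * obs.tail r\<bar>))"
        using n by simp
      also have "\<dots> \<le> (real (k n) / real n) * (e / 8)" by (intro mult_left_mono b) simp
      also have "\<dots> \<le> (8 * obs.tail r) * (e / 8)" using elim(3) r e by (intro mult_right_mono) auto
      finally show "sqrt (real (k n)) * \<bar>tail_mean (comp_fun u) r - comp_mean u * obs.tail r\<bar> \<le> e * obs.tail r" by (simp add: mult.commute)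
    qed
  qed
qed

lemma tail_mean_dev: "tail_mean (dev t) r = (\<Sum>u=1..N. t u * (tail_mean (comp_fun u) r - comp_mean u * obs.tail r))"
proof -
  have i1: "integrable Q (\<lambda>y. indicator {r<..} (enorm d y) * comp_fun u (angle d y))" if "u \<in> {1..N}" for u
  proof (rule obs.integrable_const_bound[of _ "real d"])
    show "AE y in Q. norm (indicator {r<..} (enorm d y) * comp_fun u (angle d y)) \<le> real d"
      using comp_fun_bounds[OF that] by (auto simp: indicator_def)
    show "(\<lambda>y. indicator {r<..} (enorm d y) * comp_fun u (angle d y)) \<in> borel_measurable Q" using that by measurable
  qed
  have i2: "integrable Q (\<lambda>y. indicat_real {r<..} (enorm d y))"
    by (rule obs.integrable_const_bound[of _ 1]) (auto simp: indicator_def)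
  have i3: "integrable Q (\<lambda>y. t u * (indicator {r<..} (enorm d y) * comp_fun u (angle d y) - comp_mean u * indicat_real {r<..} (enorm d y)))"
    if "u \<in> {1..N}" for u
    by (intro integrable_mult_right Bochner_Integration.integrable_diff i1[OF that] i2)
  have "tail_mean (dev t) r = (LINT y|Q. (\<Sum>u=1..N. t u * (indicator {r<..} (enorm d y) * comp_fun u (angle d y) - comp_mean u * indicator {r<..} (enorm d y))))"
    unfolding tail_mean_def dev_def sum_distrib_left by (intro Bochner_Integration.integral_cong sum.cong refl) (simp add: algebra_simps)
  also have "\<dots> = (\<Sum>u=1..N. LINT y|Q. t u * (indicator {r<..} (enorm d y) * comp_fun u (angle d y) - comp_mean u * indicator {r<..} (enorm d y)))"
    by (rule Bochner_Integration.integral_sum) (rule i3)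
  also have "\<dots> = (\<Sum>u=1..N. t u * (tail_mean (comp_fun u) r - comp_mean u * obs.tail r))"
  proof (rule sum.cong[OF refl])
    fix u assume u: "u \<in> {1..N}"
    have "(LINT y|Q. t u * (indicator {r<..} (enorm d y) * comp_fun u (angle d y) - comp_mean u * indicator {r<..} (enorm d y))) =
        t u * ((LINT y|Q. indicator {r<..} (enorm d y) * comp_fun u (angle d y)) - comp_mean u * (LINT y|Q. indicator {r<..} (enorm d y)))"
      by (simp only: integral_mult_right_zero Bochner_Integration.integral_diff[OF i1[OF u] integrable_mult_right[OF i2]])
    then show "(LINT y|Q. t u * (indicator {r<..} (enorm d y) * comp_fun u (angle d y) - comp_mean u * indicator {r<..} (enorm d y))) = t u * (tail_mean (comp_fun u) r - comp_mean u * obs.tail r)"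
      by (simp only: obs.integral_indicator_gt tail_mean_def)
  qed
  finally show ?thesis .
qed

lemma first_moment:
  assumes e: "e > 0"
  shows "\<forall>\<^sub>F n in sequentially. \<forall>r. r1 n < r \<longrightarrow> r \<le> r2 n \<longrightarrow>
    sqrt (real (k n)) * \<bar>tail_mean (dev t) r\<bar> \<le> e * obs.tail r"
proof -
  \<comment> \<open>The added 1 keeps \<open>A\<close> positive when all coefficients
    \<open>t u\<close> vanish.\<close>
  define A where "A = (\<Sum>u=1..N. \<bar>t u\<bar>) + 1"
  have A: "A > 0" unfolding A_def by (intro add_nonneg_pos sum_nonneg) auto
  have "\<forall>\<^sub>F n in sequentially. \<forall>u\<in>{1..N}. \<forall>r. r1 n < r \<longrightarrow> r \<le> r2 n \<longrightarrow>
      sqrt (real (k n)) * \<bar>tail_mean (comp_fun u) r - comp_mean u * obs.tail r\<bar> \<le> e / A * obs.tail r"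
    using e A by (intro eventually_ball_finite ballI first_moment_component) auto
  then show ?thesis
  proof eventually_elim
    case (elim n)
    show ?case
    proof (intro allI impI)
      fix r assume r: "r1 n < r" "r \<le> r2 n"
      have "sqrt (real (k n)) * \<bar>tail_mean (dev t) r\<bar> \<le> sqrt (real (k n)) * (\<Sum>u=1..N. \<bar>t u\<bar> * \<bar>tail_mean (comp_fun u) r - comp_mean u * obs.tail r\<bar>)"
        unfolding tail_mean_dev abs_mult[symmetric] by (intro mult_left_mono sum_abs) simp
      also have "\<dots> = (\<Sum>u=1..N. \<bar>t u\<bar> * (sqrt (real (k n)) * \<bar>tail_mean (comp_fun u) r - comp_mean u * obs.tail r\<bar>))"
        by (simp add: sum_distrib_left mult_ac)
      also have "\<dots> \<le> (\<Sum>u=1..N. \<bar>t u\<bar> * (e / A * obs.tail r))"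
        using elim r by (intro sum_mono mult_left_mono) auto
      also have "\<dots> = (A - 1) * (e / A * obs.tail r)"
        by (simp only: sum_distrib_right[symmetric] A_def add_diff_cancel_right')
      also have "\<dots> \<le> A * (e / A * obs.tail r)"
        using e A obs.tail_nonneg[of r] by (intro mult_right_mono mult_nonneg_nonneg) auto
      also have "\<dots> = e * obs.tail r" using A by simp
      finally show "sqrt (real (k n)) * \<bar>tail_mean (dev t) r\<bar> \<le> e * obs.tail r" .
    qed
  qed
qed

theorem dev_char_limit:
  "(\<lambda>n. CLINT x|obs.sample n. iexp ((\<Sum>l\<in>top_indices n (k n) (\<lambda>l. enorm d (x l)). dev t (angle d (x l))) / sqrt (real (k n))))
    \<longlonglongrightarrow> exp (- dev_var t / 2)"
proof (rule obs.top_sum_char_limit[where ?r1.0 = r1 and ?r2.0 = r2])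
  show "(\<lambda>y. dev t (angle d y)) \<in> borel_measurable Q" by simp
  show "\<bar>dev t (angle d y)\<bar> \<le> (\<Sum>u=1..N. \<bar>t u\<bar> * (real d + \<bar>comp_mean u\<bar>))" for y by (rule dev_bound)
  show "\<forall>\<^sub>F n in sequentially. k n \<le> n" using k_ratio[of 1] by simp
  show "\<forall>\<^sub>F n in sequentially. \<forall>r. r1 n < r \<longrightarrow> r \<le> r2 n \<longrightarrow>
      sqrt (real (k n)) * \<bar>LINT z|Q. indicator {r<..} (enorm d z) * dev t (angle d z)\<bar> \<le> \<epsilon> * obs.tail r" if "\<epsilon> > 0" for \<epsilon>
    using first_moment[OF that, of t] unfolding tail_mean_def .
  show "\<forall>\<^sub>F n in sequentially. \<forall>r. r1 n < r \<longrightarrow> r \<le> r2 n \<longrightarrow>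
      \<bar>(LINT z|Q. indicator {r<..} (enorm d z) * (dev t (angle d z))\<^sup>2) - dev_var t * obs.tail r\<bar> \<le> \<epsilon> * obs.tail r" if "\<epsilon> > 0" for \<epsilon>
  proof -
    obtain r0 where r0: "\<And>r. r \<ge> r0 \<Longrightarrow> \<bar>tail_mean (\<lambda>w. (dev t w)\<^sup>2) r - dev_var t * obs.tail r\<bar> \<le> \<epsilon> * obs.tail r"
      using second_moment[OF \<open>\<epsilon> > 0\<close>, of t] unfolding eventually_at_top_linorder by blast
    have "\<forall>\<^sub>F n in sequentially. r0 \<le> r1 n" using r1_top by (simp add: filterlim_at_top)
    then show ?thesis by eventually_elim (use r0 in \<open>auto simp: tail_mean_def\<close>)
  qed
qed (rule dev_var_nonneg k_top tail_r1 tail_r2)+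

end

section \<open>From the estimators to convergence in distribution\<close>

lemma sigma2_hat_top:
  "sigma2_hat d n k0 xs h =
    (\<Sum>l\<in>top_indices n k0 (\<lambda>l. enorm d (xs l)). f_max d h (angle d (xs l))) / real k0"
proof -
  have "(\<Sum>l=1..n. (MAX j\<in>h. (angle d (xs l) j)\<^sup>2) *
        indicator {l. enorm d (xs l) \<ge> kth_largest n k0 (\<lambda>m. enorm d (xs m))} l) =
      (\<Sum>l\<in>top_indices n k0 (\<lambda>l. enorm d (xs l)). (MAX j\<in>h. (angle d (xs l) j)\<^sup>2))"
    unfolding top_indices_def sum.inter_filter[OF finite_atLeastAtMost]
    by (intro sum.cong refl) (simp add: indicator_def)
  then show ?thesis unfolding sigma2_hat_def f_max_def by (simp flip: sum_distrib_left)
qed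

lemma measurable_top_sum:
  fixes g :: "'b \<Rightarrow> real"
  assumes k0: "1 \<le> k0" "k0 \<le> n" and \<rho>: "\<rho> \<in> borel_measurable Q" and g: "g \<in> borel_measurable Q"
    and V: "\<And>l. l \<in> {1..n} \<Longrightarrow> (\<lambda>x. V x l) \<in> M \<rightarrow>\<^sub>M Q"
  shows "(\<lambda>x. \<Sum>l\<in>top_indices n k0 (\<lambda>l. \<rho> (V x l)). g (V x l)) \<in> borel_measurable M"
proof -
  have K: "(\<lambda>x. kth_largest n k0 (\<lambda>l. \<rho> (V x l))) \<in> borel_measurable M"
    by (intro measurable_kth_largest k0 measurable_compose[OF V \<rho>])
  have "(\<lambda>x. \<Sum>l=1..n. if kth_largest n k0 (\<lambda>l. \<rho> (V x l)) \<le> \<rho> (V x l) then g (V x l) else 0) \<in> borel_measurable M"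
  proof (rule borel_measurable_sum)
    fix l assume l: "l \<in> {1..n}"
    note [measurable] = K measurable_compose[OF V[OF l] \<rho>] measurable_compose[OF V[OF l] g]
    show "(\<lambda>x. if kth_largest n k0 (\<lambda>l. \<rho> (V x l)) \<le> \<rho> (V x l) then g (V x l) else 0) \<in> borel_measurable M"
      by measurable
  qed
  then show ?thesis unfolding top_indices_def by (subst sum.inter_filter) auto
qed

context ml_sample begin

text \<open>The transpose of \<open>T\<close> applied to \<open>t\<close>: a frequency for the
  vector of coefficient errors becomes one for the vector of estimated scalings.\<close>

definition T_weights :: "(nat \<Rightarrow> real) \<Rightarrow> nat \<Rightarrow> real" where
  "T_weights t v = (\<Sum>u=1..N. t u * T_mat d u v)"

lemma estimation_error_top_sum:
  assumes A2: "\<And>u. u \<in> {1..N} \<Longrightarrow> A2_vec d a u = (\<Sum>v=1..N. T_mat d u v * comp_mean v)"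
    and k0: "k0 \<ge> 1" and card: "card (top_indices n k0 (\<lambda>l. enorm d (xs l))) = k0"
  shows "(\<Sum>u=1..N. t u * (sqrt (real k0) * (A2_hat d n k0 xs u - A2_vec d a u))) =
    (\<Sum>l\<in>top_indices n k0 (\<lambda>l. enorm d (xs l)). dev (T_weights t) (angle d (xs l))) / sqrt (real k0)"
proof -
  let ?J = "top_indices n k0 (\<lambda>l. enorm d (xs l))"
  \<comment> \<open>Because exactly \<open>k0\<close> terms are summed, the mean can be subtracted
    inside the sum without a remainder.\<close>
  have S: "SM_hat d n k0 xs v - comp_mean v = (\<Sum>l\<in>?J. comp_fun v (angle d (xs l)) - comp_mean v) / real k0" if "v \<in> {1..N}" for v
    using that k0 by (simp add: SM_hat_def sigma2_hat_top comp_fun_def sum_subtractf card diff_divide_distrib)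
  have diff: "A2_hat d n k0 xs u - A2_vec d a u =
      (\<Sum>v=1..N. T_mat d u v * ((\<Sum>l\<in>?J. comp_fun v (angle d (xs l)) - comp_mean v) / real k0))" if u: "u \<in> {1..N}" for u
  proof -
    have "A2_hat d n k0 xs u - A2_vec d a u = (\<Sum>v=1..N. T_mat d u v * (SM_hat d n k0 xs v - comp_mean v))"
      using u by (simp add: A2_hat_def A2 right_diff_distrib sum_subtractf)
    then show ?thesis by (simp only: S cong: sum.cong)
  qed
  have sq: "sqrt (real k0) * (y / real k0) = y / sqrt (real k0)" for y
    using k0 by (simp add: real_div_sqrt divide_simps)
  have "(\<Sum>u=1..N. t u * (sqrt (real k0) * (A2_hat d n k0 xs u - A2_vec d a u))) =
      (\<Sum>u=1..N. t u * (sqrt (real k0) * (\<Sum>v=1..N. T_mat d u v * ((\<Sum>l\<in>?J. comp_fun v (angle d (xs l)) - comp_mean v) / real k0))))"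
    by (intro sum.cong refl) (simp only: diff)
  also have "\<dots> = (\<Sum>u=1..N. \<Sum>v=1..N. t u * T_mat d u v * (sqrt (real k0) * ((\<Sum>l\<in>?J. comp_fun v (angle d (xs l)) - comp_mean v) / real k0)))"
    by (simp add: sum_distrib_left mult_ac)
  also have "\<dots> = (\<Sum>v=1..N. \<Sum>u=1..N. t u * T_mat d u v * (sqrt (real k0) * ((\<Sum>l\<in>?J. comp_fun v (angle d (xs l)) - comp_mean v) / real k0)))"
    by (rule sum.swap)
  also have "\<dots> = (\<Sum>v=1..N. T_weights t v * ((\<Sum>l\<in>?J. comp_fun v (angle d (xs l)) - comp_mean v) / sqrt (real k0)))"
    unfolding sq by (simp only: T_weights_def sum_distrib_right[symmetric])
  also have "\<dots> = (\<Sum>v=1..N. \<Sum>l\<in>?J. T_weights t v * (comp_fun v (angle d (xs l)) - comp_mean v)) / sqrt (real k0)"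
    by (simp add: sum_distrib_left sum_divide_distrib)
  also have "(\<Sum>v=1..N. \<Sum>l\<in>?J. T_weights t v * (comp_fun v (angle d (xs l)) - comp_mean v)) =
      (\<Sum>l\<in>?J. dev (T_weights t) (angle d (xs l)))"
    unfolding dev_def by (rule sum.swap)
  finally show ?thesis .
qed

lemma AE_card_top_indices:
  assumes k0: "1 \<le> k0" "k0 \<le> n"
  shows "AE x in M. card (top_indices n k0 (\<lambda>l. enorm d (Xs l x))) = k0"
proof -
  have "AE z in distr M (obs.sample n) (\<lambda>x. \<lambda>l\<in>{1..n}. Xs l x). inj_on (\<lambda>l. enorm d (z l)) {1..n}"
    using k0 by (simp only: sample_law obs.AE_inj order_trans[OF k0])
  then have "AE x in M. inj_on (\<lambda>l. enorm d ((\<lambda>l\<in>{1..n}. Xs l x) l)) {1..n}"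
    by (rule AE_distrD[OF sample_meas])
  then show ?thesis
  proof eventually_elim
    case (elim x)
    have inj: "inj_on (\<lambda>l. enorm d (Xs l x)) {1..n}"
      by (rule inj_on_cong[THEN iffD1, OF _ elim]) simp
    obtain l0 where l0: "enorm d (Xs l0 x) = kth_largest n k0 (\<lambda>l. enorm d (Xs l x))"
        "card {l\<in>{1..n}. enorm d (Xs l x) > kth_largest n k0 (\<lambda>l. enorm d (Xs l x))} = k0 - 1"
        "{l\<in>{1..n}. enorm d (Xs l x) \<ge> kth_largest n k0 (\<lambda>l. enorm d (Xs l x))} =
          insert l0 {l\<in>{1..n}. enorm d (Xs l x) > kth_largest n k0 (\<lambda>l. enorm d (Xs l x))}"
      using kth_largest_inj[OF k0 inj] by blast
    show ?case unfolding top_indices_def l0(3) using l0(1,2) k0 by (subst card_insert_disjoint) auto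
  qed
qed

definition err :: "nat \<Rightarrow> 'a \<Rightarrow> nat \<Rightarrow> real" where
  "err n x = (\<lambda>u\<in>{1..N}. sqrt (real (k n)) * (A2_hat d n (k n) (\<lambda>l. Xs l x) u - A2_vec d a u))"

lemma err_meas:
  assumes kn: "1 \<le> k n" "k n \<le> n"
  shows "err n \<in> M \<rightarrow>\<^sub>M Rvec N"
proof -
  have S: "(\<lambda>x. sigma2_hat d n (k n) (\<lambda>l. Xs l x) (comp_set d v)) \<in> borel_measurable M" if "v \<in> {1..N}" for v
    unfolding sigma2_hat_top
    by (intro borel_measurable_divide borel_measurable_const
        measurable_top_sum[OF kn, where Q = "Rvec d" and g = "\<lambda>y. f_max d (comp_set d v) (angle d y)"]
        f_max_measurable comp_set_subset that Xs_meas) auto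
  show ?thesis unfolding err_def[abs_def]
  proof (rule measurable_restrict)
    fix u assume u: "u \<in> {1..N}"
    have "(\<lambda>x. \<Sum>v=1..N. T_mat d u v * sigma2_hat d n (k n) (\<lambda>l. Xs l x) (comp_set d v)) \<in> borel_measurable M"
      by (intro borel_measurable_sum borel_measurable_times borel_measurable_const S)
    then show "(\<lambda>x. sqrt (real (k n)) * (A2_hat d n (k n) (\<lambda>l. Xs l x) u - A2_vec d a u)) \<in> borel_measurable M"
      using u by (simp add: A2_hat_def SM_hat_def)
  qed
qed

text \<open>Moves the problem from \<open>M\<close> to the product space of the observations, where
  the order-statistics argument lives; the two integrands agree outside the null set of
  ties.\<close>

lemma err_char:
  assumes A2: "\<And>u. u \<in> {1..N} \<Longrightarrow> A2_vec d a u = (\<Sum>v=1..N. T_mat d u v * comp_mean v)"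
    and kn: "1 \<le> k n" "k n \<le> n"
  shows "(CLINT y|distr M (Rvec N) (err n). iexp (\<Sum>u=1..N. t u * y u)) =
    (CLINT x|obs.sample n. iexp ((\<Sum>l\<in>top_indices n (k n) (\<lambda>l. enorm d (x l)). dev (T_weights t) (angle d (x l))) / sqrt (real (k n))))"
proof -
  let ?G = "\<lambda>z. (\<Sum>l\<in>top_indices n (k n) (\<lambda>l. enorm d (z l)). dev (T_weights t) (angle d (z l))) / sqrt (real (k n))"
  let ?V = "\<lambda>x. \<lambda>l\<in>{1..n}. Xs l x"
  have mexp: "(\<lambda>y. iexp (g y)) \<in> borel_measurable P" if "g \<in> borel_measurable P" for g and P :: "'c measure"
    using that by measurable
  have G: "?G \<in> borel_measurable (obs.sample n)"
    by (intro borel_measurable_divide borel_measurable_const measurable_top_sum[OF kn, where Q = Q and V = "\<lambda>z l. z l"]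
        measurable_component_singleton) auto
  have lin: "(\<lambda>y. \<Sum>u=1..N. t u * y u) \<in> borel_measurable (Rvec N)"
    by (intro borel_measurable_sum borel_measurable_times borel_measurable_const measurable_component_singleton)
  \<comment> \<open>The product space only sees the observations restricted to
    \<open>{1..n}\<close>, and \<open>kth_largest\<close> and the index set read no others.\<close>
  have GV: "?G (?V x) = (\<Sum>l\<in>top_indices n (k n) (\<lambda>l. enorm d (Xs l x)). dev (T_weights t) (angle d (Xs l x))) / sqrt (real (k n))" for x
  proof -
    have "map (\<lambda>l. enorm d (?V x l)) [1..<n + 1] = map (\<lambda>l. enorm d (Xs l x)) [1..<n + 1]"
      by (rule map_cong) auto
    then have "kth_largest n (k n) (\<lambda>l. enorm d (?V x l)) = kth_largest n (k n) (\<lambda>l. enorm d (Xs l x))"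
      unfolding kth_largest_def by (simp only:)
    then have "top_indices n (k n) (\<lambda>l. enorm d (?V x l)) = top_indices n (k n) (\<lambda>l. enorm d (Xs l x))"
      by (auto simp: top_indices_def)
    then show ?thesis by (auto simp: top_indices_def intro!: sum.cong)
  qed
  have "(CLINT y|distr M (Rvec N) (err n). iexp (\<Sum>u=1..N. t u * y u)) = (CLINT x|M. iexp (\<Sum>u=1..N. t u * err n x u))"
    by (rule integral_distr[OF err_meas[OF kn] mexp[OF lin]])
  also have "\<dots> = (CLINT x|M. iexp (?G (?V x)))"
  proof (rule integral_cong_AE)
    show "(\<lambda>x. iexp (\<Sum>u=1..N. t u * err n x u)) \<in> borel_measurable M"
      by (rule measurable_compose[OF err_meas[OF kn] mexp[OF lin]])
    show "(\<lambda>x. iexp (?G (?V x))) \<in> borel_measurable M"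
      by (rule measurable_compose[OF sample_meas mexp[OF G]])
    show "AE x in M. iexp (\<Sum>u=1..N. t u * err n x u) = iexp (?G (?V x))"
      using AE_card_top_indices[OF kn]
    proof eventually_elim
      case (elim x)
      have "(\<Sum>u=1..N. t u * err n x u) = (\<Sum>u=1..N. t u * (sqrt (real (k n)) * (A2_hat d n (k n) (\<lambda>l. Xs l x) u - A2_vec d a u)))"
        by (intro sum.cong refl) (simp add: err_def)
      also have "\<dots> = ?G (?V x)"
        unfolding GV by (rule estimation_error_top_sum[OF A2 kn(1) elim])
      finally show ?case by simp
    qed
  qed
  also have "\<dots> = (CLINT z|distr M (obs.sample n) ?V. iexp (?G z))"
    by (rule integral_distr[OF sample_meas mexp[OF G], symmetric])
  also have "distr M (obs.sample n) ?V = obs.sample n" using kn by (intro sample_law) simp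
  finally show ?thesis .
qed

text \<open>The covariance form writes \<open>W\<close> as \<open>B\<close> times its transpose with
  the \<open>d\<close> columns \<open>sqrt (q j) * b p j\<close>, so the target matrix is
  \<open>T B\<close> times its transpose. This is the factorization required to construct the normal
  law.\<close>

lemma TWT_factorization:
  "TWT_mat d a u v = (\<Sum>j=1..d.
     (\<Sum>p=1..N. T_mat d u p * (sqrt (col_sq d a j / real d) * (comp_fun p (col_angle d a j) - comp_mean p))) *
     (\<Sum>q=1..N. T_mat d v q * (sqrt (col_sq d a j / real d) * (comp_fun q (col_angle d a j) - comp_mean q))))"
proof -
  define b where "b p j = comp_fun p (col_angle d a j) - comp_mean p" for p j
  define q where "q j = col_sq d a j / real d" for j
  have q0: "q j \<ge> 0" for j by (auto simp: q_def col_sq_def intro!: divide_nonneg_nonneg sum_nonneg)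
  have W: "W_mat d a p p' = (\<Sum>j=1..d. (sqrt (q j) * b p j) * (sqrt (q j) * b p' j))" if "p \<in> {1..N}" "p' \<in> {1..N}" for p p'
  proof -
    have "W_mat d a p p' = (\<Sum>j=1..d. q j * b p j * b p' j)"
      unfolding W_mat_def b_def q_def comp_fun_def comp_mean_def
      by (rule W_entry_covariance[OF std d col_sq_pos comp_set_subset(1,2)[OF that(1)] comp_set_subset(1,2)[OF that(2)]])
    also have "\<dots> = (\<Sum>j=1..d. (sqrt (q j) * b p j) * (sqrt (q j) * b p' j))"
    proof (rule sum.cong[OF refl])
      fix j
      have "q j = sqrt (q j) * sqrt (q j)" using q0 by simp
      then show "q j * b p j * b p' j = (sqrt (q j) * b p j) * (sqrt (q j) * b p' j)"
        by (metis mult.assoc mult.left_commute)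
    qed
    finally show ?thesis .
  qed
  have "TWT_mat d a u v = (\<Sum>p=1..N. \<Sum>p'=1..N. \<Sum>j=1..d. (T_mat d u p * (sqrt (q j) * b p j)) * (T_mat d v p' * (sqrt (q j) * b p' j)))"
    unfolding TWT_mat_def by (intro sum.cong refl) (simp add: W sum_distrib_left sum_distrib_right mult_ac)
  also have "\<dots> = (\<Sum>p=1..N. \<Sum>j=1..d. \<Sum>p'=1..N. (T_mat d u p * (sqrt (q j) * b p j)) * (T_mat d v p' * (sqrt (q j) * b p' j)))"
    by (intro sum.cong refl sum.swap)
  also have "\<dots> = (\<Sum>j=1..d. \<Sum>p=1..N. \<Sum>p'=1..N. (T_mat d u p * (sqrt (q j) * b p j)) * (T_mat d v p' * (sqrt (q j) * b p' j)))"
    by (rule sum.swap)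
  also have "\<dots> = (\<Sum>j=1..d. (\<Sum>p=1..N. T_mat d u p * (sqrt (q j) * b p j)) * (\<Sum>p'=1..N. T_mat d v p' * (sqrt (q j) * b p' j)))"
    by (simp only: sum_product)
  finally show ?thesis unfolding b_def q_def .
qed

text \<open>Matches the exponent of the normal characteristic function with the limit variance of
  the sum over the largest observations.\<close>

lemma TWT_quadratic_form: "(\<Sum>u=1..N. \<Sum>v=1..N. t u * TWT_mat d a u v * t v) = dev_var (T_weights t)"
proof -
  define L where "L u j = (\<Sum>p=1..N. T_mat d u p * (sqrt (col_sq d a j / real d) * (comp_fun p (col_angle d a j) - comp_mean p)))" for u j
  have "(\<Sum>u=1..N. \<Sum>v=1..N. t u * TWT_mat d a u v * t v) = (\<Sum>u=1..N. \<Sum>v=1..N. \<Sum>j=1..d. (t u * L u j) * (t v * L v j))"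
    by (intro sum.cong refl) (simp add: TWT_factorization L_def[symmetric] sum_distrib_left sum_distrib_right mult_ac)
  also have "\<dots> = (\<Sum>u=1..N. \<Sum>j=1..d. \<Sum>v=1..N. (t u * L u j) * (t v * L v j))"
    by (intro sum.cong refl sum.swap)
  also have "\<dots> = (\<Sum>j=1..d. \<Sum>u=1..N. \<Sum>v=1..N. (t u * L u j) * (t v * L v j))"
    by (rule sum.swap)
  also have "\<dots> = (\<Sum>j=1..d. (\<Sum>u=1..N. t u * L u j)\<^sup>2)"
    by (simp only: sum_product power2_eq_square)
  also have "\<dots> = dev_var (T_weights t)"
    unfolding dev_var_def
  proof (rule sum.cong[OF refl])
    fix j
    have q0: "col_sq d a j / real d \<ge> 0" by (auto simp: col_sq_def intro!: divide_nonneg_nonneg sum_nonneg)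
    have "(\<Sum>u=1..N. t u * L u j) = (\<Sum>u=1..N. \<Sum>p=1..N. (t u * T_mat d u p) * (sqrt (col_sq d a j / real d) * (comp_fun p (col_angle d a j) - comp_mean p)))"
      by (simp add: L_def sum_distrib_left mult_ac)
    also have "\<dots> = (\<Sum>p=1..N. \<Sum>u=1..N. (t u * T_mat d u p) * (sqrt (col_sq d a j / real d) * (comp_fun p (col_angle d a j) - comp_mean p)))"
      by (rule sum.swap)
    also have "\<dots> = (\<Sum>p=1..N. T_weights t p * (sqrt (col_sq d a j / real d) * (comp_fun p (col_angle d a j) - comp_mean p)))"
      by (simp only: T_weights_def sum_distrib_right[symmetric])
    also have "\<dots> = sqrt (col_sq d a j / real d) * dev (T_weights t) (col_angle d a j)"
      unfolding dev_def sum_distrib_left by (intro sum.cong refl) (rule mult.left_commute)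
    finally show "(\<Sum>u=1..N. t u * L u j)\<^sup>2 = col_sq d a j / real d * (dev (T_weights t) (col_angle d a j))\<^sup>2"
      using q0 by (simp only: power_mult_distrib real_sqrt_pow2)
  qed
  finally show ?thesis .
qed

theorem err_asymptotically_normal:
  assumes A2: "\<And>u. u \<in> {1..N} \<Longrightarrow> A2_vec d a u = (\<Sum>v=1..N. T_mat d u v * comp_mean v)"
  shows "\<exists>\<mu>. mv_normal N (\<lambda>_. 0) (TWT_mat d a) \<mu> \<and> conv_in_distribution M N err \<mu>"
proof -
  obtain \<mu> where \<mu>: "mv_normal N (\<lambda>_. 0) (TWT_mat d a) \<mu>"
    using mv_normal_linear_image[where N = N and \<Sigma> = "TWT_mat d a", OF TWT_factorization] by blast
  have char_\<mu>: "(CLINT y|\<mu>. iexp (\<Sum>u=1..N. t u * y u)) = exp (- dev_var (T_weights t) / 2)" for t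
    using \<mu> by (simp add: mv_normal_def TWT_quadratic_form exp_of_real[symmetric])
  have "\<forall>\<^sub>F n in sequentially. 1 \<le> k n \<and> k n \<le> n"
    using eventually_conj[OF k_pos k_ratio[of 1]] by simp
  \<comment> \<open>Measurability of the error vector is established for
    \<open>1 <= k n <= n\<close> only, so the continuity theorem is applied to the shifted sequence;
    a finite shift does not affect the limit.\<close>
  then obtain n0 where n0: "\<And>n. n \<ge> n0 \<Longrightarrow> 1 \<le> k n \<and> k n \<le> n"
    unfolding eventually_sequentially by blast
  then have kn: "1 \<le> k (n + n0)" "k (n + n0) \<le> n + n0" for n by simp_all
  interpret char_fun_convergence N "\<lambda>n. distr M (Rvec N) (err (n + n0))" \<mu>
  proof (rule char_fun_convergence.intro)
    show "prob_space (distr M (Rvec N) (err (n + n0)))" for n by (rule prob_space_distr[OF err_meas[OF kn]])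
    show "prob_space \<mu>" "sets \<mu> = sets (Rvec N)" using \<mu> by (simp_all add: mv_normal_def)
    show "sets (distr M (Rvec N) (err (n + n0))) = sets (Rvec N)" for n by simp
    show "(\<lambda>n. CLINT y|distr M (Rvec N) (err (n + n0)). iexp (\<Sum>u=1..N. t u * y u)) \<longlonglongrightarrow>
        (CLINT y|\<mu>. iexp (\<Sum>u=1..N. t u * y u))" for t
      unfolding char_\<mu>
    proof (subst err_char)
      show "A2_vec d a u = (\<Sum>v=1..N. T_mat d u v * comp_mean v)" if "u \<in> {1..N}" for u using that by (rule A2)
    qed (rule kn LIMSEQ_ignore_initial_segment[OF dev_char_limit])+
  qed
  have "conv_in_distribution M N err \<mu>"
    unfolding conv_in_distribution_def
  proof (intro allI impI)
    fix g :: "(nat \<Rightarrow> real) \<Rightarrow> real"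
    assume "continuous_on ({1..N} \<rightarrow>\<^sub>E UNIV) g \<and> bounded (g ` ({1..N} \<rightarrow>\<^sub>E UNIV))"
    then have "(\<lambda>n. LINT y|distr M (Rvec N) (err (n + n0)). g y) \<longlonglongrightarrow> (LINT y|\<mu>. g y)"
      by (intro bounded_continuous_conv) auto
    then show "(\<lambda>n. LINT y|distr M (Rvec N) (err n). g y) \<longlonglongrightarrow> (LINT y|\<mu>. g y)"
      by (rule LIMSEQ_offset)
  qed
  with \<mu> show ?thesis by blast
qed

end

theorem theorem6:
  fixes M :: "'a measure"
    and d :: nat
    and E :: "(nat \<times> nat) set"
    and c a :: "nat \<Rightarrow> nat \<Rightarrow> real"
    and Z X :: "'a \<Rightarrow> nat \<Rightarrow> real"
    and Xs :: "nat \<Rightarrow> 'a \<Rightarrow> nat \<Rightarrow> real"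
    and k :: "nat \<Rightarrow> nat"
  assumes "prob_space M"
    and "d \<ge> 1"
    and "well_ordered_dag d E"
    and "edge_weights d E c"
    and "standardized_innovations M d Z"
    and "recursive_ml M d E c Z X"
    and "a = ml_coeff E c"
    and "standardized d a"
    and "iid_copies M d X Xs"
    and "(\<lambda>n. real (k n)) \<in> o(\<lambda>n. real n)"
    and "filterlim k at_top sequentially"
    and "\<And>h. h \<in> comp_set d ` {1..dimN d} \<Longrightarrow>
           (LINT w|norm_spectral M d X.
              (f_max d h w - (LINT v|norm_spectral M d X. f_max d h v))\<^sup>2) > 0"
    and "\<And>h K. h \<in> comp_set d ` {1..dimN d} \<Longrightarrow> compact K \<Longrightarrow> K \<subseteq> {0..} \<Longrightarrow>
           uniform_limit K
             (\<lambda>n. bias_term M d (Xs 1) (norm_spectral M d X) (f_max d h) n (k n))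
             (\<lambda>_. 0) sequentially"
    and "\<And>h. h \<in> comp_set d ` {1..dimN d} \<Longrightarrow>
           real d * (\<Sum>j=1..d. MAX i\<in>h. (a i j) ^ 4 / (enorm d (\<lambda>m. a m j))\<^sup>2)
             - (\<Sum>j=1..d. MAX i\<in>h. (a i j)\<^sup>2)\<^sup>2 > 0"
  shows "\<exists>\<mu>. mv_normal (dimN d) (\<lambda>_. 0) (TWT_mat d a) \<mu> \<and>
           conv_in_distribution M (dimN d)
             (\<lambda>n x. \<lambda>u\<in>{1..dimN d}. sqrt (real (k n)) *
                (A2_hat d n (k n) (\<lambda>l. Xs l x) u - A2_vec d a u)) \<mu>"
proof -
  interpret prob_space M by fact
  interpret D: ml_dag d E c by unfold_locales (fact assms(3), fact assms(4))
  have Z: "Z \<in> M \<rightarrow>\<^sub>M Rvec d" "indep_vars (\<lambda>_. borel) (\<lambda>i x. Z x i) {1..d}"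
    "\<And>i z. i \<in> {1..d} \<Longrightarrow> measure M {x \<in> space M. Z x i = z} = 0"
    "\<And>i. i \<in> {1..d} \<Longrightarrow> measure_support (distr M borel (\<lambda>x. Z x i)) = {0..}"
    "\<And>i x. i \<in> {1..d} \<Longrightarrow> x > 0 \<Longrightarrow>
      (\<lambda>n. real n * measure M {y \<in> space M. real n powr (-1/2) * Z y i > x}) \<longlonglongrightarrow> x powr (-2)"
    using assms(5) by (auto simp: standardized_innovations_def innovations_def)
  \<comment> \<open>Nonnegativity of the innovations is encoded in the support of their laws and
    hence holds almost surely.\<close>
  have nonneg: "AE x in M. \<forall>i\<in>{1..d}. 0 \<le> Z x i"
  proof (rule AE_finite_allI)
    fix i assume i: "i \<in> {1..d}"
    have "(\<lambda>x. Z x i) \<in> borel_measurable M"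
      by (rule measurable_compose[OF Z(1) measurable_component_singleton[OF i]])
    then show "AE x in M. 0 \<le> Z x i" using AE_in_support[OF _ Z(4)[OF i]] by simp
  qed simp
  have X: "X \<in> M \<rightarrow>\<^sub>M Rvec d"
    "\<And>x i. x \<in> space M \<Longrightarrow> i \<in> {1..d} \<Longrightarrow> X x i = Max (insert (c i i * Z x i) ((\<lambda>k. c i k * X x k) ` pa E i))"
    using assms(6) by (auto simp: recursive_ml_def)
  have X_max: "AE x in M. \<forall>i\<in>{1..d}. X x i = (MAX j\<in>{1..d}. a i j * Z x j)"
    using nonneg AE_space
  proof eventually_elim
    case (elim x)
    then show ?case unfolding assms(7) by (intro ballI D.recursive_ml_solution X(2)) auto
  qed
  interpret ml_sample M d a Z X Xs k
  proof
    show "0 \<le> a i j" if "j \<in> {1..d}" for i j using that unfolding assms(7) by (rule D.ml_coeff_nonneg)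
    show "0 < a i i" if "i \<in> {1..d}" for i using that unfolding assms(7) D.ml_coeff_diag by (rule D.weight_pos(1))
  qed (fact Z X nonneg X_max assms)+
  have "A2_vec d a u = (\<Sum>v=1..dimN d. T_mat d u v * comp_mean v)" if "u \<in> {1..dimN d}" for u
    using D.A2_vec_eq[of u, folded assms(7)] assms(8) that by (simp only: comp_mean_def)
  from err_asymptotically_normal[OF this] show ?thesis unfolding err_def[abs_def] .
qed

end
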